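(* Let $(R,\Delta)$ be a Hermitian form ring with $R$ commutative, let $(I,\Omega)$ be an odd form ideal of $(R,\Delta)$ and let $H$ be a subgroup of $\mathrm{U}_{7}(R,\Delta)$ normalised by $\mathrm{EU}_{7}((R,\Delta),(I,\Omega))$. Then \[\mathrm{EU}_{7}((R,\Delta),U(H)\ast I^{12})\leq H\leq \mathrm{CU}_{7}((R,\Delta),U(H)).\]
   Context: Form rings. Rings are associative with $1\neq 0$; $R$ is a commutative ring. A Hermitian ring $(R,\bar{\ },\lambda,\mu)$ consists of $R$, a bijection $x\mapsto\bar x$ of $R$ with $\overline{x+y}=\bar x+\bar y$, $\overline{xy}=\bar y\bar x$, $\bar 1=1$, an element $\lambda\in R$ with $\bar{\bar x}=\lambda x\bar\lambda$ for all $x\in R$ (it follows that $\bar\lambda=\lambda^{-1}$), and an element $\mu\in R$ with $\mu=\bar\mu\lambda$. A subset $A\subseteq R$ is involution invariant if $\bar x\in A$ for all $x\in A$. The Heisenberg group $\mathfrak{H}$ is $R\times R$ with group operation $(x_1,y_1)\dotplus(x_2,y_2)=(x_1+x_2,\,y_1+y_2-\bar x_1\mu x_2)$; the inverse of $\alpha$ is written $\dot{-}\alpha$, and $\alpha\,\dot{-}\,\beta:=\alpha\dotplus(\dot{-}\beta)$. For $a\in R$ put $(x,y)\circ a=(xa,\bar a y a)$; $\circ$ has higher priority than $\dotplus$ and $\dot{-}$. An $R^{\bullet}$-submodule of $\mathfrak{H}$ is a subgroup stable under all maps $\alpha\mapsto\alpha\circ a$ ($a\in R$). For $A\subseteq\mathfrak{H}$,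 $B\subseteq R$, $A\circ B$ is the subgroup of $\mathfrak{H}$ generated by all $\alpha\circ b$ ($\alpha\in A$, $b\in B$); for $A,B\subseteq \mathfrak{H}$, $A\dotplus B=\{\alpha\dotplus\beta\mid\alpha\in A,\beta\in B\}$. For a subgroup $\Omega$ of $\mathfrak{H}$, $\alpha\equiv\beta\bmod\Omega$ means $\alpha\,\dot{-}\,\beta\in\Omega$. Let $\Delta_{\min}=\{(0,x-\bar x\lambda)\mid x\in R\}$ and $\Delta_{\max}=\{(x,y)\mid \bar x\mu x+y+\bar y\lambda=0\}$. An odd form parameter is an $R^\bullet$-submodule $\Delta$ of $\mathfrak{H}$ with $\Delta_{\min}\subseteq\Delta\subseteq\Delta_{\max}$; then $(R,\Delta)$ (short for $((R,\bar{\ },\lambda,\mu),\Delta)$) is called a Hermitian form ring. Put $J(\Delta)=\{y\in R\mid\exists z\in R:(y,z)\in\Delta\}$. For an involution invariant ideal $I$ of $R$ put $\tilde I=\{x\in R\mid\overline{J(\Delta)}\mu x\subseteq I\}$, $\Omega^I_{\min}=\{(0,x-\bar x\lambda)\mid x\in I\}\dotplus\Delta\circ I$ and $\Omega^I_{\max}=\Delta\cap(\tilde I\times I)$. An odd form ideal of $(R,\Delta)$ is a pair $(I,\Omega)$ where $I$ is an involution invariant ideal and $\Omega$ is an $R^\bullet$-submodule of $\mathfrak{H}$ with $\Omega^I_{\min}\subseteq\Omega\subseteq\Omega^I_{\max}$. Put $\Delta^{1}=\Delta$, $\Delta^{-1}=\{(x,y)\mid(x,\bar y)\in\Delta\}$,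 $\Omega^1=\Omega$, $\Omega^{-1}=\{(x,y)\mid(x,\bar y)\in\Omega\}$. Product. For an odd form ideal $(J,\Sigma)$ and an involution invariant ideal $K$, $(J,\Sigma)\ast K$ is the odd form ideal $(JK,\Omega^{JK}_{\min}\dotplus\Sigma\circ K)$. Groups (for $n\in\mathbb{N}$; here $n=3$). Let $\Theta_+=\{1,\dots,n\}$, $\Theta_-=\{-n,\dots,-1\}$, $\Theta=\Theta_+\cup\{0\}\cup\Theta_-$, $\Theta_{\mathrm{hb}}=\Theta\setminus\{0\}$, $\epsilon(i)=1$ for $i\in\Theta_+$ and $\epsilon(i)=-1$ for $i\in\Theta_-$. Coordinates of $M=R^{2n+1}$ (columns) and rows/columns of $(2n+1)\times(2n+1)$ matrices are indexed by $\Theta$ in the order $1,\dots,n,0,-n,\dots,-1$. $\sigma_{ij}$ is the $(i,j)$ entry and $\sigma_{*j}$ the $j$-th column of $\sigma$; $\sigma_{\mathrm{hb}}=(\sigma_{ij})_{i,j\in\Theta_{\mathrm{hb}}}$; $e$ is the identity matrix, $e^{ij}$ a matrix unit. For $u,v\in M$ let $B(u,v)=\sum_{i=1}^n\bar u_iv_{-i}+\bar u_0\mu v_0+\sum_{i=-n}^{-1}\bar u_i\lambda v_{-i}$ and $Q(u)=(u_0,\sum_{i=1}^n\bar u_iu_{-i})\in\mathfrak{H}$. $\mathrm{U}_{2n+1}(R,\Delta)$ is the group of $\sigma\in\mathrm{GL}_{2n+1}(R)$ with $B(\sigma u,\sigma v)=B(u,v)$ and $Q(\sigma u)\equiv Q(u)\bmod\Delta$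 for all $u,v\in M$. Elementary subgroups. For $i,j\in\Theta_{\mathrm{hb}}$, $i\neq\pm j$, $x\in R$: $T_{ij}(x)=e+xe^{ij}-\lambda^{(\epsilon(j)-1)/2}\bar x\lambda^{(1-\epsilon(i))/2}e^{-j,-i}$. For $i\in\Theta_{\mathrm{hb}}$, $(x,y)\in\Delta^{-\epsilon(i)}$: $T_i(x,y)=e+xe^{0,-i}-\lambda^{-(1+\epsilon(i))/2}\bar x\mu e^{i0}+ye^{i,-i}$. $\mathrm{EU}_{2n+1}(R,\Delta)$ is the subgroup of $\mathrm{U}_{2n+1}(R,\Delta)$ generated by all these elements. For an odd form ideal $(I,\Omega)$, $\mathrm{EU}_{2n+1}(I,\Omega)$ is the subgroup generated by all $T_{ij}(x)$ with $x\in I$ and all $T_i(x,y)$ with $(x,y)\in\Omega^{-\epsilon(i)}$, and $\mathrm{EU}_{2n+1}((R,\Delta),(I,\Omega))$ is the normal closure of $\mathrm{EU}_{2n+1}(I,\Omega)$ in $\mathrm{EU}_{2n+1}(R,\Delta)$. Congruence subgroups. Let $M(R,\Delta)=\{u\in M\mid u_0\in J(\Delta)\}$. $\mathrm{U}_{2n+1}((R,\Delta),(I,\Omega))$ is the group of $\sigma\in\mathrm{U}_{2n+1}(R,\Delta)$ with $\sigma_{\mathrm{hb}}\equiv e_{\mathrm{hb}}\bmod I$ and $Q(\sigma u)\equiv Q(u)\bmod\Omega$ for all $u\in M(R,\Delta)$. $\mathrm{NU}_{2n+1}((R,\Delta),(I,\Omega))$ is its normaliser in $\mathrm{U}_{2n+1}(R,\Delta)$,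 and $\mathrm{CU}_{2n+1}((R,\Delta),(I,\Omega))=\{\sigma\in\mathrm{NU}_{2n+1}((R,\Delta),(I,\Omega))\mid[\sigma,\mathrm{EU}_{2n+1}(R,\Delta)]\leq\mathrm{U}_{2n+1}((R,\Delta),(I,\Omega))\}$, where $[g,h]=ghg^{-1}h^{-1}$. Upper level. For a subgroup $H\leq\mathrm{U}_{2n+1}(R,\Delta)$, the upper level $U(H)$ is the odd form ideal $(J,\Sigma)$ where $J$ is the ideal generated by $Y\cup\bar Y$, $Y$ being the set of all elements $\sigma_{ij}$, $\sigma_{ii}-\sigma_{jj}$ and all elements of the sets $\sigma_{i0}J(\Delta)$, $\overline{J(\Delta)}\mu\sigma_{0j}$, $\overline{J(\Delta)}\mu(\sigma_{00}-\sigma_{jj})J(\Delta)$ with $\sigma\in H$, $i\neq j\in\Theta_{\mathrm{hb}}$; and $\Sigma=\Omega^J_{\min}\dotplus Z\circ R$, where $Z$ is the set of all $Q(\sigma_{*j})$ and $(Q(\sigma_{*0})\,\dot{-}\,(1,0))\circ y\dotplus(y,z)\,\dot{-}\,(y,z)\circ\sigma_{ii}$ with $\sigma\in H$, $i,j\in\Theta_{\mathrm{hb}}$, $(y,z)\in\Delta$. *)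

theory Defs
  imports
    "HOL-Analysis.Cartesian_Space"
    "HOL-Library.Numeral_Type"
    "HOL-Algebra.Generated_Groups"
    "HOL-Algebra.Group_Action"
begin

text \<open>A commutative ring is a module over itself by multiplication. Its submodules are the
  ideals, and \<open>ring_module.span Y\<close> is the ideal generated by \<open>Y\<close>.\<close>

interpretation ring_module: module "(*) :: 'a::comm_ring_1 \<Rightarrow> 'a \<Rightarrow> 'a"
  by unfold_locales (simp_all add: algebra_simps)

abbreviation is_ideal :: "'a::comm_ring_1 set \<Rightarrow> bool" where
  "is_ideal \<equiv> ring_module.subspace"

abbreviation ideal_gen :: "'a::comm_ring_1 set \<Rightarrow> 'a set" where
  "ideal_gen \<equiv> ring_module.span"

definition ideal_mult :: "'a::comm_ring_1 set \<Rightarrow> 'a set \<Rightarrow> 'a set" where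
  "ideal_mult I J = ideal_gen {x * y | x y. x \<in> I \<and> y \<in> J}"

primrec ideal_pow :: "'a::comm_ring_1 set \<Rightarrow> nat \<Rightarrow> 'a set" where
  "ideal_pow I 0 = UNIV"
| "ideal_pow I (Suc k) = ideal_mult (ideal_pow I k) I"

record 'a herm =
  invol :: "'a \<Rightarrow> 'a"
  lam :: 'a
  mu :: 'a

locale hermitian_ring =
  fixes S :: "'a::comm_ring_1 herm"
  assumes invol_bij: "bij (invol S)"
    and invol_add: "invol S (x + y) = invol S x + invol S y"
    and invol_mult: "invol S (x * y) = invol S y * invol S x"
    and invol_one: "invol S 1 = 1"
    and invol_invol: "invol S (invol S x) = lam S * x * invol S (lam S)"
    and mu_eq: "mu S = invol S (mu S) * lam S"

definition invol_invariant :: "'a herm \<Rightarrow> 'a set \<Rightarrow> bool" where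
  "invol_invariant S A \<longleftrightarrow> (\<forall>x\<in>A. invol S x \<in> A)"

text \<open>Integer powers of \<open>\<lambda>\<close>. In a Hermitian ring the inverse of \<open>\<lambda>\<close> is its conjugate,
  by \<open>invol_invol\<close> at \<open>x = 1\<close>.\<close>

definition lam_pow :: "'a::comm_ring_1 herm \<Rightarrow> int \<Rightarrow> 'a" where
  "lam_pow S k = (if 0 \<le> k then lam S ^ nat k else invol S (lam S) ^ nat (- k))"

definition heis :: "'a::comm_ring_1 herm \<Rightarrow> ('a \<times> 'a) monoid" where
  "heis S = \<lparr>carrier = UNIV,
    mult = (\<lambda>(x1, y1) (x2, y2). (x1 + x2, y1 + y2 - invol S x1 * mu S * x2)),
    one = (0, 0)\<rparr>"

abbreviation heis_minus :: "'a::comm_ring_1 herm \<Rightarrow> 'a \<times> 'a \<Rightarrow> 'a \<times> 'a \<Rightarrow> 'a \<times> 'a" where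
  "heis_minus S \<alpha> \<beta> \<equiv> \<alpha> \<otimes>\<^bsub>heis S\<^esub> inv\<^bsub>heis S\<^esub> \<beta>"

definition act :: "'a::comm_ring_1 herm \<Rightarrow> 'a \<times> 'a \<Rightarrow> 'a \<Rightarrow> 'a \<times> 'a" where
  "act S \<alpha> a = (fst \<alpha> * a, invol S a * snd \<alpha> * a)"

definition heis_submodule :: "'a::comm_ring_1 herm \<Rightarrow> ('a \<times> 'a) set \<Rightarrow> bool" where
  "heis_submodule S \<Omega> \<longleftrightarrow> subgroup \<Omega> (heis S) \<and> (\<forall>\<alpha>\<in>\<Omega>. \<forall>a. act S \<alpha> a \<in> \<Omega>)"

definition act_gen :: "'a::comm_ring_1 herm \<Rightarrow> ('a \<times> 'a) set \<Rightarrow> 'a set \<Rightarrow> ('a \<times> 'a) set" where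
  "act_gen S A B = generate (heis S) {act S \<alpha> b | \<alpha> b. \<alpha> \<in> A \<and> b \<in> B}"

definition heis_cong ::
    "'a::comm_ring_1 herm \<Rightarrow> ('a \<times> 'a) set \<Rightarrow> 'a \<times> 'a \<Rightarrow> 'a \<times> 'a \<Rightarrow> bool" where
  "heis_cong S \<Omega> \<alpha> \<beta> \<longleftrightarrow> heis_minus S \<alpha> \<beta> \<in> \<Omega>"

definition Delta_min :: "'a::comm_ring_1 herm \<Rightarrow> ('a \<times> 'a) set" where
  "Delta_min S = {(0, x - invol S x * lam S) | x. True}"

definition Delta_max :: "'a::comm_ring_1 herm \<Rightarrow> ('a \<times> 'a) set" where
  "Delta_max S = {(x, y). invol S x * mu S * x + y + invol S y * lam S = 0}"

definition odd_form_parameter :: "'a::comm_ring_1 herm \<Rightarrow> ('a \<times> 'a) set \<Rightarrow> bool" where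
  "odd_form_parameter S \<Delta> \<longleftrightarrow>
     heis_submodule S \<Delta> \<and> Delta_min S \<subseteq> \<Delta> \<and> \<Delta> \<subseteq> Delta_max S"

locale hermitian_form_ring = hermitian_ring S for S :: "'a::comm_ring_1 herm" +
  fixes \<Delta> :: "('a \<times> 'a) set"
  assumes odd_form_parameter: "odd_form_parameter S \<Delta>"

definition J_of :: "('a \<times> 'a) set \<Rightarrow> 'a set" where
  "J_of \<Delta> = {y. \<exists>z. (y, z) \<in> \<Delta>}"

definition tilde :: "'a::comm_ring_1 herm \<Rightarrow> ('a \<times> 'a) set \<Rightarrow> 'a set \<Rightarrow> 'a set" where
  "tilde S \<Delta> I = {x. \<forall>y\<in>J_of \<Delta>. invol S y * mu S * x \<in> I}"

definition Omega_min ::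
    "'a::comm_ring_1 herm \<Rightarrow> ('a \<times> 'a) set \<Rightarrow> 'a set \<Rightarrow> ('a \<times> 'a) set" where
  "Omega_min S \<Delta> I = {(0, x - invol S x * lam S) | x. x \<in> I} <#>\<^bsub>heis S\<^esub> act_gen S \<Delta> I"

definition Omega_max ::
    "'a::comm_ring_1 herm \<Rightarrow> ('a \<times> 'a) set \<Rightarrow> 'a set \<Rightarrow> ('a \<times> 'a) set" where
  "Omega_max S \<Delta> I = \<Delta> \<inter> (tilde S \<Delta> I \<times> I)"

definition odd_form_ideal ::
    "'a::comm_ring_1 herm \<Rightarrow> ('a \<times> 'a) set \<Rightarrow> 'a set \<times> ('a \<times> 'a) set \<Rightarrow> bool" where
  "odd_form_ideal S \<Delta> = (\<lambda>(I, \<Omega>).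
     is_ideal I \<and> invol_invariant S I \<and> heis_submodule S \<Omega> \<and>
     Omega_min S \<Delta> I \<subseteq> \<Omega> \<and> \<Omega> \<subseteq> Omega_max S \<Delta> I)"

text \<open>\<open>signed S k \<Omega>\<close> is \<open>\<Omega>\<^sup>k\<close> for \<open>k\<close> equal to \<open>1\<close> or \<open>-1\<close>.\<close>

definition signed :: "'a herm \<Rightarrow> int \<Rightarrow> ('a \<times> 'a) set \<Rightarrow> ('a \<times> 'a) set" where
  "signed S k \<Omega> = (if k = 1 then \<Omega> else {(x, y). (x, invol S y) \<in> \<Omega>})"

definition form_ideal_mult ::
    "'a::comm_ring_1 herm \<Rightarrow> ('a \<times> 'a) set \<Rightarrow> 'a set \<times> ('a \<times> 'a) set \<Rightarrow> 'a set
      \<Rightarrow> 'a set \<times> ('a \<times> 'a) set" where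
  "form_ideal_mult S \<Delta> = (\<lambda>(J, \<Sigma>) K.
     (ideal_mult J K, Omega_min S \<Delta> (ideal_mult J K) <#>\<^bsub>heis S\<^esub> act_gen S \<Sigma> K))"

text \<open>The type \<open>'n theta\<close> is the index set \<open>\<Theta>\<close> with \<open>2n + 1\<close> elements, where \<open>n\<close> is the
  number of elements of \<open>'n\<close>: \<open>Pos k\<close>, \<open>Zero\<close>, \<open>Neg k\<close> are the positive indices, the index
  zero and the opposites of the positive indices. No definition below depends on the order of
  the indices beyond their signs.\<close>

datatype 'n theta = Pos 'n | Zero | Neg 'n

instance theta :: (finite) finite
proof
  have "x \<in> range Pos \<union> {Zero} \<union> range Neg" for x :: "'a theta"
    by (cases x) simp_all
  then have "(UNIV :: 'a theta set) \<subseteq> range Pos \<union> {Zero} \<union> range Neg"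
    by blast
  moreover have "finite (range Pos \<union> {Zero} \<union> range Neg :: 'a theta set)"
    by simp
  ultimately show "finite (UNIV :: 'a theta set)"
    by (rule finite_subset)
qed

instantiation theta :: (type) uminus
begin

primrec uminus_theta :: "'a theta \<Rightarrow> 'a theta" where
  "- Pos k = Neg k"
| "- Zero = Zero"
| "- Neg k = Pos k"

instance ..

end

abbreviation Theta_pos :: "'n theta set" where "Theta_pos \<equiv> range Pos"
abbreviation Theta_neg :: "'n theta set" where "Theta_neg \<equiv> range Neg"
abbreviation Theta_hb :: "'n theta set" where "Theta_hb \<equiv> - {Zero}"

definition eps :: "'n theta \<Rightarrow> int" where
  "eps i = (if i \<in> Theta_pos then 1 else - 1)"

type_synonym ('a, 'n) vec_th = "'a ^ ('n theta)"
type_synonym ('a, 'n) mat_th = "'a ^ ('n theta) ^ ('n theta)"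

text \<open>\<open>mat_entry i j x\<close> is \<open>x e\<^sup>i\<^sup>j\<close>.\<close>

definition mat_entry :: "'n theta \<Rightarrow> 'n theta \<Rightarrow> 'a::zero \<Rightarrow> ('a, 'n::finite) mat_th" where
  "mat_entry i j x = (\<chi> k l. if k = i \<and> l = j then x else 0)"

definition B_form ::
    "'a::comm_ring_1 herm \<Rightarrow> ('a, 'n::finite) vec_th \<Rightarrow> ('a, 'n) vec_th \<Rightarrow> 'a" where
  "B_form S u v =
     (\<Sum>i\<in>Theta_pos. invol S (u $ i) * v $ (- i))
     + invol S (u $ Zero) * mu S * v $ Zero
     + (\<Sum>i\<in>Theta_neg. invol S (u $ i) * lam S * v $ (- i))"

definition Q_form ::
    "'a::comm_ring_1 herm \<Rightarrow> ('a, 'n::finite) vec_th \<Rightarrow> 'a \<times> 'a" where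
  "Q_form S u = (u $ Zero, \<Sum>i\<in>Theta_pos. invol S (u $ i) * u $ (- i))"

definition U_grp ::
    "'a::comm_ring_1 herm \<Rightarrow> ('a \<times> 'a) set \<Rightarrow> ('a, 'n::finite) mat_th monoid" where
  "U_grp S \<Delta> = \<lparr>carrier = {\<sigma>. invertible \<sigma> \<and>
        (\<forall>u v. B_form S (\<sigma> *v u) (\<sigma> *v v) = B_form S u v) \<and>
        (\<forall>u. heis_cong S \<Delta> (Q_form S (\<sigma> *v u)) (Q_form S u))},
     mult = (**), one = mat 1\<rparr>"

definition T_short ::
    "'a::comm_ring_1 herm \<Rightarrow> 'n theta \<Rightarrow> 'n theta \<Rightarrow> 'a \<Rightarrow> ('a, 'n::finite) mat_th" where
  "T_short S i j x = mat 1 + mat_entry i j x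
     - mat_entry (- j) (- i)
         (lam_pow S ((eps j - 1) div 2) * invol S x * lam_pow S ((1 - eps i) div 2))"

definition T_long ::
    "'a::comm_ring_1 herm \<Rightarrow> 'n theta \<Rightarrow> 'a \<times> 'a \<Rightarrow> ('a, 'n::finite) mat_th" where
  "T_long S i = (\<lambda>(x, y). mat 1 + mat_entry Zero (- i) x
     - mat_entry i Zero (lam_pow S (- ((1 + eps i) div 2)) * invol S x * mu S)
     + mat_entry i (- i) y)"

text \<open>\<open>EU S \<Delta> (I, \<Omega>)\<close> is the subgroup of \<open>U_grp S \<Delta>\<close> generated by the elementary matrices of
  level \<open>(I, \<Omega>)\<close>. The elementary group of the form ring itself is the case
  \<open>(I, \<Omega>) = (UNIV, \<Delta>)\<close>.\<close>

definition EU ::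
    "'a::comm_ring_1 herm \<Rightarrow> ('a \<times> 'a) set \<Rightarrow> 'a set \<times> ('a \<times> 'a) set
      \<Rightarrow> ('a, 'n::finite) mat_th set" where
  "EU S \<Delta> = (\<lambda>(I, \<Omega>). generate (U_grp S \<Delta>)
     ({T_short S i j x | i j x. i \<in> Theta_hb \<and> j \<in> Theta_hb \<and> i \<noteq> j \<and> i \<noteq> - j \<and> x \<in> I}
      \<union> {T_long S i \<alpha> | i \<alpha>. i \<in> Theta_hb \<and> \<alpha> \<in> signed S (- eps i) \<Omega>}))"

abbreviation EU_full ::
    "'a::comm_ring_1 herm \<Rightarrow> ('a \<times> 'a) set \<Rightarrow> ('a, 'n::finite) mat_th set" where
  "EU_full S \<Delta> \<equiv> EU S \<Delta> (UNIV, \<Delta>)"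

definition EU_rel ::
    "'a::comm_ring_1 herm \<Rightarrow> ('a \<times> 'a) set \<Rightarrow> 'a set \<times> ('a \<times> 'a) set
      \<Rightarrow> ('a, 'n::finite) mat_th set" where
  "EU_rel S \<Delta> L = generate (U_grp S \<Delta>)
     {\<tau> \<otimes>\<^bsub>U_grp S \<Delta>\<^esub> \<sigma> \<otimes>\<^bsub>U_grp S \<Delta>\<^esub> inv\<^bsub>U_grp S \<Delta>\<^esub> \<tau> | \<tau> \<sigma>.
        \<tau> \<in> EU_full S \<Delta> \<and> \<sigma> \<in> EU S \<Delta> L}"

definition U_rel ::
    "'a::comm_ring_1 herm \<Rightarrow> ('a \<times> 'a) set \<Rightarrow> 'a set \<times> ('a \<times> 'a) set
      \<Rightarrow> ('a, 'n::finite) mat_th set" where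
  "U_rel S \<Delta> = (\<lambda>(I, \<Omega>). {\<sigma> \<in> carrier (U_grp S \<Delta>).
     (\<forall>i\<in>Theta_hb. \<forall>j\<in>Theta_hb. \<sigma> $ i $ j - mat 1 $ i $ j \<in> I) \<and>
     (\<forall>u. u $ Zero \<in> J_of \<Delta> \<longrightarrow> heis_cong S \<Omega> (Q_form S (\<sigma> *v u)) (Q_form S u))})"

definition NU_rel ::
    "'a::comm_ring_1 herm \<Rightarrow> ('a \<times> 'a) set \<Rightarrow> 'a set \<times> ('a \<times> 'a) set
      \<Rightarrow> ('a, 'n::finite) mat_th set" where
  "NU_rel S \<Delta> L = normalizer (U_grp S \<Delta>) (U_rel S \<Delta> L)"

definition CU_rel ::
    "'a::comm_ring_1 herm \<Rightarrow> ('a \<times> 'a) set \<Rightarrow> 'a set \<times> ('a \<times> 'a) set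
      \<Rightarrow> ('a, 'n::finite) mat_th set" where
  "CU_rel S \<Delta> L = {\<sigma> \<in> NU_rel S \<Delta> L.
     generate (U_grp S \<Delta>)
       {\<sigma> \<otimes>\<^bsub>U_grp S \<Delta>\<^esub> \<tau> \<otimes>\<^bsub>U_grp S \<Delta>\<^esub> inv\<^bsub>U_grp S \<Delta>\<^esub> \<sigma> \<otimes>\<^bsub>U_grp S \<Delta>\<^esub> inv\<^bsub>U_grp S \<Delta>\<^esub> \<tau> | \<tau>.
          \<tau> \<in> EU_full S \<Delta>}
     \<subseteq> U_rel S \<Delta> L}"

definition level_gens ::
    "'a::comm_ring_1 herm \<Rightarrow> ('a \<times> 'a) set \<Rightarrow> ('a, 'n::finite) mat_th set \<Rightarrow> 'a set" where
  "level_gens S \<Delta> H = (\<Union>\<sigma>\<in>H. \<Union>i\<in>Theta_hb. \<Union>j\<in>Theta_hb - {i}.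
     {\<sigma> $ i $ j, \<sigma> $ i $ i - \<sigma> $ j $ j}
     \<union> {\<sigma> $ i $ Zero * y | y. y \<in> J_of \<Delta>}
     \<union> {invol S y * mu S * \<sigma> $ Zero $ j | y. y \<in> J_of \<Delta>}
     \<union> {invol S y * mu S * (\<sigma> $ Zero $ Zero - \<sigma> $ j $ j) * z | y z.
          y \<in> J_of \<Delta> \<and> z \<in> J_of \<Delta>})"

definition level_form_gens ::
    "'a::comm_ring_1 herm \<Rightarrow> ('a \<times> 'a) set \<Rightarrow> ('a, 'n::finite) mat_th set \<Rightarrow> ('a \<times> 'a) set" where
  "level_form_gens S \<Delta> H =
     {Q_form S (column j \<sigma>) | \<sigma> j. \<sigma> \<in> H \<and> j \<in> Theta_hb}
     \<union> {heis_minus S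
          (act S (heis_minus S (Q_form S (column Zero \<sigma>)) (1, 0)) y \<otimes>\<^bsub>heis S\<^esub> (y, z))
          (act S (y, z) (\<sigma> $ i $ i)) | \<sigma> i y z.
        \<sigma> \<in> H \<and> i \<in> Theta_hb \<and> (y, z) \<in> \<Delta>}"

definition upper_level ::
    "'a::comm_ring_1 herm \<Rightarrow> ('a \<times> 'a) set \<Rightarrow> ('a, 'n::finite) mat_th set
      \<Rightarrow> 'a set \<times> ('a \<times> 'a) set" where
  "upper_level S \<Delta> H =
     (let J = ideal_gen (level_gens S \<Delta> H \<union> invol S ` level_gens S \<Delta> H)
      in (J, Omega_min S \<Delta> J <#>\<^bsub>heis S\<^esub> act_gen S (level_form_gens S \<Delta> H) UNIV))"

end

theory Submission imports Defs begin

text \<open>Transvections are used in the form of Eichler, Siegel and Dickson: \<open>esd u v y\<close> maps \<open>w\<close> to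
  \<open>w + v B(u, w) - u bar (B(w, v)) + u bar y B(u, w)\<close>. Conjugation by a unitary matrix \<open>g\<close> replaces
  \<open>u, v\<close> by \<open>g u, g v\<close> (\<open>esd_conj\<close>), and for fixed \<open>u\<close> the product is addition of the \<open>v\<close>, with
  a correction of \<open>y\<close> (\<open>esd_mult\<close>). Up to a unit in the parameter, the elementary generators are
  \<open>short p r x = esd (e p) (x e r) 0\<close> and \<open>long p (x, y) = esd (e p) (x e 0) y\<close> (\<open>EU_eq\<close>).

  Upper inclusion. Let \<open>(J, \<Sigma>)\<close> be a level. Say that \<open>\<sigma>\<close> is the scalar \<open>c\<close> modulo the level if
  \<open>\<sigma> u - c u\<close> is orthogonal modulo \<open>J\<close> to all vectors with zero coordinate in \<open>J(\<Delta>)\<close>, and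
  if \<open>\<sigma>\<close> acts on the elements \<open>Q w + (0, z)\<close> of \<open>\<Delta>\<close> as the map \<open>\<alpha> \<mapsto> \<alpha> \<circ> c\<close> modulo \<open>\<Sigma>\<close>
  (\<open>level_scalar\<close>). Such matrices are closed under products, inverses and elementary
  conjugation, and the scalar 1 gives the principal congruence subgroup. The generators of the
  upper level \<open>U(H)\<close> say precisely that each \<open>\<sigma>\<close> in \<open>H\<close> is the scalar \<open>\<sigma>\<^sub>i\<^sub>i\<close> modulo
  \<open>U(H)\<close>, and \<open>U(H)\<close> is the least such level (\<open>upper_level_scalar\<close>, \<open>upper_least\<close>). Hence
  \<open>[\<sigma>, \<tau>]\<close> is the scalar \<open>c bar c\<close>, that is 1, for elementary \<open>\<tau>\<close>, which is the upper inclusion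
  (\<open>H_CU\<close>). Moreover \<open>U(H)\<close> does not change if \<open>H\<close> is conjugated by an elementary matrix
  (\<open>upper_conj_by\<close>).

  Lower inclusion. The hypothesis on \<open>H\<close> is also stable under elementary conjugation
  (\<open>normalised_conj_by\<close>). So it is enough to show that each such \<open>H\<close> contains the generators
  of \<open>EU(U(H) * I\<^sup>1\<^sup>2)\<close>; the normal closure follows by applying this to all conjugates of \<open>H\<close>.
  Conjugation also multiplies results: a statement about the entries of all \<open>\<sigma>\<close> in \<open>H\<close> that ends in a
  fixed transvection may be applied to \<open>\<tau>\<^sup>-\<^sup>1 \<sigma> \<tau>\<close> for each elementary \<open>\<tau>\<close> that commutes with
  this transvection.

  The source of all transvections in \<open>H\<close> is \<open>key_commutator\<close>. For \<open>\<sigma>\<close> in \<open>H\<close>, take \<open>u\<close>, \<open>v\<close> in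
  the span of three basis vectors with \<open>(\<sigma> u)\<^sub>i = (\<sigma> v)\<^sub>i = 0\<close>, and let \<open>t\<close> be the transvection
  of \<open>u\<close> and \<open>v a\<close>. Then \<open>\<sigma> t \<sigma>\<^sup>-\<^sup>1\<close> fixes the basis vector \<open>e (- i)\<close>, and commutators
  with elementary matrices of level \<open>I\<close> lead to a short transvection in \<open>H\<close>, whose parameter is
  quadratic in row \<open>i\<close> of \<open>\<sigma>\<close>. Different choices of \<open>u\<close>, \<open>v\<close> and conjugations give products
  of two entries of the row, and as the row is unimodular, they give its entries with a
  factor in \<open>I\<^sup>7\<close> (\<open>absorbs_row_entry\<close>). Three further factors move these parameters to all positions
  (\<open>absorbs_spread\<close>), and the other generators of the ideal \<open>J\<close> of \<open>U(H)\<close> are obtained by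
  conjugation. So \<open>H\<close> contains \<open>short p r x\<close> for all \<open>x\<close> in \<open>J I\<^sup>1\<^sup>0\<close> (\<open>uJ_short\<close>), and then
  all generators of the least level with ideal \<open>J I\<^sup>1\<^sup>0\<close>. These lie in the set \<open>core J\<close> of matrices
  common to all normalised \<open>H\<close> of ideal \<open>J\<close>, which is stable under elementary conjugation.

  For the forms, the same \<open>t\<close> is used with \<open>u = e\<^sub>i \<sigma>\<^sub>j\<^sub>j - e\<^sub>j \<sigma>\<^sub>j\<^sub>i\<close>. Now \<open>J\<close> measures the distance of
  \<open>\<sigma>\<close> to a scalar, and modulo \<open>core J\<close> one obtains the long transvection with parameter
  \<open>Q(\<sigma>\<^sub>*\<^sub>i) \<circ> (a b)\<close>, \<open>a\<close> in \<open>I\<^sup>1\<^sup>0\<close> and \<open>b\<close> in \<open>I\<close> (\<open>long_column_product\<close>). This covers all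
  positions except \<open>i\<close> and \<open>- i\<close>, which cost one more factor (\<open>long_column_12\<close>). The elements \<open>\<alpha>\<close> with
  \<open>long d (\<alpha> \<circ> k)\<close> in \<open>H\<close> for all \<open>k\<close> in \<open>I\<^sup>1\<^sup>2\<close> form a level (\<open>absorbed_forms_is_level\<close>). It
  contains \<open>Q(\<sigma>\<^sub>*\<^sub>i)\<close>, and it contains the generators of \<open>U(H)\<close> of the other kind because these measure
  the column \<open>- k\<close> of a conjugate of \<open>\<sigma>\<close> by \<open>long k (y, z)\<close> (\<open>absorbed_forms_gens\<close>).\<close>

section \<open>The Hermitian form and the quadratic form\<close>

text \<open>With this rule \<open>ac_simps\<close> would loop on products in a commutative ring.\<close>

declare ring_module.scale_scale [simp del]

locale form_ring3 = hermitian_form_ring S \<Delta>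
  for S :: "'a::comm_ring_1 herm" and \<Delta> :: "('a \<times> 'a) set"
begin

abbreviation bar :: "'a \<Rightarrow> 'a" where "bar \<equiv> invol S"
abbreviation ell :: 'a ("\<ell>") where "\<ell> \<equiv> lam S"
abbreviation emm :: 'a ("\<mu>") where "\<mu> \<equiv> mu S"
abbreviation B :: "('a, 3) vec_th \<Rightarrow> ('a, 3) vec_th \<Rightarrow> 'a" where "B \<equiv> B_form S"
abbreviation Q :: "('a, 3) vec_th \<Rightarrow> 'a \<times> 'a" where "Q \<equiv> Q_form S"
abbreviation q :: "('a, 3) vec_th \<Rightarrow> 'a" where "q u \<equiv> snd (Q_form S u)"
abbreviation e :: "3 theta \<Rightarrow> ('a, 3) vec_th" where "e p \<equiv> axis p 1"

lemma bar_mult: "bar (x * y) = bar x * bar y"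
  using invol_mult[of x y] by (simp add: mult.commute)

lemma bar_0 [simp]: "bar 0 = 0"
  using invol_add[of 0 0] by simp

lemma bar_1 [simp]: "bar 1 = 1"
  by (rule invol_one)

lemma bar_minus: "bar (- x) = - bar x"
  using invol_add[of x "- x"] by (simp add: eq_neg_iff_add_eq_0 add.commute)

lemma bar_diff: "bar (x - y) = bar x - bar y"
  using invol_add[of x "- y"] by (simp add: bar_minus)

lemma bar_sum: "bar (sum f A) = (\<Sum>x\<in>A. bar (f x))"
  by (induction A rule: infinite_finite_induct) (auto simp: invol_add)

lemma ell_bar: "\<ell> * bar \<ell> = 1"
  using invol_invol[of 1] by simp

lemma bar_ell: "bar \<ell> * \<ell> = 1"
  by (subst mult.commute) (rule ell_bar)

lemma bar_bar [simp]: "bar (bar x) = x"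
  by (subst invol_invol, subst mult.assoc, subst mult.left_commute) (simp only: ell_bar mult_1_right)

lemma bar_mu: "bar \<mu> = \<mu> * bar \<ell>"
  by (subst (2) mu_eq) (simp only: mult.assoc ell_bar mult_1_right)

lemmas bar_simps = invol_add bar_mult bar_minus bar_diff bar_mu

lemma ell_cancel [simp]: "\<ell> * bar \<ell> = 1" "bar \<ell> * \<ell> = 1" "\<ell> * (bar \<ell> * x) = x" "bar \<ell> * (\<ell> * x) = x"
  by (simp_all add: ell_bar bar_ell flip: mult.assoc)

lemma ell_cancel_deep: "\<ell> * (x * bar \<ell>) = x" "\<ell> * (x * (bar \<ell> * y)) = x * y"
  "\<ell> * (x * (z * bar \<ell>)) = x * z" "\<ell> * (x * (z * (bar \<ell> * y))) = x * (z * y)"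
  by (simp_all add: mult.left_commute[of _ "bar \<ell>"] mult.commute[of _ "bar \<ell>"])

text \<open>The coefficient of \<open>B\<close> at the pairing of index \<open>p\<close> with \<open>- p\<close>. It makes \<open>B\<close> a single sum over all
  indices (\<open>B_sum\<close>).\<close>

definition om :: "3 theta \<Rightarrow> 'a" where
  "om p = (case p of Pos k \<Rightarrow> 1 | Zero \<Rightarrow> \<mu> | Neg k \<Rightarrow> \<ell>)"

lemma om_bar: "p \<noteq> Zero \<Longrightarrow> om p * bar (om p) = 1"
  by (cases p) (auto simp: om_def ell_bar)

lemma om_uminus: "\<ell> * bar (om (- p)) = om p"
proof -
  have "\<ell> * bar \<mu> = \<mu>"
    unfolding bar_mu by (subst mult.left_commute) (simp only: ell_bar mult_1_right)
  then show ?thesis by (cases p) (auto simp: om_def ell_bar)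
qed

lemma theta_minus_minus [simp]: "- (- p) = (p :: 3 theta)"
  by (cases p) auto

lemma theta_minus_eq [simp]: "(- p = - r) = (p = (r :: 3 theta))"
  by (metis theta_minus_minus)

lemma theta_minus_Zero [simp]: "- p = Zero \<longleftrightarrow> p = (Zero :: 3 theta)" "Zero = - p \<longleftrightarrow> p = (Zero :: 3 theta)"
  by (cases p; auto)+

lemma theta_ne_minus: "p \<noteq> Zero \<Longrightarrow> - p \<noteq> (p :: 3 theta)"
  by (cases p) auto

lemma theta_UNIV: "UNIV = Theta_pos \<union> Theta_neg \<union> {Zero :: 3 theta}"
proof -
  have "x \<in> Theta_pos \<union> Theta_neg \<union> {Zero}" for x :: "3 theta"
    by (cases x) auto
  then show ?thesis by blast
qed

lemma sum_theta:
  "(\<Sum>p\<in>UNIV. f p) = (\<Sum>p\<in>Theta_pos. f p) + f Zero + (\<Sum>p\<in>Theta_neg. f (p :: 3 theta) :: 'a)"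
proof -
  have "(\<Sum>p\<in>UNIV. f p) = (\<Sum>p\<in>Theta_pos \<union> Theta_neg. f p) + f Zero"
    by (subst theta_UNIV, subst sum.union_disjoint) auto
  also have "(\<Sum>p\<in>Theta_pos \<union> Theta_neg. f p) = (\<Sum>p\<in>Theta_pos. f p) + (\<Sum>p\<in>Theta_neg. f p)"
    by (rule sum.union_disjoint) auto
  finally show ?thesis by (simp add: ac_simps)
qed

lemma B_sum: "B u v = (\<Sum>p\<in>UNIV. om p * bar (u $ p) * v $ (- p))"
proof -
  have "(\<Sum>p\<in>Theta_neg. bar (u $ p) * \<ell> * v $ (- p)) = (\<Sum>p\<in>Theta_neg. om p * bar (u $ p) * v $ (- p))"
    by (rule sum.cong) (auto simp: om_def mult.commute)
  moreover have "(\<Sum>p\<in>Theta_pos. bar (u $ p) * v $ (- p)) = (\<Sum>p\<in>Theta_pos. om p * bar (u $ p) * v $ (- p))"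
    by (rule sum.cong) (auto simp: om_def)
  moreover have "bar (u $ Zero) * \<mu> * v $ Zero = om Zero * bar (u $ Zero) * v $ (- Zero)"
    by (simp add: om_def mult.commute)
  ultimately show ?thesis
    unfolding B_form_def sum_theta by simp
qed

lemma B_add_left: "B (u + u') v = B u v + B u' v"
  and B_add_right: "B u (v + v') = B u v + B u v'"
  and B_minus_left: "B (- u) v = - B u v"
  and B_minus_right: "B u (- v) = - B u v"
  and B_diff_left: "B (u - u') v = B u v - B u' v"
  and B_diff_right: "B u (v - v') = B u v - B u v'"
  and B_scale_left: "B (c *s u) v = bar c * B u v"
  and B_scale_right: "B u (c *s v) = c * B u v"
  and B_zero_left [simp]: "B 0 v = 0"
  and B_zero_right [simp]: "B u 0 = 0"
  unfolding B_sum
  by (simp_all add: bar_simps sum.distrib sum_negf sum_subtractf sum_distrib_left algebra_simps)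

lemmas B_simps = B_add_left B_add_right B_minus_left B_minus_right B_diff_left B_diff_right
  B_scale_left B_scale_right

lemma B_herm: "B u v = \<ell> * bar (B v u)"
proof -
  have "\<ell> * bar (B v u) = (\<Sum>p\<in>UNIV. \<ell> * bar (om p) * v $ p * bar (u $ (- p)))"
    unfolding B_sum by (simp add: bar_sum bar_mult sum_distrib_left ac_simps)
  also have "\<dots> = (\<Sum>p\<in>UNIV. \<ell> * bar (om (- p)) * v $ (- p) * bar (u $ p))"
    by (rule sum.reindex_bij_witness[of _ uminus uminus]) auto
  also have "\<dots> = B u v"
    unfolding B_sum om_uminus by (simp add: ac_simps)
  finally show ?thesis ..
qed

lemma B_bar: "bar (B u v) = bar \<ell> * B v u"
proof -
  have "bar (B u v) = (bar \<ell> * \<ell>) * bar (B u v)" by (simp add: bar_ell)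
  also have "\<dots> = bar \<ell> * B v u" by (subst (2) B_herm) (simp only: mult.assoc)
  finally show ?thesis .
qed

lemma B_e_left [simp]: "B (e p) w = om p * w $ (- p)"
proof -
  have "B (e p) w = (\<Sum>k\<in>UNIV. if k = p then om p * w $ (- p) else 0)"
    unfolding B_sum by (rule sum.cong) (auto simp: axis_def)
  then show ?thesis by simp
qed

lemma B_e_right: "B w (e p) = om (- p) * bar (w $ (- p))"
  by (subst B_herm) (use om_uminus[of "- p"] in \<open>simp add: bar_mult ac_simps\<close>,
      metis (no_types, lifting) mult.assoc mult.commute)

text \<open>The part of \<open>B\<close> over the negative indices. Since \<open>Q\<close> involves only half of the pairings, it is
  quadratic with polar form \<open>B\<close> up to an element \<open>x - bar x \<ell>\<close>; this is the \<open>x\<close>, see \<open>q_add\<close>.\<close>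

definition Bm :: "('a, 3) vec_th \<Rightarrow> ('a, 3) vec_th \<Rightarrow> 'a" where
  "Bm u v = (\<Sum>p\<in>Theta_neg. \<ell> * bar (u $ p) * v $ (- p))"

lemma q_sum: "q u = (\<Sum>p\<in>Theta_pos. bar (u $ p) * u $ (- p))"
  by (simp add: Q_form_def)

lemma Bm_add_left: "Bm (u + u') v = Bm u v + Bm u' v"
  and Bm_add_right: "Bm u (v + v') = Bm u v + Bm u v'"
  and Bm_scale_left: "Bm (c *s u) v = bar c * Bm u v"
  and Bm_scale_right: "Bm u (c *s v) = c * Bm u v"
  unfolding Bm_def
  by (simp_all add: bar_simps sum.distrib sum_subtractf sum_distrib_left algebra_simps)

lemma sum_pos_neg: "(\<Sum>p\<in>Theta_pos. f (- p)) = (\<Sum>p\<in>Theta_neg. f (p :: 3 theta) :: 'a)"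
  by (rule sum.reindex_bij_witness[of _ uminus uminus]) auto

lemma B_split: "B u v = (\<Sum>p\<in>Theta_pos. bar (u $ p) * v $ (- p)) + bar (u $ Zero) * \<mu> * v $ Zero + Bm u v"
  unfolding B_form_def Bm_def by (simp add: ac_simps)

lemma q_add: "q (u + v) = q u + q v + (B u v - bar (u $ Zero) * \<mu> * v $ Zero) - (Bm u v - bar (Bm u v) * \<ell>)"
proof -
  have "(\<Sum>p\<in>Theta_pos. bar (v $ p) * u $ (- p)) = bar (Bm u v) * \<ell>"
  proof -
    have "bar (Bm u v) * \<ell> = (\<ell> * bar \<ell>) * (\<Sum>p\<in>Theta_neg. u $ p * bar (v $ (- p)))"
      unfolding Bm_def by (simp add: bar_sum bar_mult sum_distrib_left sum_distrib_right ell_cancel_deep ac_simps)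
    also have "\<dots> = (\<Sum>p\<in>Theta_pos. u $ (- p) * bar (v $ p))"
      using sum_pos_neg[of "\<lambda>p. u $ p * bar (v $ (- p))"] by (simp add: ell_bar)
    finally show ?thesis by (simp add: ac_simps)
  qed
  then show ?thesis
    unfolding B_split q_sum by (simp add: invol_add sum.distrib algebra_simps)
qed

lemma q_scale: "q (c *s u) = bar c * c * q u"
  unfolding q_sum by (simp add: bar_mult sum_distrib_left ac_simps)

lemma q_zero [simp]: "q 0 = 0"
  unfolding q_sum by simp

lemma q_e [simp]: "p \<noteq> Zero \<Longrightarrow> q (e p) = 0"
  unfolding q_sum by (rule sum.neutral) (use theta_ne_minus in \<open>auto simp: axis_def\<close>)

lemma q_eZero [simp]: "q (e Zero) = 0"
  unfolding q_sum by (rule sum.neutral) (auto simp: axis_def)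

lemma B_diag: "B v v = bar (v $ Zero) * \<mu> * v $ Zero + q v + bar (q v) * \<ell>"
proof -
  have "Bm v v = bar (q v) * \<ell>"
  proof -
    have "Bm v v = \<ell> * (\<Sum>p\<in>Theta_pos. bar (v $ (- p)) * v $ p)"
      unfolding Bm_def using sum_pos_neg[of "\<lambda>p. \<ell> * bar (v $ p) * v $ (- p)"]
      by (simp add: sum_distrib_left ac_simps)
    then show ?thesis unfolding q_sum by (simp add: bar_sum bar_mult ac_simps)
  qed
  then show ?thesis
    unfolding B_split q_sum by simp
qed

section \<open>The Heisenberg group\<close>

lemma heis_simps [simp]:
  "carrier (heis S) = UNIV" "\<one>\<^bsub>heis S\<^esub> = (0, 0)"
  "(x1, y1) \<otimes>\<^bsub>heis S\<^esub> (x2, y2) = (x1 + x2, y1 + y2 - bar x1 * \<mu> * x2)"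
  by (simp_all add: heis_def)

lemma group_heis: "group (heis S)"
proof (rule groupI)
  fix \<alpha> :: "'a \<times> 'a"
  obtain x y where "\<alpha> = (x, y)" by fastforce
  then have "(- x, - y - bar x * \<mu> * x) \<otimes>\<^bsub>heis S\<^esub> \<alpha> = \<one>\<^bsub>heis S\<^esub>" by (simp add: bar_simps)
  then show "\<exists>\<beta>\<in>carrier (heis S). \<beta> \<otimes>\<^bsub>heis S\<^esub> \<alpha> = \<one>\<^bsub>heis S\<^esub>" by auto
qed (auto simp: bar_simps algebra_simps)

lemma heis_inv [simp]: "inv\<^bsub>heis S\<^esub> (x, y) = (- x, - y - bar x * \<mu> * x)"
  by (rule group.inv_equality[OF group_heis]) (simp_all add: bar_simps)

lemma act_simp [simp]: "act S (x, y) a = (x * a, bar a * y * a)"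
  by (simp add: act_def)

definition heis_diff :: "'a \<times> 'a \<Rightarrow> 'a \<times> 'a \<Rightarrow> 'a \<times> 'a" where
  "heis_diff \<alpha> \<beta> = (fst \<alpha> - fst \<beta>, snd \<alpha> - snd \<beta> + bar (fst \<alpha> - fst \<beta>) * \<mu> * fst \<beta>)"

lemma heis_minus_eq: "heis_minus S \<alpha> \<beta> = heis_diff \<alpha> \<beta>"
  by (cases \<alpha>; cases \<beta>) (simp add: heis_diff_def bar_simps algebra_simps)

text \<open>The closure conditions of a submodule of the Heisenberg group written out in coordinates
  (\<open>heis_submodule_iff\<close>), so that memberships can be checked by computing in the ring.\<close>

definition hsubmod :: "('a \<times> 'a) set \<Rightarrow> bool" where
  "hsubmod \<Omega> \<longleftrightarrow> (0, 0) \<in> \<Omega>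
    \<and> (\<forall>x y x' y'. (x, y) \<in> \<Omega> \<longrightarrow> (x', y') \<in> \<Omega> \<longrightarrow> (x + x', y + y' - bar x * \<mu> * x') \<in> \<Omega>)
    \<and> (\<forall>x y. (x, y) \<in> \<Omega> \<longrightarrow> (- x, - y - bar x * \<mu> * x) \<in> \<Omega>)
    \<and> (\<forall>x y a. (x, y) \<in> \<Omega> \<longrightarrow> (x * a, bar a * y * a) \<in> \<Omega>)"

lemma heis_submodule_iff: "heis_submodule S \<Omega> \<longleftrightarrow> hsubmod \<Omega>"
proof
  assume "heis_submodule S \<Omega>"
  then have s: "subgroup \<Omega> (heis S)" and a: "\<And>\<alpha> a. \<alpha> \<in> \<Omega> \<Longrightarrow> act S \<alpha> a \<in> \<Omega>"
    by (auto simp: heis_submodule_def)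
  show "hsubmod \<Omega>" unfolding hsubmod_def
    using subgroup.one_closed[OF s] subgroup.m_closed[OF s] subgroup.m_inv_closed[OF s] a
    by (metis heis_simps(2,3) heis_inv act_simp)
next
  assume h: "hsubmod \<Omega>"
  have "subgroup \<Omega> (heis S)"
    by (rule group.subgroupI[OF group_heis]) (use h in \<open>auto simp: hsubmod_def\<close>)
  then show "heis_submodule S \<Omega>"
    unfolding heis_submodule_def using h by (auto simp: hsubmod_def)
qed

lemma hsubmod_0: "hsubmod \<Omega> \<Longrightarrow> (0, 0) \<in> \<Omega>"
  and hsubmod_add: "hsubmod \<Omega> \<Longrightarrow> (x, y) \<in> \<Omega> \<Longrightarrow> (x', y') \<in> \<Omega> \<Longrightarrow> (x + x', y + y' - bar x * \<mu> * x') \<in> \<Omega>"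
  and hsubmod_neg: "hsubmod \<Omega> \<Longrightarrow> (x, y) \<in> \<Omega> \<Longrightarrow> (- x, - y - bar x * \<mu> * x) \<in> \<Omega>"
  and hsubmod_act: "hsubmod \<Omega> \<Longrightarrow> (x, y) \<in> \<Omega> \<Longrightarrow> (x * a, bar a * y * a) \<in> \<Omega>"
  unfolding hsubmod_def by blast+

lemma hsubmod_add0: "hsubmod \<Omega> \<Longrightarrow> (x, y) \<in> \<Omega> \<Longrightarrow> (0, y') \<in> \<Omega> \<Longrightarrow> (x, y + y') \<in> \<Omega>"
  using hsubmod_add[of \<Omega> x y 0 y'] by simp

lemma hsubmod_neg0: "hsubmod \<Omega> \<Longrightarrow> (0, y) \<in> \<Omega> \<Longrightarrow> (0, - y) \<in> \<Omega>"
  using hsubmod_neg[of \<Omega> 0 y] by simp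

lemma hsubmod_diff0: "hsubmod \<Omega> \<Longrightarrow> (x, y) \<in> \<Omega> \<Longrightarrow> (0, y') \<in> \<Omega> \<Longrightarrow> (x, y - y') \<in> \<Omega>"
  using hsubmod_add0[OF _ _ hsubmod_neg0] by fastforce

definition cong_mod :: "('a \<times> 'a) set \<Rightarrow> 'a \<times> 'a \<Rightarrow> 'a \<times> 'a \<Rightarrow> bool" where
  "cong_mod \<Omega> \<alpha> \<beta> \<longleftrightarrow> heis_diff \<alpha> \<beta> \<in> \<Omega>"

lemma heis_cong_iff: "heis_cong S \<Omega> \<alpha> \<beta> \<longleftrightarrow> cong_mod \<Omega> \<alpha> \<beta>"
  by (simp add: heis_cong_def cong_mod_def heis_minus_eq)

lemma cong_mod_refl: "hsubmod \<Omega> \<Longrightarrow> cong_mod \<Omega> \<alpha> \<alpha>"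
  by (simp add: cong_mod_def heis_diff_def hsubmod_0)

lemma cong_mod_sym: "hsubmod \<Omega> \<Longrightarrow> cong_mod \<Omega> \<alpha> \<beta> \<Longrightarrow> cong_mod \<Omega> \<beta> \<alpha>"
  unfolding cong_mod_def heis_diff_def by (drule (1) hsubmod_neg) (simp add: bar_simps algebra_simps)

lemma cong_mod_trans: "hsubmod \<Omega> \<Longrightarrow> cong_mod \<Omega> \<alpha> \<beta> \<Longrightarrow> cong_mod \<Omega> \<beta> \<gamma> \<Longrightarrow> cong_mod \<Omega> \<alpha> \<gamma>"
  unfolding cong_mod_def heis_diff_def by (drule (2) hsubmod_add) (simp add: bar_simps algebra_simps)

lemma cong_mod_act: "hsubmod \<Omega> \<Longrightarrow> cong_mod \<Omega> (x, y) (x', y') \<Longrightarrow> cong_mod \<Omega> (x * a, bar a * y * a) (x' * a, bar a * y' * a)"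
  unfolding cong_mod_def heis_diff_def by (drule hsubmod_act[of _ _ _ a], simp) (simp add: bar_simps algebra_simps)

lemma cong_mod_shift: "cong_mod \<Omega> (x, y) (x', y') \<Longrightarrow> cong_mod \<Omega> (x, y + z) (x', y' + z)"
  unfolding cong_mod_def heis_diff_def by simp

lemma cong_mod_mem: "hsubmod \<Omega> \<Longrightarrow> cong_mod \<Omega> \<alpha> \<beta> \<Longrightarrow> \<beta> \<in> \<Omega> \<Longrightarrow> \<alpha> \<in> \<Omega>"
  using hsubmod_add[of \<Omega> "fst \<alpha> - fst \<beta>" "snd \<alpha> - snd \<beta> + bar (fst \<alpha> - fst \<beta>) * \<mu> * fst \<beta>" "fst \<beta>" "snd \<beta>"]
  by (cases \<alpha>; cases \<beta>) (auto simp: cong_mod_def heis_diff_def)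

lemma \<Delta>_sub: "hsubmod \<Delta>" and \<Delta>_min: "(0, x - bar x * \<ell>) \<in> \<Delta>"
  and \<Delta>_max: "(x, y) \<in> \<Delta> \<Longrightarrow> bar x * \<mu> * x + y + bar y * \<ell> = 0"
  using odd_form_parameter by (auto simp: odd_form_parameter_def heis_submodule_iff Delta_min_def Delta_max_def)

section \<open>Eichler-Siegel-Dickson transvections\<close>

lemma vec_expand: "w = (\<Sum>p\<in>UNIV. w $ p *s e p)" for w :: "('a, 3) vec_th"
  by (simp add: vec_eq_iff axis_def if_distrib cong: if_cong)

lemma B_expand_right: "B u w = (\<Sum>p\<in>UNIV. B u (e p) * w $ p)"
  unfolding B_e_right B_sum[of u w]
  by (rule sum.reindex_bij_witness[of _ uminus uminus]) (auto simp: B_sum axis_def if_distrib cong: if_cong)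

text \<open>As a map this is \<open>esd_apply\<close>. The family contains the elementary matrices and, unlike them, it
  is stable under conjugation by unitary matrices.\<close>

definition esd :: "('a, 3) vec_th \<Rightarrow> ('a, 3) vec_th \<Rightarrow> 'a \<Rightarrow> ('a, 3) mat_th" where
  "esd u v y = (\<chi> i j. (if i = j then 1 else 0) + B u (e j) * v $ i - bar (B (e j) v) * u $ i
     + bar y * B u (e j) * u $ i)"

lemma esd_apply:
  "esd u v y *v w = w + B u w *s v - bar (B w v) *s u + (bar y * B u w) *s u"
proof -
  have 1: "(\<Sum>j\<in>UNIV. B u (e j) * w $ j) = B u w"
    using B_expand_right[of u w] by simp
  have "bar (B w v) = bar \<ell> * B v w" by (rule B_bar)
  also have "\<dots> = (\<Sum>j\<in>UNIV. bar \<ell> * B v (e j) * w $ j)"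
    by (subst B_expand_right) (simp add: sum_distrib_left ac_simps)
  finally have 2: "(\<Sum>j\<in>UNIV. bar (B (e j) v) * w $ j) = bar (B w v)"
    unfolding B_bar by simp
  show ?thesis
  proof (rule vec_eq_iff[THEN iffD2, rule_format])
    fix i
    have "(esd u v y *v w) $ i = (\<Sum>j\<in>UNIV. (if i = j then w $ j else 0))
        + (\<Sum>j\<in>UNIV. B u (e j) * w $ j) * v $ i - (\<Sum>j\<in>UNIV. bar (B (e j) v) * w $ j) * u $ i
        + bar y * (\<Sum>j\<in>UNIV. B u (e j) * w $ j) * u $ i"
      unfolding matrix_vector_mult_def esd_def sum_distrib_left sum_distrib_right
        sum.distrib[symmetric] sum_subtractf[symmetric] vec_lambda_beta
      by (rule sum.cong) (auto simp: algebra_simps simp del: B_e_left)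
    then show "(esd u v y *v w) $ i = (w + B u w *s v - bar (B w v) *s u + (bar y * B u w) *s u) $ i"
      unfolding 1 2 by simp
  qed
qed

lemma mat_eqI: "(\<And>w. A *v w = C *v w) \<Longrightarrow> A = C" for A :: "('a, 3) mat_th"
  using matrix_eq by blast

lemma mv_add: "A *v (u + v) = A *v u + A *v v" for A :: "('a, 3) mat_th"
  by (rule matrix_vector_right_distrib)

lemma mv_scale: "A *v (c *s u) = c *s (A *v u)" for A :: "('a, 3) mat_th"
  by (simp add: vec_eq_iff matrix_vector_mult_def sum_distrib_left ac_simps)

lemma mv_diff: "A *v (u - v) = A *v u - A *v v" for A :: "('a, 3) mat_th"
proof -
  have "u - v = u + (- 1) *s v" "A *v u - A *v v = A *v u + (- 1) *s (A *v v)"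
    by (simp_all add: vec_eq_iff)
  then show ?thesis by (simp only: mv_add mv_scale)
qed

lemma mv_mul: "(A ** C) *v u = A *v (C *v u)" for A :: "('a, 3) mat_th"
  by (simp add: matrix_vector_mul_assoc)

lemmas mv_simps = mv_add mv_scale mv_diff mv_mul

lemma vec_simps: "(a *s u) $ i = a * u $ i" "(u + v) $ i = u $ i + v $ i" "(u - v) $ i = u $ i - v $ i"
  for u :: "('a, 3) vec_th"
  by simp_all

lemma esd_conj:
  assumes "\<And>u v. B (g *v u) (g *v v) = B u v"
  shows "g ** esd u v y = esd (g *v u) (g *v v) y ** g"
  by (rule mat_eqI) (simp add: mv_simps esd_apply assms)

lemma esd_mult:
  assumes "B u u = 0" "B u v = 0" "B u v' = 0"
  shows "esd u v y ** esd u v' y' = esd u (v + v') (y + y' - B v' v)"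
proof (rule mat_eqI)
  fix w
  have "B v u = 0" "B v' u = 0" using assms by (subst B_herm, simp)+
  then show "(esd u v y ** esd u v' y') *v w = esd u (v + v') (y + y' - B v' v) *v w"
    by (simp add: mv_simps esd_apply B_simps assms vec_eq_iff bar_simps algebra_simps)
qed

lemma esd_0 [simp]: "esd u 0 0 = mat 1"
  by (rule mat_eqI) (simp add: esd_apply)

text \<open>For \<open>y = 0\<close> the vectors \<open>u\<close> and \<open>v\<close> play the same role up to a unit.\<close>

lemma esd_sym: "esd u v 0 = esd v (- bar \<ell> *s u) 0"
proof (rule mat_eqI)
  fix w
  have "bar (B w (- bar \<ell> *s u)) = - \<ell> * bar (B w u)"
    unfolding B_scale_right by (simp add: bar_simps)
  also have "\<dots> = - B u w" by (subst (2) B_herm) simp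
  finally have 1: "bar (B w (- bar \<ell> *s u)) = - B u w" .
  have 2: "bar (B w v) = bar \<ell> * B v w" by (rule B_bar)
  show "esd u v 0 *v w = esd v (- bar \<ell> *s u) 0 *v w"
    unfolding esd_apply 1 2 by (simp add: vec_eq_iff algebra_simps)
qed

lemma esd_scale: "esd (c *s u) v y = esd u (bar c *s v) (y * c * bar c)"
  by (rule mat_eqI) (simp add: esd_apply B_simps bar_simps vec_eq_iff algebra_simps)

lemma esd_pres:
  assumes "B u u = 0" "B u v = 0" "B v v + y + bar y * \<ell> = 0"
  shows "B (esd u v y *v w) (esd u v y *v w') = B w w'"
proof -
  have 0: "B v u = 0" using assms by (subst B_herm, simp)
  have 1: "B w u = \<ell> * bar (B u w)" "B v w' = \<ell> * bar (B w' v)" by (rule B_herm)+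
  have "B (esd u v y *v w) (esd u v y *v w') = B w w' + bar (B u w) * B u w' * (B v v + y + bar y * \<ell>)"
    unfolding esd_apply B_simps 0 1 using assms(1,2) by (simp add: bar_simps algebra_simps)
  then show ?thesis using assms(3) by simp
qed

end

context form_ring3 begin

section \<open>Levels\<close>

text \<open>The closure conditions of an odd form ideal \<open>(J, \<Omega>)\<close> in coordinates; the second coordinates of
  \<open>\<Omega>\<close> are not restricted to \<open>J\<close>. Instances are the pair of the whole
  ring and \<open>\<Delta>\<close>, the upper level of a subgroup, and the levels generated by a set of forms.\<close>

definition is_level :: "'a set \<Rightarrow> ('a \<times> 'a) set \<Rightarrow> bool" where
  "is_level J \<Omega> \<longleftrightarrow> is_ideal J \<and> (\<forall>x\<in>J. bar x \<in> J) \<and> hsubmod \<Omega> \<and> \<Omega> \<subseteq> \<Delta>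
    \<and> (\<forall>x\<in>J. (0, x - bar x * \<ell>) \<in> \<Omega>)
    \<and> (\<forall>x y a. (x, y) \<in> \<Delta> \<longrightarrow> a \<in> J \<longrightarrow> (x * a, bar a * y * a) \<in> \<Omega>)
    \<and> (\<forall>x y z. (x, y) \<in> \<Omega> \<longrightarrow> z \<in> J_of \<Delta> \<longrightarrow> bar z * \<mu> * x \<in> J)"

lemma ideal_add: "is_ideal J \<Longrightarrow> x \<in> J \<Longrightarrow> y \<in> J \<Longrightarrow> x + y \<in> J"
  and ideal_0: "is_ideal J \<Longrightarrow> 0 \<in> J"
  and ideal_diff: "is_ideal J \<Longrightarrow> x \<in> J \<Longrightarrow> y \<in> J \<Longrightarrow> x - y \<in> J"
  and ideal_neg: "is_ideal J \<Longrightarrow> x \<in> J \<Longrightarrow> - x \<in> J"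
  and ideal_mult_left: "is_ideal J \<Longrightarrow> x \<in> J \<Longrightarrow> c * x \<in> J"
  and ideal_mult_right: "is_ideal J \<Longrightarrow> x \<in> J \<Longrightarrow> x * c \<in> J"
  for J :: "'a set"
  using ring_module.subspace_add ring_module.subspace_0 ring_module.subspace_diff
    ring_module.subspace_neg ring_module.subspace_scale
  by (fastforce simp: mult.commute)+

lemma ideal_sum: "is_ideal J \<Longrightarrow> (\<And>i. i \<in> A \<Longrightarrow> f i \<in> J) \<Longrightarrow> sum f A \<in> J" for J :: "'a set"
  by (rule ring_module.subspace_sum)

lemmas ideal_closed = ideal_add ideal_diff ideal_neg ideal_mult_left ideal_mult_right

lemma is_level_ideal: "is_level J \<Omega> \<Longrightarrow> is_ideal J"
  and is_level_bar: "is_level J \<Omega> \<Longrightarrow> x \<in> J \<Longrightarrow> bar x \<in> J"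
  and is_level_hsubmod: "is_level J \<Omega> \<Longrightarrow> hsubmod \<Omega>"
  and is_level_sub: "is_level J \<Omega> \<Longrightarrow> \<Omega> \<subseteq> \<Delta>"
  and is_level_min: "is_level J \<Omega> \<Longrightarrow> x \<in> J \<Longrightarrow> (0, x - bar x * \<ell>) \<in> \<Omega>"
  and is_level_act: "is_level J \<Omega> \<Longrightarrow> (x, y) \<in> \<Delta> \<Longrightarrow> a \<in> J \<Longrightarrow> (x * a, bar a * y * a) \<in> \<Omega>"
  and is_level_tilde: "is_level J \<Omega> \<Longrightarrow> (x, y) \<in> \<Omega> \<Longrightarrow> z \<in> J_of \<Delta> \<Longrightarrow> bar z * \<mu> * x \<in> J"
  unfolding is_level_def by blast+

lemma is_level_full: "is_level UNIV \<Delta>"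
  unfolding is_level_def using \<Delta>_sub \<Delta>_min by (auto simp: hsubmod_act)

lemma JD_I: "(x, y) \<in> \<Delta> \<Longrightarrow> x \<in> J_of \<Delta>"
  by (auto simp: J_of_def)

lemma JD_ideal: "is_ideal (J_of \<Delta>)"
proof (rule ring_module.subspaceI)
  show "0 \<in> J_of \<Delta>" using hsubmod_0[OF \<Delta>_sub] by (rule JD_I)
  show "x + y \<in> J_of \<Delta>" if "x \<in> J_of \<Delta>" "y \<in> J_of \<Delta>" for x y
    using that hsubmod_add[OF \<Delta>_sub] by (fastforce simp: J_of_def)
  show "c * x \<in> J_of \<Delta>" if "x \<in> J_of \<Delta>" for c x
    using that hsubmod_act[OF \<Delta>_sub] by (fastforce simp: J_of_def mult.commute)
qed

text \<open>The element \<open>Q w\<close> multiplied by \<open>(0, z)\<close>. If \<open>w $ Zero\<close> is in \<open>J(\<Delta>)\<close>, then \<open>z\<close> can be chosen so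
  that this lies in \<open>\<Delta>\<close>; a congruence between values of \<open>Q\<close> is not affected by the same shift on both
  sides (\<open>cong_mod_shift\<close>).\<close>

definition Qplus :: "'a \<Rightarrow> ('a, 3) vec_th \<Rightarrow> 'a \<times> 'a" where
  "Qplus z w = (w $ Zero, q w + z)"

lemma Q_fst [simp]: "fst (Q u) = u $ Zero"
  by (simp add: Q_form_def)

lemma e_nth [simp]: "e p $ k = (if k = p then 1 else 0)"
  by (simp add: axis_def)

lemma form_neg: "(x, y) \<in> \<Delta> \<Longrightarrow> - y - bar x * \<mu> * x = bar y * \<ell>"
proof -
  assume "(x, y) \<in> \<Delta>"
  then have "bar x * \<mu> * x + y + bar y * \<ell> = 0" by (rule \<Delta>_max)
  then have "bar y * \<ell> = 0 - (bar x * \<mu> * x + y)" by (metis add_diff_cancel_left')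
  then show ?thesis by (simp add: algebra_simps)
qed

lemma flip_form: "(x, y) \<in> \<Delta> \<Longrightarrow> (x, bar y * \<ell>) \<in> \<Delta>"
  using hsubmod_act[OF \<Delta>_sub hsubmod_neg[OF \<Delta>_sub], of x y "- 1"] form_neg[of x y]
  by (simp add: bar_simps)

text \<open>The transvection changes \<open>w\<close> by multiples of \<open>v\<close> and \<open>e p\<close> with coefficients in the ideal
  generated by \<open>w $ (- p)\<close>, \<open>B w v\<close> and their conjugates. If these lie in \<open>J\<close>, then \<open>Q w\<close> changes by the
  form of \<open>v\<close> times an element of \<open>J\<close> and an element \<open>m - bar m \<ell>\<close> with \<open>m\<close> in \<open>J\<close>. For \<open>J\<close> the
  whole ring this says that the transvection preserves \<open>Q\<close> modulo \<open>\<Delta>\<close>; for small \<open>w\<close> it says that the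
  elementary group preserves \<open>Q w\<close> modulo every level.\<close>

lemma esd_Q_cong:
  assumes "is_level J \<Omega>" and p: "p \<noteq> Zero" and v: "v $ (- p) = 0" "Qplus y v \<in> \<Delta>"
    and k: "w $ (- p) \<in> J" and h: "B w v \<in> J"
  shows "cong_mod \<Omega> (Q (esd (e p) v y *v w)) (Q w)"
proof -
  define \<kappa> where "\<kappa> = B (e p) w"
  define k where "k = B w v"
  define \<rho> where "\<rho> = bar y * \<kappa> - bar k"
  define w1 where "w1 = w + \<kappa> *s v"
  note J = is_level_ideal[OF assms(1)] and Jbar = is_level_bar[OF assms(1)]
  have \<kappa>J: "\<kappa> \<in> J" unfolding \<kappa>_def using k by (simp add: ideal_mult_left[OF J])
  have kJ: "k \<in> J" using h by (simp add: k_def)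
  have \<rho>J: "\<rho> \<in> J" unfolding \<rho>_def using \<kappa>J kJ Jbar by (intro ideal_diff[OF J] ideal_mult_left[OF J]) auto
  have T: "esd (e p) v y *v w = w1 + \<rho> *s e p"
    unfolding esd_apply w1_def \<rho>_def \<kappa>_def k_def by (simp add: vec_eq_iff algebra_simps)
  have vp: "B v (e p) = 0" using v by (simp add: B_e_right)
  have wp: "B w (e p) = \<ell> * bar \<kappa>" unfolding \<kappa>_def by (rule B_herm)
  have p': "Zero \<noteq> p" using p by simp
  then have ep0: "e p $ Zero = 0" by simp
  define g1 where "g1 = Bm w (\<kappa> *s v)"
  define g2 where "g2 = Bm w1 (\<rho> *s e p)"
  have gJ: "g1 \<in> J" "g2 \<in> J"
    unfolding g1_def g2_def Bm_scale_right using \<kappa>J \<rho>J by (auto intro: ideal_mult_right[OF J])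
  have q1: "q w1 = q w + bar \<kappa> * \<kappa> * q v + (\<kappa> * k - bar (w $ Zero) * \<mu> * (\<kappa> * v $ Zero)) - (g1 - bar g1 * \<ell>)"
    unfolding w1_def q_add g1_def by (simp add: q_scale B_scale_right k_def)
  have q2: "q (w1 + \<rho> *s e p) = q w1 + \<rho> * \<ell> * bar \<kappa> - (g2 - bar g2 * \<ell>)"
    unfolding q_add g2_def[symmetric]
    unfolding w1_def by (simp add: q_scale B_simps wp vp p p' ac_simps)
  define t where "t = bar \<kappa> * bar (v $ Zero) * \<mu> * w $ Zero"
  have tJ: "t \<in> J" unfolding t_def using Jbar[OF \<kappa>J] by (simp add: ideal_mult_right[OF J])
  have tb: "bar t * \<ell> = \<kappa> * v $ Zero * \<mu> * bar (w $ Zero)"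
    unfolding t_def by (simp add: bar_simps ell_cancel_deep ac_simps)
  define m where "m = \<kappa> * k - g1 - g2 + t"
  have mJ: "m \<in> J" unfolding m_def using \<kappa>J gJ tJ by (intro ideal_add[OF J] ideal_diff[OF J] ideal_mult_right[OF J])
  have "(v $ Zero, bar (q v) * \<ell> + bar y * \<ell>) \<in> \<Delta>"
    using flip_form[of "v $ Zero" "q v + y"] v(2) by (simp add: Qplus_def bar_simps distrib_right)
  from hsubmod_add0[OF \<Delta>_sub this \<Delta>_min[of "q v"]] have "(v $ Zero, q v + bar y * \<ell>) \<in> \<Delta>"
    by (simp add: algebra_simps)
  from is_level_act[OF assms(1) this \<kappa>J]
  have "(v $ Zero * \<kappa>, bar \<kappa> * (q v + bar y * \<ell>) * \<kappa>) \<in> \<Omega>" .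
  from hsubmod_add0[OF is_level_hsubmod[OF assms(1)] this is_level_min[OF assms(1) mJ]]
  have *: "(v $ Zero * \<kappa>, bar \<kappa> * (q v + bar y * \<ell>) * \<kappa> + (m - bar m * \<ell>)) \<in> \<Omega>" .
  have "heis_diff (Q (esd (e p) v y *v w)) (Q w) = (v $ Zero * \<kappa>, bar \<kappa> * (q v + bar y * \<ell>) * \<kappa> + (m - bar m * \<ell>))"
  proof -
    have 1: "(w1 + \<rho> *s e p) $ Zero = w $ Zero + \<kappa> * v $ Zero"
      by (simp add: w1_def p')
    have 2: "\<rho> * \<ell> * bar \<kappa> = bar y * \<kappa> * \<ell> * bar \<kappa> - bar (\<kappa> * k) * \<ell>"
      unfolding \<rho>_def by (simp add: bar_simps algebra_simps)
    have 3: "bar m * \<ell> = bar (\<kappa> * k) * \<ell> - bar g1 * \<ell> - bar g2 * \<ell> + \<kappa> * v $ Zero * \<mu> * bar (w $ Zero)"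
      unfolding m_def tb[symmetric] by (simp add: bar_simps algebra_simps)
    show ?thesis
      unfolding T heis_diff_def Q_fst fst_conv snd_conv 1 q2 q1 2 3 unfolding m_def t_def
      by (simp add: bar_simps algebra_simps)
  qed
  with * show ?thesis unfolding cong_mod_def by simp
qed

section \<open>The unitary group and its elementary matrices\<close>

abbreviation Ug :: "('a, 3) mat_th monoid" where "Ug \<equiv> U_grp S \<Delta>"

lemma U_simps [simp]: "mult Ug = (**)" "one Ug = mat 1"
  by (simp_all add: U_grp_def)

lemma U_iff: "\<sigma> \<in> carrier Ug \<longleftrightarrow> invertible \<sigma> \<and> (\<forall>u v. B (\<sigma> *v u) (\<sigma> *v v) = B u v)
    \<and> (\<forall>u. cong_mod \<Delta> (Q (\<sigma> *v u)) (Q u))"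
  by (simp add: U_grp_def heis_cong_iff)

lemma U_B: "\<sigma> \<in> carrier Ug \<Longrightarrow> B (\<sigma> *v u) (\<sigma> *v v) = B u v"
  by (simp add: U_iff)

lemma U_Q: "\<sigma> \<in> carrier Ug \<Longrightarrow> cong_mod \<Delta> (Q (\<sigma> *v u)) (Q u)"
  by (simp add: U_iff)

lemma group_U: "group Ug"
proof (rule groupI)
  fix \<sigma> \<tau> assume \<sigma>: "\<sigma> \<in> carrier Ug" and \<tau>: "\<tau> \<in> carrier Ug"
  have "invertible (\<sigma> ** \<tau>)" using \<sigma> \<tau> by (auto simp: U_iff invertible_mult)
  moreover have "cong_mod \<Delta> (Q ((\<sigma> ** \<tau>) *v u)) (Q u)" for u
    unfolding mv_mul by (rule cong_mod_trans[OF \<Delta>_sub U_Q[OF \<sigma>] U_Q[OF \<tau>]])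
  ultimately show "\<sigma> \<otimes>\<^bsub>Ug\<^esub> \<tau> \<in> carrier Ug"
    unfolding U_iff by (simp add: mv_mul U_B \<sigma> \<tau>)
next
  show "\<one>\<^bsub>Ug\<^esub> \<in> carrier Ug"
    unfolding U_iff by (auto simp: invertible_def cong_mod_refl[OF \<Delta>_sub] intro!: exI[of _ "mat 1"])
next
  fix \<sigma> assume \<sigma>: "\<sigma> \<in> carrier Ug"
  then obtain \<tau> where \<tau>: "\<sigma> ** \<tau> = mat 1" "\<tau> ** \<sigma> = mat 1" by (auto simp: U_iff invertible_def)
  have s: "\<sigma> *v (\<tau> *v u) = u" for u using \<tau> by (simp flip: mv_mul)
  have "B (\<tau> *v u) (\<tau> *v v) = B u v" for u v
    using U_B[OF \<sigma>, of "\<tau> *v u" "\<tau> *v v"] by (simp add: s)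
  moreover have "cong_mod \<Delta> (Q (\<tau> *v u)) (Q u)" for u
    using cong_mod_sym[OF \<Delta>_sub U_Q[OF \<sigma>, of "\<tau> *v u"]] by (simp add: s)
  ultimately have "\<tau> \<in> carrier Ug" using \<tau> by (auto simp: U_iff invertible_def)
  with \<tau> show "\<exists>\<tau>\<in>carrier Ug. \<tau> \<otimes>\<^bsub>Ug\<^esub> \<sigma> = \<one>\<^bsub>Ug\<^esub>" by auto
qed (auto simp: matrix_mul_assoc)

end

sublocale form_ring3 \<subseteq> G: group "U_grp S \<Delta> :: ('a, 3) mat_th monoid"
  by (rule group_U)

context form_ring3 begin

abbreviation iv :: "('a, 3) mat_th \<Rightarrow> ('a, 3) mat_th" where "iv g \<equiv> inv\<^bsub>U_grp S \<Delta>\<^esub> g"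

lemma iv_mul: "g \<in> carrier Ug \<Longrightarrow> g ** iv g = mat 1" "g \<in> carrier Ug \<Longrightarrow> iv g ** g = mat 1"
  using G.r_inv[of g] G.l_inv[of g] by simp_all

lemma iv_mv [simp]: "g \<in> carrier Ug \<Longrightarrow> g *v (iv g *v u) = u" "g \<in> carrier Ug \<Longrightarrow> iv g *v (g *v u) = u"
  by (simp_all add: iv_mul flip: mv_mul)

lemma U_mul: "g \<in> carrier Ug \<Longrightarrow> h \<in> carrier Ug \<Longrightarrow> g ** h \<in> carrier Ug"
  using G.m_closed[of g h] by simp

lemma esd_in_U:
  assumes p: "p \<noteq> Zero" and v: "v $ (- p) = 0" "Qplus y v \<in> \<Delta>"
  shows "esd (e p) v y \<in> carrier Ug"
proof -
  have 0: "B (e p) (e p) = 0" "B (e p) v = 0" using p v by (auto simp: theta_ne_minus)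
  have 1: "B v v + y + bar y * \<ell> = 0"
    unfolding B_diag using \<Delta>_max[of "v $ Zero" "q v + y"] v(2) by (simp add: Qplus_def bar_simps algebra_simps)
  have "esd (e p) v y ** esd (e p) (- v) (bar y * \<ell>) = mat 1"
    "esd (e p) (- v) (bar y * \<ell>) ** esd (e p) v y = mat 1"
    using 1 by (simp_all add: esd_mult 0 B_simps algebra_simps del: B_e_left)
  then show ?thesis
    unfolding U_iff using esd_pres[OF 0 1] esd_Q_cong[OF is_level_full p v]
    by (auto simp: invertible_def)
qed

definition short :: "3 theta \<Rightarrow> 3 theta \<Rightarrow> 'a \<Rightarrow> ('a, 3) mat_th" where
  "short p r x = esd (e p) (x *s e r) 0"

definition long :: "3 theta \<Rightarrow> 'a \<times> 'a \<Rightarrow> ('a, 3) mat_th" where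
  "long p \<alpha> = esd (e p) (fst \<alpha> *s e Zero) (snd \<alpha>)"

lemma mat_entry_mv: "mat_entry i j x *v w = (x * w $ j) *s e i" for w :: "('a, 3) vec_th"
  by (simp add: vec_eq_iff mat_entry_def matrix_vector_mult_def axis_def if_distrib if_distribR cong: if_cong)

lemma mv_mat_add: "(A + C) *v w = A *v w + C *v w" "(A - C) *v w = A *v w - C *v w" for w :: "('a, 3) vec_th"
  by (simp_all add: vec_eq_iff matrix_vector_mult_def algebra_simps sum.distrib sum_subtractf)

lemma eps_simps [simp]: "eps (Pos k) = 1" "eps (Neg k) = - 1"
  by (auto simp: eps_def)

lemma T_short_eq:
  assumes "i \<noteq> Zero" "j \<noteq> Zero"
  shows "T_short S i j x = short (- j) i (x * bar (om (- j)))"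
proof (rule mat_eqI)
  fix w
  have c: "lam_pow S ((eps j - 1) div 2) * bar x * lam_pow S ((1 - eps i) div 2) = bar x * om (- j) * bar (om (- i))"
    using assms by (cases i; cases j) (simp_all add: lam_pow_def om_def ell_cancel_deep ac_simps)
  have d: "bar (om (- j)) * om (- j) = 1" using om_bar[of "- j"] assms by (simp add: mult.commute)
  have d': "x * bar (om (- j)) * om (- j) = x" using d by (simp add: mult.assoc)
  have "B w (e i) = om (- i) * bar (w $ (- i))" by (rule B_e_right)
  then have "short (- j) i (x * bar (om (- j))) *v w
    = w + (x * bar (om (- j)) * om (- j) * w $ j) *s e i - (bar x * om (- j) * bar (om (- i)) * w $ (- i)) *s e (- j)"
    unfolding short_def esd_apply by (simp add: B_simps bar_simps vector_smult_assoc ac_simps)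
  then show "T_short S i j x *v w = short (- j) i (x * bar (om (- j))) *v w"
    unfolding T_short_def mv_mat_add mat_entry_mv c d' by simp
qed

lemma T_long_eq:
  assumes "i \<noteq> Zero"
  shows "T_long S i (x, y) = long i (x * bar (om i), bar y * om i)"
proof (rule mat_eqI)
  fix w
  have c: "lam_pow S (- ((1 + eps i) div 2)) * bar x * \<mu> = bar x * om i * (\<mu> * bar \<ell>)"
    using assms by (cases i) (simp_all add: lam_pow_def om_def ell_cancel_deep ac_simps)
  have d: "bar (om i) * om i = 1" using om_bar[of i] assms by (simp add: mult.commute)
  have d': "x * bar (om i) * om i = x" "y * bar (om i) * om i = y" using d by (simp_all add: mult.assoc)
  have "bar (B w (e Zero)) = \<mu> * bar \<ell> * w $ Zero" by (simp add: B_e_right om_def bar_simps)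
  then have "long i (x * bar (om i), bar y * om i) *v w
    = w + (x * bar (om i) * om i * w $ (- i)) *s e Zero - (bar x * om i * (\<mu> * bar \<ell>) * w $ Zero) *s e i
      + (y * bar (om i) * om i * w $ (- i)) *s e i"
    unfolding long_def esd_apply by (simp add: B_simps bar_simps vector_smult_assoc ac_simps)
  then show "T_long S i (x, y) *v w = long i (x * bar (om i), bar y * om i) *v w"
    unfolding T_long_def prod.case mv_mat_add mat_entry_mv c d' by simp
qed

definition elementary_gens :: "'a set \<Rightarrow> ('a \<times> 'a) set \<Rightarrow> ('a, 3) mat_th set" where
  "elementary_gens K \<Omega> = {short p r x | p r x. p \<noteq> Zero \<and> r \<noteq> Zero \<and> p \<noteq> r \<and> p \<noteq> - r \<and> x \<in> K}
     \<union> {long p \<alpha> | p \<alpha>. p \<noteq> Zero \<and> \<alpha> \<in> \<Omega>}"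

lemma long_sign:
  assumes h: "hsubmod \<Omega>" "\<Omega> \<subseteq> \<Delta>" and xy: "(x, y) \<in> \<Omega>"
  shows "(x * bar \<ell>, bar y * \<ell>) \<in> \<Omega>" "(x * \<ell>, bar y * \<ell>) \<in> \<Omega>"
proof -
  have "- y - bar x * \<mu> * x = bar y * \<ell>"
    using form_neg xy h by blast
  then have "(- x, bar y * \<ell>) \<in> \<Omega>" using hsubmod_neg[OF h(1) xy] by simp
  from hsubmod_act[OF h(1) this, of "- bar \<ell>"] hsubmod_act[OF h(1) this, of "- \<ell>"]
  show "(x * bar \<ell>, bar y * \<ell>) \<in> \<Omega>" "(x * \<ell>, bar y * \<ell>) \<in> \<Omega>"
    by (simp_all add: bar_simps ell_cancel_deep ac_simps)
qed

text \<open>The powers of \<open>\<lambda>\<close> in the definition of the generators are units, so they disappear when the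
  parameters run through an ideal and a submodule; the conjugations in \<open>signed\<close> disappear by \<open>long_sign\<close>.\<close>

lemma EU_eq:
  assumes K: "is_ideal K" and h: "hsubmod \<Omega>" "\<Omega> \<subseteq> \<Delta>"
  shows "EU S \<Delta> (K, \<Omega>) = generate Ug (elementary_gens K \<Omega>)"
proof -
  have "{T_short S i j x | i j x. i \<in> Theta_hb \<and> j \<in> Theta_hb \<and> i \<noteq> j \<and> i \<noteq> - j \<and> x \<in> K}
    = {short p r x | p r x. p \<noteq> Zero \<and> r \<noteq> Zero \<and> p \<noteq> r \<and> p \<noteq> - r \<and> x \<in> K}" (is "?A = ?B")
  proof (intro subset_antisym subsetI)
    fix g assume "g \<in> ?A"
    then obtain i j x where g: "g = T_short S i j x" "i \<noteq> Zero" "j \<noteq> Zero" "i \<noteq> j" "i \<noteq> - j" "x \<in> K" by auto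
    then have "g = short (- j) i (x * bar (om (- j)))" by (simp add: T_short_eq)
    moreover have "x * bar (om (- j)) \<in> K" using K g by (simp add: ideal_mult_right)
    ultimately show "g \<in> ?B" using g by fastforce
  next
    fix g assume "g \<in> ?B"
    then obtain p r x where g: "g = short p r x" "p \<noteq> Zero" "r \<noteq> Zero" "p \<noteq> r" "p \<noteq> - r" "x \<in> K" by auto
    have "g = T_short S r (- p) (x * om p)"
      using g om_bar[of p] by (simp add: T_short_eq mult.assoc)
    moreover have "x * om p \<in> K" using K g by (simp add: ideal_mult_right)
    moreover have "r \<noteq> - p" "r \<noteq> - (- p)" using g by auto
    ultimately show "g \<in> ?A" using g by fastforce
  qed
  moreover have "{T_long S i \<alpha> | i \<alpha>. i \<in> Theta_hb \<and> \<alpha> \<in> signed S (- eps i) \<Omega>}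
    = {long p \<alpha> | p \<alpha>. p \<noteq> Zero \<and> \<alpha> \<in> \<Omega>}" (is "?A = ?B")
  proof (intro subset_antisym subsetI)
    fix g assume "g \<in> ?A"
    then obtain i x y where g: "g = T_long S i (x, y)" "i \<noteq> Zero" "(x, y) \<in> signed S (- eps i) \<Omega>" by auto
    have "(x * bar (om i), bar y * om i) \<in> \<Omega>"
      using g long_sign(1)[OF h, of x y] by (cases i) (auto simp: om_def signed_def)
    then show "g \<in> ?B" using g T_long_eq[of i x y] by blast
  next
    fix g assume "g \<in> ?B"
    then obtain p x y where g: "g = long p (x, y)" "p \<noteq> Zero" "(x, y) \<in> \<Omega>" by auto
    have "(x * om p, bar y * om p) \<in> signed S (- eps p) \<Omega>"
      using g long_sign(2)[OF h, of x y] by (cases p) (auto simp: om_def signed_def)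
    moreover have "g = T_long S p (x * om p, bar y * om p)"
    proof -
      have "x * om p * bar (om p) = x" "bar (bar y * om p) * om p = y"
        using om_bar[of p] g(2) by (simp_all add: bar_simps mult.assoc mult.commute[of "bar (om p)"])
      then show ?thesis using g by (simp add: T_long_eq)
    qed
    ultimately show "g \<in> ?A" using g by blast
  qed
  ultimately show ?thesis unfolding EU_def prod.case elementary_gens_def by simp
qed

end

context form_ring3 begin

section \<open>Matrices that are scalar modulo a level\<close>

text \<open>Small vectors take the place of vectors with coordinates in \<open>J\<close>; in the coordinate \<open>Zero\<close> only
  products with elements of \<open>J(\<Delta>)\<close> can be controlled.\<close>

definition small :: "'a set \<Rightarrow> ('a, 3) vec_th \<Rightarrow> bool" where
  "small J d \<longleftrightarrow> d $ Zero \<in> J_of \<Delta> \<and> (\<forall>v. v $ Zero \<in> J_of \<Delta> \<longrightarrow> B v d \<in> J)"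

text \<open>Up to small vectors, \<open>\<sigma>\<close> is multiplication by \<open>c\<close>.\<close>

definition scalar_mod :: "'a set \<Rightarrow> 'a \<Rightarrow> ('a, 3) mat_th \<Rightarrow> bool" where
  "scalar_mod J c \<sigma> \<longleftrightarrow> (\<forall>u v. u $ Zero \<in> J_of \<Delta> \<longrightarrow> v $ Zero \<in> J_of \<Delta> \<longrightarrow> B v (\<sigma> *v u - c *s u) \<in> J)"

text \<open>The relation \<open>\<sigma> \<equiv> c\<close> modulo \<open>(J, \<Omega>)\<close>, for vectors and for forms. The case \<open>c = 1\<close> is the
  congruence subgroup of \<open>(J, \<Omega>)\<close>, see \<open>U_rel_level_scalar\<close>.\<close>

definition level_scalar :: "'a set \<Rightarrow> ('a \<times> 'a) set \<Rightarrow> 'a \<Rightarrow> ('a, 3) mat_th \<Rightarrow> bool" where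
  "level_scalar J \<Omega> c \<sigma> \<longleftrightarrow> \<sigma> \<in> carrier Ug \<and> scalar_mod J c \<sigma>
    \<and> (\<forall>w z. Qplus z w \<in> \<Delta> \<longrightarrow> cong_mod \<Omega> (Qplus z (\<sigma> *v w)) (act S (Qplus z w) c))"

lemma U_Qplus_cong_mod: "\<sigma> \<in> carrier Ug \<Longrightarrow> cong_mod \<Delta> (Qplus z (\<sigma> *v w)) (Qplus z w)"
  using cong_mod_shift[of \<Delta> "(\<sigma> *v w) $ Zero" "q (\<sigma> *v w)" "w $ Zero" "q w" z] U_Q[of \<sigma> w]
  unfolding Qplus_def by (simp add: Q_form_def)

lemma U_Qplus: "\<sigma> \<in> carrier Ug \<Longrightarrow> Qplus z w \<in> \<Delta> \<Longrightarrow> Qplus z (\<sigma> *v w) \<in> \<Delta>"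
  using cong_mod_mem[OF \<Delta>_sub] U_Qplus_cong_mod by blast

lemma JD_Qplus: "w $ Zero \<in> J_of \<Delta> \<Longrightarrow> \<exists>z. Qplus z w \<in> \<Delta>"
proof -
  assume "w $ Zero \<in> J_of \<Delta>"
  then obtain y where "(w $ Zero, y) \<in> \<Delta>" by (auto simp: J_of_def)
  then have "Qplus (y - q w) w \<in> \<Delta>" by (simp add: Qplus_def)
  then show ?thesis ..
qed

lemma Qplus_JD: "Qplus z w \<in> \<Delta> \<Longrightarrow> w $ Zero \<in> J_of \<Delta>"
  by (simp add: Qplus_def JD_I)

lemma U_JD: "\<sigma> \<in> carrier Ug \<Longrightarrow> w $ Zero \<in> J_of \<Delta> \<Longrightarrow> (\<sigma> *v w) $ Zero \<in> J_of \<Delta>"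
  using JD_Qplus U_Qplus Qplus_JD by blast

lemma JD_0 [simp]: "0 \<in> J_of \<Delta>"
  by (rule ideal_0[OF JD_ideal])

lemma JD_diff: "x \<in> J_of \<Delta> \<Longrightarrow> y \<in> J_of \<Delta> \<Longrightarrow> x - y \<in> J_of \<Delta>"
  and JD_scale: "x \<in> J_of \<Delta> \<Longrightarrow> c * x \<in> J_of \<Delta>"
  using ideal_closed[OF JD_ideal] by blast+

lemma small_coord: "is_ideal J \<Longrightarrow> small J d \<Longrightarrow> k \<noteq> Zero \<Longrightarrow> d $ k \<in> J"
proof -
  assume J: "is_ideal J" and d: "small J d" and k: "k \<noteq> Zero"
  have "B (e (- k)) d \<in> J" using d k unfolding small_def by (simp del: B_e_left)
  then have "bar (om (- k)) * (om (- k) * d $ k) \<in> J" by (simp add: ideal_mult_left[OF J])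
  moreover have "bar (om (- k)) * (om (- k) * d $ k) = d $ k"
  proof -
    have "bar (om (- k)) * (om (- k) * d $ k) = (om (- k) * bar (om (- k))) * d $ k" by (simp only: ac_simps)
    then show ?thesis using om_bar[of "- k"] k by simp
  qed
  ultimately show ?thesis by simp
qed

lemma small_U:
  assumes \<tau>: "\<tau> \<in> carrier Ug" and d: "small J d"
  shows "small J (\<tau> *v d)"
  unfolding small_def
proof (intro conjI allI impI)
  show "(\<tau> *v d) $ Zero \<in> J_of \<Delta>" using U_JD[OF \<tau>] d by (simp add: small_def)
next
  fix v :: "('a, 3) vec_th" assume "v $ Zero \<in> J_of \<Delta>"
  then have "(iv \<tau> *v v) $ Zero \<in> J_of \<Delta>" using U_JD[of "iv \<tau>"] \<tau> by simp
  then have "B (iv \<tau> *v v) d \<in> J" using d by (simp add: small_def)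
  then show "B v (\<tau> *v d) \<in> J" using U_B[OF \<tau>, of "iv \<tau> *v v" d] \<tau> by simp
qed

lemma Bm_ideal: "is_ideal J \<Longrightarrow> (\<And>k. k \<noteq> Zero \<Longrightarrow> d $ k \<in> J) \<Longrightarrow> Bm a d \<in> J"
  unfolding Bm_def by (rule ideal_sum) (auto intro: ideal_mult_left)

lemma heis_diff_small:
  assumes l: "is_level J \<Omega>" and d: "small J d" and a: "a $ Zero \<in> J_of \<Delta>"
  obtains m where "m \<in> J"
    "heis_diff (Qplus z (a + d)) (Qplus z' a) = (d $ Zero, (q d + (B a d + z - z')) + (m - bar m * \<ell>))"
proof -
  note J = is_level_ideal[OF l]
  define g where "g = Bm a d"
  define t where "t = bar (d $ Zero) * \<mu> * a $ Zero"
  have gJ: "g \<in> J" unfolding g_def using small_coord[OF J d] by (rule Bm_ideal[OF J])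
  have tb: "bar t * \<ell> = bar (a $ Zero) * \<mu> * d $ Zero"
    unfolding t_def by (simp add: bar_simps ell_cancel_deep ac_simps)
  have "B (a $ Zero *s e Zero) d \<in> J" using d a by (auto simp: small_def)
  then have "bar (a $ Zero) * \<mu> * d $ Zero \<in> J" by (simp add: B_simps om_def ac_simps)
  then have "bar t * \<ell> \<in> J" by (simp add: tb)
  from ideal_mult_right[OF J is_level_bar[OF l this], of \<ell>] have "bar (bar t * \<ell>) * \<ell> \<in> J" .
  moreover have "bar (bar t * \<ell>) * \<ell> = t" by (simp add: bar_simps mult.assoc)
  ultimately have tJ: "t \<in> J" by simp
  show thesis
  proof (rule that)
    show "t - g \<in> J" by (rule ideal_diff[OF J tJ gJ])
    show "heis_diff (Qplus z (a + d)) (Qplus z' a) = (d $ Zero, (q d + (B a d + z - z')) + ((t - g) - bar (t - g) * \<ell>))"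
      unfolding heis_diff_def Qplus_def q_add g_def[symmetric] using tb
      by (simp add: t_def bar_simps algebra_simps)
  qed
qed

text \<open>For small \<open>d\<close> all cross terms between \<open>a\<close> and \<open>d\<close> other than \<open>B a d\<close> are of the form
  \<open>m - bar m \<ell>\<close> with \<open>m\<close> in \<open>J\<close>. So the congruence becomes a membership that involves only \<open>Q d\<close> and the
  unitary invariant \<open>B a d\<close>. This is the reason why congruences can be transported by conjugation.\<close>

lemma cong_mod_small_iff:
  assumes l: "is_level J \<Omega>" and d: "small J d" and a: "a $ Zero \<in> J_of \<Delta>"
  shows "cong_mod \<Omega> (Qplus z (a + d)) (Qplus z' a) \<longleftrightarrow> Qplus (B a d + z - z') d \<in> \<Omega>"
proof -
  note h = is_level_hsubmod[OF l]
  obtain m where m: "m \<in> J" and eq: "heis_diff (Qplus z (a + d)) (Qplus z' a) = (d $ Zero, (q d + (B a d + z - z')) + (m - bar m * \<ell>))"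
    using heis_diff_small[OF l d a] .
  note mM = is_level_min[OF l m]
  show ?thesis unfolding cong_mod_def eq unfolding Qplus_def
  proof
    assume "(d $ Zero, (q d + (B a d + z - z')) + (m - bar m * \<ell>)) \<in> \<Omega>"
    from hsubmod_diff0[OF h this mM] show "(d $ Zero, q d + (B a d + z - z')) \<in> \<Omega>" by simp
  next
    assume "(d $ Zero, q d + (B a d + z - z')) \<in> \<Omega>"
    from hsubmod_add0[OF h this mM] show "(d $ Zero, (q d + (B a d + z - z')) + (m - bar m * \<ell>)) \<in> \<Omega>" .
  qed
qed

lemma scalar_mod_small: "scalar_mod J c \<sigma> \<Longrightarrow> \<sigma> \<in> carrier Ug \<Longrightarrow> w $ Zero \<in> J_of \<Delta> \<Longrightarrow> small J (\<sigma> *v w - c *s w)"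
  unfolding small_def scalar_mod_def by (simp add: JD_diff JD_scale U_JD)

text \<open>Apply \<open>\<sigma> \<equiv> c\<close> to the pair \<open>e 1\<close>, \<open>e (- 1)\<close>, on which \<open>B\<close> has the value 1.\<close>

lemma scalar_mod_unit:
  assumes J: "is_ideal J" "\<And>x. x \<in> J \<Longrightarrow> bar x \<in> J" and \<sigma>: "\<sigma> \<in> carrier Ug" and a: "scalar_mod J c \<sigma>"
  shows "1 - c * bar c \<in> J"
proof -
  let ?k = "Pos 1 :: 3 theta"
  have z: "e ?k $ Zero \<in> J_of \<Delta>" "e (- ?k) $ Zero \<in> J_of \<Delta>" by simp_all
  have "B (\<sigma> *v e ?k) (\<sigma> *v e (- ?k) - c *s e (- ?k)) \<in> J"
    using a z U_JD[OF \<sigma>] unfolding scalar_mod_def by blast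
  moreover have "B (\<sigma> *v e ?k) (\<sigma> *v e (- ?k)) = 1"
    unfolding U_B[OF \<sigma>] by (simp add: om_def)
  ultimately have 1: "1 - c * B (\<sigma> *v e ?k) (e (- ?k)) \<in> J" unfolding B_simps by simp
  have "B (e (- ?k)) (\<sigma> *v e ?k - c *s e ?k) \<in> J" using a z unfolding scalar_mod_def by blast
  then have "bar (B (e (- ?k)) (\<sigma> *v e ?k) - c * \<ell>) \<in> J"
    by (intro J(2)) (simp add: B_simps om_def algebra_simps)
  then have "\<ell> * bar (B (e (- ?k)) (\<sigma> *v e ?k) - c * \<ell>) \<in> J" by (rule ideal_mult_left[OF J(1)])
  moreover have "\<ell> * bar (B (e (- ?k)) (\<sigma> *v e ?k) - c * \<ell>) = B (\<sigma> *v e ?k) (e (- ?k)) - bar c"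
    by (subst (2) B_herm) (simp add: bar_simps ell_cancel_deep algebra_simps del: B_e_left)
  ultimately have "c * (B (\<sigma> *v e ?k) (e (- ?k)) - bar c) \<in> J" by (simp add: ideal_mult_left[OF J(1)])
  from ideal_add[OF J(1) 1 this] show ?thesis by (simp add: algebra_simps)
qed

lemma act_cong:
  assumes l: "is_level J \<Omega>" and xy: "(x, y) \<in> \<Delta>" and c: "c - c' \<in> J"
  shows "cong_mod \<Omega> (act S (x, y) c) (act S (x, y) c')"
proof -
  note J = is_level_ideal[OF l] and h = is_level_hsubmod[OF l]
  define j where "j = c - c'"
  have c_eq: "c = c' + j" by (simp add: j_def)
  have jJ: "j \<in> J" using c by (simp add: j_def)
  define g where "g = bar c' * y * j"
  have gJ: "g \<in> J" unfolding g_def by (rule ideal_mult_left[OF J jJ])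
  have "bar x * \<mu> * x = - y - bar y * \<ell>"
    using form_neg[OF xy] by (simp add: algebra_simps)
  moreover have "bar (x * j) * \<mu> * (x * c') = bar j * (bar x * \<mu> * x) * c'"
    by (simp add: bar_simps ac_simps)
  ultimately have "bar (x * j) * \<mu> * (x * c') = bar j * (- y - bar y * \<ell>) * c'"
    by simp
  then have eq: "heis_diff (act S (x, y) c) (act S (x, y) c') = (x * j, bar j * y * j + (g - bar g * \<ell>))"
    unfolding heis_diff_def c_eq g_def by (simp add: bar_simps algebra_simps)
  show ?thesis unfolding cong_mod_def eq
    by (rule hsubmod_add0[OF h is_level_act[OF l xy jJ] is_level_min[OF l gJ]])
qed

lemma level_scalar_carrier: "level_scalar J \<Omega> c \<sigma> \<Longrightarrow> \<sigma> \<in> carrier Ug"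
  and level_scalar_scalar_mod: "level_scalar J \<Omega> c \<sigma> \<Longrightarrow> scalar_mod J c \<sigma>"
  and level_scalar_Qplus: "level_scalar J \<Omega> c \<sigma> \<Longrightarrow> Qplus z w \<in> \<Delta> \<Longrightarrow> cong_mod \<Omega> (Qplus z (\<sigma> *v w)) (act S (Qplus z w) c)"
  by (simp_all add: level_scalar_def)

lemma level_scalar_unit: "is_level J \<Omega> \<Longrightarrow> level_scalar J \<Omega> c \<sigma> \<Longrightarrow> 1 - c * bar c \<in> J"
  by (rule scalar_mod_unit[OF is_level_ideal is_level_bar level_scalar_carrier level_scalar_scalar_mod])

lemma level_scalar_cong:
  assumes l: "is_level J \<Omega>" and p: "level_scalar J \<Omega> c \<sigma>" and c: "c - c' \<in> J"
  shows "level_scalar J \<Omega> c' \<sigma>"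
proof -
  note J = is_level_ideal[OF l]
  have "B v (\<sigma> *v u - c' *s u) \<in> J" if "u $ Zero \<in> J_of \<Delta>" "v $ Zero \<in> J_of \<Delta>" for u v
  proof -
    have "B v (\<sigma> *v u - c *s u) + (c - c') * B v u \<in> J"
      using level_scalar_scalar_mod[OF p] that unfolding scalar_mod_def by (intro ideal_add[OF J] ideal_mult_right[OF J c]) blast
    then show ?thesis by (simp add: B_simps algebra_simps)
  qed
  moreover have "cong_mod \<Omega> (Qplus z (\<sigma> *v w)) (act S (Qplus z w) c')" if "Qplus z w \<in> \<Delta>" for w z
    using level_scalar_Qplus[OF p that] act_cong[OF l _ c, of "fst (Qplus z w)" "snd (Qplus z w)"] that
    by (auto intro: cong_mod_trans[OF is_level_hsubmod[OF l]])
  ultimately show ?thesis using level_scalar_carrier[OF p] by (simp add: level_scalar_def scalar_mod_def)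
qed

lemma act_act: "act S (act S \<alpha> b) c = act S \<alpha> (b * c)"
  by (simp add: act_def bar_simps ac_simps)

lemma cong_mod_act': "hsubmod \<Omega> \<Longrightarrow> cong_mod \<Omega> \<alpha> \<beta> \<Longrightarrow> cong_mod \<Omega> (act S \<alpha> a) (act S \<beta> a)"
  using cong_mod_act[of \<Omega> "fst \<alpha>" "snd \<alpha>" "fst \<beta>" "snd \<beta>" a] by (simp add: act_def)

lemma level_scalar_mult:
  assumes l: "is_level J \<Omega>" and p: "level_scalar J \<Omega> c \<sigma>" and p': "level_scalar J \<Omega> c' \<tau>"
  shows "level_scalar J \<Omega> (c * c') (\<sigma> ** \<tau>)"
proof -
  note J = is_level_ideal[OF l] and \<sigma> = level_scalar_carrier[OF p] and \<tau> = level_scalar_carrier[OF p']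
  have "B v ((\<sigma> ** \<tau>) *v u - (c * c') *s u) \<in> J" if u: "u $ Zero \<in> J_of \<Delta>" "v $ Zero \<in> J_of \<Delta>" for u v
  proof -
    have "B v (\<sigma> *v (\<tau> *v u) - c *s (\<tau> *v u)) + c * B v (\<tau> *v u - c' *s u) \<in> J"
      using level_scalar_scalar_mod[OF p] level_scalar_scalar_mod[OF p'] u U_JD[OF \<tau>] unfolding scalar_mod_def
      by (intro ideal_add[OF J] ideal_mult_left[OF J]) blast+
    then show ?thesis by (simp add: mv_mul B_simps algebra_simps)
  qed
  moreover have "cong_mod \<Omega> (Qplus z ((\<sigma> ** \<tau>) *v w)) (act S (Qplus z w) (c * c'))" if w: "Qplus z w \<in> \<Delta>" for w z
    using cong_mod_trans[OF is_level_hsubmod[OF l] level_scalar_Qplus[OF p U_Qplus[OF \<tau> w]] cong_mod_act'[OF is_level_hsubmod[OF l] level_scalar_Qplus[OF p' w]]]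
    by (simp add: mv_mul act_act mult.commute)
  ultimately show ?thesis using U_mul[OF \<sigma> \<tau>] by (simp add: level_scalar_def scalar_mod_def)
qed

lemma level_scalar_inv:
  assumes l: "is_level J \<Omega>" and p: "level_scalar J \<Omega> c \<sigma>"
  shows "level_scalar J \<Omega> (bar c) (iv \<sigma>)"
proof -
  note J = is_level_ideal[OF l] and h = is_level_hsubmod[OF l] and \<sigma> = level_scalar_carrier[OF p] and un = level_scalar_unit[OF l p]
  have \<sigma>': "iv \<sigma> \<in> carrier Ug" using \<sigma> by simp
  have "B v (iv \<sigma> *v u - bar c *s u) \<in> J" if u: "u $ Zero \<in> J_of \<Delta>" "v $ Zero \<in> J_of \<Delta>" for u v
  proof -
    define u' where "u' = iv \<sigma> *v u"
    have u': "u' $ Zero \<in> J_of \<Delta>" "\<sigma> *v u' = u" using U_JD[OF \<sigma>'] u \<sigma> by (auto simp: u'_def)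
    have "B v (\<sigma> *v u' - c *s u') \<in> J" using level_scalar_scalar_mod[OF p] u(2) u'(1) unfolding scalar_mod_def by blast
    from ideal_diff[OF J ideal_mult_right[OF J un] ideal_mult_left[OF J this]]
    have "(1 - c * bar c) * B v u' - bar c * B v (\<sigma> *v u' - c *s u') \<in> J" .
    moreover have e1: "B v (\<sigma> *v u' - c *s u') = B v u - c * B v u'" by (simp add: B_simps u'(2))
    moreover have e2: "B v (u' - bar c *s u) = B v u' - bar c * B v u" by (simp add: B_simps)
    have "B v (u' - bar c *s u) = (1 - c * bar c) * B v u' - bar c * B v (\<sigma> *v u' - c *s u')"
      unfolding e1 e2 by (simp add: algebra_simps)
    ultimately have "B v (u' - bar c *s u) \<in> J" by simp
    then show ?thesis by (simp add: u'_def)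
  qed
  moreover have "cong_mod \<Omega> (Qplus z (iv \<sigma> *v w)) (act S (Qplus z w) (bar c))" if w: "Qplus z w \<in> \<Delta>" for w z
  proof -
    define w' where "w' = iv \<sigma> *v w"
    have w': "Qplus z w' \<in> \<Delta>" "\<sigma> *v w' = w" using U_Qplus[OF \<sigma>' w] \<sigma> by (auto simp: w'_def)
    have "cong_mod \<Omega> (act S (Qplus z w) (bar c)) (act S (Qplus z w') (c * bar c))"
      using cong_mod_act'[OF h level_scalar_Qplus[OF p w'(1)], of "bar c"] w'(2) by (simp add: act_act)
    moreover have "cong_mod \<Omega> (act S (Qplus z w') (c * bar c)) (act S (Qplus z w') 1)"
      using act_cong[OF l, of "fst (Qplus z w')" "snd (Qplus z w')" "c * bar c" 1] w'(1) ideal_neg[OF J un] by simp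
    ultimately have "cong_mod \<Omega> (act S (Qplus z w) (bar c)) (Qplus z w')"
      by (metis act_def cong_mod_trans h invol_one mult_1_right mult_1 prod.collapse)
    then show ?thesis using cong_mod_sym[OF h] by (simp add: w'_def)
  qed
  ultimately show ?thesis using \<sigma>' by (simp add: level_scalar_def scalar_mod_def)
qed

text \<open>Elementary matrices need not be scalar modulo a level, but they preserve \<open>Q\<close> on small vectors
  (\<open>EUf_form_invariant\<close>). This is what conjugation requires.\<close>

definition form_invariant :: "'a set \<Rightarrow> ('a \<times> 'a) set \<Rightarrow> ('a, 3) mat_th \<Rightarrow> bool" where
  "form_invariant J \<Omega> \<tau> \<longleftrightarrow> \<tau> \<in> carrier Ug \<and> (\<forall>d. small J d \<longrightarrow> cong_mod \<Omega> (Q (\<tau> *v d)) (Q d))"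

text \<open>Write \<open>\<sigma> (\<tau> w) = c \<tau> w + d\<close> with \<open>d\<close> small. For the conjugate of \<open>\<sigma>\<close> the vector \<open>d\<close> is replaced
  by its image under the inverse of \<open>\<tau>\<close>, which has the same \<open>Q\<close> modulo \<open>\<Omega>\<close>; then \<open>cong_mod_small_iff\<close>
  transports the congruence.\<close>

lemma level_scalar_conj:
  assumes l: "is_level J \<Omega>" and p: "level_scalar J \<Omega> c \<sigma>" and \<tau>: "form_invariant J \<Omega> \<tau>"
  shows "level_scalar J \<Omega> c (iv \<tau> ** \<sigma> ** \<tau>)"
proof -
  note J = is_level_ideal[OF l] and h = is_level_hsubmod[OF l] and \<sigma> = level_scalar_carrier[OF p]
  have \<tau>c: "\<tau> \<in> carrier Ug" and \<tau>i: "iv \<tau> \<in> carrier Ug" using \<tau> by (simp_all add: form_invariant_def)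
  have "B v ((iv \<tau> ** \<sigma> ** \<tau>) *v u - c *s u) \<in> J" if u: "u $ Zero \<in> J_of \<Delta>" "v $ Zero \<in> J_of \<Delta>" for u v
  proof -
    have "B (\<tau> *v v) (\<sigma> *v (\<tau> *v u) - c *s (\<tau> *v u)) \<in> J"
      using level_scalar_scalar_mod[OF p] u U_JD[OF \<tau>c] unfolding scalar_mod_def by blast
    also have "\<sigma> *v (\<tau> *v u) - c *s (\<tau> *v u) = \<tau> *v ((iv \<tau> ** \<sigma> ** \<tau>) *v u - c *s u)"
      by (simp add: mv_simps \<tau>c)
    finally show ?thesis by (simp add: U_B[OF \<tau>c])
  qed
  moreover have "cong_mod \<Omega> (Qplus z ((iv \<tau> ** \<sigma> ** \<tau>) *v w)) (act S (Qplus z w) c)" if w: "Qplus z w \<in> \<Delta>" for w z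
  proof -
    define a where "a = c *s (\<tau> *v w)"
    define d where "d = \<sigma> *v (\<tau> *v w) - a"
    define d' where "d' = iv \<tau> *v d"
    have tw: "(\<tau> *v w) $ Zero \<in> J_of \<Delta>" using Qplus_JD[OF w] U_JD[OF \<tau>c] by blast
    have d: "small J d" unfolding d_def a_def by (rule scalar_mod_small[OF level_scalar_scalar_mod[OF p] \<sigma> tw])
    have d': "small J d'" unfolding d'_def by (rule small_U[OF \<tau>i d])
    have a: "a $ Zero \<in> J_of \<Delta>" using tw by (simp add: a_def JD_scale)
    have a': "(iv \<tau> *v a) $ Zero \<in> J_of \<Delta>" using U_JD[OF \<tau>i a] .
    define z' where "z' = bar c * c * z"
    have Fc: "act S (Qplus z v) c = Qplus z' (c *s v)" for v
      by (simp add: Qplus_def z'_def q_scale algebra_simps)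
    have "cong_mod \<Omega> (Qplus z (a + d)) (Qplus z' a)"
      using level_scalar_Qplus[OF p U_Qplus[OF \<tau>c w]] unfolding Fc by (simp add: a_def d_def)
    then have "Qplus (B a d + z - z') d \<in> \<Omega>" using cong_mod_small_iff[OF l d a] by simp
    moreover have "cong_mod \<Omega> (Qplus (B a d + z - z') d') (Qplus (B a d + z - z') d)"
    proof -
      have "cong_mod \<Omega> (Q (\<tau> *v d')) (Q d')" using \<tau> d' by (simp add: form_invariant_def)
      then have "cong_mod \<Omega> (Q d') (Q d)" using cong_mod_sym[OF h] \<tau>c by (simp add: d'_def)
      then show ?thesis using cong_mod_shift unfolding Qplus_def by (simp add: Q_form_def)
    qed
    ultimately have "Qplus (B a d + z - z') d' \<in> \<Omega>" using cong_mod_mem[OF h] by blast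
    moreover have "B a d = B (iv \<tau> *v a) d'" unfolding d'_def by (simp add: U_B[OF \<tau>i])
    ultimately have "cong_mod \<Omega> (Qplus z (iv \<tau> *v a + d')) (Qplus z' (iv \<tau> *v a))"
      using cong_mod_small_iff[OF l d' a'] by simp
    moreover have "iv \<tau> *v a + d' = (iv \<tau> ** \<sigma> ** \<tau>) *v w"
      unfolding d'_def d_def by (simp add: mv_simps)
    moreover have "iv \<tau> *v a = c *s w" by (simp add: a_def mv_scale \<tau>c)
    ultimately show ?thesis unfolding Fc by simp
  qed
  ultimately show ?thesis using U_mul[OF U_mul[OF \<tau>i \<sigma>] \<tau>c] by (simp add: level_scalar_def scalar_mod_def)
qed

lemma form_invariant_mult:
  assumes l: "is_level J \<Omega>" and "form_invariant J \<Omega> \<sigma>" "form_invariant J \<Omega> \<tau>" shows "form_invariant J \<Omega> (\<sigma> ** \<tau>)"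
  unfolding form_invariant_def
proof (intro conjI allI impI)
  have \<sigma>: "\<sigma> \<in> carrier Ug" and \<tau>: "\<tau> \<in> carrier Ug" using assms by (simp_all add: form_invariant_def)
  show "\<sigma> ** \<tau> \<in> carrier Ug" by (rule U_mul[OF \<sigma> \<tau>])
  fix d assume d: "small J d"
  have "cong_mod \<Omega> (Q (\<sigma> *v (\<tau> *v d))) (Q (\<tau> *v d))" using assms(2) small_U[OF \<tau> d] by (simp add: form_invariant_def)
  moreover have "cong_mod \<Omega> (Q (\<tau> *v d)) (Q d)" using assms(3) d by (simp add: form_invariant_def)
  ultimately show "cong_mod \<Omega> (Q ((\<sigma> ** \<tau>) *v d)) (Q d)" unfolding mv_mul by (rule cong_mod_trans[OF is_level_hsubmod[OF l]])
qed

lemma form_invariant_inv: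
  assumes l: "is_level J \<Omega>" and "form_invariant J \<Omega> \<sigma>" shows "form_invariant J \<Omega> (iv \<sigma>)"
  unfolding form_invariant_def
proof (intro conjI allI impI)
  have \<sigma>: "\<sigma> \<in> carrier Ug" using assms by (simp add: form_invariant_def)
  show "iv \<sigma> \<in> carrier Ug" using \<sigma> by simp
  fix d assume "small J d"
  then have "small J (iv \<sigma> *v d)" using small_U[of "iv \<sigma>"] \<sigma> by simp
  then have "cong_mod \<Omega> (Q (\<sigma> *v (iv \<sigma> *v d))) (Q (iv \<sigma> *v d))" using assms(2) unfolding form_invariant_def by blast
  then have "cong_mod \<Omega> (Q d) (Q (iv \<sigma> *v d))" using \<sigma> by simp
  then show "cong_mod \<Omega> (Q (iv \<sigma> *v d)) (Q d)" by (rule cong_mod_sym[OF is_level_hsubmod[OF l]])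
qed

lemma esd_form_invariant:
  assumes l: "is_level J \<Omega>" and p: "p \<noteq> Zero" and v: "v $ (- p) = 0" "Qplus y v \<in> \<Delta>"
  shows "form_invariant J \<Omega> (esd (e p) v y)"
  unfolding form_invariant_def
proof (intro conjI allI impI)
  show "esd (e p) v y \<in> carrier Ug" by (rule esd_in_U[OF p v])
  fix d assume d: "small J d"
  have "B v d \<in> J" using d Qplus_JD[OF v(2)] by (simp add: small_def)
  then have "B d v \<in> J" unfolding B_herm[of d v] by (intro ideal_mult_left[OF is_level_ideal[OF l]] is_level_bar[OF l])
  moreover have "d $ (- p) \<in> J" using small_coord[OF is_level_ideal[OF l] d] p by simp
  ultimately show "cong_mod \<Omega> (Q (esd (e p) v y *v d)) (Q d)"
    by (intro esd_Q_cong[OF l p v])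
qed

lemma long_form_invariant: "is_level J \<Omega> \<Longrightarrow> p \<noteq> Zero \<Longrightarrow> \<alpha> \<in> \<Delta> \<Longrightarrow> form_invariant J \<Omega> (long p \<alpha>)"
  unfolding long_def by (rule esd_form_invariant) (auto simp: Qplus_def q_scale)

lemma short_form_invariant: "is_level J \<Omega> \<Longrightarrow> p \<noteq> Zero \<Longrightarrow> r \<noteq> Zero \<Longrightarrow> p \<noteq> - r \<Longrightarrow> form_invariant J \<Omega> (short p r x)"
  unfolding short_def by (rule esd_form_invariant) (auto simp: Qplus_def q_scale hsubmod_0[OF \<Delta>_sub])

abbreviation EUf :: "('a, 3) mat_th set" where "EUf \<equiv> EU S \<Delta> (UNIV, \<Delta>)"

lemma EUf_eq: "EUf = generate Ug (elementary_gens UNIV \<Delta>)"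
  using EU_eq[of UNIV \<Delta>] \<Delta>_sub by simp

lemma EUf_form_invariant:
  assumes l: "is_level J \<Omega>" and "\<tau> \<in> EUf" shows "form_invariant J \<Omega> \<tau>"
proof -
  have g: "form_invariant J \<Omega> g" if "g \<in> elementary_gens UNIV \<Delta>" for g
    using that long_form_invariant[OF l] short_form_invariant[OF l] unfolding elementary_gens_def by auto
  from assms(2) show ?thesis unfolding EUf_eq
  proof (induction rule: generate.induct)
    case one
    have "form_invariant J \<Omega> (long (Pos 1) (0, 0))" using l hsubmod_0[OF \<Delta>_sub] by (intro long_form_invariant) auto
    then show ?case by (simp add: long_def)
  next
    case (incl h) then show ?case by (rule g)
  next
    case (inv h) then show ?case using form_invariant_inv[OF l g] by simp
  next
    case (eng h1 h2) then show ?case using form_invariant_mult[OF l] by simp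
  qed
qed

end

context form_ring3 begin

section \<open>Generated levels\<close>

lemma subgroup_hsubmod: "hsubmod \<Omega> \<Longrightarrow> subgroup \<Omega> (heis S)"
  using heis_submodule_iff heis_submodule_def by metis

lemma hsubmod_act': "hsubmod \<Omega> \<Longrightarrow> \<alpha> \<in> \<Omega> \<Longrightarrow> act S \<alpha> b \<in> \<Omega>"
  by (cases \<alpha>) (simp add: hsubmod_act)

lemma act_mult: "act S (\<alpha> \<otimes>\<^bsub>heis S\<^esub> \<beta>) r = act S \<alpha> r \<otimes>\<^bsub>heis S\<^esub> act S \<beta> r"
  by (cases \<alpha>; cases \<beta>) (simp add: bar_simps algebra_simps)

lemma act_inv: "act S (inv\<^bsub>heis S\<^esub> \<alpha>) r = inv\<^bsub>heis S\<^esub> (act S \<alpha> r)"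
  by (cases \<alpha>) (simp add: bar_simps algebra_simps)

lemma act_gen_hsubmod:
  assumes K: "is_ideal K"
  shows "hsubmod (act_gen S X K)"
proof -
  have sub: "subgroup (act_gen S X K) (heis S)"
    unfolding act_gen_def by (rule group.generate_is_subgroup[OF group_heis]) simp
  have "act S g r \<in> act_gen S X K" if "g \<in> act_gen S X K" for g r
    using that unfolding act_gen_def
  proof (induction rule: generate.induct)
    case one then show ?case using generate.one[of "heis S"] by (simp add: act_def)
  next
    case (incl h)
    then obtain \<alpha> b where h: "h = act S \<alpha> b" "\<alpha> \<in> X" "b \<in> K" by auto
    then have "b * r \<in> K" using K by (simp add: ideal_mult_right)
    then have "act S h r \<in> {act S \<alpha> b | \<alpha> b. \<alpha> \<in> X \<and> b \<in> K}" unfolding h act_act using h by blast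
    then show ?case by (rule generate.incl)
  next
    case (inv h)
    then obtain \<alpha> b where h: "h = act S \<alpha> b" "\<alpha> \<in> X" "b \<in> K" by auto
    then have "b * r \<in> K" using K by (simp add: ideal_mult_right)
    then have "act S h r \<in> {act S \<alpha> b | \<alpha> b. \<alpha> \<in> X \<and> b \<in> K}" unfolding h act_act using h by blast
    then show ?case unfolding act_inv by (rule generate.inv)
  next
    case (eng h1 h2) then show ?case unfolding act_mult by (intro generate.eng)
  qed
  with sub have "heis_submodule S (act_gen S X K)" by (simp add: heis_submodule_def)
  then show ?thesis by (simp add: heis_submodule_iff)
qed

lemma act_gen_subset:
  assumes "hsubmod \<Omega>" "\<And>\<alpha> b. \<alpha> \<in> X \<Longrightarrow> b \<in> K \<Longrightarrow> act S \<alpha> b \<in> \<Omega>"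
  shows "act_gen S X K \<subseteq> \<Omega>"
  unfolding act_gen_def using assms
  by (intro group.generate_subgroup_incl[OF group_heis _ subgroup_hsubmod]) auto

lemma act_gen_incl: "\<alpha> \<in> X \<Longrightarrow> b \<in> K \<Longrightarrow> act S \<alpha> b \<in> act_gen S X K"
  unfolding act_gen_def by (rule generate.incl) blast

definition tilde_forms :: "'a set \<Rightarrow> ('a \<times> 'a) set" where
  "tilde_forms J = {(x, y). \<forall>z\<in>J_of \<Delta>. bar z * \<mu> * x \<in> J}"

lemma tilde_forms_hsubmod:
  assumes J: "is_ideal J" shows "hsubmod (tilde_forms J)"
  unfolding hsubmod_def tilde_forms_def
  by (auto simp: distrib_left ideal_0[OF J] ideal_add[OF J] ideal_neg[OF J] mult.assoc[symmetric]
      intro: ideal_mult_right[OF J])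

text \<open>The form parameter of ideal \<open>J\<close> generated by the elements of \<open>Z \<circ> K\<close>. It occurs in the upper level
  and in the product of a form ideal with an ideal.\<close>

definition gen_form :: "'a set \<Rightarrow> ('a \<times> 'a) set \<Rightarrow> 'a set \<Rightarrow> ('a \<times> 'a) set" where
  "gen_form J Z K = Omega_min S \<Delta> J <#>\<^bsub>heis S\<^esub> act_gen S Z K"

lemma gen_form_mem: "\<alpha> \<in> gen_form J Z K \<longleftrightarrow> (\<exists>a1 a2 c1 c2 x. (a1, a2) \<in> act_gen S \<Delta> J \<and> (c1, c2) \<in> act_gen S Z K
   \<and> x \<in> J \<and> \<alpha> = (a1 + c1, (x - bar x * \<ell>) + a2 + c2 - bar a1 * \<mu> * c1))"
  unfolding gen_form_def Omega_min_def set_mult_def by fastforce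

text \<open>The product of sets in the definition is a subgroup since exchanging an element of \<open>\<Delta> \<circ> J\<close> with
  one of \<open>Z \<circ> K\<close> costs an element \<open>g - bar g \<ell>\<close>, where \<open>g\<close> is in \<open>J\<close> by the hypothesis on \<open>Z \<circ> K\<close>.\<close>

lemma gen_form_is_level:
  assumes J: "is_ideal J" "\<And>x. x \<in> J \<Longrightarrow> bar x \<in> J" and K: "is_ideal K" and Z: "Z \<subseteq> \<Delta>"
    and Zt: "\<And>\<alpha> b. \<alpha> \<in> Z \<Longrightarrow> b \<in> K \<Longrightarrow> act S \<alpha> b \<in> tilde_forms J"
  shows "is_level J (gen_form J Z K)" "act_gen S Z K \<subseteq> gen_form J Z K"
proof -
  let ?A = "act_gen S \<Delta> J" and ?C = "act_gen S Z K"
  have hA: "hsubmod ?A" and hC: "hsubmod ?C" using J K by (auto intro: act_gen_hsubmod)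
  have AD: "?A \<subseteq> \<Delta>" by (rule act_gen_subset[OF \<Delta>_sub]) (rule hsubmod_act'[OF \<Delta>_sub])
  have CD: "?C \<subseteq> \<Delta>" by (rule act_gen_subset[OF \<Delta>_sub]) (use Z in \<open>blast intro: hsubmod_act'[OF \<Delta>_sub]\<close>)
  have At: "?A \<subseteq> tilde_forms J"
    by (rule act_gen_subset[OF tilde_forms_hsubmod[OF J(1)]]) (auto simp: act_def tilde_forms_def intro: ideal_mult_left[OF J(1)])
  have Ct: "?C \<subseteq> tilde_forms J"
    by (rule act_gen_subset[OF tilde_forms_hsubmod[OF J(1)] Zt])
  have com: "bar c * \<mu> * a \<in> J" "bar a * \<mu> * c \<in> J" if "(c, c2) \<in> ?C" "(a, a2) \<in> ?A" for c c2 a a2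
  proof -
    show *: "bar a * \<mu> * c \<in> J" using that Ct AD by (auto simp: tilde_forms_def dest: JD_I)
    have "bar c * \<mu> * a = bar (bar a * \<mu> * c) * \<ell>" by (simp add: bar_simps ell_cancel_deep ac_simps)
    then show "bar c * \<mu> * a \<in> J" using J(2)[OF *] by (simp add: ideal_mult_right[OF J(1)])
  qed
  have I: "(a1 + c1, (x - bar x * \<ell>) + a2 + c2 - bar a1 * \<mu> * c1) \<in> gen_form J Z K"
    if "(a1, a2) \<in> ?A" "(c1, c2) \<in> ?C" "x \<in> J" for a1 a2 c1 c2 x
    using that unfolding gen_form_mem by blast
  have hs: "hsubmod (gen_form J Z K)"
    unfolding hsubmod_def
  proof (intro conjI allI impI)
    show "(0, 0) \<in> gen_form J Z K" using I[OF hsubmod_0[OF hA] hsubmod_0[OF hC] ideal_0[OF J(1)]] by simp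
  next
    fix x y x' y' assume "(x, y) \<in> gen_form J Z K" "(x', y') \<in> gen_form J Z K"
    then obtain a1 a2 c1 c2 t a1' a2' c1' c2' t' where
      1: "(a1, a2) \<in> ?A" "(c1, c2) \<in> ?C" "t \<in> J" "x = a1 + c1" "y = (t - bar t * \<ell>) + a2 + c2 - bar a1 * \<mu> * c1" and
      2: "(a1', a2') \<in> ?A" "(c1', c2') \<in> ?C" "t' \<in> J" "x' = a1' + c1'" "y' = (t' - bar t' * \<ell>) + a2' + c2' - bar a1' * \<mu> * c1'"
      unfolding gen_form_mem by auto
    define g where "g = bar a1' * \<mu> * c1"
    have gb: "bar g * \<ell> = bar c1 * \<mu> * a1'" unfolding g_def by (simp add: bar_simps ell_cancel_deep ac_simps)
    have "t + t' + g \<in> J" using 1 2 com[OF 1(2) 2(1)] by (auto simp: g_def intro: ideal_add[OF J(1)])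
    from I[OF hsubmod_add[OF hA 1(1) 2(1)] hsubmod_add[OF hC 1(2) 2(2)] this]
    show "(x + x', y + y' - bar x * \<mu> * x') \<in> gen_form J Z K"
      unfolding 1(4,5) 2(4,5) invol_add distrib_right gb by (simp add: g_def bar_simps algebra_simps)
  next
    fix x y assume "(x, y) \<in> gen_form J Z K"
    then obtain a1 a2 c1 c2 t where
      1: "(a1, a2) \<in> ?A" "(c1, c2) \<in> ?C" "t \<in> J" "x = a1 + c1" "y = (t - bar t * \<ell>) + a2 + c2 - bar a1 * \<mu> * c1"
      unfolding gen_form_mem by auto
    define g where "g = bar a1 * \<mu> * c1"
    have gb: "bar g * \<ell> = bar c1 * \<mu> * a1" unfolding g_def by (simp add: bar_simps ell_cancel_deep ac_simps)
    have "g - t \<in> J" using 1 com[OF 1(2) 1(1)] by (auto simp: g_def intro: ideal_diff[OF J(1)])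
    from I[OF hsubmod_neg[OF hA 1(1)] hsubmod_neg[OF hC 1(2)] this]
    show "(- x, - y - bar x * \<mu> * x) \<in> gen_form J Z K"
      unfolding 1(4,5) bar_diff left_diff_distrib gb by (simp add: g_def bar_simps algebra_simps)
  next
    fix x y r assume "(x, y) \<in> gen_form J Z K"
    then obtain a1 a2 c1 c2 t where
      1: "(a1, a2) \<in> ?A" "(c1, c2) \<in> ?C" "t \<in> J" "x = a1 + c1" "y = (t - bar t * \<ell>) + a2 + c2 - bar a1 * \<mu> * c1"
      unfolding gen_form_mem by auto
    have "bar r * t * r \<in> J" using 1 by (intro ideal_mult_right[OF J(1)] ideal_mult_left[OF J(1)])
    from I[OF hsubmod_act[OF hA 1(1), of r] hsubmod_act[OF hC 1(2), of r] this]
    show "(x * r, bar r * y * r) \<in> gen_form J Z K"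
      unfolding 1(4,5) by (simp add: bar_simps algebra_simps)
  qed
  have M: "(0, x - bar x * \<ell>) \<in> gen_form J Z K" if "x \<in> J" for x
    using I[OF hsubmod_0[OF hA] hsubmod_0[OF hC] that] by simp
  have A: "?A \<subseteq> gen_form J Z K"
    using I[OF _ hsubmod_0[OF hC] ideal_0[OF J(1)]] by auto
  have D: "gen_form J Z K \<subseteq> \<Delta>"
  proof
    fix \<alpha> assume "\<alpha> \<in> gen_form J Z K"
    then obtain a1 a2 c1 c2 t where
      1: "(a1, a2) \<in> ?A" "(c1, c2) \<in> ?C" "t \<in> J" "\<alpha> = (a1 + c1, (t - bar t * \<ell>) + a2 + c2 - bar a1 * \<mu> * c1)"
      unfolding gen_form_mem by auto
    have "(a1 + c1, a2 + c2 - bar a1 * \<mu> * c1) \<in> \<Delta>" using 1 AD CD by (auto intro: hsubmod_add[OF \<Delta>_sub])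
    from hsubmod_add0[OF \<Delta>_sub this \<Delta>_min[of t]] show "\<alpha> \<in> \<Delta>" unfolding 1(4) by (simp add: algebra_simps)
  qed
  have T: "bar z * \<mu> * x \<in> J" if "(x, y) \<in> gen_form J Z K" "z \<in> J_of \<Delta>" for x y z
  proof -
    from that(1) obtain a1 a2 c1 c2 where 1: "(a1, a2) \<in> ?A" "(c1, c2) \<in> ?C" "x = a1 + c1"
      unfolding gen_form_mem by blast
    then have "bar z * \<mu> * a1 \<in> J" "bar z * \<mu> * c1 \<in> J" using At Ct that(2) by (auto simp: tilde_forms_def)
    then show ?thesis unfolding 1(3) distrib_left by (rule ideal_add[OF J(1)])
  qed
  show "is_level J (gen_form J Z K)"
    unfolding is_level_def using J hs D M T A act_gen_incl[of "(_, _)" \<Delta> _ J] by (auto simp: act_def)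
  show "act_gen S Z K \<subseteq> gen_form J Z K"
    using I[OF hsubmod_0[OF hA] _ ideal_0[OF J(1)]] by auto
qed

lemma gen_form_subset:
  assumes h: "hsubmod \<Omega>" and M: "\<And>x. x \<in> J \<Longrightarrow> (0, x - bar x * \<ell>) \<in> \<Omega>"
    and D: "\<And>\<alpha> b. \<alpha> \<in> \<Delta> \<Longrightarrow> b \<in> J \<Longrightarrow> act S \<alpha> b \<in> \<Omega>"
    and Z: "\<And>\<alpha> b. \<alpha> \<in> Z \<Longrightarrow> b \<in> K \<Longrightarrow> act S \<alpha> b \<in> \<Omega>"
  shows "gen_form J Z K \<subseteq> \<Omega>"
proof
  fix \<alpha> assume "\<alpha> \<in> gen_form J Z K"
  then obtain a1 a2 c1 c2 t where
    1: "(a1, a2) \<in> act_gen S \<Delta> J" "(c1, c2) \<in> act_gen S Z K" "t \<in> J" "\<alpha> = (a1 + c1, (t - bar t * \<ell>) + a2 + c2 - bar a1 * \<mu> * c1)"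
    unfolding gen_form_mem by auto
  have "act_gen S \<Delta> J \<subseteq> \<Omega>" "act_gen S Z K \<subseteq> \<Omega>"
    by (rule act_gen_subset[OF h]; simp add: D Z)+
  then have "(a1 + c1, a2 + c2 - bar a1 * \<mu> * c1) \<in> \<Omega>"
    using 1 by (auto intro: hsubmod_add[OF h])
  from hsubmod_add0[OF h this M[OF 1(3)]] show "\<alpha> \<in> \<Omega>" unfolding 1(4) by (auto simp: algebra_simps)
qed

lemma gen_form_least:
  assumes l: "is_level J' \<Omega>" and J: "J \<subseteq> J'" and Z: "\<And>\<alpha> b. \<alpha> \<in> Z \<Longrightarrow> b \<in> K \<Longrightarrow> act S \<alpha> b \<in> \<Omega>"
  shows "gen_form J Z K \<subseteq> \<Omega>"
  using J is_level_min[OF l] is_level_act[OF l] Z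
  by (intro gen_form_subset[OF is_level_hsubmod[OF l]]) (auto simp: act_def)

section \<open>The upper level\<close>

abbreviation uJ :: "('a, 3) mat_th set \<Rightarrow> 'a set" where "uJ H \<equiv> fst (upper_level S \<Delta> H)"
abbreviation uS :: "('a, 3) mat_th set \<Rightarrow> ('a \<times> 'a) set" where "uS H \<equiv> snd (upper_level S \<Delta> H)"

lemma uJ_eq: "uJ H = ideal_gen (level_gens S \<Delta> H \<union> bar ` level_gens S \<Delta> H)"
  by (simp add: upper_level_def Let_def)

lemma uS_eq: "uS H = gen_form (uJ H) (level_form_gens S \<Delta> H) UNIV"
  by (simp add: upper_level_def Let_def gen_form_def)

lemma uJ_ideal: "is_ideal (uJ H)"
  unfolding uJ_eq by (rule ring_module.subspace_span)

lemma uJ_gen: "x \<in> level_gens S \<Delta> H \<Longrightarrow> x \<in> uJ H"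
  unfolding uJ_eq by (rule ring_module.span_base) simp

lemma uJ_bar: "x \<in> uJ H \<Longrightarrow> bar x \<in> uJ H"
proof -
  let ?Y = "level_gens S \<Delta> H \<union> bar ` level_gens S \<Delta> H"
  assume "x \<in> uJ H"
  then have "x \<in> ideal_gen ?Y" by (simp add: uJ_eq)
  then have "bar x \<in> ideal_gen ?Y"
  proof (induction rule: ring_module.span_induct_alt)
    case base then show ?case by (simp add: ring_module.span_zero)
  next
    case (step c x y)
    have "bar x \<in> ideal_gen ?Y" using step(1) by (intro ring_module.span_base) (auto simp: image_iff)
    then show ?case using step by (simp add: bar_simps ring_module.span_add ring_module.span_scale)
  qed
  then show ?thesis by (simp add: uJ_eq)
qed

lemma level_gensI:
  assumes "\<sigma> \<in> H" "i \<noteq> Zero" "j \<noteq> Zero" "i \<noteq> j"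
    and "x \<in> {\<sigma> $ i $ j, \<sigma> $ i $ i - \<sigma> $ j $ j}
     \<union> {\<sigma> $ i $ Zero * y | y. y \<in> J_of \<Delta>}
     \<union> {bar y * \<mu> * \<sigma> $ Zero $ j | y. y \<in> J_of \<Delta>}
     \<union> {bar y * \<mu> * (\<sigma> $ Zero $ Zero - \<sigma> $ j $ j) * z | y z. y \<in> J_of \<Delta> \<and> z \<in> J_of \<Delta>}"
  shows "x \<in> uJ H"
proof (rule uJ_gen)
  show "x \<in> level_gens S \<Delta> H"
    unfolding level_gens_def
    by (rule UN_I[OF assms(1)], rule UN_I[of i], use assms(2) in simp, rule UN_I[of j], use assms(3,4) in simp, rule assms(5))
qed

lemma level_mem:
  assumes "\<sigma> \<in> H" "i \<noteq> Zero" "j \<noteq> Zero" "i \<noteq> j"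
  shows "\<sigma> $ i $ j \<in> uJ H" "\<sigma> $ i $ i - \<sigma> $ j $ j \<in> uJ H"
  by (rule level_gensI[OF assms], blast)+

lemma level_mem_Zero:
  assumes "\<sigma> \<in> H" "i \<noteq> Zero" "y \<in> J_of \<Delta>"
  shows "\<sigma> $ i $ Zero * y \<in> uJ H" "bar y * \<mu> * \<sigma> $ Zero $ i \<in> uJ H"
    "z \<in> J_of \<Delta> \<Longrightarrow> bar y * \<mu> * (\<sigma> $ Zero $ Zero - \<sigma> $ i $ i) * z \<in> uJ H"
proof -
  have n: "- i \<noteq> Zero" "- i \<noteq> i" "i \<noteq> - i" using assms theta_ne_minus[of i] by auto
  show "\<sigma> $ i $ Zero * y \<in> uJ H"
    by (rule level_gensI[OF assms(1,2) n(1,3)]) (use assms(3) in blast)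
  show "bar y * \<mu> * \<sigma> $ Zero $ i \<in> uJ H"
    by (rule level_gensI[OF assms(1) n(1) assms(2) n(2)]) (use assms(3) in blast)
  show "bar y * \<mu> * (\<sigma> $ Zero $ Zero - \<sigma> $ i $ i) * z \<in> uJ H" if "z \<in> J_of \<Delta>"
    by (rule level_gensI[OF assms(1) n(1) assms(2) n(2)]) (use assms(3) that in blast)
qed

lemma mv_col: "(\<sigma> *v e j) $ i = \<sigma> $ i $ j" for \<sigma> :: "('a, 3) mat_th"
  by (simp add: matrix_vector_mult_def if_distrib cong: if_cong)

lemma column_eq: "column j \<sigma> = \<sigma> *v e j" for \<sigma> :: "('a, 3) mat_th"
  by (simp add: vec_eq_iff column_def mv_col)

lemma mv_nth: "(\<sigma> *v u) $ i = (\<Sum>j\<in>UNIV. \<sigma> $ i $ j * u $ j)" for \<sigma> :: "('a, 3) mat_th"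
  by (simp add: matrix_vector_mult_def)

text \<open>The generators of \<open>uJ H\<close> are the entries of \<open>\<sigma> - \<sigma>\<^sub>i\<^sub>i\<close>, those in row or column \<open>Zero\<close> being
  multiplied by elements of \<open>J(\<Delta>)\<close> and \<open>\<mu>\<close> as in the pairing \<open>B v (\<sigma> u - \<sigma>\<^sub>i\<^sub>i u)\<close>.\<close>

lemma upper_scalar_mod:
  assumes \<sigma>: "\<sigma> \<in> H" and i: "i \<noteq> Zero"
  shows "scalar_mod (uJ H) (\<sigma> $ i $ i) \<sigma>"
proof -
  let ?c = "\<sigma> $ i $ i" and ?J = "uJ H"
  note J = uJ_ideal[of H]
  have dj: "\<sigma> $ k $ k - ?c \<in> ?J" if "k \<noteq> Zero" for k
    using level_mem(2)[OF \<sigma> that i] ideal_0[OF J] by (cases "k = i") auto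
  have "B v (\<sigma> *v u - ?c *s u) \<in> ?J" if u: "u $ Zero \<in> J_of \<Delta>" and v: "v $ Zero \<in> J_of \<Delta>" for u v
  proof -
    define D where "D = \<sigma> *v u - ?c *s u"
    have Dsum: "D $ k = (\<Sum>j\<in>UNIV. (\<sigma> $ k $ j - (if j = k then ?c else 0)) * u $ j)" for k
    proof -
      have "(if j = k then ?c else 0) * u $ j = (if j = k then ?c * u $ k else 0)" for j by simp
      then have "(\<Sum>j\<in>UNIV. (if j = k then ?c else 0) * u $ j) = ?c * u $ k" by simp
      then show ?thesis unfolding D_def by (simp only: left_diff_distrib sum_subtractf vec_simps mv_nth)
    qed
    have Dk: "D $ k \<in> ?J" if k: "k \<noteq> Zero" for k
      unfolding Dsum
    proof (rule ideal_sum[OF J])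
      fix j
      show "(\<sigma> $ k $ j - (if j = k then ?c else 0)) * u $ j \<in> ?J"
        using level_mem_Zero(1)[OF \<sigma> k u] level_mem(1)[OF \<sigma> k, of j] dj[OF k] k
        by (cases "j = Zero"; cases "j = k") (auto intro: ideal_mult_right[OF J])
    qed
    have "bar (v $ Zero) * \<mu> * D $ Zero = (\<Sum>j\<in>UNIV. bar (v $ Zero) * \<mu> * ((\<sigma> $ Zero $ j - (if j = Zero then ?c else 0)) * u $ j))"
      unfolding Dsum sum_distrib_left ..
    also have "\<dots> \<in> ?J"
    proof (rule ideal_sum[OF J])
      fix j
      show "bar (v $ Zero) * \<mu> * ((\<sigma> $ Zero $ j - (if j = Zero then ?c else 0)) * u $ j) \<in> ?J"
        using level_mem_Zero(3)[OF \<sigma> i v u] level_mem_Zero(2)[OF \<sigma> _ v, of j]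
        by (cases "j = Zero") (auto simp: mult.assoc[symmetric] intro: ideal_mult_right[OF J])
    qed
    finally have D0: "bar (v $ Zero) * \<mu> * D $ Zero \<in> ?J" .
    have "om p * bar (v $ p) * D $ (- p) \<in> ?J" for p
    proof (cases "p = Zero")
      case True with D0 show ?thesis by (simp add: om_def mult.commute[of \<mu>])
    next
      case False with Dk[of "- p"] show ?thesis by (simp add: ideal_mult_left[OF J])
    qed
    then show ?thesis unfolding D_def[symmetric] B_sum by (intro ideal_sum[OF J])
  qed
  then show ?thesis unfolding scalar_mod_def by blast
qed

lemma form_gen_eq: "heis_minus S (act S (heis_minus S (Q (\<sigma> *v e Zero)) (1, 0)) y \<otimes>\<^bsub>heis S\<^esub> (y, z)) (act S (y, z) c)
  = heis_diff (Qplus z (\<sigma> *v (y *s e Zero))) (act S (y, z) c)"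
proof -
  have "act S (heis_diff (Q (\<sigma> *v e Zero)) (1, 0)) y \<otimes>\<^bsub>heis S\<^esub> (y, z) = Qplus z (\<sigma> *v (y *s e Zero))"
    by (simp add: heis_diff_def act_def Qplus_def mv_scale q_scale bar_simps algebra_simps)
  then show ?thesis unfolding heis_minus_eq by simp
qed

lemma level_form_mem:
  assumes "\<sigma> \<in> H" "i \<noteq> Zero"
  shows "Q (\<sigma> *v e i) \<in> level_form_gens S \<Delta> H"
    "(y, z) \<in> \<Delta> \<Longrightarrow> heis_diff (Qplus z (\<sigma> *v (y *s e Zero))) (act S (y, z) (\<sigma> $ i $ i)) \<in> level_form_gens S \<Delta> H"
  using assms unfolding level_form_gens_def column_eq form_gen_eq by blast+

lemma level_form_cases:
  assumes "\<alpha> \<in> level_form_gens S \<Delta> H"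
  obtains \<sigma> i where "\<sigma> \<in> H" "i \<noteq> Zero" "\<alpha> = Q (\<sigma> *v e i)"
  | \<sigma> i y z where "\<sigma> \<in> H" "i \<noteq> Zero" "(y, z) \<in> \<Delta>" "\<alpha> = heis_diff (Qplus z (\<sigma> *v (y *s e Zero))) (act S (y, z) (\<sigma> $ i $ i))"
  using assms unfolding level_form_gens_def column_eq form_gen_eq by blast

lemma Q_col_\<Delta>: "\<sigma> \<in> carrier Ug \<Longrightarrow> i \<noteq> Zero \<Longrightarrow> Q (\<sigma> *v e i) \<in> \<Delta>"
  using U_Qplus[of \<sigma> 0 "e i"] hsubmod_0[OF \<Delta>_sub] by (simp add: Qplus_def Q_form_def[symmetric]) (simp add: Q_form_def)

lemma level_form_sub:
  assumes H: "H \<subseteq> carrier Ug"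
  shows "level_form_gens S \<Delta> H \<subseteq> \<Delta>" "level_form_gens S \<Delta> H \<subseteq> tilde_forms (uJ H)"
proof -
  show "level_form_gens S \<Delta> H \<subseteq> \<Delta>"
  proof
    fix \<alpha> assume "\<alpha> \<in> level_form_gens S \<Delta> H"
    then show "\<alpha> \<in> \<Delta>"
    proof (cases rule: level_form_cases)
      case (1 \<sigma> i) then show ?thesis using H Q_col_\<Delta> by auto
    next
      case (2 \<sigma> i y z)
      have "Qplus z (y *s e Zero) \<in> \<Delta>" using 2 by (simp add: Qplus_def q_scale)
      then have "cong_mod \<Delta> (Qplus z (\<sigma> *v (y *s e Zero))) (act S (y, z) (\<sigma> $ i $ i))"
        using 2 H U_Qplus[of \<sigma>] hsubmod_act[OF \<Delta>_sub] hsubmod_add[OF \<Delta>_sub _ hsubmod_neg[OF \<Delta>_sub]]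
        unfolding cong_mod_def heis_minus_eq[symmetric]
        by (intro subgroup.m_closed[OF subgroup_hsubmod[OF \<Delta>_sub]] subgroup.m_inv_closed[OF subgroup_hsubmod[OF \<Delta>_sub]]) auto
      then show ?thesis using 2 by (simp add: cong_mod_def)
    qed
  qed
  show "level_form_gens S \<Delta> H \<subseteq> tilde_forms (uJ H)"
  proof
    fix \<alpha> assume "\<alpha> \<in> level_form_gens S \<Delta> H"
    then show "\<alpha> \<in> tilde_forms (uJ H)"
    proof (cases rule: level_form_cases)
      case (1 \<sigma> i) then show ?thesis using level_mem_Zero(2)[OF 1(1,2)] by (simp add: tilde_forms_def Q_form_def mv_col)
    next
      case (2 \<sigma> i y z)
      then show ?thesis using level_mem_Zero(3)[OF 2(1,2)] JD_I[OF 2(3)]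
        by (simp add: tilde_forms_def heis_diff_def Qplus_def mv_scale mv_col algebra_simps)
    qed
  qed
qed

lemma level_form_act: "H \<subseteq> carrier Ug \<Longrightarrow> \<alpha> \<in> level_form_gens S \<Delta> H \<Longrightarrow> act S \<alpha> b \<in> tilde_forms (uJ H)"
  using level_form_sub(2) hsubmod_act'[OF tilde_forms_hsubmod[OF uJ_ideal]] by blast

lemma upper_is_level: "H \<subseteq> carrier Ug \<Longrightarrow> is_level (uJ H) (uS H)"
  unfolding uS_eq
  by (rule gen_form_is_level(1)[OF uJ_ideal uJ_bar ring_module.subspace_UNIV level_form_sub(1) level_form_act])

lemma upper_gens:
  assumes H: "H \<subseteq> carrier Ug" shows "level_form_gens S \<Delta> H \<subseteq> uS H"
proof
  fix \<alpha> assume "\<alpha> \<in> level_form_gens S \<Delta> H"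
  then have "act S \<alpha> 1 \<in> act_gen S (level_form_gens S \<Delta> H) UNIV" by (rule act_gen_incl) simp
  then have "act S \<alpha> 1 \<in> uS H"
    unfolding uS_eq using gen_form_is_level(2)[OF uJ_ideal uJ_bar ring_module.subspace_UNIV level_form_sub(1)[OF H] level_form_act[OF H]] by blast
  then show "\<alpha> \<in> uS H" by (simp add: act_def)
qed

text \<open>As \<open>Q\<close> is not additive, the coordinates are added one at a time, beginning with coordinate \<open>Zero\<close>.\<close>

lemma vec_zero_span_induct:
  assumes base: "\<And>y. R (y *s e Zero)"
    and step: "\<And>w x k. R w \<Longrightarrow> k \<noteq> Zero \<Longrightarrow> w $ k = 0 \<Longrightarrow> R (w + x *s e k)"
  shows "R (w :: ('a, 3) vec_th)"
proof -
  have "R (w $ Zero *s e Zero + (\<Sum>k\<in>A. w $ k *s e k))" if "finite A" "Zero \<notin> A" for A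
    using that
  proof (induction A)
    case empty then show ?case using base by simp
  next
    case (insert k A)
    have "(w $ Zero *s e Zero + (\<Sum>k\<in>A. w $ k *s e k)) $ k = 0"
      using insert by (auto intro!: sum.neutral)
    then show ?case using insert step[of "w $ Zero *s e Zero + (\<Sum>k\<in>A. w $ k *s e k)" k "w $ k"] by (auto simp: ac_simps)
  qed
  from this[of "- {Zero}"] have "R (w $ Zero *s e Zero + (\<Sum>k\<in>- {Zero}. w $ k *s e k))" by simp
  moreover have "w $ Zero *s e Zero + (\<Sum>k\<in>- {Zero}. w $ k *s e k) = w"
    using vec_expand[of w] sum.remove[of UNIV Zero "\<lambda>k. w $ k *s e k"] by (simp add: Compl_eq_Diff_UNIV)
  ultimately show ?thesis by simp
qed

text \<open>The value of \<open>Q\<close> at \<open>w + x e\<^sub>k\<close> and that at its image under \<open>\<sigma>\<close> have the same cross terms modulo \<open>J\<close>,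
  because \<open>\<sigma>\<close> preserves \<open>B\<close> and is a scalar \<open>c\<close> with \<open>c bar c \<equiv> 1\<close>. So the coordinate can be
  removed at the expense of \<open>Q (\<sigma> e\<^sub>k)\<close> and of the same change of \<open>z\<close> on both sides.\<close>

lemma Qplus_step:
  assumes l: "is_level J \<Omega>" and \<sigma>: "\<sigma> \<in> carrier Ug" and scalar_mod: "scalar_mod J c \<sigma>" and k: "k \<noteq> Zero" and w0: "w $ Zero \<in> J_of \<Delta>"
    and Qk: "Q (\<sigma> *v e k) \<in> \<Omega>"
  obtains z1 where "Qplus z (w + x *s e k) = Qplus z1 w" "cong_mod \<Omega> (Qplus z (\<sigma> *v (w + x *s e k))) (Qplus z1 (\<sigma> *v w))"
proof -
  note J = is_level_ideal[OF l] and h = is_level_hsubmod[OF l]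
  have un: "1 - c * bar c \<in> J" by (rule scalar_mod_unit[OF J is_level_bar[OF l] \<sigma> scalar_mod])
  define g where "g = Bm w (x *s e k)"
  define g' where "g' = Bm (\<sigma> *v w) (x *s (\<sigma> *v e k))"
  define z1 where "z1 = B w (x *s e k) - (g - bar g * \<ell>) + z"
  have F1: "Qplus z (w + x *s e k) = Qplus z1 w"
    unfolding Qplus_def q_add g_def[symmetric] z1_def using k by (simp add: q_scale)
  have sw0: "(\<sigma> *v w) $ Zero \<in> J_of \<Delta>" by (rule U_JD[OF \<sigma> w0])
  have \<Omega>k: "(\<sigma> $ Zero $ k, q (\<sigma> *v e k)) \<in> \<Omega>" using Qk by (simp add: Q_form_def mv_col)
  define t where "t = bar (x * \<sigma> $ Zero $ k) * \<mu> * (\<sigma> *v w) $ Zero"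
  have tb: "bar t * \<ell> = bar ((\<sigma> *v w) $ Zero) * \<mu> * (x * \<sigma> $ Zero $ k)"
    unfolding t_def by (simp add: bar_simps ell_cancel_deep ac_simps)
  have "bar ((\<sigma> *v w) $ Zero) * \<mu> * \<sigma> $ Zero $ k * x \<in> J"
    by (rule ideal_mult_right[OF J is_level_tilde[OF l \<Omega>k sw0]])
  then have "bar t * \<ell> \<in> J" unfolding tb by (simp add: ac_simps)
  from ideal_mult_right[OF J is_level_bar[OF l this], of \<ell>] have tJ: "t \<in> J" by (simp add: bar_simps mult.assoc)
  have gg: "g' - g \<in> J"
  proof -
    define d where "d = \<sigma> *v w - c *s w"
    define d' where "d' = x *s (\<sigma> *v e k - c *s e k)"
    have d: "small J d" "small J (\<sigma> *v e k - c *s e k)" unfolding d_def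
      using k by (auto intro: scalar_mod_small[OF scalar_mod \<sigma> w0] scalar_mod_small[OF scalar_mod \<sigma>])
    have dJ: "d $ p \<in> J" "d' $ p \<in> J" if "p \<noteq> Zero" for p
      using small_coord[OF J d(1) that] small_coord[OF J d(2) that] unfolding d'_def
      by (auto intro: ideal_mult_left[OF J] simp del: vector_minus_component e_nth)
    have e: "\<sigma> *v w = c *s w + d" "x *s (\<sigma> *v e k) = c *s (x *s e k) + d'"
      by (simp_all add: d_def d'_def vec_eq_iff algebra_simps)
    have "g' - g = - (1 - c * bar c) * g + Bm (c *s w) d' + Bm d (x *s (\<sigma> *v e k))"
      unfolding g'_def g_def by (subst e(1), unfold Bm_add_left, subst e(2))
        (simp add: Bm_add_right Bm_scale_left Bm_scale_right algebra_simps)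
    moreover have "Bm (c *s w) d' \<in> J" by (rule Bm_ideal[OF J]) (rule dJ)
    moreover have "Bm d (x *s (\<sigma> *v e k)) \<in> J"
      unfolding Bm_def by (rule ideal_sum[OF J], rule ideal_mult_right[OF J], rule ideal_mult_left[OF J], rule is_level_bar[OF l])
        (auto intro: dJ)
    moreover have "- (1 - c * bar c) * g \<in> J" by (rule ideal_mult_right[OF J ideal_neg[OF J un]])
    ultimately show ?thesis by (auto intro: ideal_add[OF J])
  qed
  define m where "m = t - (g' - g)"
  have mJ: "m \<in> J" unfolding m_def by (rule ideal_diff[OF J tJ gg])
  have "(x * \<sigma> $ Zero $ k, bar x * x * q (\<sigma> *v e k)) \<in> \<Omega>"
    using hsubmod_act[OF h \<Omega>k, of x] by (simp add: ac_simps)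
  from hsubmod_add0[OF h this is_level_min[OF l mJ]]
  have "cong_mod \<Omega> (Qplus z (\<sigma> *v (w + x *s e k))) (Qplus z1 (\<sigma> *v w))"
    unfolding cong_mod_def heis_diff_def Qplus_def mv_add mv_scale q_add g'_def[symmetric]
    unfolding m_def z1_def
    using U_B[OF \<sigma>, of w "e k"] tb unfolding t_def
    by (simp add: B_scale_right q_scale mv_col bar_simps algebra_simps)
  with F1 show thesis by (rule that)
qed

text \<open>The induction over the coordinates starts with the generators \<open>(Q(\<sigma>\<^sub>*\<^sub>0) - (1, 0)) \<circ> y + (y, z) - (y, z) \<circ> \<sigma>\<^sub>i\<^sub>i\<close> of
  the upper level, and each step uses a generator \<open>Q(\<sigma>\<^sub>*\<^sub>k)\<close>.\<close>

lemma upper_level_scalar: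
  assumes H: "H \<subseteq> carrier Ug" and \<sigma>: "\<sigma> \<in> H" and i: "i \<noteq> Zero"
  shows "level_scalar (uJ H) (uS H) (\<sigma> $ i $ i) \<sigma>"
proof -
  let ?c = "\<sigma> $ i $ i" and ?J = "uJ H" and ?S = "uS H"
  note l = upper_is_level[OF H] and scalar_mod = upper_scalar_mod[OF \<sigma> i] and fg = upper_gens[OF H]
  have h: "hsubmod ?S" by (rule is_level_hsubmod[OF l])
  have \<sigma>c: "\<sigma> \<in> carrier Ug" using H \<sigma> by blast
  have "\<forall>z. Qplus z w \<in> \<Delta> \<longrightarrow> cong_mod ?S (Qplus z (\<sigma> *v w)) (act S (Qplus z w) ?c)" for w
  proof (induction w rule: vec_zero_span_induct)
    case (1 y)
    show ?case
    proof (intro allI impI)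
      fix z assume "Qplus z (y *s e Zero) \<in> \<Delta>"
      then have yz: "(y, z) \<in> \<Delta>" and Qplus: "Qplus z (y *s e Zero) = (y, z)" by (simp_all add: Qplus_def q_scale)
      show "cong_mod ?S (Qplus z (\<sigma> *v (y *s e Zero))) (act S (Qplus z (y *s e Zero)) ?c)"
        unfolding cong_mod_def Qplus using level_form_mem(2)[OF \<sigma> i yz] fg by blast
    qed
  next
    case (2 w x k)
    show ?case
    proof (intro allI impI)
      fix z assume Fz: "Qplus z (w + x *s e k) \<in> \<Delta>"
      have w0: "w $ Zero \<in> J_of \<Delta>" using Qplus_JD[OF Fz] 2 by simp
      have "Q (\<sigma> *v e k) \<in> ?S" using level_form_mem(1)[OF \<sigma> 2(2)] fg by blast
      then obtain z1 where z1: "Qplus z (w + x *s e k) = Qplus z1 w" "cong_mod ?S (Qplus z (\<sigma> *v (w + x *s e k))) (Qplus z1 (\<sigma> *v w))"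
        using Qplus_step[OF l \<sigma>c scalar_mod 2(2) w0] by blast
      have "cong_mod ?S (Qplus z1 (\<sigma> *v w)) (act S (Qplus z1 w) ?c)" using 2 Fz z1 by simp
      from cong_mod_trans[OF h z1(2) this] show "cong_mod ?S (Qplus z (\<sigma> *v (w + x *s e k))) (act S (Qplus z (w + x *s e k)) ?c)"
        unfolding z1(1) .
    qed
  qed
  then show ?thesis using \<sigma>c scalar_mod by (simp add: level_scalar_def)
qed

lemma level_scalar_entries:
  assumes l: "is_level J \<Omega>" and p: "level_scalar J \<Omega> c \<sigma>" and i: "i \<noteq> Zero" and y: "y \<in> J_of \<Delta>" and z: "z \<in> J_of \<Delta>"
  shows "\<sigma> $ j $ i - (if j = i then c else 0) \<in> J \<or> j = Zero"
    and "\<sigma> $ i $ Zero * y \<in> J" and "bar y * \<mu> * \<sigma> $ Zero $ i \<in> J"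
    and "bar y * \<mu> * (\<sigma> $ Zero $ Zero - c) * z \<in> J"
proof -
  note J = is_level_ideal[OF l] and \<sigma> = level_scalar_carrier[OF p] and scalar_mod = level_scalar_scalar_mod[OF p]
  have s: "small J (\<sigma> *v e i - c *s e i)" "small J (\<sigma> *v (y *s e Zero) - c *s (y *s e Zero))"
    "small J (\<sigma> *v (z *s e Zero) - c *s (z *s e Zero))"
    using i y z by (auto intro!: scalar_mod_small[OF scalar_mod \<sigma>])
  show "\<sigma> $ j $ i - (if j = i then c else 0) \<in> J \<or> j = Zero"
    using small_coord[OF J s(1), of j] by (auto simp: mv_col)
  show "\<sigma> $ i $ Zero * y \<in> J"
    using small_coord[OF J s(2) i] i by (simp add: mv_scale mv_col mult.commute)
  have "B (y *s e Zero) (\<sigma> *v e i - c *s e i) \<in> J" using s(1) y by (auto simp: small_def)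
  then show "bar y * \<mu> * \<sigma> $ Zero $ i \<in> J"
    using i by (auto simp: B_scale_left om_def mv_col mult.assoc split: if_splits)
  have "B (y *s e Zero) (\<sigma> *v (z *s e Zero) - c *s (z *s e Zero)) \<in> J" using s(3) y by (auto simp: small_def)
  then show "bar y * \<mu> * (\<sigma> $ Zero $ Zero - c) * z \<in> J"
    by (simp add: B_scale_left om_def mv_col mv_scale algebra_simps)
qed

text \<open>Together with \<open>upper_level_scalar\<close> this describes the upper level without coordinates, which
  makes its invariance under elementary conjugation evident.\<close>

lemma upper_least:
  assumes H: "H \<subseteq> carrier Ug" and l: "is_level J \<Omega>" and p: "\<And>\<sigma>. \<sigma> \<in> H \<Longrightarrow> \<exists>c. level_scalar J \<Omega> c \<sigma>"
  shows "uJ H \<subseteq> J" "uS H \<subseteq> \<Omega>"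
proof -
  note J = is_level_ideal[OF l] and h = is_level_hsubmod[OF l]
  have diag: "\<sigma> $ i $ i - c \<in> J" if "level_scalar J \<Omega> c \<sigma>" "i \<noteq> Zero" for \<sigma> c i
    using level_scalar_entries(1)[OF l that JD_0 JD_0, of i] that(2) by simp
  have g: "x \<in> J" if "x \<in> level_gens S \<Delta> H" for x
  proof -
    from that obtain \<sigma> i j where \<sigma>: "\<sigma> \<in> H" "i \<noteq> Zero" "j \<noteq> Zero" "i \<noteq> j" and
      x: "x \<in> {\<sigma> $ i $ j, \<sigma> $ i $ i - \<sigma> $ j $ j}
     \<union> {\<sigma> $ i $ Zero * y | y. y \<in> J_of \<Delta>}
     \<union> {bar y * \<mu> * \<sigma> $ Zero $ j | y. y \<in> J_of \<Delta>}
     \<union> {bar y * \<mu> * (\<sigma> $ Zero $ Zero - \<sigma> $ j $ j) * z | y z. y \<in> J_of \<Delta> \<and> z \<in> J_of \<Delta>}"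
      unfolding level_gens_def by blast
    obtain c where c: "level_scalar J \<Omega> c \<sigma>" using p \<sigma> by blast
    have "\<sigma> $ i $ j \<in> J" using level_scalar_entries(1)[OF l c \<sigma>(3) JD_0 JD_0, of i] \<sigma> by auto
    moreover have "\<sigma> $ i $ i - \<sigma> $ j $ j \<in> J"
      using ideal_diff[OF J diag[OF c \<sigma>(2)] diag[OF c \<sigma>(3)]] by simp
    moreover have "bar y * \<mu> * (\<sigma> $ Zero $ Zero - \<sigma> $ j $ j) * z \<in> J" if "y \<in> J_of \<Delta>" "z \<in> J_of \<Delta>" for y z
    proof -
      have "bar y * \<mu> * (\<sigma> $ j $ j - c) * z \<in> J"
        by (intro ideal_mult_right[OF J] ideal_mult_left[OF J] diag[OF c \<sigma>(3)])
      from ideal_diff[OF J level_scalar_entries(4)[OF l c \<sigma>(3) that] this] show ?thesis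
        by (simp add: algebra_simps)
    qed
    ultimately show ?thesis
      using x level_scalar_entries(2)[OF l c \<sigma>(2) _ JD_0] level_scalar_entries(3)[OF l c \<sigma>(3) _ JD_0] by auto
  qed
  show uJ: "uJ H \<subseteq> J"
    unfolding uJ_eq by (rule ring_module.span_minimal) (use g is_level_bar[OF l] J in auto)
  have f: "\<alpha> \<in> \<Omega>" if "\<alpha> \<in> level_form_gens S \<Delta> H" for \<alpha>
    using that
  proof (cases rule: level_form_cases)
    case (1 \<sigma> i)
    obtain c where c: "level_scalar J \<Omega> c \<sigma>" using p 1 by blast
    have "Qplus 0 (e i) = (0, 0)" using 1 by (simp add: Qplus_def)
    then have "cong_mod \<Omega> (Qplus 0 (\<sigma> *v e i)) (0, 0)"
      using level_scalar_Qplus[OF c, of 0 "e i"] hsubmod_0[OF \<Delta>_sub] by (simp add: act_def)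
    then have "Qplus 0 (\<sigma> *v e i) \<in> \<Omega>" by (rule cong_mod_mem[OF h _ hsubmod_0[OF h]])
    then show ?thesis using 1 by (simp add: Qplus_def Q_form_def)
  next
    case (2 \<sigma> i y z)
    obtain c where c: "level_scalar J \<Omega> c \<sigma>" using p 2 by blast
    have Qplus: "Qplus z (y *s e Zero) = (y, z)" by (simp add: Qplus_def q_scale)
    have "c - \<sigma> $ i $ i \<in> J" using ideal_neg[OF J diag[OF c 2(2)]] by simp
    from level_scalar_Qplus[OF level_scalar_cong[OF l c this], of z "y *s e Zero"] show ?thesis
      unfolding Qplus using 2 by (simp add: cong_mod_def)
  qed
  show "uS H \<subseteq> \<Omega>"
    unfolding uS_eq by (rule gen_form_least[OF l uJ]) (use f hsubmod_act'[OF h] in blast)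
qed

section \<open>Elementary conjugation and the upper inclusion\<close>

definition conj_by :: "('a, 3) mat_th \<Rightarrow> ('a, 3) mat_th set \<Rightarrow> ('a, 3) mat_th set" where
  "conj_by \<tau> H = (\<lambda>h. iv \<tau> ** h ** \<tau>) ` H"

lemma EUf_sub: "subgroup EUf Ug"
  unfolding EUf_eq
proof (rule G.generate_is_subgroup, rule subsetI)
  fix g assume "g \<in> elementary_gens UNIV \<Delta>"
  then show "g \<in> carrier Ug"
    using long_form_invariant[OF is_level_full] short_form_invariant[OF is_level_full] unfolding elementary_gens_def form_invariant_def by auto
qed

lemma EUf_U: "\<tau> \<in> EUf \<Longrightarrow> \<tau> \<in> carrier Ug"
  and EUf_iv: "\<tau> \<in> EUf \<Longrightarrow> iv \<tau> \<in> EUf"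
  and EUf_mul: "\<tau> \<in> EUf \<Longrightarrow> \<tau>' \<in> EUf \<Longrightarrow> \<tau> ** \<tau>' \<in> EUf"
  using EUf_sub subgroup.subset subgroup.m_inv_closed subgroup.m_closed[of EUf Ug \<tau> \<tau>'] by fastforce+

lemma conj_by_sub: "H \<subseteq> carrier Ug \<Longrightarrow> \<tau> \<in> carrier Ug \<Longrightarrow> conj_by \<tau> H \<subseteq> carrier Ug"
  unfolding conj_by_def by (auto intro!: U_mul)

lemma conj_by_conj_by: "H \<subseteq> carrier Ug \<Longrightarrow> \<tau> \<in> carrier Ug \<Longrightarrow> conj_by (iv \<tau>) (conj_by \<tau> H) = H"
proof -
  assume H: "H \<subseteq> carrier Ug" and \<tau>: "\<tau> \<in> carrier Ug"
  have "\<tau> ** (iv \<tau> ** h ** \<tau>) ** iv \<tau> = h" for h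
    by (rule mat_eqI) (simp add: mv_mul \<tau>)
  then show ?thesis unfolding conj_by_def using \<tau> by (auto simp: image_image)
qed

lemma upper_conj_by_sub:
  assumes H: "H \<subseteq> carrier Ug" and \<tau>: "\<tau> \<in> EUf"
  shows "uJ (conj_by \<tau> H) \<subseteq> uJ H" "uS (conj_by \<tau> H) \<subseteq> uS H"
proof -
  note l = upper_is_level[OF H]
  have ex: "\<exists>c. level_scalar (uJ H) (uS H) c \<sigma>" if "\<sigma> \<in> conj_by \<tau> H" for \<sigma>
    using that upper_level_scalar[OF H, of _ "Pos 1"] level_scalar_conj[OF l _ EUf_form_invariant[OF l \<tau>]] unfolding conj_by_def by blast
  show "uJ (conj_by \<tau> H) \<subseteq> uJ H" "uS (conj_by \<tau> H) \<subseteq> uS H"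
    by (rule upper_least[OF conj_by_sub[OF H EUf_U[OF \<tau>]] l ex], assumption)+
qed

lemma upper_conj_by:
  assumes H: "H \<subseteq> carrier Ug" and \<tau>: "\<tau> \<in> EUf"
  shows "uJ (conj_by \<tau> H) = uJ H" "uS (conj_by \<tau> H) = uS H"
  using upper_conj_by_sub[OF H \<tau>] upper_conj_by_sub[OF conj_by_sub[OF H EUf_U[OF \<tau>]] EUf_iv[OF \<tau>]]
  by (simp_all add: conj_by_conj_by[OF H EUf_U[OF \<tau>]] subset_antisym)

text \<open>The definition of the congruence subgroup says nothing on the entries \<open>\<sigma>\<^sub>i\<^sub>0\<close>. They are found by
  pairing the column \<open>Zero\<close> with the other columns, to which it is orthogonal.\<close>

lemma U_rel_level_scalar:
  assumes l: "is_level J \<Omega>"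
  shows "U_rel S \<Delta> (J, \<Omega>) = {\<sigma>. level_scalar J \<Omega> 1 \<sigma>}"
proof (intro subset_antisym subsetI CollectI)
  note J = is_level_ideal[OF l] and h = is_level_hsubmod[OF l]
  fix \<sigma> :: "('a, 3) mat_th" assume "\<sigma> \<in> U_rel S \<Delta> (J, \<Omega>)"
  then have \<sigma>: "\<sigma> \<in> carrier Ug" and hb: "\<And>i j. i \<noteq> Zero \<Longrightarrow> j \<noteq> Zero \<Longrightarrow> \<sigma> $ i $ j - mat 1 $ i $ j \<in> J"
    and c: "\<And>u. u $ Zero \<in> J_of \<Delta> \<Longrightarrow> cong_mod \<Omega> (Q (\<sigma> *v u)) (Q u)"
    by (simp_all add: U_rel_def heis_cong_iff)
  have D0: "bar y * \<mu> * (\<sigma> *v u - u) $ Zero \<in> J" if "u $ Zero \<in> J_of \<Delta>" "y \<in> J_of \<Delta>" for u y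
    using is_level_tilde[OF l _ that(2)] c[OF that(1)] unfolding cong_mod_def heis_diff_def by auto
  have col0: "\<sigma> $ i $ Zero * y \<in> J" if i: "i \<noteq> Zero" and y: "y \<in> J_of \<Delta>" for i y
  proof -
    define a where "a = \<sigma> *v (y *s e Zero)"
    have a0: "a $ Zero \<in> J_of \<Delta>" unfolding a_def using U_JD[OF \<sigma>, of "y *s e Zero"] y by simp
    have "B a (\<sigma> *v e (- i)) = 0" unfolding a_def U_B[OF \<sigma>] using i by (simp add: B_scale_left)
    moreover have "B a (\<sigma> *v e (- i) - e (- i)) \<in> J"
      unfolding B_sum
    proof (rule ideal_sum[OF J])
      fix p :: "3 theta"
      show "om p * bar (a $ p) * (\<sigma> *v e (- i) - e (- i)) $ (- p) \<in> J"
      proof (cases "p = Zero")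
        case True then show ?thesis using D0[of "e (- i)" "a $ Zero"] a0 i by (auto simp: om_def mult.commute[of \<mu>])
      next
        case False
        then show ?thesis using hb[of "- p" "- i"] i by (auto simp: mat_def mv_col intro!: ideal_mult_left[OF J])
      qed
    qed
    ultimately have "B a (e (- i)) \<in> J" using ideal_neg[OF J] by (fastforce simp: B_simps)
    then have "bar (om i) * (om i * bar (a $ i)) \<in> J" by (simp add: B_e_right ideal_mult_left[OF J])
    then have "bar (a $ i) \<in> J" using om_bar[OF i] by (simp add: mult.assoc[symmetric] mult.commute[of "bar (om i)"])
    from is_level_bar[OF l this] show ?thesis by (simp add: a_def mv_scale mv_col mult.commute)
  qed
  have "B v (\<sigma> *v u - 1 *s u) \<in> J" if u: "u $ Zero \<in> J_of \<Delta>" "v $ Zero \<in> J_of \<Delta>" for u v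
    unfolding B_sum
  proof (rule ideal_sum[OF J])
    fix p :: "3 theta"
    show "om p * bar (v $ p) * (\<sigma> *v u - 1 *s u) $ (- p) \<in> J"
    proof (cases "p = Zero")
      case True then show ?thesis using D0[OF u] by (auto simp: om_def mult.commute[of \<mu>])
    next
      case False
      then have p: "- p \<noteq> Zero" by simp
      have "(\<sigma> *v u - 1 *s u) $ (- p) = (\<Sum>j\<in>UNIV. (\<sigma> $ (- p) $ j - mat 1 $ (- p) $ j) * u $ j)"
        using mv_nth[of "mat 1" u "- p"] by (simp add: mv_nth left_diff_distrib sum_subtractf)
      also have "\<dots> \<in> J"
      proof (rule ideal_sum[OF J])
        fix j show "(\<sigma> $ (- p) $ j - mat 1 $ (- p) $ j) * u $ j \<in> J"
          using hb[OF p, of j] col0[OF p u(1)] p by (cases "j = Zero") (auto simp: mat_def intro: ideal_mult_right[OF J])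
      qed
      finally show ?thesis by (rule ideal_mult_left[OF J])
    qed
  qed
  moreover have "cong_mod \<Omega> (Qplus z (\<sigma> *v w)) (act S (Qplus z w) 1)" if "Qplus z w \<in> \<Delta>" for w z
    using cong_mod_shift[of \<Omega> "(\<sigma> *v w) $ Zero" "q (\<sigma> *v w)" "w $ Zero" "q w" z] c[OF Qplus_JD[OF that]]
    by (simp add: Qplus_def act_def Q_form_def)
  ultimately show "level_scalar J \<Omega> 1 \<sigma>" using \<sigma> by (simp add: level_scalar_def scalar_mod_def)
next
  note J = is_level_ideal[OF l] and h = is_level_hsubmod[OF l]
  fix \<sigma> :: "('a, 3) mat_th" assume "\<sigma> \<in> {\<sigma>. level_scalar J \<Omega> 1 \<sigma>}"
  then have p: "level_scalar J \<Omega> 1 \<sigma>" by simp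
  have "\<sigma> $ i $ j - mat 1 $ i $ j \<in> J" if "i \<noteq> Zero" "j \<noteq> Zero" for i j
    using level_scalar_entries(1)[OF l p that(2) JD_0 JD_0, of i] that by (simp add: mat_def)
  moreover have "cong_mod \<Omega> (Q (\<sigma> *v u)) (Q u)" if u: "u $ Zero \<in> J_of \<Delta>" for u
  proof -
    obtain z where z: "Qplus z u \<in> \<Delta>" using JD_Qplus[OF u] by blast
    have "cong_mod \<Omega> (Qplus z (\<sigma> *v u)) (Qplus z u)" using level_scalar_Qplus[OF p z] by (simp add: act_def)
    then show ?thesis
      using cong_mod_shift[of \<Omega> "(\<sigma> *v u) $ Zero" "q (\<sigma> *v u) + z" "u $ Zero" "q u + z" "- z"]
      by (simp add: Qplus_def Q_form_def)
  qed
  ultimately show "\<sigma> \<in> U_rel S \<Delta> (J, \<Omega>)"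
    using level_scalar_carrier[OF p] by (simp add: U_rel_def heis_cong_iff)
qed

lemma level_scalar_one: assumes l: "is_level J \<Omega>" shows "level_scalar J \<Omega> 1 (mat 1)"
  using ideal_0[OF is_level_ideal[OF l]] cong_mod_refl[OF is_level_hsubmod[OF l]] G.one_closed
  by (simp add: level_scalar_def scalar_mod_def act_def)

lemma normalizer_iff:
  assumes K: "K \<subseteq> carrier Ug"
  shows "g \<in> normalizer Ug K \<longleftrightarrow> g \<in> carrier Ug \<and> (\<lambda>k. g ** k ** iv g) ` K = K"
proof -
  have "g <#\<^bsub>Ug\<^esub> K #>\<^bsub>Ug\<^esub> iv g = (\<lambda>k. g ** k ** iv g) ` K"
    unfolding l_coset_def r_coset_def by auto
  then show ?thesis using K by (simp add: normalizer_def stabilizer_def)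
qed

text \<open>If \<open>\<sigma>\<close> is the scalar \<open>c\<close>, then conjugation by \<open>\<sigma>\<close> turns the scalar 1 into \<open>c bar c \<equiv> 1\<close>. The
  commutator \<open>[\<sigma>, \<tau>]\<close> is the product of \<open>\<sigma>\<close> with a conjugate of its inverse, hence again \<open>c bar c\<close>.\<close>

lemma H_CU:
  assumes H: "subgroup H Ug" and \<sigma>: "\<sigma> \<in> H"
  shows "\<sigma> \<in> CU_rel S \<Delta> (uJ H, uS H)"
proof -
  let ?J = "uJ H" and ?S = "uS H" and ?K = "U_rel S \<Delta> (uJ H, uS H) :: ('a, 3) mat_th set"
  have Hc: "H \<subseteq> carrier Ug" by (rule subgroup.subset[OF H])
  note l = upper_is_level[OF Hc]
  define c where "c = \<sigma> $ (Pos 1) $ (Pos 1)"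
  have p: "level_scalar ?J ?S c \<sigma>" unfolding c_def by (rule upper_level_scalar[OF Hc \<sigma>]) simp
  note p' = level_scalar_inv[OF l p] and \<sigma>c = level_scalar_carrier[OF p]
  have un: "c * bar c - 1 \<in> ?J" "bar c * c - 1 \<in> ?J"
    using ideal_neg[OF uJ_ideal level_scalar_unit[OF l p]] by (simp_all add: mult.commute)
  have K: "?K = {\<sigma>. level_scalar ?J ?S 1 \<sigma>}" by (rule U_rel_level_scalar[OF l])
  have Kc: "?K \<subseteq> carrier Ug" unfolding K using level_scalar_carrier by blast
  have 1: "level_scalar ?J ?S 1 (\<sigma> ** k ** iv \<sigma>)" "level_scalar ?J ?S 1 (iv \<sigma> ** k ** \<sigma>)" if "level_scalar ?J ?S 1 k" for k
  proof -
    show "level_scalar ?J ?S 1 (\<sigma> ** k ** iv \<sigma>)"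
      using level_scalar_cong[OF l level_scalar_mult[OF l level_scalar_mult[OF l p that] p'], of 1] un(1) by simp
    show "level_scalar ?J ?S 1 (iv \<sigma> ** k ** \<sigma>)"
      using level_scalar_cong[OF l level_scalar_mult[OF l level_scalar_mult[OF l p' that] p], of 1] un(2) by simp
  qed
  have "(\<lambda>k. \<sigma> ** k ** iv \<sigma>) ` ?K = ?K"
  proof (intro subset_antisym subsetI)
    fix k assume "k \<in> ?K"
    then have "iv \<sigma> ** k ** \<sigma> \<in> ?K" using 1 K by blast
    moreover have "\<sigma> ** (iv \<sigma> ** k ** \<sigma>) ** iv \<sigma> = k"
      by (rule mat_eqI) (simp add: mv_mul \<sigma>c)
    ultimately show "k \<in> (\<lambda>k. \<sigma> ** k ** iv \<sigma>) ` ?K" by (metis image_eqI)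
  qed (use 1 K in auto)
  then have N: "\<sigma> \<in> NU_rel S \<Delta> (?J, ?S)" unfolding NU_rel_def normalizer_iff[OF Kc] using \<sigma>c by simp
  have sub: "subgroup ?K Ug"
  proof (rule G.subgroupI[OF Kc])
    show "?K \<noteq> {}" using level_scalar_one[OF l] K by blast
    show "iv k \<in> ?K" if "k \<in> ?K" for k using level_scalar_inv[OF l, of 1 k] that K by simp
    show "k \<otimes>\<^bsub>Ug\<^esub> k' \<in> ?K" if "k \<in> ?K" "k' \<in> ?K" for k k' using level_scalar_mult[OF l, of 1 k 1 k'] that K by simp
  qed
  have "\<sigma> ** \<tau> ** iv \<sigma> ** iv \<tau> \<in> ?K" if \<tau>: "\<tau> \<in> EUf" for \<tau>
  proof -
    have "level_scalar ?J ?S (bar c) (iv (iv \<tau>) ** iv \<sigma> ** iv \<tau>)"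
      by (rule level_scalar_conj[OF l p' EUf_form_invariant[OF l EUf_iv[OF \<tau>]]])
    then have "level_scalar ?J ?S (c * bar c) (\<sigma> ** (\<tau> ** iv \<sigma> ** iv \<tau>))"
      using level_scalar_mult[OF l p] EUf_U[OF \<tau>] by simp
    from level_scalar_cong[OF l this un(1)] show ?thesis unfolding K by (simp add: matrix_mul_assoc)
  qed
  then have "generate Ug {\<sigma> \<otimes>\<^bsub>Ug\<^esub> \<tau> \<otimes>\<^bsub>Ug\<^esub> iv \<sigma> \<otimes>\<^bsub>Ug\<^esub> iv \<tau> | \<tau>. \<tau> \<in> EUf} \<subseteq> ?K"
    by (intro G.generate_subgroup_incl[OF _ sub]) auto
  with N show ?thesis unfolding CU_rel_def by blast
qed

end

context form_ring3 begin

section \<open>Short transvections\<close>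

lemma esd_conj_iv: "g \<in> carrier Ug \<Longrightarrow> g ** esd u v y ** iv g = esd (g *v u) (g *v v) y"
  using esd_conj[of g u v y] by (simp add: U_B matrix_mul_assoc[symmetric] iv_mul)

lemma left_inverse_iv: "h ** g = mat 1 \<Longrightarrow> g \<in> carrier Ug \<Longrightarrow> h = iv g"
  by (metis iv_mul(1) matrix_mul_assoc matrix_mul_lid matrix_mul_rid)

lemma vec_scale_cancel: "- b *s u + b *s u = 0" for u :: "('a, 3) vec_th"
  by (simp add: vec_eq_iff)

lemma esd_e_mult:
  assumes "p \<noteq> Zero" "v $ (- p) = 0" "v' $ (- p) = 0"
  shows "esd (e p) v y ** esd (e p) v' y' = esd (e p) (v + v') (y + y' - B v' v)"
  using assms theta_ne_minus by (intro esd_mult) auto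

lemma short_carrier: "p \<noteq> Zero \<Longrightarrow> r \<noteq> Zero \<Longrightarrow> p \<noteq> - r \<Longrightarrow> short p r x \<in> carrier Ug"
  using short_form_invariant[OF is_level_full] by (simp add: form_invariant_def)

lemma short_0 [simp]: "short p r 0 = mat 1"
  by (simp add: short_def)

lemma short_add: "p \<noteq> Zero \<Longrightarrow> r \<noteq> Zero \<Longrightarrow> p \<noteq> - r \<Longrightarrow> short p r x ** short p r y = short p r (x + y)"
  unfolding short_def using theta_ne_minus[of r]
  by (subst esd_e_mult) (auto simp: B_simps vector_sadd_rdistrib)

lemma short_iv: "p \<noteq> Zero \<Longrightarrow> r \<noteq> Zero \<Longrightarrow> p \<noteq> - r \<Longrightarrow> iv (short p r x) = short p r (- x)"
  by (rule left_inverse_iv[symmetric]) (simp_all add: short_carrier short_add)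

lemma short_sym: "short p r x = short r p (- (bar \<ell> * bar x))"
  unfolding short_def by (subst esd_sym, subst esd_scale) (simp add: vector_smult_assoc ac_simps)

lemma short_diag: "short p p x = long p (0, bar x - bar (bar x) * \<ell>)"
proof (rule mat_eqI)
  fix w
  have "bar (B w (x *s e p)) = bar x * (bar \<ell> * B (e p) w)"
    unfolding B_scale_right bar_mult by (subst B_bar) simp
  then show "short p p x *v w = long p (0, bar x - bar (bar x) * \<ell>) *v w"
    unfolding short_def long_def esd_apply by (simp add: bar_simps vec_eq_iff algebra_simps)
qed

lemma esd_mv: "esd (e p) v 0 *v w = w + (om p * w $ (- p)) *s v - bar (B w v) *s e p"
  by (simp add: esd_apply)

lemma short_mv: "short p r x *v w = w + (om p * w $ (- p) * x) *s e r - (bar x * bar (B w (e r))) *s e p"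
  by (simp add: short_def esd_mv B_simps bar_simps vector_smult_assoc)

lemma short_fix: "k \<noteq> - p \<Longrightarrow> k \<noteq> - r \<Longrightarrow> short p r x *v e k = e k"
  by (simp add: short_mv) (metis theta_minus_minus)

lemma short_move: "p \<noteq> r \<Longrightarrow> short p r x *v e (- p) = e (- p) + (om p * x) *s e r"
  by (simp add: short_mv)

lemma short_long_EUf: "p \<noteq> Zero \<Longrightarrow> r \<noteq> Zero \<Longrightarrow> p \<noteq> r \<Longrightarrow> p \<noteq> - r \<Longrightarrow> short p r x \<in> EUf"
  "p \<noteq> Zero \<Longrightarrow> \<alpha> \<in> \<Delta> \<Longrightarrow> long p \<alpha> \<in> EUf"
  unfolding EUf_eq elementary_gens_def by (rule generate.incl, blast)+

lemma unit_cancel: assumes "i \<noteq> Zero" shows "om i * (bar (om i) * x) = x" "bar (om i) * (om i * x) = x"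
proof -
  show 1: "om i * (bar (om i) * x) = x" using om_bar[OF assms] by (simp flip: mult.assoc)
  show "bar (om i) * (om i * x) = x" by (subst mult.left_commute) (rule 1)
qed

text \<open>The elementary matrix \<open>g\<close> fixes \<open>e p\<close> and maps \<open>e r\<close> to \<open>e r + b e k\<close>.\<close>

lemma short_conj:
  assumes "p \<noteq> Zero" "r \<noteq> Zero" "k \<noteq> Zero" "p \<noteq> r" "p \<noteq> - r" "k \<noteq> - p" "k \<noteq> r" "k \<noteq> - r"
    and g: "g = short (- r) k (bar (om (- r)) * b)"
  shows "g ** short p r x ** iv g = short p r x ** short p k (x * b)"
proof -
  have gU: "g \<in> carrier Ug" unfolding g using assms by (intro short_carrier) auto
  have gp: "g *v e p = e p" unfolding g using assms by (intro short_fix) auto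
  have "g *v e (- (- r)) = e (- (- r)) + (om (- r) * (bar (om (- r)) * b)) *s e k"
    unfolding g using assms by (intro short_move) auto
  then have gr: "g *v e r = e r + b *s e k" using assms unit_cancel(1)[of "- r"] by simp
  have "g ** short p r x ** iv g = esd (e p) (x *s e r + (x * b) *s e k) 0"
    unfolding short_def by (simp add: esd_conj_iv[OF gU] gp gr mv_scale vector_add_ldistrib vector_smult_assoc)
  also have "\<dots> = short p r x ** short p k (x * b)"
    unfolding short_def using assms by (subst esd_e_mult) (auto simp: B_simps)
  finally show ?thesis .
qed

text \<open>Then the indices \<open>\<plusminus>i, \<plusminus>j, \<plusminus>l\<close> and \<open>Zero\<close> are all seven indices (\<open>frame_cases\<close>), and
  \<open>e i, e j, e l\<close> span a totally isotropic subspace. All results below are stated for an arbitrary frame, so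
  that signs and permutations of the indices require no separate proof.\<close>

definition frame :: "3 theta \<Rightarrow> 3 theta \<Rightarrow> 3 theta \<Rightarrow> bool" where
  "frame i j l \<longleftrightarrow> i \<noteq> Zero \<and> j \<noteq> Zero \<and> l \<noteq> Zero \<and> i \<noteq> j \<and> i \<noteq> - j \<and> i \<noteq> l \<and> i \<noteq> - l \<and> j \<noteq> l \<and> j \<noteq> - l"

lemma theta_swap: "- p = r \<longleftrightarrow> p = - (r :: 3 theta)"
  by (metis theta_minus_minus)

lemma frameD:
  assumes "frame i j l"
  shows "i \<noteq> Zero" "j \<noteq> Zero" "l \<noteq> Zero" "Zero \<noteq> i" "Zero \<noteq> j" "Zero \<noteq> l"
    "i \<noteq> j" "j \<noteq> i" "i \<noteq> l" "l \<noteq> i" "j \<noteq> l" "l \<noteq> j"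
    "i \<noteq> - j" "j \<noteq> - i" "i \<noteq> - l" "l \<noteq> - i" "j \<noteq> - l" "l \<noteq> - j"
    "- i \<noteq> j" "- j \<noteq> i" "- i \<noteq> l" "- l \<noteq> i" "- j \<noteq> l" "- l \<noteq> j"
    "i \<noteq> - i" "j \<noteq> - j" "l \<noteq> - l" "- i \<noteq> i" "- j \<noteq> j" "- l \<noteq> l"
  using assms theta_ne_minus unfolding frame_def by (metis theta_minus_minus)+

lemma frame_perm:
  assumes "frame i j l"
  shows "frame j i l" "frame i l j" "frame l j i" "frame j l i" "frame l i j"
    "frame (- i) j l" "frame i (- j) l" "frame i j (- l)"
  using frameD[OF assms] by (simp_all add: frame_def)

section \<open>Powers of an ideal\<close>

lemma pow_ideal: "is_ideal (ideal_pow I n)" for I :: "'a set"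
  by (cases n) (simp_all add: ideal_mult_def ring_module.subspace_span)

lemma pow_Suc_mem: "a \<in> ideal_pow I n \<Longrightarrow> b \<in> I \<Longrightarrow> a * b \<in> ideal_pow I (Suc n)" for I :: "'a set"
  by (auto simp: ideal_mult_def intro!: ring_module.span_base)

lemma pow_induct:
  fixes I :: "'a set"
  assumes "a \<in> ideal_pow I (Suc n)" "R 0" "\<And>x y. R x \<Longrightarrow> R y \<Longrightarrow> R (x + y)"
    "\<And>a b. a \<in> ideal_pow I n \<Longrightarrow> b \<in> I \<Longrightarrow> R (a * b)"
  shows "R a"
proof -
  have "a \<in> ideal_gen {x * y | x y. x \<in> ideal_pow I n \<and> y \<in> I}" using assms(1) by (simp add: ideal_mult_def)
  then show ?thesis
  proof (induction rule: ring_module.span_induct_alt)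
    case base show ?case by (rule assms)
  next
    case (step c x y)
    then obtain a' b' where "x = a' * b'" "a' \<in> ideal_pow I n" "b' \<in> I" by auto
    then have "R ((c * a') * b')" using assms(4) ideal_mult_left[OF pow_ideal] by blast
    then show ?case using assms(3) step \<open>x = a' * b'\<close> by (simp add: mult.assoc)
  qed
qed

lemma pow_mono: "is_ideal I \<Longrightarrow> n \<le> m \<Longrightarrow> ideal_pow I m \<subseteq> ideal_pow I n" for I :: "'a set"
proof (induction m)
  case (Suc m)
  have "ideal_pow I (Suc m) \<subseteq> ideal_pow I m"
    by (auto intro: pow_induct[where n = m and R = "\<lambda>a. a \<in> ideal_pow I m"] ideal_0[OF pow_ideal] ideal_add[OF pow_ideal] ideal_mult_right[OF pow_ideal]
        simp del: ideal_pow.simps)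
  with Suc show ?case by (cases "n = Suc m") (auto simp del: ideal_pow.simps)
qed simp

lemma pow_bar:
  assumes "\<And>x. x \<in> I \<Longrightarrow> bar x \<in> I" shows "a \<in> ideal_pow I n \<Longrightarrow> bar a \<in> ideal_pow I n"
proof (induction n arbitrary: a)
  case (Suc n)
  show ?case
    by (rule pow_induct[OF Suc.prems, where R = "\<lambda>a. bar a \<in> ideal_pow I (Suc n)"])
      (auto simp: bar_simps Suc.IH assms pow_Suc_mem simp del: ideal_pow.simps
        intro: ideal_add[OF pow_ideal] ideal_0[OF pow_ideal])
qed simp

section \<open>Subgroups normalised by the relative elementary group\<close>

definition normalises :: "('a, 3) mat_th set \<Rightarrow> ('a, 3) mat_th \<Rightarrow> bool" where
  "normalises H g \<longleftrightarrow> g \<in> carrier Ug \<and> (\<forall>h\<in>H. g ** h ** iv g \<in> H \<and> iv g ** h ** g \<in> H)"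

end

text \<open>The ideal \<open>I\<close> is that of the form ideal whose relative elementary group normalises \<open>H\<close>.\<close>

locale lower = form_ring3 S \<Delta>
  for S :: "'a::comm_ring_1 herm" and \<Delta> :: "('a \<times> 'a) set" +
  fixes I :: "'a set"
  assumes I: "is_ideal I" and I_bar: "\<And>x. x \<in> I \<Longrightarrow> bar x \<in> I"
begin

text \<open>For \<open>p = r\<close> these are long transvections, whose forms belong to every form parameter of ideal \<open>I\<close>.\<close>

definition short_gens :: "('a, 3) mat_th set" where
  "short_gens = {short p r x | p r x. p \<noteq> Zero \<and> r \<noteq> Zero \<and> p \<noteq> - r \<and> x \<in> I}"

text \<open>Normalisation by short transvections of level \<open>I\<close> and their elementary conjugates. Quantifying
  over the conjugates makes the condition stable under \<open>conj_by\<close>.\<close>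

definition normalised :: "('a, 3) mat_th set \<Rightarrow> bool" where
  "normalised H \<longleftrightarrow> subgroup H Ug \<and> (\<forall>\<tau>\<in>EUf. \<forall>g\<in>short_gens. normalises H (\<tau> ** g ** iv \<tau>))"

text \<open>The elements \<open>x\<close> which, multiplied by \<open>n\<close> factors from \<open>I\<close>, are parameters of short transvections of \<open>H\<close> at
  position \<open>(p, r)\<close>. If \<open>H\<close> is normalised they form an ideal, and \<open>n\<close> counts the factors that have been spent.\<close>

definition absorbs :: "('a, 3) mat_th set \<Rightarrow> 3 theta \<Rightarrow> 3 theta \<Rightarrow> nat \<Rightarrow> 'a \<Rightarrow> bool" where
  "absorbs H p r n x \<longleftrightarrow> (\<forall>a\<in>ideal_pow I n. short p r (x * a) \<in> H)"

context
  fixes H assumes normalised: "normalised H"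
begin

lemma H_sub: "subgroup H Ug" using normalised by (simp add: normalised_def)
lemma H_U: "h \<in> H \<Longrightarrow> h \<in> carrier Ug" using subgroup.subset[OF H_sub] by blast
lemma H_mul: "g \<in> H \<Longrightarrow> h \<in> H \<Longrightarrow> g ** h \<in> H" using subgroup.m_closed[OF H_sub] by simp
lemma H_iv: "g \<in> H \<Longrightarrow> iv g \<in> H" using subgroup.m_inv_closed[OF H_sub] by simp
lemma H_one: "mat 1 \<in> H" using subgroup.one_closed[OF H_sub] by simp

lemma normalises_U: "normalises H g \<Longrightarrow> g \<in> carrier Ug" by (simp add: normalises_def)

lemma normalises_conj: "normalises H g \<Longrightarrow> h \<in> H \<Longrightarrow> g ** h ** iv g \<in> H"
  by (simp add: normalises_def)

lemma iv_mul2: "g \<in> carrier Ug \<Longrightarrow> h \<in> carrier Ug \<Longrightarrow> iv (g ** h) = iv h ** iv g"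
  using G.inv_mult_group[of g h] by simp

lemma normalises_mul: "normalises H g \<Longrightarrow> normalises H h \<Longrightarrow> normalises H (g ** h)"
  unfolding normalises_def by (auto simp: U_mul iv_mul2 matrix_mul_assoc) (metis matrix_mul_assoc)+

lemma normalises_iv: "normalises H g \<Longrightarrow> normalises H (iv g)"
  unfolding normalises_def by auto

lemma normalises_short: "p \<noteq> Zero \<Longrightarrow> r \<noteq> Zero \<Longrightarrow> p \<noteq> - r \<Longrightarrow> x \<in> I \<Longrightarrow> normalises H (short p r x)"
proof -
  assume "p \<noteq> Zero" "r \<noteq> Zero" "p \<noteq> - r" "x \<in> I"
  then have "short p r x \<in> short_gens" by (auto simp: short_gens_def)
  moreover have "mat 1 \<in> EUf" using subgroup.one_closed[OF EUf_sub] by simp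
  ultimately have "normalises H (mat 1 ** short p r x ** iv (mat 1))" using normalised unfolding normalised_def by blast
  then show ?thesis using G.inv_one by simp
qed

lemma comm_mem: "h \<in> H \<Longrightarrow> normalises H g \<Longrightarrow> h ** g ** iv h ** iv g \<in> H"
  using H_mul[OF _ normalises_conj[OF _ H_iv], of h g h] by (simp add: matrix_mul_assoc)

lemma short_H_add: "p \<noteq> Zero \<Longrightarrow> r \<noteq> Zero \<Longrightarrow> p \<noteq> - r \<Longrightarrow> short p r x \<in> H \<Longrightarrow> short p r y \<in> H \<Longrightarrow> short p r (x + y) \<in> H"
  using H_mul[of "short p r x" "short p r y"] by (simp add: short_add)

lemma absorbs_mem: "absorbs H p r n x \<Longrightarrow> a \<in> ideal_pow I n \<Longrightarrow> short p r (x * a) \<in> H"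
  by (simp add: absorbs_def)

lemma absorbs_0: "absorbs H p r n 0" by (simp add: absorbs_def H_one)

lemma absorbs_add: "p \<noteq> Zero \<Longrightarrow> r \<noteq> Zero \<Longrightarrow> p \<noteq> - r \<Longrightarrow> absorbs H p r n x \<Longrightarrow> absorbs H p r n y \<Longrightarrow> absorbs H p r n (x + y)"
  unfolding absorbs_def by (auto simp: distrib_right short_H_add)

lemma absorbs_scale: "absorbs H p r n x \<Longrightarrow> absorbs H p r n (x * c)"
  unfolding absorbs_def using ideal_mult_left[OF pow_ideal] by (simp add: mult.assoc)

lemma absorbs_scale': "absorbs H p r n x \<Longrightarrow> absorbs H p r n (c * x)"
  using absorbs_scale[of p r n x c] by (simp add: mult.commute)

lemma absorbs_diff: "p \<noteq> Zero \<Longrightarrow> r \<noteq> Zero \<Longrightarrow> p \<noteq> - r \<Longrightarrow> absorbs H p r n x \<Longrightarrow> absorbs H p r n y \<Longrightarrow> absorbs H p r n (x - y)"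
  using absorbs_add[of p r n x "- y"] absorbs_scale[of p r n y "- 1"] by simp

lemma absorbs_mono: "absorbs H p r n x \<Longrightarrow> n \<le> m \<Longrightarrow> absorbs H p r m x"
  unfolding absorbs_def using pow_mono[OF I] by blast

lemma absorbs_sym: "absorbs H p r n x \<Longrightarrow> absorbs H r p n (bar x)"
  unfolding absorbs_def
proof
  fix a assume "\<forall>a\<in>ideal_pow I n. short p r (x * a) \<in> H" "a \<in> ideal_pow I n"
  then have "short p r (x * (- bar \<ell> * bar a)) \<in> H"
    using pow_bar[OF I_bar, of a n] ideal_mult_left[OF pow_ideal] by blast
  then show "short r p (bar x * a) \<in> H"
    by (subst short_sym) (simp add: bar_simps ac_simps)
qed

lemma absorbs_sum: "p \<noteq> Zero \<Longrightarrow> r \<noteq> Zero \<Longrightarrow> p \<noteq> - r \<Longrightarrow> (\<And>i. i \<in> A \<Longrightarrow> absorbs H p r n (f i)) \<Longrightarrow> absorbs H p r n (sum f A)"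
  by (induction A rule: infinite_finite_induct) (auto simp: absorbs_0 absorbs_add)

lemma short_step:
  assumes "p \<noteq> Zero" "r \<noteq> Zero" "k \<noteq> Zero" "p \<noteq> r" "p \<noteq> - r" "k \<noteq> - p" "k \<noteq> r" "k \<noteq> - r"
    and x: "short p r x \<in> H" and b: "b \<in> I"
  shows "short p k (x * b) \<in> H"
proof -
  define g where "g = short (- r) k (bar (om (- r)) * b)"
  have g: "normalises H g" unfolding g_def using assms ideal_mult_left[OF I b] by (intro normalises_short) auto
  have "short p r x ** short p k (x * b) \<in> H" using normalises_conj[OF g x] short_conj[OF assms(1-8) g_def] by simp
  from H_mul[OF H_iv[OF x] this] show ?thesis
    using iv_mul(2)[OF H_U[OF x]] by (simp add: matrix_mul_assoc)
qed

text \<open>Each change of one index of the position costs one factor.\<close>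

lemma absorbs_step:
  assumes "p \<noteq> Zero" "r \<noteq> Zero" "k \<noteq> Zero" "p \<noteq> r" "p \<noteq> - r" "k \<noteq> - p" "k \<noteq> r" "k \<noteq> - r"
    and "absorbs H p r n x"
  shows "absorbs H p k (Suc n) x"
  unfolding absorbs_def
proof
  fix a assume "a \<in> ideal_pow I (Suc n)"
  then show "short p k (x * a) \<in> H"
  proof (rule pow_induct[where R = "\<lambda>a. short p k (x * a) \<in> H"])
    show "short p k (x * 0) \<in> H" by (simp add: H_one)
    show "short p k (x * (a + b)) \<in> H" if "short p k (x * a) \<in> H" "short p k (x * b) \<in> H" for a b
      using short_H_add[OF _ _ _ that] assms by (simp add: distrib_left) (metis theta_minus_minus)
    show "short p k (x * (a * b)) \<in> H" if "a \<in> ideal_pow I n" "b \<in> I" for a b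
      using short_step[OF assms(1-8) absorbs_mem[OF assms(9) that(1)] that(2)] by (simp add: mult.assoc)
  qed
qed

lemma normalises_esd_basis:
  assumes "frame i j l" "m \<in> {i, j, l}" "x1 \<in> I" "x2 \<in> I" "x3 \<in> I"
  shows "normalises H (esd (e m) (x1 *s e i + x2 *s e j + x3 *s e l) 0)"
proof -
  note n = frameD[OF assms(1)]
  have m: "m \<noteq> Zero" "m \<noteq> - i" "m \<noteq> - j" "m \<noteq> - l" "- m \<noteq> i" "- m \<noteq> j" "- m \<noteq> l"
    "i \<noteq> - m" "j \<noteq> - m" "l \<noteq> - m" using assms(2) n by auto
  have "short m i x1 ** short m j x2 ** short m l x3 = esd (e m) (x1 *s e i + x2 *s e j + x3 *s e l) 0"
    unfolding short_def using m n by (subst esd_e_mult, simp, simp, simp, subst esd_e_mult) (auto simp: B_simps)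
  moreover have "normalises H (short m i x1 ** short m j x2 ** short m l x3)"
    using assms m n by (intro normalises_mul normalises_short) auto
  ultimately show ?thesis by simp
qed

lemma normalises_esd_span:
  assumes ind: "frame i j l" and u: "u = u1 *s e i + u2 *s e j + u3 *s e l"
    and x: "x1 \<in> I" "x2 \<in> I" "x3 \<in> I"
  shows "normalises H (esd u (x1 *s e i + x2 *s e j + x3 *s e l) 0)"
proof -
  note n = frameD[OF ind]
  have 1: "normalises H (esd u (x *s e m) 0)" if "m \<in> {i, j, l}" "x \<in> I" for x m
  proof -
    define c where "c = - (bar x * bar \<ell>)"
    have "esd u (x *s e m) 0 = esd (e m) ((c * u1) *s e i + (c * u2) *s e j + (c * u3) *s e l) 0"
      by (subst esd_sym, subst esd_scale) (simp add: u c_def vector_smult_assoc vector_add_ldistrib ac_simps)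
    moreover have "c * y \<in> I" for y
      unfolding c_def using that I_bar by (intro ideal_mult_right[OF I] ideal_neg[OF I]) auto
    ultimately show ?thesis using normalises_esd_basis[OF ind that(1)] by simp
  qed
  have B0: "B u (e m) = 0" if "m \<in> {i, j, l}" for m
    using that n by (auto simp: B_e_right u)
  have "B u u = 0" by (subst (2) u) (simp add: B_simps B0)
  then have "esd u (x1 *s e i + x2 *s e j + x3 *s e l) 0
      = esd u (x1 *s e i) 0 ** esd u (x2 *s e j) 0 ** esd u (x3 *s e l) 0"
    using n by (subst esd_mult, simp, simp add: B_scale_right B0, simp add: B_scale_right B0,
        subst esd_mult) (simp_all add: B_simps B0)
  then show ?thesis using 1 x by (auto intro!: normalises_mul)
qed

section \<open>The basic commutator\<close>

text \<open>The commutator with an elementary matrix that maps \<open>e l\<close> to \<open>e l + b e r\<close> removes the unknown \<open>y\<close>.\<close>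

lemma short_from_esd:
  assumes ind: "frame i j l" and y: "esd (e (- i)) (x *s e l) y \<in> H" and b: "b \<in> I" and r: "r = j \<or> r = - j"
  shows "short (- i) r (x * b) \<in> H"
proof -
  note n = frameD[OF ind]
  define g where "g = short (- l) r (bar (om (- l)) * b)"
  have r': "r \<noteq> Zero" "- l \<noteq> - r" "r \<noteq> i" "r \<noteq> - i" "i \<noteq> r" "- i \<noteq> - r" "l \<noteq> - r" "- l \<noteq> r" "r \<noteq> l" "l \<noteq> r" "r \<noteq> - l" "i \<noteq> - r" using r n by auto
  have g: "normalises H g" unfolding g_def using n r' ideal_mult_left[OF I b] by (intro normalises_short) auto
  have "om (- l) * bar (om (- l)) = 1" using n by (simp add: om_bar)
  then have b': "om (- l) * (bar (om (- l)) * b) = b" by (simp flip: mult.assoc)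
  have gp: "g *v e (- i) = e (- i)" unfolding g_def using n r' by (intro short_fix) auto
  have "g *v e (- (- l)) = e (- (- l)) + (om (- l) * (bar (om (- l)) * b)) *s e r"
    unfolding g_def using n r' by (intro short_move) auto
  then have gr: "g *v e l = e l + b *s e r" unfolding b' by simp
  have "g ** esd (e (- i)) (x *s e l) y ** iv g = esd (e (- i)) (x *s e l + (x * b) *s e r) y"
    by (simp add: esd_conj_iv[OF normalises_U[OF g]] gp gr mv_scale vector_add_ldistrib vector_smult_assoc)
  also have "\<dots> = esd (e (- i)) (x *s e l) y ** short (- i) r (x * b)"
    unfolding short_def using n r' by (subst esd_e_mult) (auto simp: B_simps)
  finally have "esd (e (- i)) (x *s e l) y ** short (- i) r (x * b) \<in> H" using normalises_conj[OF g y] by simp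
  from H_mul[OF H_iv[OF y] this] show ?thesis
    using iv_mul(2)[OF H_U[OF y]] by (simp add: matrix_mul_assoc)
qed

text \<open>Let \<open>t = esd u (v a) 0\<close> and \<open>\<xi> = \<sigma> t \<sigma>\<^sup>-\<^sup>1\<close>. The commutator \<open>\<xi> t\<^sup>-\<^sup>1\<close> is in \<open>H\<close>, and by the choice of
  \<open>u\<close> and \<open>v\<close> the matrix \<open>\<xi>\<close> fixes \<open>e (- i)\<close>, while \<open>t\<close> maps \<open>e (- i)\<close> to \<open>e (- i) + y\<close>. Let \<open>x\<close> be an elementary
  transvection along \<open>e (- i)\<close>. Then \<open>Z = \<xi> x \<xi>\<^sup>-\<^sup>1\<close> is again a transvection along \<open>e (- i)\<close>, \<open>A = t x t\<^sup>-\<^sup>1\<close> is one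
  along \<open>e (- i) + y\<close>, and \<open>m = Z A\<^sup>-\<^sup>1\<close> is in \<open>H\<close>. Transvections along the same vector commute up to the last
  parameter. So in the commutator of \<open>m\<close> with another transvection \<open>x'\<close> along \<open>e (- i)\<close> the unknown
  vector of \<open>Z\<close> cancels, and what remains comes from \<open>y\<close>. The \<open>i\<close>-th coordinate of \<open>y\<close> disturbs this; the
  last hypotheses say that the transvections caused by it are already in \<open>H\<close>. They are trivial if
  \<open>y\<^sub>i = 0\<close>. The \<open>j\<close>-th coordinate of \<open>y\<close> is the parameter that is gained, at the cost of the three
  factors \<open>b, c, f\<close>.\<close>

lemma key_commutator:
  assumes ind: "frame i j l" and \<sigma>: "\<sigma> \<in> H" and a: "a \<in> I"
    and u: "u = u1 *s e i + u2 *s e j + u3 *s e l" and v: "v = v1 *s e i + v2 *s e j + v3 *s e l"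
    and su: "(\<sigma> *v u) $ i = 0" and sv: "(\<sigma> *v v) $ i = 0"
    and yi: "yi = om i * bar u1 * a * v1 - bar (om (- i)) * bar a * bar v1 * u1"
    and yj: "yj = om i * bar u1 * a * v2 - bar (om (- i)) * bar a * bar v1 * u2"
    and b: "b \<in> I" and c: "c \<in> I" and f: "f \<in> I"
    and hyp: "\<And>k. short l (- j) (k * (c * bar b * yi)) \<in> H" "\<And>k. short l l (k * (c * bar b * yi)) \<in> H"
      "\<And>k. short (- i) (- j) (k * (c * bar b * yi)) \<in> H"
      "\<And>k. short (- i) l (k * (c * bar b * yi)) \<in> H" "\<And>k. short (- i) l (k * bar (c * bar b * yi)) \<in> H"
    and r: "r = j \<or> r = - j"
  shows "short (- i) r (bar yj * (b * c * f)) \<in> H"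
proof -
  note n = frameD[OF ind]
  have \<sigma>U: "\<sigma> \<in> carrier Ug" by (rule H_U[OF \<sigma>])
  define t where "t = esd u (a *s v) 0"
  have av: "a *s v = (a * v1) *s e i + (a * v2) *s e j + (a * v3) *s e l"
    by (simp add: v vector_add_ldistrib vector_smult_assoc)
  have t: "normalises H t" unfolding t_def av using a by (intro normalises_esd_span[OF ind u] ideal_mult_right[OF I])
  note tU = normalises_U[OF t]
  let ?d = "e (- i)" and ?p = "e l" and ?p' = "e (- j)"
  \<comment> \<open>The conjugate of \<open>t\<close> fixes \<open>e (- i)\<close> because \<open>\<sigma> u\<close> and \<open>\<sigma> v\<close> are orthogonal to it.\<close>
  define \<xi> where "\<xi> = \<sigma> ** t ** iv \<sigma>"
  have \<xi>U: "\<xi> \<in> carrier Ug" unfolding \<xi>_def using \<sigma>U tU by (simp add: U_mul)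
  have "\<xi> = esd (\<sigma> *v u) (a *s (\<sigma> *v v)) 0"
    unfolding \<xi>_def t_def esd_conj_iv[OF \<sigma>U] mv_scale ..
  then have \<xi>d: "\<xi> *v ?d = ?d"
    using su sv by (simp add: esd_apply B_simps B_e_right)
  have uv0: "B u (e m) = 0 \<and> B v (e m) = 0 \<and> B (e m) v = 0" if "m \<in> {i, j, l}" for m
    using that n by (auto simp: B_e_right u v)
  define y where "y = t *v ?d - ?d"
  have yu: "y = (om i * bar u1 * a) *s v - (bar (om (- i)) * bar a * bar v1) *s u"
    unfolding y_def t_def esd_apply by (simp add: B_e_right B_simps u v n bar_simps vector_smult_assoc vec_eq_iff algebra_simps)
  have td: "t *v ?d = ?d + y" by (simp add: y_def)
  have tp: "t *v ?p = ?p" unfolding t_def esd_apply B_scale_right using uv0[of l] by simp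
  have y1: "y $ i = yi" and y2: "y $ j = yj"
    unfolding yu yi yj by (simp_all add: u v n algebra_simps)
  have y0: "y $ (- i) = 0" "y $ (- j) = 0" "y $ (- l) = 0" unfolding yu by (simp_all add: u v n)
  define x where "x = short (- i) l b"
  have x: "normalises H x" unfolding x_def using b n by (intro normalises_short) auto
  define A where "A = esd (?d + y) (b *s ?p) 0"
  have A: "t ** x ** iv t = A" unfolding x_def short_def esd_conj_iv[OF tU] td mv_scale tp A_def ..
  have nA: "normalises H A" unfolding A[symmetric] by (intro normalises_mul normalises_iv t x)
  define \<zeta> where "\<zeta> = b *s (\<xi> *v ?p)"
  \<comment> \<open>The vector \<open>\<zeta>\<close> of this transvection depends on the unknown matrix \<open>\<sigma>\<close> and must be eliminated.\<close>
  define Z where "Z = esd ?d \<zeta> 0"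
  have Z: "\<xi> ** x ** iv \<xi> = Z" unfolding x_def short_def esd_conj_iv[OF \<xi>U] \<xi>d mv_scale Z_def \<zeta>_def ..
  have ZU: "Z \<in> carrier Ug" using \<xi>U normalises_U[OF x] unfolding Z[symmetric] by (simp add: U_mul)
  define m where "m = Z ** iv A"
  have m: "m \<in> H"
  proof -
    define \<theta> where "\<theta> = \<sigma> ** t ** iv \<sigma> ** iv t"
    have \<theta>: "\<theta> \<in> H" unfolding \<theta>_def by (rule comm_mem[OF \<sigma> t])
    have "\<xi> = \<theta> ** t" unfolding \<theta>_def \<xi>_def using tU by (simp add: matrix_mul_assoc[symmetric] iv_mul)
    then have "Z = \<theta> ** A ** iv \<theta>"
      unfolding Z[symmetric] A[symmetric] using H_U[OF \<theta>] tU by (simp add: iv_mul2 matrix_mul_assoc)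
    then show ?thesis unfolding m_def using comm_mem[OF \<theta> nA] by simp
  qed
  define x' where "x' = short (- i) (- j) c"
  have x': "normalises H x'" unfolding x'_def using c n by (intro normalises_short) auto
  \<comment> \<open>Conjugating \<open>x'\<close> by the inverse of \<open>A\<close> gives a transvection \<open>X\<close> along \<open>e (- i)\<close> and a part \<open>R\<close> along \<open>e l\<close>
    caused by the coordinate \<open>yi\<close>.\<close>
  define \<beta> where "\<beta> = b * (om i * bar yi)"
  define \<gamma> where "\<gamma> = b * (om j * bar yj)"
  have iA: "iv A = esd (?d + y) (- b *s ?p) 0"
  proof (rule left_inverse_iv[OF _ normalises_U[OF nA], symmetric])
    have "B (?d + y) ?p = 0" "B (?d + y) (?d + y) = 0"
    proof -
      have "B y (e l) = 0" using y0 n by (simp add: B_e_right)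
      then show "B (?d + y) ?p = 0" using n by (simp add: B_simps)
      have "B (?d + y) (?d + y) = B (t *v ?d) (t *v ?d)" by (simp add: td)
      also have "\<dots> = 0" unfolding U_B[OF tU] using n by simp
      finally show "B (?d + y) (?d + y) = 0" .
    qed
    then show "esd (?d + y) (- b *s ?p) 0 ** A = mat 1" unfolding A_def
      by (subst esd_mult) (simp_all add: B_simps n vec_scale_cancel)
  qed
  have iAd: "iv A *v ?d = ?d - \<beta> *s ?p"
    unfolding iA esd_apply using n y1 by (simp add: B_simps B_e_right \<beta>_def vector_smult_assoc bar_simps vec_eq_iff)
  have iAp: "iv A *v ?p' = ?p' - \<gamma> *s ?p"
    unfolding iA esd_apply using n y2 by (simp add: B_simps B_e_right \<gamma>_def vector_smult_assoc bar_simps vec_eq_iff)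
  define s where "s = c *s (?p' - \<gamma> *s ?p)"
  define X where "X = esd ?d s 0"
  define R where "R = esd ?p (- bar \<beta> *s s) 0"
  have XR: "iv A ** x' ** A = X ** R"
  proof -
    have "iv A ** x' ** iv (iv A) = esd (?d - \<beta> *s ?p) s 0"
      unfolding x'_def short_def using normalises_U[OF nA] by (subst esd_conj_iv) (simp_all add: iAd iAp mv_scale s_def)
    also have "\<dots> = X ** R"
      unfolding X_def R_def
    proof (rule mat_eqI)
      fix w
      have 0: "B ?d ?p = 0" "B ?d s = 0" "B ?p s = 0" "B s s = 0"
        using n by (simp_all add: s_def B_simps)
      show "esd (?d - \<beta> *s ?p) s 0 *v w = (esd ?d s 0 ** esd ?p (- bar \<beta> *s s) 0) *v w"
        unfolding mv_mul esd_apply B_simps 0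
        by (simp add: 0 vec_eq_iff bar_simps algebra_simps del: B_e_left e_nth)
    qed
    finally show ?thesis using normalises_U[OF nA] by simp
  qed
  have s_eq: "s = c *s ?p' - (c * \<gamma>) *s ?p"
    by (simp add: s_def vec_eq_iff algebra_simps)
  have s0: "s $ i = 0" "s $ (- l) = 0" using n by (simp_all add: s_eq)
  let ?z = "c * bar b * yi"
  have bz: "c * bar \<beta> = bar (om i) * ?z" "bar c * \<beta> = om i * bar ?z"
    by (simp_all add: \<beta>_def bar_simps ac_simps)
  have R: "R \<in> H"
  proof -
    have "R = short l (- j) (- (c * bar \<beta>)) ** short l l (c * bar \<beta> * \<gamma>)"
    proof -
      have "- bar \<beta> *s s = (- (c * bar \<beta>)) *s ?p' + (c * bar \<beta> * \<gamma>) *s ?p"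
        unfolding s_eq by (simp add: vec_eq_iff algebra_simps)
      then show ?thesis unfolding R_def short_def using n by (simp add: esd_e_mult B_simps)
    qed
    moreover have "- (c * bar \<beta>) = (- bar (om i)) * ?z" "c * bar \<beta> * \<gamma> = (bar (om i) * \<gamma>) * ?z"
      unfolding bz by (simp_all add: ac_simps)
    ultimately show ?thesis using hyp(1)[of "- bar (om i)"] hyp(2)[of "bar (om i) * \<gamma>"] H_mul by simp
  qed
  note RU = H_U[OF R]
  define \<kappa> where "\<kappa> = B ?p \<zeta>"
  define k2 where "k2 = bar (B \<zeta> ?p') - bar \<gamma> * bar (B \<zeta> ?p)"
  have Bzs: "bar (B \<zeta> s) = bar c * k2"
    unfolding s_eq k2_def B_simps by (simp add: bar_simps algebra_simps)
  have R\<zeta>: "R *v \<zeta> = \<zeta> - (\<kappa> * bar \<beta>) *s s + (\<beta> * (bar c * k2)) *s ?p"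
    unfolding R_def esd_apply \<kappa>_def[symmetric] B_simps bar_mult Bzs[symmetric]
    by (simp add: vec_eq_iff bar_simps algebra_simps)
  have Rd: "R *v ?d = ?d"
    unfolding R_def esd_apply using n by (simp add: s_eq B_simps B_e_right)
  have \<zeta>0: "\<zeta> $ i = 0"
  proof -
    have "B ?d (\<xi> *v ?p) = B (\<xi> *v ?d) (\<xi> *v ?p)" by (simp only: \<xi>d)
    also have "\<dots> = 0" unfolding U_B[OF \<xi>U] using n by simp
    finally have "bar (om (- i)) * (om (- i) * (\<xi> *v ?p) $ i) = 0" by simp
    moreover have "bar (om (- i)) * om (- i) = 1" using om_bar[of "- i"] n by (simp add: mult.commute)
    ultimately show ?thesis by (simp add: \<zeta>_def flip: mult.assoc)
  qed
  have R\<zeta>0: "(R *v \<zeta>) $ i = 0" unfolding R\<zeta> using \<zeta>0 s0 n by simp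
  have BR: "B (R *v \<zeta>) (R *v \<zeta>) = 0"
    unfolding U_B[OF RU] \<zeta>_def B_simps U_B[OF \<xi>U] using n by simp
  have iZ: "R ** iv Z ** iv R = esd ?d (- (R *v \<zeta>)) 0"
  proof -
    have "R ** Z ** iv R = esd ?d (R *v \<zeta>) 0" unfolding Z_def esd_conj_iv[OF RU] Rd ..
    moreover have "iv (R ** Z ** iv R) = R ** iv Z ** iv R"
      using RU ZU by (simp add: iv_mul2 U_mul matrix_mul_assoc)
    moreover have "iv (esd ?d (R *v \<zeta>) 0) = esd ?d (- (R *v \<zeta>)) 0"
    proof (rule left_inverse_iv[symmetric])
      show "esd ?d (R *v \<zeta>) 0 \<in> carrier Ug"
        using RU ZU unfolding calculation(1)[symmetric] by (simp add: U_mul)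
      show "esd ?d (- (R *v \<zeta>)) 0 ** esd ?d (R *v \<zeta>) 0 = mat 1"
        using n R\<zeta>0 BR by (simp add: esd_e_mult B_simps)
    qed
    ultimately show ?thesis by simp
  qed
  \<comment> \<open>Up to the correction by \<open>R\<close>, which is in \<open>H\<close>, the commutator of \<open>m\<close> and \<open>x'\<close> is a product of transvections
    along \<open>e (- i)\<close>, in which \<open>Z\<close> occurs with its inverse.\<close>
  define M where "M = m ** x' ** iv m ** iv x'"
  have M: "M \<in> H" unfolding M_def by (rule comm_mem[OF m x'])
  have x'U: "x' \<in> carrier Ug" by (rule normalises_U[OF x'])
  have "M ** (x' ** iv R ** iv x') \<in> H" by (rule H_mul[OF M normalises_conj[OF x' H_iv[OF R]]])
  also have "M ** (x' ** iv R ** iv x') = Z ** X ** (R ** iv Z ** iv R) ** iv x'"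
  proof -
    have "m ** x' ** iv m = Z ** (iv A ** x' ** A) ** iv Z"
      unfolding m_def using normalises_U[OF nA] ZU by (simp add: iv_mul2 matrix_mul_assoc)
    then have "M = Z ** X ** R ** iv Z ** iv x'" unfolding M_def XR by (simp add: matrix_mul_assoc)
    moreover have "iv x' ** x' = mat 1" by (rule iv_mul(2)[OF x'U])
    then have "N ** iv x' ** (x' ** iv R ** iv x') = N ** iv R ** iv x'" for N
    proof -
      have "N ** iv x' ** (x' ** iv R ** iv x') = N ** (iv x' ** x') ** iv R ** iv x'"
        by (simp only: matrix_mul_assoc)
      then show ?thesis by (simp add: iv_mul(2)[OF x'U])
    qed
    ultimately show ?thesis by (simp add: matrix_mul_assoc)
  qed
  finally have N: "Z ** X ** (R ** iv Z ** iv R) ** iv x' \<in> H" .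
  have ix: "iv x' = short (- i) (- j) (- c)" unfolding x'_def using n by (intro short_iv) auto
  define V where "V = (\<kappa> * (c * bar \<beta>)) *s ?p' - (\<kappa> * (c * bar \<beta>) * \<gamma> + \<beta> * (bar c * k2) + c * \<gamma>) *s ?p"
  have "\<exists>Y. Z ** X ** (R ** iv Z ** iv R) ** iv x' = esd ?d V Y"
  proof -
    have "\<zeta> + s + - (R *v \<zeta>) + (- c) *s ?p' = V"
      unfolding R\<zeta> s_eq V_def by (simp add: vec_eq_iff algebra_simps)
    moreover have "\<exists>Y. Z ** X ** (R ** iv Z ** iv R) ** iv x' = esd ?d (\<zeta> + s + - (R *v \<zeta>) + (- c) *s ?p') Y"
      unfolding iZ ix unfolding Z_def X_def short_def using n s0 \<zeta>0 R\<zeta>0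
      by (simp add: esd_e_mult) blast
    ultimately show ?thesis by simp
  qed
  then obtain Y where Y: "esd ?d V Y \<in> H" using N by metis
  \<comment> \<open>Short transvections with parameters in the ideal of \<open>yi\<close> remove all but the wanted multiple of \<open>e l\<close>.\<close>
  have h1: "short (- i) (- j) (- (\<kappa> * (c * bar \<beta>))) \<in> H"
    using hyp(3)[of "- \<kappa> * bar (om i)"] unfolding bz by (simp add: ac_simps)
  have h2: "short (- i) l (\<kappa> * (c * bar \<beta>) * \<gamma>) \<in> H"
    using hyp(4)[of "\<kappa> * bar (om i) * \<gamma>"] unfolding bz by (simp add: ac_simps)
  have h3: "short (- i) l (\<beta> * (bar c * k2)) \<in> H"
  proof -
    have "\<beta> * (bar c * k2) = k2 * (bar c * \<beta>)" by (simp only: ac_simps)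
    also have "\<dots> = (k2 * om i) * bar ?z" unfolding bz(2) by (simp only: mult.assoc)
    finally show ?thesis using hyp(5)[of "k2 * om i"] by simp
  qed
  have "esd ?d V Y ** short (- i) (- j) (- (\<kappa> * (c * bar \<beta>))) ** short (- i) l (\<kappa> * (c * bar \<beta>) * \<gamma>) ** short (- i) l (\<beta> * (bar c * k2)) \<in> H"
    by (intro H_mul Y h1 h2 h3)
  moreover have "\<exists>Y'. esd ?d V Y ** short (- i) (- j) (- (\<kappa> * (c * bar \<beta>))) ** short (- i) l (\<kappa> * (c * bar \<beta>) * \<gamma>) ** short (- i) l (\<beta> * (bar c * k2))
     = esd ?d ((- (c * \<gamma>)) *s ?p) Y'"
  proof -
    have "V + (- (\<kappa> * (c * bar \<beta>))) *s ?p' + (\<kappa> * (c * bar \<beta>) * \<gamma>) *s ?p + (\<beta> * (bar c * k2)) *s ?p = (- (c * \<gamma>)) *s ?p"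
      unfolding V_def by (simp add: vec_eq_iff algebra_simps)
    moreover have V0: "V $ i = 0" unfolding V_def using n by simp
    moreover have "\<exists>Y'. esd ?d V Y ** short (- i) (- j) (- (\<kappa> * (c * bar \<beta>))) ** short (- i) l (\<kappa> * (c * bar \<beta>) * \<gamma>) ** short (- i) l (\<beta> * (bar c * k2))
       = esd ?d (V + (- (\<kappa> * (c * bar \<beta>))) *s ?p' + (\<kappa> * (c * bar \<beta>) * \<gamma>) *s ?p + (\<beta> * (bar c * k2)) *s ?p) Y'"
      unfolding short_def using n V0 by (simp add: esd_e_mult) blast
    ultimately show ?thesis by metis
  qed
  ultimately obtain Y' where Y': "esd ?d ((- (c * \<gamma>)) *s ?p) Y' \<in> H" by metis
  have "- bar (om j) * f \<in> I" by (rule ideal_mult_left[OF I f])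
  from short_from_esd[OF ind Y' this r]
  have "short (- i) r (- (c * \<gamma>) * (- bar (om j) * f)) \<in> H" .
  moreover have "- (c * \<gamma>) * (- bar (om j) * f) = (om j * bar (om j)) * (bar yj * (b * c * f))"
    unfolding \<gamma>_def by (simp add: ac_simps)
  ultimately show ?thesis using n by (simp add: om_bar)
qed

end
end

context lower begin

lemma normalised_conj_by:
  assumes g: "normalised H" and \<tau>: "\<tau> \<in> EUf"
  shows "normalised (conj_by \<tau> H)"
  unfolding normalised_def
proof (intro conjI ballI)
  note H = H_sub[OF g] and \<tau>U = EUf_U[OF \<tau>]
  have Hc: "H \<subseteq> carrier Ug" by (rule subgroup.subset[OF H])
  show "subgroup (conj_by \<tau> H) Ug"
  proof (rule G.subgroupI)
    show "conj_by \<tau> H \<subseteq> carrier Ug" by (rule conj_by_sub[OF Hc \<tau>U])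
    show "conj_by \<tau> H \<noteq> {}" using H_one[OF g] by (auto simp: conj_by_def)
    show "iv a \<in> conj_by \<tau> H" if "a \<in> conj_by \<tau> H" for a
      using that \<tau>U H_U[OF g] H_iv[OF g] by (auto simp: conj_by_def iv_mul2[OF g] U_mul matrix_mul_assoc)
    show "a \<otimes>\<^bsub>Ug\<^esub> b \<in> conj_by \<tau> H" if ab: "a \<in> conj_by \<tau> H" "b \<in> conj_by \<tau> H" for a b
    proof -
      obtain h h' where h: "h \<in> H" "h' \<in> H" "a = iv \<tau> ** h ** \<tau>" "b = iv \<tau> ** h' ** \<tau>" using ab by (auto simp: conj_by_def)
      then have "a ** b = iv \<tau> ** (h ** h') ** \<tau>" by (intro mat_eqI) (simp add: mv_mul \<tau>U)
      then show ?thesis using H_mul[OF g h(1,2)] by (auto simp: conj_by_def)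
    qed
  qed
  fix \<theta> g' assume \<theta>: "\<theta> \<in> EUf" and g': "g' \<in> short_gens"
  have g'U: "g' \<in> carrier Ug" using g' short_carrier by (auto simp: short_gens_def)
  define k where "k = \<tau> ** \<theta> ** g' ** iv (\<tau> ** \<theta>)"
  have k: "normalises H k" using g \<theta> g' EUf_mul[OF \<tau> \<theta>] unfolding normalised_def k_def by blast
  note \<theta>U = EUf_U[OF \<theta>]
  have kU: "k \<in> carrier Ug" using k by (simp add: normalises_def)
  have c: "\<theta> ** g' ** iv \<theta> \<in> carrier Ug" using \<theta>U g'U by (simp add: U_mul)
  have e: "\<theta> ** g' ** iv \<theta> = iv \<tau> ** k ** \<tau>"
    unfolding k_def by (rule mat_eqI) (simp add: mv_mul iv_mul2[OF g] \<theta>U \<tau>U U_mul)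
  have e': "iv (\<theta> ** g' ** iv \<theta>) = iv \<tau> ** iv k ** \<tau>"
    unfolding e using \<tau>U kU by (simp add: iv_mul2[OF g] U_mul matrix_mul_assoc)
  show "normalises (conj_by \<tau> H) (\<theta> ** g' ** iv \<theta>)"
    unfolding normalises_def
  proof (intro conjI ballI c)
    fix h assume "h \<in> conj_by \<tau> H"
    then obtain h' where h': "h' \<in> H" "h = iv \<tau> ** h' ** \<tau>" by (auto simp: conj_by_def)
    have "\<theta> ** g' ** iv \<theta> ** h ** iv (\<theta> ** g' ** iv \<theta>) = iv \<tau> ** (k ** h' ** iv k) ** \<tau>"
      unfolding e' unfolding e h'(2) by (rule mat_eqI) (simp add: mv_mul \<tau>U)
    moreover have "k ** h' ** iv k \<in> H" using k h' by (simp add: normalises_def)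
    ultimately show "\<theta> ** g' ** iv \<theta> ** h ** iv (\<theta> ** g' ** iv \<theta>) \<in> conj_by \<tau> H" by (simp add: conj_by_def)
    have "iv (\<theta> ** g' ** iv \<theta>) ** h ** (\<theta> ** g' ** iv \<theta>) = iv \<tau> ** (iv k ** h' ** k) ** \<tau>"
      unfolding e' unfolding e h'(2) by (rule mat_eqI) (simp add: mv_mul \<tau>U)
    moreover have "iv k ** h' ** k \<in> H" using k h' by (simp add: normalises_def)
    ultimately show "iv (\<theta> ** g' ** iv \<theta>) ** h ** (\<theta> ** g' ** iv \<theta>) \<in> conj_by \<tau> H" by (simp add: conj_by_def)
  qed
qed

lemma conj_by_mem: "\<sigma> \<in> H \<Longrightarrow> iv \<tau> ** \<sigma> ** \<tau> \<in> conj_by \<tau> H"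
  by (simp add: conj_by_def)

text \<open>Conjugation by \<open>\<tau>\<close> does not change the short transvections at position \<open>(p, r)\<close>.\<close>

lemma conj_by_short:
  assumes \<tau>: "\<tau> \<in> carrier Ug" and fx: "\<tau> *v e p = e p" "\<tau> *v e r = e r" and absorbs: "absorbs (conj_by \<tau> H) p r n x"
  shows "absorbs H p r n x"
  unfolding absorbs_def
proof
  fix a assume "a \<in> ideal_pow I n"
  then have "short p r (x * a) \<in> conj_by \<tau> H" using absorbs by (simp add: absorbs_def)
  then obtain h where h: "h \<in> H" "short p r (x * a) = iv \<tau> ** h ** \<tau>" by (auto simp: conj_by_def)
  have "h = \<tau> ** (iv \<tau> ** h ** \<tau>) ** iv \<tau>" by (rule mat_eqI) (simp add: mv_mul \<tau>)
  also have "\<dots> = \<tau> ** short p r (x * a) ** iv \<tau>" using h by simp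
  also have "\<dots> = short p r (x * a)" unfolding short_def esd_conj_iv[OF \<tau>] by (simp add: fx mv_scale)
  finally show "short p r (x * a) \<in> H" using h by simp
qed

section \<open>The entries of a row\<close>

text \<open>The \<open>i\<close>-th row as a linear form. If \<open>\<tau>\<close> fixes \<open>e (- i)\<close>, conjugation by \<open>\<tau>\<close> is a substitution in this form
  (\<open>row_conj\<close>).\<close>

definition row :: "('a, 3) mat_th \<Rightarrow> 3 theta \<Rightarrow> ('a, 3) vec_th \<Rightarrow> 'a" where
  "row \<sigma> i w = (\<sigma> *v w) $ i"

lemma row_simps: "row \<sigma> i (u + v) = row \<sigma> i u + row \<sigma> i v" "row \<sigma> i (u - v) = row \<sigma> i u - row \<sigma> i v"
  "row \<sigma> i (c *s u) = c * row \<sigma> i u"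
  by (simp_all add: row_def mv_simps)

lemma row_conj:
  assumes \<tau>: "\<tau> \<in> carrier Ug" and fx: "\<tau> *v e (- i) = e (- i)" and i: "i \<noteq> Zero"
  shows "row (iv \<tau> ** \<sigma> ** \<tau>) i w = row \<sigma> i (\<tau> *v w)"
proof -
  have c: "x $ i = bar (om (- i)) * B (e (- i)) x" for x
  proof -
    have "bar (om (- i)) * B (e (- i)) x = (om (- i) * bar (om (- i))) * x $ i" by (simp add: ac_simps)
    then show ?thesis using om_bar[of "- i"] i by simp
  qed
  have "B (e (- i)) (iv \<tau> *v x) = B (e (- i)) x" for x
    using U_B[OF \<tau>, of "e (- i)" "iv \<tau> *v x"] \<tau> by (simp add: fx del: B_e_left)
  then have "(iv \<tau> *v x) $ i = x $ i" for x using c by metis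
  then show ?thesis by (simp add: row_def mv_mul)
qed

lemma pow_in_I: "a \<in> ideal_pow I (Suc n) \<Longrightarrow> a \<in> I"
  by (rule pow_induct[where R = "\<lambda>a. a \<in> I"]) (auto intro: ideal_0[OF I] ideal_add[OF I] ideal_mult_left[OF I])

text \<open>A factor from \<open>I\<^sup>n\<close> and three factors from \<open>I\<close>, as in \<open>key_commutator\<close>, generate \<open>I\<^sup>n\<^sup>+\<^sup>3\<close>.\<close>

lemma absorbs_product:
  assumes normalised: "normalised H" and pr: "p \<noteq> Zero" "r \<noteq> Zero" "p \<noteq> - r"
    and h: "\<And>a b c f. a \<in> ideal_pow I n \<Longrightarrow> b \<in> I \<Longrightarrow> c \<in> I \<Longrightarrow> f \<in> I \<Longrightarrow> short p r (x * (a * b * c * f)) \<in> H"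
  shows "absorbs H p r (n + 3) x"
proof -
  have z: "short p r (x * 0) \<in> H" using H_one[OF normalised] by simp
  have ad: "short p r (x * a) \<in> H \<Longrightarrow> short p r (x * b) \<in> H \<Longrightarrow> short p r (x * (a + b)) \<in> H" for a b
    using short_H_add[OF normalised pr] by (simp add: distrib_left)
  have 1: "short p r (x * (a * c * f)) \<in> H" if a: "a \<in> ideal_pow I (Suc n)" and cf: "c \<in> I" "f \<in> I" for a c f
    by (rule pow_induct[OF a, where R = "\<lambda>a. short p r (x * (a * c * f)) \<in> H"])
      (use z ad[of "_ * c * f" "_ * c * f"] h cf in \<open>auto simp: distrib_right\<close>)
  have 2: "short p r (x * (a * f)) \<in> H" if a: "a \<in> ideal_pow I (Suc (Suc n))" and cf: "f \<in> I" for a f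
    by (rule pow_induct[OF a, where R = "\<lambda>a. short p r (x * (a * f)) \<in> H"])
      (use z ad[of "_ * f" "_ * f"] 1 cf in \<open>auto simp: distrib_right\<close>)
  have 3: "short p r (x * a) \<in> H" if a: "a \<in> ideal_pow I (Suc (Suc (Suc n)))" for a
    by (rule pow_induct[OF a, where R = "\<lambda>a. short p r (x * a) \<in> H"]) (use z ad 2 in auto)
  show ?thesis unfolding absorbs_def using 3 by (simp add: numeral_3_eq_3 del: ideal_pow.simps)
qed

text \<open>Apply \<open>key_commutator\<close> with \<open>u = (0, s\<^sub>l, - s\<^sub>j)\<close> and \<open>v = (s\<^sub>j, - s\<^sub>i, 0)\<close> or \<open>v = (s\<^sub>l, 0, - s\<^sub>i)\<close>, where \<open>s\<close> is
  the row. Since \<open>u\<^sub>i = 0\<close> and \<open>y\<^sub>i = 0\<close>, there are no side conditions.\<close>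

lemma absorbs_quadratic:
  assumes normalised: "normalised H" and ind: "frame i j l" and \<sigma>: "\<sigma> \<in> H" and r: "r = j \<or> r = - j"
  shows "absorbs H (- i) r 4 (row \<sigma> i (e j) * bar (row \<sigma> i (e l)))"
    and "absorbs H (- i) r 4 (row \<sigma> i (e l) * bar (row \<sigma> i (e l)))"
proof -
  note n = frameD[OF ind]
  define s where "s k = row \<sigma> i (e k)" for k
  have sv: "row \<sigma> i (e k) = (\<sigma> *v e k) $ i" for k by (simp add: row_def)
  define u where "u = 0 *s e i + s l *s e j + (- s j) *s e l"
  have u0: "(\<sigma> *v u) $ i = 0"
    unfolding u_def by (simp add: mv_simps s_def row_def algebra_simps)
  have r': "- i \<noteq> Zero" "r \<noteq> Zero" "- i \<noteq> - r" using r n by auto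
  have gen: "short (- i) r (v1 * bar (s l) * (a * b * c * f)) \<in> H" if v: "v = v1 *s e i + v2 *s e j + v3 *s e l"
    and v0: "(\<sigma> *v v) $ i = 0" and I': "a \<in> ideal_pow I 1" "b \<in> I" "c \<in> I" "f \<in> I" for v v1 v2 v3 a b c f
  proof -
    have aI: "a \<in> I" using pow_in_I[of a 0] I' by simp
    define a' where "a' = - bar (om (- i)) * a"
    have a'I: "a' \<in> I" unfolding a'_def by (rule ideal_mult_left[OF I aI])
    have "short (- i) r (bar (- bar (om (- i)) * bar a' * bar v1 * s l) * (b * c * f)) \<in> H"
      by (rule key_commutator[OF normalised ind \<sigma> a'I u_def v u0 v0, where yi = 0]) (use I' r in \<open>simp_all add: H_one[OF normalised]\<close>)
    moreover have "bar (- bar (om (- i)) * bar a' * bar v1 * s l) * (b * c * f) = v1 * bar (s l) * (om (- i) * (bar (om (- i)) * (a * b * c * f)))"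
      unfolding a'_def by (simp add: bar_simps ac_simps)
    ultimately show ?thesis using n unit_cancel[of "- i"] by simp
  qed
  have "absorbs H (- i) r (1 + 3) (s j * bar (s l))"
    by (rule absorbs_product[OF normalised r'], rule gen[of _ _ "- s i" 0, OF refl]) (simp_all add: mv_simps s_def row_def)
  then show "absorbs H (- i) r 4 (row \<sigma> i (e j) * bar (row \<sigma> i (e l)))" by (simp add: s_def)
  have "absorbs H (- i) r (1 + 3) (s l * bar (s l))"
    by (rule absorbs_product[OF normalised r'], rule gen[of _ _ 0 "- s i", OF refl]) (simp_all add: mv_simps s_def row_def)
  then show "absorbs H (- i) r 4 (row \<sigma> i (e l) * bar (row \<sigma> i (e l)))" by (simp add: s_def)
qed

lemma absorbs_quadratic5:
  assumes normalised: "normalised H" and ind: "frame i j l" and \<sigma>: "\<sigma> \<in> H" and r: "r \<in> {j, - j, l, - l}"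
  shows "absorbs H (- i) r 5 (row \<sigma> i (e j) * bar (row \<sigma> i (e l)))"
    and "absorbs H (- i) r 5 (row \<sigma> i (e l) * bar (row \<sigma> i (e j)))"
    and "absorbs H (- i) r 5 (row \<sigma> i (e l) * bar (row \<sigma> i (e l)))"
    and "absorbs H (- i) r 5 (row \<sigma> i (e j) * bar (row \<sigma> i (e j)))"
proof -
  have 1: "absorbs H (- i) r 5 x" if h: "\<And>r. r = j \<or> r = - j \<Longrightarrow> absorbs H (- i) r 4 x" and r: "r \<in> {j, - j, l, - l}" and ind: "frame i j l" for x r j l
  proof (cases "r = j \<or> r = - j")
    case True then show ?thesis using absorbs_mono[OF normalised h[OF True]] by simp
  next
    case False
    note n = frameD[OF ind]
    have "absorbs H (- i) r (Suc 4) x"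
      by (rule absorbs_step[OF normalised _ _ _ _ _ _ _ _ h[of j]]) (use n False r in auto)
    then show ?thesis by simp
  qed
  show "absorbs H (- i) r 5 (row \<sigma> i (e j) * bar (row \<sigma> i (e l)))"
    by (rule 1[OF absorbs_quadratic(1)[OF normalised ind \<sigma>] r ind])
  show "absorbs H (- i) r 5 (row \<sigma> i (e l) * bar (row \<sigma> i (e l)))"
    by (rule 1[OF absorbs_quadratic(2)[OF normalised ind \<sigma>] r ind])
  have r': "r \<in> {l, - l, j, - j}" using r by auto
  show "absorbs H (- i) r 5 (row \<sigma> i (e l) * bar (row \<sigma> i (e j)))"
    by (rule 1[OF absorbs_quadratic(1)[OF normalised frame_perm(2)[OF ind] \<sigma>] r' frame_perm(2)[OF ind]])
  show "absorbs H (- i) r 5 (row \<sigma> i (e j) * bar (row \<sigma> i (e j)))"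
    by (rule 1[OF absorbs_quadratic(2)[OF normalised frame_perm(2)[OF ind] \<sigma>] r' frame_perm(2)[OF ind]])
qed

lemma absorbs_quadratic5_conj:
  assumes normalised: "normalised H" and ind: "frame i j l" and \<sigma>: "\<sigma> \<in> H" and r: "r \<in> {j, - j, l, - l}"
    and \<tau>: "\<tau> \<in> EUf" and fx: "\<tau> *v e (- i) = e (- i)" "\<tau> *v e r = e r"
  shows "absorbs H (- i) r 5 (row \<sigma> i (\<tau> *v e j) * bar (row \<sigma> i (\<tau> *v e l)))"
    "absorbs H (- i) r 5 (row \<sigma> i (\<tau> *v e l) * bar (row \<sigma> i (\<tau> *v e j)))"
proof -
  note \<tau>U = EUf_U[OF \<tau>] and g = normalised_conj_by[OF normalised \<tau>] and m = conj_by_mem[OF \<sigma>, of \<tau>]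
  have i: "i \<noteq> Zero" using ind by (simp add: frame_def)
  show "absorbs H (- i) r 5 (row \<sigma> i (\<tau> *v e j) * bar (row \<sigma> i (\<tau> *v e l)))"
    using conj_by_short[OF \<tau>U fx absorbs_quadratic5(1)[OF g ind m r]] by (simp add: row_conj[OF \<tau>U fx(1) i])
  show "absorbs H (- i) r 5 (row \<sigma> i (\<tau> *v e l) * bar (row \<sigma> i (\<tau> *v e j)))"
    using conj_by_short[OF \<tau>U fx absorbs_quadratic5(2)[OF g ind m r]] by (simp add: row_conj[OF \<tau>U fx(1) i])
qed

lemma long_mv: "long p (y, z) *v w = w + (om p * w $ (- p) * y) *s e Zero - (bar y * bar (B w (e Zero))) *s e p
   + (bar z * om p * w $ (- p)) *s e p"
  by (simp add: long_def esd_apply B_simps bar_simps vector_smult_assoc ac_simps)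

lemma long_fix: "k \<noteq> - p \<Longrightarrow> k \<noteq> Zero \<Longrightarrow> long p (y, z) *v e k = e k"
  by (auto simp: long_mv B_e_right theta_swap)

lemma long_move: "p \<noteq> Zero \<Longrightarrow> long p (y, z) *v e (- p) = e (- p) + (om p * y) *s e Zero + (bar z * om p) *s e p"
  by (auto simp: long_mv B_e_right)

text \<open>Conjugation by an elementary matrix that fixes \<open>e (- i)\<close> and \<open>e r\<close> adds another column to column \<open>j\<close>.
  The difference of the products before and after is the product with that column. For column \<open>- l\<close> such a
  matrix must also change column \<open>l\<close>, which leaves the relation in the last part.\<close>

lemma absorbs_other_columns:
  assumes normalised: "normalised H" and ind: "frame i j l" and \<sigma>: "\<sigma> \<in> H" and r: "r \<in> {j, - j, l, - l}" "r \<noteq> j"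
  shows "absorbs H (- i) r 5 (row \<sigma> i (e (- i)) * bar (row \<sigma> i (e l)))"
    "absorbs H (- i) r 5 (row \<sigma> i (e l) * bar (row \<sigma> i (e (- i))))"
    "y \<in> J_of \<Delta> \<Longrightarrow> absorbs H (- i) r 5 (row \<sigma> i (y *s e Zero) * bar (row \<sigma> i (e l)))"
    "y \<in> J_of \<Delta> \<Longrightarrow> absorbs H (- i) r 5 (row \<sigma> i (e l) * bar (row \<sigma> i (y *s e Zero)))"
    "\<exists>c. r \<noteq> l \<longrightarrow> absorbs H (- i) r 5 (row \<sigma> i (e (- l)) * bar (row \<sigma> i (e l)) - c * (row \<sigma> i (e j) * bar (row \<sigma> i (e (- j)))))"
proof -
  note n = frameD[OF ind]
  have pr: "- i \<noteq> Zero" "r \<noteq> Zero" "- i \<noteq> - r" "r \<noteq> i" "r \<noteq> - i" using n r by auto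
  have rj: "r \<in> {- j, - (- j), l, - l}" using r by auto
  have rl: "r \<in> {- j, - (- j), - l, - (- l)}" using r by auto
  note indj = frame_perm(7)[OF ind]
  note indjl = frame_perm(8)[OF indj]
  let ?s = "row \<sigma> i"
  note dif = absorbs_diff[OF normalised pr(1-3)] and sum = absorbs_add[OF normalised pr(1-3)]
  define \<tau> where "\<tau> = short (- j) (- i) (bar (om (- j)))"
  have \<tau>: "\<tau> \<in> EUf" unfolding \<tau>_def using n by (intro short_long_EUf) auto
  have f: "\<tau> *v e (- i) = e (- i)" "\<tau> *v e r = e r" "\<tau> *v e l = e l"
    unfolding \<tau>_def using n r pr by (auto intro!: short_fix)
  have "\<tau> *v e (- (- j)) = e (- (- j)) + (om (- j) * bar (om (- j))) *s e (- i)"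
    unfolding \<tau>_def using n by (intro short_move) auto
  then have mj: "\<tau> *v e j = e j + e (- i)" using n om_bar[of "- j"] by simp
  from dif[OF absorbs_quadratic5_conj(1)[OF normalised ind \<sigma> r(1) \<tau> f(1,2)] absorbs_quadratic5(1)[OF normalised ind \<sigma> r(1)]]
  show "absorbs H (- i) r 5 (?s (e (- i)) * bar (?s (e l)))"
    unfolding mj f by (simp add: row_simps algebra_simps)
  from dif[OF absorbs_quadratic5_conj(2)[OF normalised ind \<sigma> r(1) \<tau> f(1,2)] absorbs_quadratic5(2)[OF normalised ind \<sigma> r(1)]]
  show "absorbs H (- i) r 5 (?s (e l) * bar (?s (e (- i))))"
    unfolding mj f by (simp add: row_simps bar_simps algebra_simps)
  show "absorbs H (- i) r 5 (?s (y *s e Zero) * bar (?s (e l)))"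
    "absorbs H (- i) r 5 (?s (e l) * bar (?s (y *s e Zero)))" if y: "y \<in> J_of \<Delta>"
  proof -
    have "bar (om (- j)) * y \<in> J_of \<Delta>" using y by (rule JD_scale)
    then obtain z where z: "(bar (om (- j)) * y, z) \<in> \<Delta>" by (auto simp: J_of_def)
    define \<theta> where "\<theta> = long (- j) (bar (om (- j)) * y, z)"
    have \<theta>: "\<theta> \<in> EUf" unfolding \<theta>_def using n z by (intro short_long_EUf) auto
    have f: "\<theta> *v e (- i) = e (- i)" "\<theta> *v e r = e r" "\<theta> *v e l = e l"
      unfolding \<theta>_def using n r pr by (auto intro!: long_fix)
    have "\<theta> *v e (- (- j)) = e (- (- j)) + (om (- j) * (bar (om (- j)) * y)) *s e Zero + (bar z * om (- j)) *s e (- j)"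
      unfolding \<theta>_def using n by (intro long_move) auto
    then have mj: "\<theta> *v e j = e j + y *s e Zero + (bar z * om (- j)) *s e (- j)" using n unit_cancel[of "- j"] by simp
    note d1 = dif[OF dif[OF absorbs_quadratic5_conj(1)[OF normalised ind \<sigma> r(1) \<theta> f(1,2)] absorbs_quadratic5(1)[OF normalised ind \<sigma> r(1)]]
      absorbs_scale'[OF normalised absorbs_quadratic5(1)[OF normalised indj \<sigma> rj], of "bar z * om (- j)"]]
    show "absorbs H (- i) r 5 (?s (y *s e Zero) * bar (?s (e l)))"
      using d1 unfolding mj f by (simp add: row_simps algebra_simps)
    note d2 = dif[OF dif[OF absorbs_quadratic5_conj(2)[OF normalised ind \<sigma> r(1) \<theta> f(1,2)] absorbs_quadratic5(2)[OF normalised ind \<sigma> r(1)]]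
      absorbs_scale'[OF normalised absorbs_quadratic5(2)[OF normalised indj \<sigma> rj], of "bar (bar z * om (- j))"]]
    show "absorbs H (- i) r 5 (?s (e l) * bar (?s (y *s e Zero)))"
      using d2 unfolding mj f by (simp add: row_simps bar_simps algebra_simps)
  qed
  show "\<exists>c. r \<noteq> l \<longrightarrow> absorbs H (- i) r 5 (?s (e (- l)) * bar (?s (e l)) - c * (?s (e j) * bar (?s (e (- j)))))"
  proof (cases "r = l")
    case False
    define \<theta> where "\<theta> = short (- j) (- l) (bar (om (- j)))"
    have \<theta>: "\<theta> \<in> EUf" unfolding \<theta>_def using n by (intro short_long_EUf) auto
    have f: "\<theta> *v e (- i) = e (- i)" "\<theta> *v e r = e r"
      unfolding \<theta>_def using n r pr False by (auto intro!: short_fix)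
    have "\<theta> *v e (- (- j)) = e (- (- j)) + (om (- j) * bar (om (- j))) *s e (- l)"
      unfolding \<theta>_def using n by (intro short_move) auto
    then have mj: "\<theta> *v e j = e j + e (- l)" using n om_bar[of "- j"] by simp
    define c where "c = om (- j) * bar (om l)"
    have ml: "\<theta> *v e l = e l - c *s e (- j)"
      unfolding \<theta>_def short_mv c_def using n by (auto simp: B_e_right)
    note d = sum[OF dif[OF absorbs_quadratic5_conj(1)[OF normalised ind \<sigma> r(1) \<theta> f(1,2)] absorbs_quadratic5(1)[OF normalised ind \<sigma> r(1)]]
      absorbs_scale'[OF normalised absorbs_quadratic5(2)[OF normalised indjl \<sigma> rl], of "bar c"]]
    have "absorbs H (- i) r 5 (?s (e (- l)) * bar (?s (e l)) - bar c * (?s (e j) * bar (?s (e (- j)))))"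
      using d unfolding mj ml by (simp add: row_simps bar_simps algebra_simps)
    then show ?thesis by blast
  qed auto
qed

text \<open>With \<open>u = (s\<^sub>j, - s\<^sub>i, 0)\<close> and \<open>v = (s\<^sub>l, 0, - s\<^sub>i)\<close> the gained parameter contains \<open>s\<^sub>i\<close>. Here \<open>y\<^sub>i\<close> is not
  zero, but it is a combination of \<open>s\<^sub>j bar s\<^sub>l\<close> and its conjugate, which are absorbed with six
  factors at the positions in question. Two of these are \<open>b\<close> and \<open>c\<close>, so \<open>a\<close> is taken from \<open>I\<^sup>4\<close>.\<close>

lemma absorbs_diagonal:
  assumes normalised: "normalised H" and ind: "frame i j l" and \<sigma>: "\<sigma> \<in> H" and r: "r = j \<or> r = - j"
  shows "absorbs H (- i) r 7 (row \<sigma> i (e l) * bar (row \<sigma> i (e i)))"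
proof -
  note n = frameD[OF ind]
  define s where "s k = row \<sigma> i (e k)" for k
  define u where "u = s j *s e i + (- s i) *s e j + 0 *s e l"
  define v where "v = s l *s e i + 0 *s e j + (- s i) *s e l"
  have u0: "(\<sigma> *v u) $ i = 0" "(\<sigma> *v v) $ i = 0"
    unfolding u_def v_def by (simp_all add: mv_simps s_def row_def algebra_simps)
  have r': "- i \<noteq> Zero" "r \<noteq> Zero" "- i \<noteq> - r" using r n by auto
  define x1 where "x1 = s l * bar (s j)"
  define x2 where "x2 = s j * bar (s l)"
  have xb: "bar x1 = x2" "bar x2 = x1" by (simp_all add: x1_def x2_def bar_simps ac_simps)
  have w5: "absorbs H (- i) k 5 x1" "absorbs H (- i) k 5 x2" if "k \<in> {j, - j, l, - l}" for k
    using absorbs_quadratic5(1,2)[OF normalised ind \<sigma> that] by (simp_all add: x1_def x2_def s_def)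
  have w6: "absorbs H (- i) k 6 x1" "absorbs H (- i) k 6 x2" if "k \<in> {j, - j, l, - l}" for k
    using w5[OF that] absorbs_mono[OF normalised, where n = 5 and m = 6] by auto
  have wlj: "absorbs H l (- j) 6 x1" "absorbs H l (- j) 6 x2"
  proof -
    have A: "absorbs H (- j) (- i) 5 x2" "absorbs H (- j) (- i) 5 x1"
      using absorbs_sym[OF normalised w5(1)[of "- j"]] absorbs_sym[OF normalised w5(2)[of "- j"]] unfolding xb by simp_all
    have "absorbs H (- j) l (Suc 5) x2" by (rule absorbs_step[OF normalised _ _ _ _ _ _ _ _ A(1)]) (simp_all add: n)
    moreover have "absorbs H (- j) l (Suc 5) x1" by (rule absorbs_step[OF normalised _ _ _ _ _ _ _ _ A(2)]) (simp_all add: n)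
    ultimately have A: "absorbs H (- j) l (Suc 5) x2" "absorbs H (- j) l (Suc 5) x1" by simp_all
    from absorbs_sym[OF normalised A(1)] absorbs_sym[OF normalised A(2)] show "absorbs H l (- j) 6 x1" "absorbs H l (- j) 6 x2"
      unfolding xb by simp_all
  qed
  have wll: "absorbs H l l 6 x1" "absorbs H l l 6 x2"
  proof -
    have A: "absorbs H l (- i) 5 x2" "absorbs H l (- i) 5 x1"
      using absorbs_sym[OF normalised w5(1)[of l]] absorbs_sym[OF normalised w5(2)[of l]] unfolding xb by simp_all
    have "absorbs H l l (Suc 5) x2" by (rule absorbs_step[OF normalised _ _ _ _ _ _ _ _ A(1)]) (simp_all add: n)
    moreover have "absorbs H l l (Suc 5) x1" by (rule absorbs_step[OF normalised _ _ _ _ _ _ _ _ A(2)]) (simp_all add: n)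
    ultimately show "absorbs H l l 6 x1" "absorbs H l l 6 x2" by simp_all
  qed
  have gen: "short p k (x1 * A1 + x2 * A2) \<in> H"
    if "absorbs H p k 6 x1" "absorbs H p k 6 x2" "p \<noteq> Zero" "k \<noteq> Zero" "p \<noteq> - k" "A1 \<in> ideal_pow I 6" "A2 \<in> ideal_pow I 6" for p k A1 A2
    by (rule short_H_add[OF normalised that(3-5) absorbs_mem[OF normalised that(1,6)] absorbs_mem[OF normalised that(2,7)]])
  have "absorbs H (- i) r (4 + 3) (s l * bar (s i))"
  proof (rule absorbs_product[OF normalised r'])
    fix a b c f assume a: "a \<in> ideal_pow I 4" and bcf: "b \<in> I" "c \<in> I" "f \<in> I"
    define a' where "a' = bar (om (- i)) * a"
    have a'4: "a' \<in> ideal_pow I 4" unfolding a'_def by (rule ideal_mult_left[OF pow_ideal a])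
    have "(4::nat) = Suc 3" by simp
    then have a'I: "a' \<in> I" using pow_in_I[of a' 3] a'4 by metis
    have I6: "k * (d * c * bar b) \<in> ideal_pow I 6" "k * (d * bar c * b) \<in> ideal_pow I 6" if "d \<in> ideal_pow I 4" for k d
    proof -
      have "d * c * bar b \<in> ideal_pow I (Suc (Suc 4))" "d * bar c * b \<in> ideal_pow I (Suc (Suc 4))"
        by (rule pow_Suc_mem[OF pow_Suc_mem[OF that bcf(2)] I_bar[OF bcf(1)]],
            rule pow_Suc_mem[OF pow_Suc_mem[OF that I_bar[OF bcf(2)]] bcf(1)])
      moreover have 6: "Suc (Suc 4) = (6 :: nat)" by simp
      ultimately show "k * (d * c * bar b) \<in> ideal_pow I 6" "k * (d * bar c * b) \<in> ideal_pow I 6"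
        unfolding 6 using ideal_mult_left[OF pow_ideal] by blast+
    qed
    have a'b: "bar a' \<in> ideal_pow I 4" by (rule pow_bar[OF I_bar a'4])
    define yi where "yi = om i * bar (s j) * a' * s l - bar (om (- i)) * bar a' * bar (s l) * s j"
    have z1: "k * (c * bar b * yi) = x1 * ((k * om i) * (a' * c * bar b)) + x2 * ((- k * bar (om (- i))) * (bar a' * c * bar b))" for k
      unfolding yi_def x1_def x2_def by (simp add: algebra_simps)
    have z2: "k * bar (c * bar b * yi) = x1 * ((- k * om (- i)) * (a' * bar c * b)) + x2 * ((k * bar (om i)) * (bar a' * bar c * b))" for k
      unfolding yi_def x1_def x2_def by (simp add: bar_simps algebra_simps)
    have "short (- i) r (bar (om i * bar (s j) * a' * 0 - bar (om (- i)) * bar a' * bar (s l) * (- s i)) * (b * c * f)) \<in> H"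
    proof (rule key_commutator[OF normalised ind \<sigma> a'I u_def v_def u0 yi_def refl bcf _ _ _ _ _ r])
      fix k
      show "short l (- j) (k * (c * bar b * yi)) \<in> H" unfolding z1 by (rule gen[OF wlj _ _ _ I6(1)[OF a'4] I6(1)[OF a'b]]) (simp_all add: n)
      show "short l l (k * (c * bar b * yi)) \<in> H" unfolding z1 by (rule gen[OF wll _ _ _ I6(1)[OF a'4] I6(1)[OF a'b]]) (simp_all add: n)
      show "short (- i) (- j) (k * (c * bar b * yi)) \<in> H" unfolding z1 by (rule gen[OF w6 _ _ _ I6(1)[OF a'4] I6(1)[OF a'b]]) (simp_all add: n)
      show "short (- i) l (k * (c * bar b * yi)) \<in> H" unfolding z1 by (rule gen[OF w6 _ _ _ I6(1)[OF a'4] I6(1)[OF a'b]]) (simp_all add: n)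
      show "short (- i) l (k * bar (c * bar b * yi)) \<in> H" unfolding z2 by (rule gen[OF w6 _ _ _ I6(2)[OF a'4] I6(2)[OF a'b]]) (simp_all add: n)
    qed
    moreover have "bar (om i * bar (s j) * a' * 0 - bar (om (- i)) * bar a' * bar (s l) * (- s i)) * (b * c * f)
      = s l * bar (s i) * (om (- i) * (bar (om (- i)) * (a * b * c * f)))"
      unfolding a'_def by (simp add: bar_simps ac_simps)
    ultimately show "short (- i) r (s l * bar (s i) * (a * b * c * f)) \<in> H"
      using n unit_cancel[of "- i"] by simp
  qed
  then show ?thesis by (simp add: s_def)
qed

lemma frame_cases: assumes "frame i j l" shows "k \<in> {Zero, i, - i, j, - j, l, - l}"
proof -
  have c: "d = a \<or> d = b \<or> d = c" if "a \<noteq> b" "a \<noteq> c" "b \<noteq> c" for a b c d :: 3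
    using that exhaust_3[of a] exhaust_3[of b] exhaust_3[of c] exhaust_3[of d] by auto
  show ?thesis using assms unfolding frame_def
    by (cases i; cases j; cases l; cases k; simp; use c in blast)
qed

text \<open>The entries of the inverse of \<open>\<sigma>\<close> express 1 as a combination of the entries of the row.\<close>

lemma absorbs_unimodular:
  assumes normalised: "normalised H" and \<sigma>: "\<sigma> \<in> H" and i: "i \<noteq> Zero" and pr: "p \<noteq> Zero" "r \<noteq> Zero" "p \<noteq> - r"
    and k: "\<And>k. k \<noteq> Zero \<Longrightarrow> absorbs H p r m (x * bar (row \<sigma> i (e k)))"
    and z: "\<And>y. y \<in> J_of \<Delta> \<Longrightarrow> absorbs H p r m (x * bar (row \<sigma> i (y *s e Zero)))"
  shows "absorbs H p r m x"
proof -
  note \<sigma>U = H_U[OF normalised \<sigma>]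
  define y where "y k = (iv \<sigma> *v e i) $ k" for k
  have "row \<sigma> i (iv \<sigma> *v e i) = 1" using \<sigma>U by (simp add: row_def)
  moreover have "row \<sigma> i (iv \<sigma> *v e i) = (\<Sum>k\<in>UNIV. row \<sigma> i (e k) * y k)"
    unfolding row_def y_def by (subst mv_nth) (simp add: mv_col)
  ultimately have "bar (\<Sum>k\<in>UNIV. row \<sigma> i (e k) * y k) = 1" by simp
  then have "(\<Sum>k\<in>UNIV. bar (row \<sigma> i (e k)) * bar (y k)) = 1" unfolding bar_sum bar_mult .
  then have x: "x = (\<Sum>k\<in>UNIV. x * (bar (row \<sigma> i (e k)) * bar (y k)))"
    unfolding sum_distrib_left[symmetric] by simp
  have "absorbs H p r m (x * (bar (row \<sigma> i (e k)) * bar (y k)))" for k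
  proof (cases "k = Zero")
    case True
    have "y Zero \<in> J_of \<Delta>" unfolding y_def using U_JD[of "iv \<sigma>" "e i"] \<sigma>U i by simp
    from z[OF this] show ?thesis unfolding True by (simp add: row_simps bar_mult ac_simps)
  next
    case False
    from absorbs_scale[OF normalised k[OF False], of "bar (y k)"] show ?thesis by (simp add: mult.assoc)
  qed
  then have "absorbs H p r m (\<Sum>k\<in>UNIV. x * (bar (row \<sigma> i (e k)) * bar (y k)))"
    by (rule absorbs_sum[OF normalised pr])
  then show ?thesis unfolding x[symmetric] .
qed

text \<open>By \<open>absorbs_unimodular\<close> it suffices to absorb \<open>s\<^sub>l bar s\<^sub>k\<close> for all \<open>k\<close>. The previous lemmas do this except for
  \<open>k = - l\<close>. In this case \<open>absorbs_unimodular\<close> is applied once more, to \<open>s\<^sub>l bar s\<^sub>-\<^sub>l\<close>: its products with the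
  conjugate row are covered, the product with \<open>bar s\<^sub>-\<^sub>l\<close> by the relation in \<open>absorbs_other_columns\<close>.\<close>

lemma absorbs_row_entry:
  assumes normalised: "normalised H" and ind: "frame i j l" and \<sigma>: "\<sigma> \<in> H" and r: "r = j \<or> r = - j"
  shows "absorbs H (- i) r 7 (row \<sigma> i (e l))"
proof -
  have *: "absorbs H (- i) (- j) 7 (row \<sigma> i (e l))" if ind: "frame i j l" for j
  proof -
    note n = frameD[OF ind]
    let ?s = "row \<sigma> i" and ?r = "- j"
    let ?V = "absorbs H (- i) ?r 7"
    have pr: "- i \<noteq> Zero" "?r \<noteq> Zero" "- i \<noteq> - ?r" using n by auto
    have up: "absorbs H (- i) ?r 5 x \<Longrightarrow> ?V x" for x using absorbs_mono[OF normalised] by fastforce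
    note add = absorbs_add[OF normalised pr] and sc = absorbs_scale'[OF normalised]
    have rm: "?r \<in> {j, - j, m, - m}" "?r \<noteq> j" for m using n by auto
    have f: "?V (?s (e m) * bar (?s (e k)))" "?V (?s (e m) * bar (?s (y *s e Zero)))"
      if m: "m = l \<or> m = - l" and k: "k \<noteq> Zero" "k \<noteq> - m" and y: "y \<in> J_of \<Delta>" for m k y
    proof -
      have im: "frame i j m" using ind frame_perm(8)[OF ind] m by auto
      have rm': "?r \<in> {- j, - (- j), m, - m}" by auto
      have "k \<in> {i, - i, j, - j, m}" using frame_cases[OF im, of k] k by auto
      then show "?V (?s (e m) * bar (?s (e k)))"
        using up[OF absorbs_quadratic5(2)[OF normalised im \<sigma> rm(1)]] up[OF absorbs_quadratic5(2)[OF normalised frame_perm(7)[OF im] \<sigma> rm']]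
          up[OF absorbs_quadratic5(3)[OF normalised im \<sigma> rm(1)]] up[OF absorbs_other_columns(2)[OF normalised im \<sigma> rm]]
          absorbs_diagonal[OF normalised im \<sigma>, of ?r] by auto
      show "?V (?s (e m) * bar (?s (y *s e Zero)))" by (rule up[OF absorbs_other_columns(4)[OF normalised im \<sigma> rm y]])
    qed
    have X: "?V (?s (e (- m)) * bar (?s (e m)))" if m: "m = l \<or> m = - l" for m
    proof (rule absorbs_unimodular[OF normalised \<sigma> n(1) pr])
      have im: "frame i j m" using ind frame_perm(8)[OF ind] m by auto
      note nm = frameD[OF im]
      have mm: "- m = l \<or> - m = - l" using m by auto
      show "?V (?s (e (- m)) * bar (?s (e m)) * bar (?s (y *s e Zero)))" if "y \<in> J_of \<Delta>" for y
        using sc[OF f(2)[OF mm n(2) _ that], of "bar (?s (e m))"] nm by (simp add: ac_simps)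
      show "?V (?s (e (- m)) * bar (?s (e m)) * bar (?s (e k)))" if k: "k \<noteq> Zero" for k
      proof (cases "k = m")
        case False
        then show ?thesis using sc[OF f(1)[OF mm k _ JD_0], of "bar (?s (e m))"] by (simp add: ac_simps)
      next
        case True
        obtain c where c: "absorbs H (- i) ?r 5 (?s (e (- m)) * bar (?s (e m)) - c * (?s (e j) * bar (?s (e (- j)))))"
          using absorbs_other_columns(5)[OF normalised im \<sigma> rm] nm by auto
        have "?V (bar (?s (e m)) * (?s (e (- m)) * bar (?s (e m)) - c * (?s (e j) * bar (?s (e (- j)))))
            + (c * bar (?s (e (- j)))) * (?s (e j) * bar (?s (e m))))"
          by (rule add[OF sc[OF up[OF c]] sc[OF up[OF absorbs_quadratic5(1)[OF normalised im \<sigma> rm(1)]]]])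
        then show ?thesis unfolding True by (simp add: algebra_simps)
      qed
    qed
    show ?thesis
    proof (rule absorbs_unimodular[OF normalised \<sigma> n(1) pr])
      show "?V (?s (e l) * bar (?s (y *s e Zero)))" if "y \<in> J_of \<Delta>" for y
        using f(2)[of l l y] that n by simp
      show "?V (?s (e l) * bar (?s (e k)))" if "k \<noteq> Zero" for k
        using f(1)[of l k 0] that X[of "- l"] n by (cases "k = - l") auto
    qed
  qed
  from r show ?thesis
  proof
    assume "r = - j" then show ?thesis using *[OF ind] by simp
  next
    assume "r = j" then show ?thesis using *[OF frame_perm(7)[OF ind]] by simp
  qed
qed

end

context lower begin

section \<open>The ideal of the upper level\<close>

text \<open>Every position can be reached from \<open>(a, b)\<close> or \<open>(a, - b)\<close> by at most three changes of one index.\<close>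

lemma absorbs_spread:
  assumes normalised: "normalised H" and ind: "frame a b c" and h: "absorbs H a b n x" "absorbs H a (- b) n x"
    and pq: "p \<noteq> Zero" "q' \<noteq> Zero" "p \<noteq> q'" "p \<noteq> - q'"
  shows "absorbs H p q' (n + 3) x"
proof -
  note nn = frameD[OF ind]
  have M1: "absorbs H p k (Suc n) x" if "absorbs H p q' n x" "frame p q' k" for p q' k n x
    using frameD[OF that(2)] by (intro absorbs_step[OF normalised _ _ _ _ _ _ _ _ that(1)]) auto
  have M2: "absorbs H k q' (Suc n) x" if "absorbs H p q' n x" "frame p q' k" for p q' k n x
    using absorbs_sym[OF normalised M1[OF absorbs_sym[OF normalised that(1)] frame_perm(1)[OF that(2)]]] by simp
  note up = absorbs_mono[OF normalised, where m = "n + 3"]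
  have I: "frame s r m" if "s = a \<or> s = - a" "r = b \<or> r = - b" "m = c \<or> m = - c" for s r m
    using that ind frame_perm(6-8) by auto
  have h0: "absorbs H a r n x" if "r = b \<or> r = - b" for r using that h by auto
  have h1: "absorbs H a m (Suc n) x" if m: "m = c \<or> m = - c" for m
    using M1[OF h(1) I[OF _ _ m]] by auto
  have h2: "absorbs H m r (Suc n) x" if m: "m = c \<or> m = - c" and r: "r = b \<or> r = - b" for m r
    using M2[OF h0[OF r] I[OF _ r m]] by auto
  have h3: "absorbs H r m (Suc (Suc n)) x" if m: "m = c \<or> m = - c" and r: "r = b \<or> r = - b" for m r
    using M2[OF h1[OF m] frame_perm(2)[OF I[OF _ r m]]] by auto
  have h4: "absorbs H m s (Suc (Suc n)) x" if m: "m = c \<or> m = - c" and s: "s = a \<or> s = - a" for m s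
    using M1[OF h2[OF m, of b] frame_perm(3)[OF I[OF s _ m]]] by auto
  have h5: "absorbs H s r (Suc (Suc n)) x" if s: "s = a \<or> s = - a" and r: "r = b \<or> r = - b" for s r
    using M2[OF h2[OF _ r, of c] frame_perm(3)[OF I[OF s r]]] by auto
  have h6: "absorbs H r s (Suc (Suc (Suc n))) x" if s: "s = a \<or> s = - a" and r: "r = b \<or> r = - b" for s r
    using M1[OF h3[OF _ r, of c] frame_perm(4)[OF I[OF s r]]] by auto
  have h7: "absorbs H s m (Suc (Suc (Suc n))) x" if s: "s = a \<or> s = - a" and m: "m = c \<or> m = - c" for s m
    using M2[OF h3[OF m, of b] frame_perm(4)[OF I[OF s _ m]]] by auto
  have "p \<in> {Zero, a, - a, b, - b, c, - c}" "q' \<in> {Zero, a, - a, b, - b, c, - c}" by (rule frame_cases[OF ind])+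
  then consider "p = a \<or> p = - a" "q' = b \<or> q' = - b" | "p = a \<or> p = - a" "q' = c \<or> q' = - c"
    | "p = b \<or> p = - b" "q' = a \<or> q' = - a" | "p = b \<or> p = - b" "q' = c \<or> q' = - c"
    | "p = c \<or> p = - c" "q' = a \<or> q' = - a" | "p = c \<or> p = - c" "q' = b \<or> q' = - b"
    using pq by auto
  then show ?thesis
  proof cases
    case 1 then show ?thesis using up[OF h5] by simp
  next
    case 2 then show ?thesis using h7 by (simp add: eval_nat_numeral)
  next
    case 3 then show ?thesis using h6 by (simp add: eval_nat_numeral)
  next
    case 4 then show ?thesis using up[OF h3] by simp
  next
    case 5 then show ?thesis using up[OF h4] by simp
  next
    case 6 then show ?thesis using up[OF h2] by simp
  qed
qed

text \<open>Ten is the number of factors after which all generators of the ideal of \<open>U(H)\<close> are absorbed at all positions.\<close>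

definition absorbs_everywhere :: "('a, 3) mat_th set \<Rightarrow> 'a \<Rightarrow> bool" where
  "absorbs_everywhere H x \<longleftrightarrow> (\<forall>p r. p \<noteq> Zero \<longrightarrow> r \<noteq> Zero \<longrightarrow> p \<noteq> r \<longrightarrow> p \<noteq> - r \<longrightarrow> absorbs H p r 10 x)"

lemma third_index: "i \<noteq> Zero \<Longrightarrow> l \<noteq> Zero \<Longrightarrow> i \<noteq> l \<Longrightarrow> i \<noteq> - l \<Longrightarrow> \<exists>j. frame i j l"
proof -
  assume a: "i \<noteq> Zero" "l \<noteq> Zero" "i \<noteq> l" "i \<noteq> - l"
  have c: "\<exists>d::3. d \<noteq> x \<and> d \<noteq> y" for x y
  proof -
    have "card {x, y} < card (UNIV :: 3 set)" by (auto simp: card_insert_if)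
    then show ?thesis by (metis UNIV_I insertCI less_irrefl set_eq_iff insert_iff empty_iff)
  qed
  obtain x where x: "i = Pos x \<or> i = Neg x" using a by (cases i) auto
  obtain y where y: "l = Pos y \<or> l = Neg y" using a by (cases l) auto
  obtain d where "d \<noteq> x" "d \<noteq> y" using c by blast
  then have "frame i (Pos d) l" using a x y by (auto simp: frame_def)
  then show ?thesis ..
qed

lemma absorbs_off_diagonal:
  assumes normalised: "normalised H" and \<sigma>: "\<sigma> \<in> H" and il: "i \<noteq> Zero" "l \<noteq> Zero" "i \<noteq> l" "i \<noteq> - l"
  shows "absorbs_everywhere H (row \<sigma> i (e l))"
  unfolding absorbs_everywhere_def
proof (intro allI impI)
  fix p r :: "3 theta" assume pr: "p \<noteq> Zero" "r \<noteq> Zero" "p \<noteq> r" "p \<noteq> - r"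
  obtain j where ind: "frame i j l" using third_index[OF il] by blast
  have "absorbs H p r (7 + 3) (row \<sigma> i (e l))"
    by (rule absorbs_spread[OF normalised frame_perm(6)[OF ind] absorbs_row_entry[OF normalised ind \<sigma>] absorbs_row_entry[OF normalised ind \<sigma>] pr]) auto
  then show "absorbs H p r 10 (row \<sigma> i (e l))" by simp
qed

text \<open>Conjugation by the matrix that maps \<open>e n\<close> to \<open>e n + e m\<close> changes the entry of column \<open>n\<close> by that of column \<open>m\<close>.\<close>

lemma absorbs_anti_diagonal:
  assumes normalised: "normalised H" and \<sigma>: "\<sigma> \<in> H" and m: "m \<noteq> Zero"
  shows "absorbs_everywhere H (row \<sigma> (- m) (e m))"
  unfolding absorbs_everywhere_def
proof (intro allI impI)
  fix p r :: "3 theta" assume pr: "p \<noteq> Zero" "r \<noteq> Zero" "p \<noteq> r" "p \<noteq> - r"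
  obtain n where n: "n \<noteq> Zero" "m \<noteq> n" "m \<noteq> - n"
    using pr by (metis theta_minus_minus)
  obtain j where ind: "frame m j n" using third_index[OF m n] by blast
  note nn = frameD[OF ind] and ind' = frame_perm(6)[OF ind]
  define \<tau> where "\<tau> = short (- n) m (bar (om (- n)))"
  have \<tau>: "\<tau> \<in> EUf" unfolding \<tau>_def using nn by (intro short_long_EUf) auto
  have f: "\<tau> *v e (- (- m)) = e (- (- m))" unfolding \<tau>_def using nn by (auto intro!: short_fix)
  have "\<tau> *v e (- (- n)) = e (- (- n)) + (om (- n) * bar (om (- n))) *s e m"
    unfolding \<tau>_def using nn by (intro short_move) auto
  then have mn: "\<tau> *v e n = e n + e m" using nn om_bar[of "- n"] by simp
  have *: "absorbs H m s 7 (row \<sigma> (- m) (e m))" if s: "s = j \<or> s = - j" for s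
  proof -
    have fs: "\<tau> *v e s = e s" unfolding \<tau>_def using nn s by (auto intro!: short_fix)
    have "absorbs (conj_by \<tau> H) (- (- m)) s 7 (row (iv \<tau> ** \<sigma> ** \<tau>) (- m) (e n))"
      by (rule absorbs_row_entry[OF normalised_conj_by[OF normalised \<tau>] ind' conj_by_mem[OF \<sigma>] s])
    from conj_by_short[OF EUf_U[OF \<tau>] f fs this]
    have 1: "absorbs H m s 7 (row \<sigma> (- m) (e n + e m))"
      using row_conj[OF EUf_U[OF \<tau>] f, of \<sigma> "e n"] nn by (simp add: mn)
    have 2: "absorbs H m s 7 (row \<sigma> (- m) (e n))" using absorbs_row_entry[OF normalised ind' \<sigma> s] by simp
    have "absorbs H m s 7 (row \<sigma> (- m) (e n + e m) - row \<sigma> (- m) (e n))"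
      by (rule absorbs_diff[OF normalised _ _ _ 1 2]) (use nn s in auto)
    then show ?thesis by (simp add: row_simps)
  qed
  have "absorbs H p r (7 + 3) (row \<sigma> (- m) (e m))"
    by (rule absorbs_spread[OF normalised ind * * pr]) auto
  then show "absorbs H p r 10 (row \<sigma> (- m) (e m))" by simp
qed

lemma B_e_row: "a \<noteq> Zero \<Longrightarrow> B (e a) (\<sigma> *v w) = om a * row \<sigma> (- a) w"
  by (simp add: row_def)

lemma absorbs_everywhere_absorbs: "absorbs_everywhere H x \<Longrightarrow> p \<noteq> Zero \<Longrightarrow> r \<noteq> Zero \<Longrightarrow> p \<noteq> r \<Longrightarrow> p \<noteq> - r \<Longrightarrow> absorbs H p r 10 x"
  by (simp add: absorbs_everywhere_def)

context
  fixes p r t :: "3 theta" assumes ind: "frame p r t"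
begin

lemma frame_pos: "p \<noteq> Zero" "r \<noteq> Zero" "p \<noteq> r" "p \<noteq> - r"
  using frameD[OF ind] by auto

lemma absorbs_B_hb:
  assumes normalised: "normalised H" and \<sigma>: "\<sigma> \<in> H" and ab: "a \<noteq> Zero" "b \<noteq> Zero" "a \<noteq> - b"
  shows "absorbs H p r 10 (B (e a) (\<sigma> *v e b))"
proof -
  have "absorbs_everywhere H (row \<sigma> (- a) (e b))"
  proof (cases "a = b")
    case True then show ?thesis using absorbs_anti_diagonal[OF normalised \<sigma> ab(1)] by simp
  next
    case False
    then show ?thesis using ab by (intro absorbs_off_diagonal[OF normalised \<sigma>]) auto
  qed
  from absorbs_scale'[OF normalised absorbs_everywhere_absorbs[OF this frame_pos]] show ?thesis unfolding B_e_row[OF ab(1)] .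
qed

text \<open>Statements about the entries \<open>B u (\<sigma> w)\<close> that hold for all normalised subgroups may be applied
  to \<open>\<tau> u\<close> and \<open>\<tau> w\<close>. The remaining generators of \<open>uJ H\<close> are found in this way from those outside the diagonal.\<close>

lemma absorbs_B_conj:
  assumes normalised: "normalised H" and \<sigma>: "\<sigma> \<in> H" and \<tau>: "\<tau> \<in> EUf" and fx: "\<tau> *v e p = e p" "\<tau> *v e r = e r"
    and h: "\<And>H \<sigma>. normalised H \<Longrightarrow> \<sigma> \<in> H \<Longrightarrow> absorbs H p r 10 (B u (\<sigma> *v w))"
  shows "absorbs H p r 10 (B (\<tau> *v u) (\<sigma> *v (\<tau> *v w)))"
proof -
  note \<tau>U = EUf_U[OF \<tau>]
  have "B u ((iv \<tau> ** \<sigma> ** \<tau>) *v w) = B (\<tau> *v u) (\<sigma> *v (\<tau> *v w))"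
    using U_B[OF \<tau>U, of u "(iv \<tau> ** \<sigma> ** \<tau>) *v w"] by (simp add: mv_mul \<tau>U)
  then show ?thesis using conj_by_short[OF \<tau>U fx h[OF normalised_conj_by[OF normalised \<tau>] conj_by_mem[OF \<sigma>]]] by simp
qed

lemma absorbs_diagonal_step:
  assumes normalised: "normalised H" and \<sigma>: "\<sigma> \<in> H" and ab: "a \<noteq> Zero" "b \<noteq> Zero" "a \<noteq> b" "a \<noteq> - b"
    and c: "p \<noteq> - a" "p \<noteq> - b" "r \<noteq> - a" "r \<noteq> - b"
  shows "absorbs H p r 10 (\<sigma> $ (- b) $ (- b) - \<sigma> $ a $ a)"
proof -
  define \<tau> where "\<tau> = short a b (bar (om a))"
  have \<tau>: "\<tau> \<in> EUf" unfolding \<tau>_def using ab by (intro short_long_EUf) auto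
  have fx: "\<tau> *v e p = e p" "\<tau> *v e r = e r" unfolding \<tau>_def using c by (auto intro!: short_fix)
  have ma: "\<tau> *v e (- a) = e (- a) + e b"
    unfolding \<tau>_def using ab om_bar[of a] by (simp add: short_move)
  have mb: "\<tau> *v e (- b) = e (- b) - (om a * bar (om (- b))) *s e a"
    unfolding \<tau>_def short_mv using ab by (auto simp: B_e_right)
  have k: "om a * bar (om (- b)) * om (- a) = om b"
  proof -
    have "om a * om (- a) = \<ell>" using ab(1) by (cases a) (auto simp: om_def)
    moreover have "om a * bar (om (- b)) * om (- a) = (om a * om (- a)) * bar (om (- b))" by (simp only: ac_simps)
    ultimately show ?thesis by (simp add: om_uminus)
  qed
  have 1: "absorbs H p r 10 (B (\<tau> *v e (- a)) (\<sigma> *v (\<tau> *v e (- b))))"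
    by (rule absorbs_B_conj[OF normalised \<sigma> \<tau> fx absorbs_B_hb]) (use ab in \<open>auto simp: theta_swap\<close>)
  have 2: "absorbs H p r 10 (B (e (- a)) (\<sigma> *v e (- b)))" "absorbs H p r 10 (B (e b) (\<sigma> *v e a))"
    by (rule absorbs_B_hb[OF normalised \<sigma>]; use ab in \<open>auto simp: theta_swap\<close>)+
  have d: "absorbs H p r 10 x \<Longrightarrow> absorbs H p r 10 y \<Longrightarrow> absorbs H p r 10 (x - y)" "absorbs H p r 10 x \<Longrightarrow> absorbs H p r 10 y \<Longrightarrow> absorbs H p r 10 (x + y)" for x y
    using absorbs_diff[OF normalised frame_pos(1,2,4)] absorbs_add[OF normalised frame_pos(1,2,4)] by blast+
  have "absorbs H p r 10 (B (\<tau> *v e (- a)) (\<sigma> *v (\<tau> *v e (- b))) - B (e (- a)) (\<sigma> *v e (- b)) + (om a * bar (om (- b))) * B (e b) (\<sigma> *v e a))"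
    by (intro d 1 2 absorbs_scale'[OF normalised])
  also have "B (\<tau> *v e (- a)) (\<sigma> *v (\<tau> *v e (- b))) - B (e (- a)) (\<sigma> *v e (- b)) + (om a * bar (om (- b))) * B (e b) (\<sigma> *v e a)
      = om b * \<sigma> $ (- b) $ (- b) - (om a * bar (om (- b)) * om (- a)) * \<sigma> $ a $ a"
    unfolding ma mb mv_simps B_simps B_e_left mv_col by (simp add: algebra_simps)
  finally have "absorbs H p r 10 (om b * (\<sigma> $ (- b) $ (- b) - \<sigma> $ a $ a))" unfolding k by (simp add: algebra_simps)
  from absorbs_scale'[OF normalised this, of "bar (om b)"] show ?thesis using unit_cancel[OF ab(2)] by simp
qed

lemma absorbs_diagonal_diff:
  assumes normalised: "normalised H" and \<sigma>: "\<sigma> \<in> H" and ab: "a \<noteq> Zero" "b \<noteq> Zero"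
  shows "absorbs H p r 10 (\<sigma> $ a $ a - \<sigma> $ b $ b)"
proof -
  note n = frameD[OF ind]
  define d where "d k = \<sigma> $ k $ k" for k
  have D: "absorbs H p r 10 x \<Longrightarrow> absorbs H p r 10 y \<Longrightarrow> absorbs H p r 10 (x - y)" "absorbs H p r 10 x \<Longrightarrow> absorbs H p r 10 y \<Longrightarrow> absorbs H p r 10 (x + y)" for x y
    using absorbs_diff[OF normalised frame_pos(1,2,4)] absorbs_add[OF normalised frame_pos(1,2,4)] by blast+
  note st = absorbs_diagonal_step[OF normalised \<sigma>, folded d_def]
  have 1: "absorbs H p r 10 (d (- r) - d p)" by (rule st) (use n in auto)
  have 2: "absorbs H p r 10 (d (- t) - d p)" by (rule st) (use n in auto)
  have 3: "absorbs H p r 10 (d (- (- t)) - d p)" by (rule st) (use n in auto)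
  have "absorbs H p r 10 (d (- (- t)) - d r)" by (rule st) (use n in auto)
  from D(1)[OF 3 this] have 4: "absorbs H p r 10 (d r - d p)" by simp
  have "absorbs H p r 10 (d (- p) - d r)" by (rule st) (use n in auto)
  from D(2)[OF this 4] have 5: "absorbs H p r 10 (d (- p) - d p)" by simp
  have *: "absorbs H p r 10 (d k - d p)" if "k \<noteq> Zero" for k
    using frame_cases[OF ind, of k] that 1 2 3 4 5 absorbs_0[OF normalised] by auto
  from D(1)[OF *[OF ab(1)] *[OF ab(2)]] show ?thesis by (simp add: d_def)
qed

lemma long_choice:
  assumes a: "a \<noteq> Zero" "p \<noteq> - a" "r \<noteq> - a" and y: "y \<in> J_of \<Delta>"
  obtains \<tau> k z where "\<tau> \<in> EUf" "\<tau> *v e p = e p" "\<tau> *v e r = e r" "\<tau> *v e (- a) = e (- a) + y *s e Zero + k *s e a"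
    "\<And>b. b \<noteq> Zero \<Longrightarrow> b \<noteq> - a \<Longrightarrow> \<tau> *v e b = e b" "\<tau> = long a (bar (om a) * y, z)"
proof -
  have "bar (om a) * y \<in> J_of \<Delta>" using y by (rule JD_scale)
  then obtain z where z: "(bar (om a) * y, z) \<in> \<Delta>" by (auto simp: J_of_def)
  show ?thesis
  proof (rule that[of "long a (bar (om a) * y, z)" "bar z * om a" z])
    show "long a (bar (om a) * y, z) \<in> EUf" using a z by (intro short_long_EUf) auto
    show "long a (bar (om a) * y, z) *v e (- a) = e (- a) + y *s e Zero + (bar z * om a) *s e a"
      using a unit_cancel[of a y] by (simp add: long_move)
  qed (use a frame_pos in \<open>auto intro!: long_fix\<close>)
qed

lemma free_index: assumes "i \<noteq> Zero" obtains a where "a \<noteq> Zero" "p \<noteq> - a" "r \<noteq> - a" "i \<noteq> a" "i \<noteq> - a"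
proof (cases "i = t \<or> i = - t")
  case True then show ?thesis using that[of p] frameD[OF ind] by auto
next
  case False then show ?thesis using that[of t] frameD[OF ind] by auto
qed

lemma absorbs_B_zero:
  assumes normalised: "normalised H" and \<sigma>: "\<sigma> \<in> H" and i: "i \<noteq> Zero" and y: "y \<in> J_of \<Delta>"
  shows "absorbs H p r 10 (B (e i) (\<sigma> *v (y *s e Zero)))" "absorbs H p r 10 (B (y *s e Zero) (\<sigma> *v e i))"
proof -
  obtain a where a: "a \<noteq> Zero" "p \<noteq> - a" "r \<noteq> - a" "i \<noteq> a" "i \<noteq> - a" using free_index[OF i] .
  obtain \<tau> k z where \<tau>: "\<tau> \<in> EUf" and fx: "\<tau> *v e p = e p" "\<tau> *v e r = e r" and ma: "\<tau> *v e (- a) = e (- a) + y *s e Zero + k *s e a"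
    and fb: "\<And>b. b \<noteq> Zero \<Longrightarrow> b \<noteq> - a \<Longrightarrow> \<tau> *v e b = e b" using long_choice[OF a(1-3) y] by metis
  have fi: "\<tau> *v e i = e i" using fb i a by blast
  have D: "absorbs H p r 10 x \<Longrightarrow> absorbs H p r 10 y \<Longrightarrow> absorbs H p r 10 (x - y)" for x y
    using absorbs_diff[OF normalised frame_pos(1,2,4)] by blast
  note hb = absorbs_B_hb[OF normalised \<sigma>]
  have "absorbs H p r 10 (B (\<tau> *v e i) (\<sigma> *v (\<tau> *v e (- a))))"
    by (rule absorbs_B_conj[OF normalised \<sigma> \<tau> fx absorbs_B_hb]) (use a i in \<open>auto simp: theta_swap\<close>)
  moreover have "absorbs H p r 10 (B (e i) (\<sigma> *v e (- a)))"
    by (rule hb) (use a i in \<open>auto simp: theta_swap\<close>)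
  moreover have "absorbs H p r 10 (k * B (e i) (\<sigma> *v e a))"
    by (rule absorbs_scale'[OF normalised hb]) (use a i in \<open>auto simp: theta_swap\<close>)
  ultimately have "absorbs H p r 10 (B (\<tau> *v e i) (\<sigma> *v (\<tau> *v e (- a))) - B (e i) (\<sigma> *v e (- a)) - k * B (e i) (\<sigma> *v e a))"
    by (intro D)
  then show "absorbs H p r 10 (B (e i) (\<sigma> *v (y *s e Zero)))"
    unfolding fi ma mv_simps B_simps by (simp add: algebra_simps)
  have "absorbs H p r 10 (B (\<tau> *v e (- a)) (\<sigma> *v (\<tau> *v e i)))"
    by (rule absorbs_B_conj[OF normalised \<sigma> \<tau> fx absorbs_B_hb]) (use a i in \<open>auto simp: theta_swap\<close>)
  moreover have "absorbs H p r 10 (B (e (- a)) (\<sigma> *v e i))"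
    by (rule hb) (use a i in \<open>auto simp: theta_swap\<close>)
  moreover have "absorbs H p r 10 (bar k * B (e a) (\<sigma> *v e i))"
    by (rule absorbs_scale'[OF normalised hb]) (use a i in \<open>auto simp: theta_swap\<close>)
  ultimately have "absorbs H p r 10 (B (\<tau> *v e (- a)) (\<sigma> *v (\<tau> *v e i)) - B (e (- a)) (\<sigma> *v e i) - bar k * B (e a) (\<sigma> *v e i))"
    by (intro D)
  then show "absorbs H p r 10 (B (y *s e Zero) (\<sigma> *v e i))"
    unfolding fi ma mv_simps B_simps by (simp add: algebra_simps)
qed

lemma absorbs_zero_entry:
  assumes normalised: "normalised H" and \<sigma>: "\<sigma> \<in> H" and i: "i \<noteq> Zero" and y: "y \<in> J_of \<Delta>" "y' \<in> J_of \<Delta>"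
  shows "absorbs H p r 10 (bar y' * \<mu> * (\<sigma> $ Zero $ Zero - \<sigma> $ i $ i) * y)"
proof -
  have a: "t \<noteq> Zero" "p \<noteq> - t" "r \<noteq> - t" using frameD[OF ind] by auto
  obtain \<tau> k z where \<tau>: "\<tau> \<in> EUf" and fx: "\<tau> *v e p = e p" "\<tau> *v e r = e r" and ma: "\<tau> *v e (- t) = e (- t) + y *s e Zero + k *s e t"
    and \<tau>_eq: "\<tau> = long t (bar (om t) * y, z)" using long_choice[OF a y(1)] by metis
  define c where "c = om t * bar y * y' * \<mu> * bar \<ell>"
  have m0: "\<tau> *v (y' *s e Zero) = y' *s e Zero - c *s e t"
    unfolding \<tau>_eq long_mv c_def using a by (simp add: B_simps om_def bar_simps ac_simps)
  have cb: "bar c * om t = bar y' * \<mu> * y"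
  proof -
    have "bar c * om t = (om t * bar (om t)) * (bar y' * \<mu> * y)"
      unfolding c_def by (simp add: bar_simps ell_cancel_deep ac_simps)
    then show ?thesis using om_bar[OF a(1)] by simp
  qed
  have D: "absorbs H p r 10 x \<Longrightarrow> absorbs H p r 10 y \<Longrightarrow> absorbs H p r 10 (x - y)" "absorbs H p r 10 x \<Longrightarrow> absorbs H p r 10 y \<Longrightarrow> absorbs H p r 10 (x + y)" for x y
    using absorbs_diff[OF normalised frame_pos(1,2,4)] absorbs_add[OF normalised frame_pos(1,2,4)] by blast+
  have t': "- t \<noteq> Zero" using a by simp
  note sc = absorbs_scale'[OF normalised]
  have 1: "absorbs H p r 10 (B (\<tau> *v (y' *s e Zero)) (\<sigma> *v (\<tau> *v e (- t))))"
    by (rule absorbs_B_conj[OF normalised \<sigma> \<tau> fx absorbs_B_zero(2)]) (use a y in auto)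
  have 2: "absorbs H p r 10 (B (y' *s e Zero) (\<sigma> *v e (- t)))" by (rule absorbs_B_zero(2)[OF normalised \<sigma> t' y(2)])
  have 3: "absorbs H p r 10 (B (y' *s e Zero) (\<sigma> *v e t))" by (rule absorbs_B_zero(2)[OF normalised \<sigma> a(1) y(2)])
  have 4: "absorbs H p r 10 (B (e t) (\<sigma> *v (y *s e Zero)))" by (rule absorbs_B_zero(1)[OF normalised \<sigma> a(1) y(1)])
  have 5: "absorbs H p r 10 (B (e t) (\<sigma> *v e t))" by (rule absorbs_B_hb[OF normalised \<sigma>]) (use frameD[OF ind] in auto)
  have "absorbs H p r 10 (B (\<tau> *v (y' *s e Zero)) (\<sigma> *v (\<tau> *v e (- t))) - B (y' *s e Zero) (\<sigma> *v e (- t)) - k * B (y' *s e Zero) (\<sigma> *v e t)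
     + bar c * B (e t) (\<sigma> *v (y *s e Zero)) + (bar c * k) * B (e t) (\<sigma> *v e t))"
    by (intro D 1 2 3 4 5 sc)
  also have "B (\<tau> *v (y' *s e Zero)) (\<sigma> *v (\<tau> *v e (- t))) - B (y' *s e Zero) (\<sigma> *v e (- t)) - k * B (y' *s e Zero) (\<sigma> *v e t)
     + bar c * B (e t) (\<sigma> *v (y *s e Zero)) + (bar c * k) * B (e t) (\<sigma> *v e t)
     = bar y' * \<mu> * \<sigma> $ Zero $ Zero * y - (bar c * om t) * \<sigma> $ (- t) $ (- t)"
  proof -
    have "om Zero = \<mu>" by (simp add: om_def)
    then show ?thesis unfolding m0 ma unfolding mv_simps B_simps B_e_left mv_col by (simp add: algebra_simps)
  qed
  finally have A: "absorbs H p r 10 (bar y' * \<mu> * \<sigma> $ Zero $ Zero * y - (bar y' * \<mu> * y) * \<sigma> $ (- t) $ (- t))" unfolding cb .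
  have "absorbs H p r 10 ((bar y' * \<mu> * y) * (\<sigma> $ (- t) $ (- t) - \<sigma> $ i $ i))"
    by (rule sc[OF absorbs_diagonal_diff[OF normalised \<sigma> t' i]])
  from D(2)[OF A this] show ?thesis by (simp add: algebra_simps)
qed

lemma absorbs_level_gens:
  assumes normalised: "normalised H" and x: "x \<in> level_gens S \<Delta> H"
  shows "absorbs H p r 10 x"
proof -
  from x obtain \<sigma> i j where \<sigma>: "\<sigma> \<in> H" "i \<noteq> Zero" "j \<noteq> Zero" "i \<noteq> j" and
    x: "x \<in> {\<sigma> $ i $ j, \<sigma> $ i $ i - \<sigma> $ j $ j}
     \<union> {\<sigma> $ i $ Zero * y | y. y \<in> J_of \<Delta>}
     \<union> {bar y * \<mu> * \<sigma> $ Zero $ j | y. y \<in> J_of \<Delta>}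
     \<union> {bar y * \<mu> * (\<sigma> $ Zero $ Zero - \<sigma> $ j $ j) * z | y z. y \<in> J_of \<Delta> \<and> z \<in> J_of \<Delta>}"
    unfolding level_gens_def by blast
  have un: "bar (om (- i)) * (om (- i) * z) = z" for z using unit_cancel(2)[of "- i"] \<sigma> by simp
  have "absorbs H p r 10 (\<sigma> $ i $ j)"
  proof -
    have "absorbs H p r 10 (B (e (- i)) (\<sigma> *v e j))" by (rule absorbs_B_hb[OF normalised \<sigma>(1)]) (use \<sigma> in auto)
    from absorbs_scale'[OF normalised this, of "bar (om (- i))"] show ?thesis by (simp add: mv_col un)
  qed
  moreover have "absorbs H p r 10 (\<sigma> $ i $ Zero * y)" if "y \<in> J_of \<Delta>" for y
  proof -
    have "absorbs H p r 10 (B (e (- i)) (\<sigma> *v (y *s e Zero)))" by (rule absorbs_B_zero(1)[OF normalised \<sigma>(1) _ that]) (use \<sigma> in auto)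
    from absorbs_scale'[OF normalised this, of "bar (om (- i))"] show ?thesis by (simp add: mv_simps mv_col un mult.commute)
  qed
  moreover have "absorbs H p r 10 (bar y * \<mu> * \<sigma> $ Zero $ j)" if "y \<in> J_of \<Delta>" for y
    using absorbs_B_zero(2)[OF normalised \<sigma>(1,3) that] by (simp add: B_simps om_def mv_col mult.assoc)
  ultimately show ?thesis
    using x absorbs_diagonal_diff[OF normalised \<sigma>(1-3)] absorbs_zero_entry[OF normalised \<sigma>(1,3)] by auto
qed

end

lemma absorbs_uJ:
  assumes normalised: "normalised H" and x: "x \<in> uJ H" and pr: "p \<noteq> Zero" "r \<noteq> Zero" "p \<noteq> r" "p \<noteq> - r"
  shows "absorbs H p r 10 x"
proof -
  obtain t where "frame p t r" using third_index[OF pr] by blast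
  then have ind: "frame p r t" "frame r p t" using frame_perm by blast+
  have "x \<in> ideal_gen (level_gens S \<Delta> H \<union> bar ` level_gens S \<Delta> H)" using x by (simp add: uJ_eq)
  then show ?thesis
  proof (induction rule: ring_module.span_induct_alt)
    case base show ?case by (rule absorbs_0[OF normalised])
  next
    case (step c x y)
    from step(1) have "absorbs H p r 10 x"
      using absorbs_level_gens[OF ind(1) normalised] absorbs_sym[OF normalised absorbs_level_gens[OF ind(2) normalised]] by auto
    then show ?case using step absorbs_add[OF normalised pr(1,2,4)] absorbs_scale'[OF normalised] by blast
  qed
qed

lemma uJ_short:
  assumes normalised: "normalised H" and x: "x \<in> ideal_mult (uJ H) (ideal_pow I 10)" and pr: "p \<noteq> Zero" "r \<noteq> Zero" "p \<noteq> r" "p \<noteq> - r"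
  shows "short p r x \<in> H"
proof -
  have "x \<in> ideal_gen {x * y | x y. x \<in> uJ H \<and> y \<in> ideal_pow I 10}" using x by (simp add: ideal_mult_def)
  then show ?thesis
  proof (induction rule: ring_module.span_induct_alt)
    case base show ?case by (simp add: H_one[OF normalised])
  next
    case (step c x y)
    then obtain a b where ab: "x = a * b" "a \<in> uJ H" "b \<in> ideal_pow I 10" by auto
    have "short p r (a * (c * b)) \<in> H"
      by (rule absorbs_mem[OF normalised absorbs_uJ[OF normalised ab(2) pr] ideal_mult_left[OF pow_ideal ab(3)]])
    then have "short p r (c * x) \<in> H" by (simp add: ab(1) ac_simps)
    then show ?case using step short_H_add[OF normalised pr(1,2,4)] by simp
  qed
qed

end

context form_ring3 begin

section \<open>Long transvections\<close>

lemma long_0 [simp]: "long d (0, 0) = mat 1"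
  by (simp add: long_def)

lemma long_mult: "d \<noteq> Zero \<Longrightarrow> long d \<alpha> ** long d \<beta> = long d (\<beta> \<otimes>\<^bsub>heis S\<^esub> \<alpha>)"
  unfolding long_def by (cases \<alpha>; cases \<beta>, subst esd_e_mult)
    (auto simp: B_simps om_def vector_sadd_rdistrib add.commute ac_simps bar_simps)

lemma long_add0: "d \<noteq> Zero \<Longrightarrow> long d (x, y + t) = long d (x, y) ** long d (0, t)"
  by (simp add: long_mult add.commute)

text \<open>For fixed \<open>d\<close> the map \<open>long d\<close> reverses products, so preimages of subgroups are subgroups.\<close>

lemma hsubmod_long:
  assumes N: "subgroup N Ug" and d: "d \<noteq> Zero"
  shows "hsubmod {\<alpha>. \<forall>k\<in>ideal_pow L n. long d (act S \<alpha> k) \<in> N}"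
proof -
  have n: "long d (- x, - y - bar x * \<mu> * x) = iv (long d (x, y))" if "long d (x, y) \<in> N" for x y
  proof (rule left_inverse_iv)
    show "long d (- x, - y - bar x * \<mu> * x) ** long d (x, y) = mat 1"
      using d by (simp add: long_mult bar_simps)
    show "long d (x, y) \<in> carrier Ug" using subgroup.subset[OF N] that by blast
  qed
  show ?thesis
    unfolding hsubmod_def mem_Collect_eq
  proof (intro conjI allI impI ballI)
    fix k show "long d (act S (0, 0) k) \<in> N" using subgroup.one_closed[OF N] by simp
  next
    fix x y x' y' k
    assume a: "\<forall>k\<in>ideal_pow L n. long d (act S (x, y) k) \<in> N" "\<forall>k\<in>ideal_pow L n. long d (act S (x', y') k) \<in> N"
      and k: "k \<in> ideal_pow L n"
    have "act S (x + x', y + y' - bar x * \<mu> * x') k = act S (x, y) k \<otimes>\<^bsub>heis S\<^esub> act S (x', y') k"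
      using act_mult[of "(x, y)" "(x', y')" k] by simp
    then have "long d (act S (x + x', y + y' - bar x * \<mu> * x') k) = long d (act S (x', y') k) ** long d (act S (x, y) k)"
      using d by (simp add: long_mult)
    then show "long d (act S (x + x', y + y' - bar x * \<mu> * x') k) \<in> N"
      using a k subgroup.m_closed[OF N] by simp
  next
    fix x y k
    assume a: "\<forall>k\<in>ideal_pow L n. long d (act S (x, y) k) \<in> N" and k: "k \<in> ideal_pow L n"
    have "act S (- x, - y - bar x * \<mu> * x) k = inv\<^bsub>heis S\<^esub> (act S (x, y) k)"
      using act_inv[of "(x, y)" k] by simp
    then show "long d (act S (- x, - y - bar x * \<mu> * x) k) \<in> N"
      using a k n[of "x * k" "bar k * y * k"] subgroup.m_inv_closed[OF N] by simp
  next
    fix x y r k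
    assume a: "\<forall>k\<in>ideal_pow L n. long d (act S (x, y) k) \<in> N" and k: "k \<in> ideal_pow L n"
    have "r * k \<in> ideal_pow L n" by (rule ideal_mult_left[OF pow_ideal k])
    then have "long d (act S (x, y) (r * k)) \<in> N" using a by blast
    then show "long d (act S (x * r, bar r * y * r) k) \<in> N"
      using act_act[of "(x, y)" r k] by (simp add: mult.assoc)
  qed
qed

lemma ideal_mult_ideal: "is_ideal (ideal_mult A C)" for A C :: "'a set"
  unfolding ideal_mult_def by (rule ring_module.subspace_span)

lemma ideal_mult_mem: "a \<in> A \<Longrightarrow> c \<in> C \<Longrightarrow> a * c \<in> ideal_mult A C" for A C :: "'a set"
  unfolding ideal_mult_def by (rule ring_module.span_base) blast

lemma ideal_mult_mono: "C \<subseteq> C' \<Longrightarrow> ideal_mult A C \<subseteq> ideal_mult A C'" for A C :: "'a set"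
  unfolding ideal_mult_def by (rule ring_module.span_mono) blast

lemma ideal_mult_bar:
  assumes A: "\<And>x. x \<in> A \<Longrightarrow> bar x \<in> A" and C: "\<And>x. x \<in> C \<Longrightarrow> bar x \<in> C" and x: "x \<in> ideal_mult A C"
  shows "bar x \<in> ideal_mult A C"
  using x unfolding ideal_mult_def
proof (induction rule: ring_module.span_induct_alt)
  case base then show ?case by (simp add: ring_module.span_zero)
next
  case (step c x y)
  then have "bar x \<in> ideal_gen {x * y | x y. x \<in> A \<and> y \<in> C}"
    by (intro ring_module.span_base) (use A C in \<open>fastforce simp: bar_simps\<close>)
  then show ?case using step by (simp add: bar_simps ring_module.span_add ring_module.span_scale)
qed

lemma other_index:
  fixes p :: "3 theta" assumes "p \<noteq> Zero" obtains s :: "3 theta" where "s \<noteq> Zero" "p \<noteq> s" "p \<noteq> - s" "- p \<noteq> s" "s \<noteq> p" "s \<noteq> - p" "- s \<noteq> p"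
proof (cases "p = Pos 1 \<or> p = Neg 1")
  case True then show thesis using that[of "Pos 2"] by auto
next
  case False
  then have "- p \<noteq> Pos 1" by (cases p) auto
  with False show thesis using that[of "Pos 1"] by auto
qed

lemma esd_conj_short_frame:
  assumes g: "g \<in> carrier Ug" and "g *v e p = e p"
  shows "g ** esd (e p) v y ** iv g = esd (e p) (g *v v) y"
  using assms by (simp add: esd_conj_iv)

end

context lower begin

section \<open>Matrices common to all normalised subgroups of a given ideal\<close>

text \<open>The common part is stable under elementary conjugation (\<open>core_conj\<close>) because the family of these \<open>H\<close> is.\<close>

definition core :: "'a set \<Rightarrow> ('a, 3) mat_th set" where
  "core J = {g \<in> carrier Ug. \<forall>H. normalised H \<longrightarrow> uJ H = J \<longrightarrow> g \<in> H}"

lemma coreD: "g \<in> core J \<Longrightarrow> normalised H \<Longrightarrow> uJ H = J \<Longrightarrow> g \<in> H"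
  by (simp add: core_def)

lemma core_subgroup: "subgroup (core J) Ug"
proof (rule G.subgroupI)
  show "core J \<noteq> {}" using H_one G.one_closed by (auto simp: core_def)
  show "iv a \<in> core J" if "a \<in> core J" for a using that H_iv by (auto simp: core_def)
  show "a \<otimes>\<^bsub>Ug\<^esub> b \<in> core J" if "a \<in> core J" "b \<in> core J" for a b
    using that H_mul U_mul by (auto simp: core_def)
qed (auto simp: core_def)

lemma core_mul: "g \<in> core J \<Longrightarrow> h \<in> core J \<Longrightarrow> g ** h \<in> core J"
  and core_iv: "g \<in> core J \<Longrightarrow> iv g \<in> core J"
  and core_one: "mat 1 \<in> core J"
  and core_U: "g \<in> core J \<Longrightarrow> g \<in> carrier Ug"
  using subgroup.m_closed[OF core_subgroup, of g J h] subgroup.m_inv_closed[OF core_subgroup, of g J]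
    subgroup.one_closed[OF core_subgroup, of J] subgroup.subset[OF core_subgroup] by auto

lemma conj_byD: "g \<in> conj_by \<tau> H \<Longrightarrow> \<tau> \<in> carrier Ug \<Longrightarrow> H \<subseteq> carrier Ug \<Longrightarrow> \<tau> ** g ** iv \<tau> \<in> H"
  unfolding conj_by_def by (auto simp: matrix_mul_assoc iv_mul) (simp add: iv_mul flip: matrix_mul_assoc)

lemma normalised_subset: "normalised H \<Longrightarrow> H \<subseteq> carrier Ug"
  using H_U by blast

lemma core_conj:
  assumes "g \<in> core J" "\<tau> \<in> EUf" shows "\<tau> ** g ** iv \<tau> \<in> core J"
  unfolding core_def
proof (intro CollectI conjI allI impI)
  note \<tau> = EUf_U[OF assms(2)]
  show "\<tau> ** g ** iv \<tau> \<in> carrier Ug" using core_U[OF assms(1)] \<tau> by (simp add: U_mul)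
  fix H assume H: "normalised H" "uJ H = J"
  have "uJ (conj_by \<tau> H) = J" using upper_conj_by(1)[OF normalised_subset[OF H(1)] assms(2)] H(2) by simp
  then have "g \<in> conj_by \<tau> H" using coreD[OF assms(1) normalised_conj_by[OF H(1) assms(2)]] by simp
  then show "\<tau> ** g ** iv \<tau> \<in> H" by (rule conj_byD[OF _ \<tau> normalised_subset[OF H(1)]])
qed

context
  fixes J assumes J: "is_ideal J" and J_bar: "\<And>x. x \<in> J \<Longrightarrow> bar x \<in> J"
begin

text \<open>The least level with the ideal \<open>J I\<^sup>1\<^sup>0\<close>; its elementary matrices are in \<open>core J\<close>.\<close>

abbreviation K :: "'a set" where "K \<equiv> ideal_mult J (ideal_pow I 10)"
abbreviation K_forms :: "('a \<times> 'a) set" where "K_forms \<equiv> gen_form K {} UNIV"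

lemma K_ideal: "is_ideal K" by (rule ideal_mult_ideal)

lemma K_bar: "x \<in> K \<Longrightarrow> bar x \<in> K"
  by (rule ideal_mult_bar[OF J_bar pow_bar[OF I_bar]])

lemma K_is_level: "is_level K K_forms"
  by (rule gen_form_is_level(1)[OF K_ideal K_bar ring_module.subspace_UNIV]) auto

text \<open>For \<open>p = r\<close>, conjugation by an elementary matrix that maps \<open>e s\<close> to \<open>e s + e p\<close> reduces to the case \<open>p \<noteq> r\<close>
  at no cost, since \<open>core J\<close> is stable under all elementary conjugations.\<close>

lemma core_short:
  assumes x: "x \<in> K" and n: "p \<noteq> Zero" "r \<noteq> Zero" "p \<noteq> - r"
  shows "short p r x \<in> core J"
proof -
  have off: "short p r x \<in> core J" if "x \<in> K" "p \<noteq> Zero" "r \<noteq> Zero" "p \<noteq> r" "p \<noteq> - r" for p r x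
    using that uJ_short short_carrier by (auto simp: core_def)
  show ?thesis
  proof (cases "p = r")
    case False then show ?thesis using off[OF x n(1,2) _ n(3)] by simp
  next
    case [simp]: True
    obtain s where "s \<noteq> Zero" "p \<noteq> s" "p \<noteq> - s" by (rule other_index[OF n(1)])
    then have s: "s \<noteq> Zero" "p \<noteq> s" "p \<noteq> - s" "p \<noteq> - p" "- s \<noteq> p" "- s \<noteq> - p" "s \<noteq> p"
      using theta_ne_minus[OF n(1)] by auto
    define g where "g = short (- s) p (bar (om (- s)) * 1)"
    have "g \<in> EUf" unfolding g_def using n s by (intro short_long_EUf) auto
    then have "g ** short p s x ** iv g \<in> core J" using core_conj off[OF x n(1) s(1-3)] by blast
    also have "g ** short p s x ** iv g = short p s x ** short p p (x * 1)"
      by (rule short_conj[OF n(1) s(1) n(1) s(2,3,4,2,3) g_def])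
    finally have "short p s (- x) ** (short p s x ** short p p x) \<in> core J"
      using core_mul[OF off[OF ideal_neg[OF K_ideal x] n(1) s(1-3)]] by simp
    then show ?thesis using n s by (simp add: matrix_mul_assoc short_add)
  qed
qed

lemma core_long0: "x \<in> K \<Longrightarrow> d \<noteq> Zero \<Longrightarrow> long d (0, x - bar x * \<ell>) \<in> core J"
  using core_short[OF K_bar, of x d d] short_diag[of d "bar x"] theta_ne_minus[of d] by simp

text \<open>Conjugate \<open>short d r k\<close> by a long matrix that maps \<open>e r\<close> to \<open>e r + x e 0 + \<zeta> e (- r)\<close>, and remove the parts
  at \<open>r\<close> and \<open>- r\<close> by short transvections.\<close>

lemma core_long_act:
  assumes xz: "(x, z) \<in> \<Delta>" and k: "k \<in> K" and d: "d \<noteq> Zero"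
  shows "long d (act S (x, z) k) \<in> core J"
proof -
  obtain r where r: "r \<noteq> Zero" "d \<noteq> r" "d \<noteq> - r" "- d \<noteq> r" "r \<noteq> d" "r \<noteq> - d" "- r \<noteq> d"
    by (rule other_index[OF d])
  note n = d r theta_ne_minus[OF d] theta_ne_minus[OF r(1)]
  define \<zeta> where "\<zeta> = bar z * om (- r)"
  define g where "g = long (- r) (x * bar (om (- r)), z)"
  have "bar (bar (om (- r))) * z * bar (om (- r)) = z" using om_bar[of "- r"] r by (simp add: ac_simps)
  then have "(x * bar (om (- r)), z) \<in> \<Delta>" using hsubmod_act[OF \<Delta>_sub xz, of "bar (om (- r))"] by simp
  then have g: "g \<in> EUf" unfolding g_def using r by (intro short_long_EUf) auto
  have gd: "g *v e d = e d" unfolding g_def using n by (intro long_fix) auto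
  have "g *v e (- (- r)) = e (- (- r)) + (om (- r) * (x * bar (om (- r)))) *s e Zero + (bar z * om (- r)) *s e (- r)"
    unfolding g_def using n by (intro long_move) auto
  then have gr: "g *v e r = e r + x *s e Zero + \<zeta> *s e (- r)"
    using om_bar[of "- r"] r by (simp add: \<zeta>_def ac_simps)
  have "g ** short d r k ** iv g = esd (e d) (k *s e r + (k * x) *s e Zero + (k * \<zeta>) *s e (- r)) 0"
    unfolding short_def esd_conj_short_frame[OF EUf_U[OF g] gd] mv_scale gr by (simp add: vector_add_ldistrib vector_smult_assoc)
  then have 1: "esd (e d) (k *s e r + (k * x) *s e Zero + (k * \<zeta>) *s e (- r)) 0 \<in> core J"
    using core_conj[OF core_short[OF k d r(1,3)] g] by simp
  have kz: "k * \<zeta> \<in> K" by (rule ideal_mult_right[OF K_ideal k])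
  have S: "short d r (- k) \<in> core J" "short d (- r) (- (k * \<zeta>)) \<in> core J"
    using n by (auto intro!: core_short ideal_neg[OF K_ideal] k kz)
  have om: "bar (om (- r)) * om (- r) = 1" using om_bar[of "- r"] r by (simp add: mult.commute)
  have V: "- k *s e r + (k *s e r + (k * x) *s e Zero + (k * \<zeta>) *s e (- r)) + (- (k * \<zeta>)) *s e (- r) = (k * x) *s e Zero"
    by (simp add: vec_eq_iff algebra_simps)
  have "short d r (- k) ** esd (e d) (k *s e r + (k * x) *s e Zero + (k * \<zeta>) *s e (- r)) 0 ** short d (- r) (- (k * \<zeta>))
    = esd (e d) (- k *s e r + (k *s e r + (k * x) *s e Zero + (k * \<zeta>) *s e (- r)) + (- (k * \<zeta>)) *s e (- r))
        (k * bar k * z * (bar (om (- r)) * om (- r)))"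
    unfolding short_def using n
    by (subst esd_e_mult, simp, simp, simp, subst esd_e_mult) (auto simp: B_simps bar_simps \<zeta>_def ac_simps)
  also have "\<dots> = esd (e d) ((k * x) *s e Zero) (k * bar k * z * (bar (om (- r)) * om (- r)))"
    unfolding V ..
  also have "\<dots> = long d (act S (x, z) k)" unfolding om long_def by (simp add: ac_simps)
  finally show ?thesis using 1 S core_mul by metis
qed

lemma core_long: assumes a: "\<alpha> \<in> K_forms" and d: "d \<noteq> Zero" shows "long d \<alpha> \<in> core J"
proof -
  have "K_forms \<subseteq> {\<alpha>. \<forall>k\<in>ideal_pow UNIV 0. long d (act S \<alpha> k) \<in> core J}"
  proof (rule gen_form_subset[OF hsubmod_long[OF core_subgroup d]])
    fix x assume x: "x \<in> K"
    have "long d (act S (0, x - bar x * \<ell>) k) \<in> core J" for k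
    proof -
      have "act S (0, x - bar x * \<ell>) k = (0, x * (bar k * k) - bar (x * (bar k * k)) * \<ell>)"
        by (simp add: bar_simps algebra_simps)
      then show ?thesis using core_long0[OF ideal_mult_right[OF K_ideal x] d] by simp
    qed
    then show "(0, x - bar x * \<ell>) \<in> {\<alpha>. \<forall>k\<in>ideal_pow UNIV 0. long d (act S \<alpha> k) \<in> core J}" by blast
  next
    fix \<alpha> b assume "\<alpha> \<in> \<Delta>" "b \<in> K"
    then have "long d (act S \<alpha> (b * k)) \<in> core J" for k
      using core_long_act[of "fst \<alpha>" "snd \<alpha>"] ideal_mult_right[OF K_ideal] d by simp
    then show "act S \<alpha> b \<in> {\<alpha>. \<forall>k\<in>ideal_pow UNIV 0. long d (act S \<alpha> k) \<in> core J}" by (simp add: act_act)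
  qed simp
  then have "long d (act S \<alpha> 1) \<in> core J" using a by auto
  then show ?thesis by (simp add: act_def)
qed

text \<open>So membership of \<open>long d \<alpha>\<close> in \<open>H\<close> depends on \<open>\<alpha>\<close> only modulo the level of \<open>K\<close>.\<close>

lemma long_cong:
  assumes c: "cong_mod K_forms \<alpha> \<beta>" and d: "d \<noteq> Zero" and H: "normalised H" "uJ H = J" and b: "long d \<beta> \<in> H"
  shows "long d \<alpha> \<in> H"
proof -
  have "long d (heis_diff \<alpha> \<beta>) \<in> H" using coreD[OF core_long[OF _ d] H] c by (simp add: cong_mod_def)
  with b have "long d \<beta> ** long d (heis_diff \<alpha> \<beta>) \<in> H" by (rule H_mul[OF H(1)])
  moreover have "heis_diff \<alpha> \<beta> \<otimes>\<^bsub>heis S\<^esub> \<beta> = \<alpha>"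
    by (cases \<alpha>; cases \<beta>) (simp add: heis_diff_def algebra_simps)
  ultimately show ?thesis using d by (simp add: long_mult)
qed

text \<open>All coordinates of \<open>w\<close> except \<open>Zero\<close> are split off as short transvections in \<open>core J\<close>.\<close>

lemma esd_long_core:
  assumes d: "d \<noteq> Zero"
  shows "w $ (- d) = 0 \<Longrightarrow> (\<And>k. k \<noteq> Zero \<Longrightarrow> w $ k \<in> K) \<Longrightarrow> \<exists>n\<in>core J. esd (e d) w y = long d (Qplus y w) ** n"
proof (induction w arbitrary: y rule: vec_zero_span_induct)
  case (1 y0)
  have "esd (e d) (y0 *s e Zero) y = long d (Qplus y (y0 *s e Zero)) ** mat 1" by (simp add: long_def Qplus_def q_scale)
  with core_one show ?case by blast
next
  case (2 w x k)
  have x: "x \<in> K" using 2(5)[of k] 2(2,3) by simp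
  have wk: "w $ m \<in> K" if "m \<noteq> Zero" for m
    using 2(5)[OF that] 2(3) ideal_0[OF K_ideal] by (cases "m = k") auto
  show ?case
  proof (cases "k = - d")
    case True
    then have "x = 0" "w $ (- d) = 0" using 2(3,4) by auto
    then show ?thesis using 2(1) wk by simp
  next
    case k: False
    have wd: "w $ (- d) = 0" using 2(4) k by auto
    define b where "b = B (x *s e k) w"
    define g where "g = Bm w (x *s e k)"
    have b: "b \<in> K" unfolding b_def using 2(2) wk by (simp add: B_simps ideal_mult_left[OF K_ideal])
    have g: "g \<in> K" unfolding g_def Bm_scale_right by (rule ideal_mult_right[OF K_ideal x])
    have bg: "- (b + g) \<in> K" by (intro ideal_neg[OF K_ideal] ideal_add[OF K_ideal] b g)
    obtain n where n: "n \<in> core J" "esd (e d) w (y + b) = long d (Qplus (y + b) w) ** n"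
      using 2(1)[OF wd wk] by blast
    have "esd (e d) (w + x *s e k) y = esd (e d) w (y + b) ** short d k x"
      unfolding short_def using wd k d by (subst esd_e_mult) (auto simp: b_def)
    also have "Qplus (y + b) w = ((w + x *s e k) $ Zero, (q (w + x *s e k) + y) + ((b + g) - bar (b + g) * \<ell>))"
    proof -
      have "B w (x *s e k) = bar b * \<ell>" unfolding b_def by (subst B_herm) (rule mult.commute)
      then show ?thesis unfolding Qplus_def q_add g_def[symmetric] using 2(2)
        by (simp add: q_scale bar_simps algebra_simps)
    qed
    then have "long d (Qplus (y + b) w) = long d (Qplus y (w + x *s e k)) ** long d (0, (b + g) - bar (b + g) * \<ell>)"
      using long_add0[OF d] by (simp only: Qplus_def)
    then have "esd (e d) w (y + b) ** short d k x
      = long d (Qplus y (w + x *s e k)) ** (long d (0, (b + g) - bar (b + g) * \<ell>) ** n ** short d k x)"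
      unfolding n(2) by (simp add: matrix_mul_assoc)
    finally have "esd (e d) (w + x *s e k) y
      = long d (Qplus y (w + x *s e k)) ** (long d (0, (b + g) - bar (b + g) * \<ell>) ** n ** short d k x)" .
    moreover have "long d (0, (b + g) - bar (b + g) * \<ell>) ** n ** short d k x \<in> core J"
      using core_mul core_long0[OF ideal_add[OF K_ideal b g] d] n(1) core_short[OF x d 2(2)] k by (metis theta_minus_minus)
    ultimately show ?thesis by blast
  qed
qed

end
end

context form_ring3 begin

section \<open>The quadratic form of a column\<close>

lemma Qplus_0: "Qplus 0 u = Q u"
  by (simp add: Qplus_def Q_form_def)

lemma Q_scale: "Q (c *s u) = act S (Q u) c"
  by (simp add: prod_eq_iff act_def q_scale ac_simps)

text \<open>Changing a vector by a multiple from \<open>J\<close> of an orthogonal vector does not change \<open>Q\<close> modulo the level.\<close>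

lemma Q_perturb:
  assumes l: "is_level J \<Omega>" and k: "k \<in> J" and x: "Q x \<in> \<Delta>" and a: "a $ Zero \<in> J_of \<Delta>" and o: "B a x = 0"
  shows "cong_mod \<Omega> (Q (a + k *s x)) (Q a)"
proof -
  have "Q x = (x $ Zero, q x)" by (simp add: prod_eq_iff)
  with x have x': "(x $ Zero, q x) \<in> \<Delta>" by simp
  then have x0: "x $ Zero \<in> J_of \<Delta>" by (rule JD_I)
  have s: "small J (k *s x)"
    unfolding small_def using x0 by (simp add: JD_scale B_scale_right ideal_mult_right[OF is_level_ideal[OF l] k])
  have "(x $ Zero * k, bar k * q x * k) \<in> \<Omega>" by (rule is_level_act[OF l x' k])
  then have "Qplus (B a (k *s x) + 0 - 0) (k *s x) \<in> \<Omega>"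
    by (simp add: Qplus_def B_scale_right o q_scale ac_simps)
  then show ?thesis using cong_mod_small_iff[OF l s a, of 0 0] by (simp add: Qplus_0)
qed

lemma q_ideal:
  assumes J: "is_ideal J" "\<And>x. x \<in> J \<Longrightarrow> bar x \<in> J" and w: "\<And>k. k \<noteq> Zero \<Longrightarrow> k \<noteq> i \<Longrightarrow> w $ k \<in> J"
  shows "q w \<in> J"
  unfolding q_sum
proof (rule ideal_sum[OF J(1)])
  fix p :: "3 theta" assume "p \<in> Theta_pos"
  then have p: "p \<noteq> Zero" "- p \<noteq> p" using theta_ne_minus by auto
  show "bar (w $ p) * w $ (- p) \<in> J"
  proof (cases "p = i")
    case True then show ?thesis using w[of "- p"] p by (simp add: ideal_mult_left[OF J(1)])
  next
    case False then show ?thesis using w[of p] p by (simp add: ideal_mult_right[OF J(1)] J(2))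
  qed
qed

lemma act_cong': "is_level J \<Omega> \<Longrightarrow> \<alpha> \<in> \<Delta> \<Longrightarrow> c - c' \<in> J \<Longrightarrow> cong_mod \<Omega> (act S \<alpha> c) (act S \<alpha> c')"
  using act_cong by (cases \<alpha>) blast

lemma Bm_e: "v $ (- k) = 0 \<Longrightarrow> Bm (e k) v = 0"
  unfolding Bm_def by (rule sum.neutral) auto

lemma esd_flip: "esd u (\<alpha> *s e m) 0 = esd (e m) ((- (bar \<alpha> * bar \<ell>)) *s u) 0"
  by (subst esd_sym, subst esd_scale) (simp add: vector_smult_assoc)

text \<open>The matrix \<open>g\<close> maps \<open>e m\<close> to \<open>e m + b e d\<close>. So the conjugate splits into parts along \<open>e m\<close> and \<open>e d\<close> and a
  mixed part.\<close>

lemma long_conj: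
  assumes n: "m \<noteq> Zero" "d \<noteq> Zero" "d \<noteq> m" "d \<noteq> - m" and \<beta>: "(x, y) \<in> \<Delta>" and g: "g = short (- m) d (bar (om (- m)) * b)"
  shows "g ** long m (x, y) ** iv g = long m (x, y) ** long d (act S (x, y) (bar b)) ** short m d (bar y * b)"
proof -
  have n': "m \<noteq> - d" "- m \<noteq> d" "- m \<noteq> - d" "m \<noteq> d" "- m \<noteq> m" "- d \<noteq> d" "Zero \<noteq> m" "Zero \<noteq> d" "- d \<noteq> m"
    using n theta_ne_minus by (metis theta_minus_minus)+
  have gU: "g \<in> carrier Ug" unfolding g using n n' by (intro short_carrier) auto
  have g0: "g *v e Zero = e Zero" unfolding g using n n' by (intro short_fix) auto
  have "g *v e (- (- m)) = e (- (- m)) + (om (- m) * (bar (om (- m)) * b)) *s e d"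
    unfolding g using n n' by (intro short_move) auto
  then have gm: "g *v e m = e m + b *s e d" using n unit_cancel(1)[of "- m"] by simp
  have L: "g ** long m (x, y) ** iv g = esd (e m + b *s e d) (x *s e Zero) y"
    unfolding long_def by (simp add: esd_conj_iv[OF gU] gm g0 mv_scale)
  have f: "bar x * (x * \<mu>) * bar \<ell> = - (y * bar \<ell>) - bar y"
  proof -
    have "bar x * (x * \<mu>) = - y - bar y * \<ell>" using form_neg[OF \<beta>] by (simp add: algebra_simps)
    then show ?thesis by (simp add: left_diff_distrib mult.assoc)
  qed
  show ?thesis
  proof (rule mat_eqI)
    fix w
    define pm where "pm = B (e m) w"
    define pd where "pd = B (e d) w"
    define T where "T = bar (B w (e Zero))"
    have 1: "B w (e d) = \<ell> * bar pd" "B (e Zero) (e Zero) = \<mu>"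
      unfolding pd_def by (rule B_herm) (simp add: om_def)
    have o: "B (e m) (e m) = 0" "B (e m) (e d) = 0" "B (e m) (e Zero) = 0" "B (e d) (e d) = 0" "B (e d) (e m) = 0"
      "B (e d) (e Zero) = 0" "B (e Zero) (e m) = 0" "B (e Zero) (e d) = 0"
      using n n' by auto
    define w1 where "w1 = w + (pm * (bar y * b)) *s e d - (y * bar b * (bar \<ell> * pd)) *s e m"
    have X1: "short m d (bar y * b) *v w = w1"
      unfolding short_def esd_mv pm_def w1_def B_scale_right 1 by (simp add: bar_simps vector_smult_assoc ac_simps)
    have B1: "B (e d) w1 = pd" "B (e m) w1 = pm" "B w1 (e Zero) = B w (e Zero)"
      unfolding w1_def B_simps o by (simp_all add: pm_def pd_def)
    define w2 where "w2 = w1 + (pd * x * bar b) *s e Zero + (b * (bar b * bar y * pd - bar x * T)) *s e d"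
    have X2: "long d (act S (x, y) (bar b)) *v w1 = w2"
      unfolding long_def esd_apply w2_def act_simp fst_conv snd_conv B_scale_right B1
      by (simp add: bar_simps T_def vec_eq_iff algebra_simps)
    have B2: "B (e m) w2 = pm" "bar (B w2 (e Zero)) = T + pd * x * bar b * (\<mu> * bar \<ell>)"
      unfolding w2_def B_simps o B1 1 by (simp_all add: T_def bar_simps ac_simps)
    have X3: "long m (x, y) *v w2 = w2 + (pm * x) *s e Zero
        + (bar y * pm - bar x * T - pd * bar b * ((bar x * (x * \<mu>)) * bar \<ell>)) *s e m"
      unfolding long_def esd_apply fst_conv snd_conv B_scale_right B2 bar_mult
      by (simp add: vec_eq_iff algebra_simps)
    have L': "esd (e m + b *s e d) (x *s e Zero) y *v w
        = w + ((pm + bar b * pd) * x) *s e Zero + (bar y * (pm + bar b * pd) - bar x * T) *s (e m + b *s e d)"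
      unfolding esd_apply B_simps bar_mult
      unfolding pm_def[symmetric] pd_def[symmetric] T_def[symmetric] by (simp add: vec_eq_iff algebra_simps)
    show "(g ** long m (x, y) ** iv g) *v w = (long m (x, y) ** long d (act S (x, y) (bar b)) ** short m d (bar y * b)) *v w"
      unfolding L L' mv_mul X1 X2 X3 f
      unfolding w2_def w1_def by (simp add: vec_eq_iff algebra_simps)
  qed
qed

end

context lower begin

text \<open>The quotient is the conjugate by \<open>t\<close> of the commutator of \<open>n\<close> and \<open>x\<close>.\<close>

lemma conj_diff_core:
  assumes n: "n \<in> core J" and x: "x \<in> EUf" and t: "t \<in> EUf"
  shows "(t ** n ** x ** iv (t ** n)) ** iv (t ** x ** iv t) \<in> core J"
proof -
  have U: "n \<in> carrier Ug" "x \<in> carrier Ug" "t \<in> carrier Ug" using core_U[OF n] EUf_U x t by auto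
  have "t ** (n ** (x ** iv n ** iv x)) ** iv t \<in> core J"
    by (intro core_conj core_mul n core_iv x t)
  also have "t ** (n ** (x ** iv n ** iv x)) ** iv t = (t ** n ** x ** iv (t ** n)) ** iv (t ** x ** iv t)"
    using U G.inv_mult_group by (intro mat_eqI) (simp add: mv_mul U_mul)
  finally show ?thesis .
qed

context
  fixes H assumes normalised: "normalised H"
begin

lemma K_ideal_H: "is_ideal (K (uJ H))" by (rule K_ideal[OF uJ_ideal uJ_bar])
lemma K_level_H: "is_level (K (uJ H)) (K_forms (uJ H))" by (rule K_is_level[OF uJ_ideal uJ_bar])

lemma core_mem: "g \<in> core (uJ H) \<Longrightarrow> g \<in> H"
  using coreD[OF _ normalised] by blast

lemma long_cong_H: "cong_mod (K_forms (uJ H)) \<alpha> \<beta> \<Longrightarrow> d \<noteq> Zero \<Longrightarrow> long d \<beta> \<in> H \<Longrightarrow> long d \<alpha> \<in> H"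
  by (rule long_cong[OF uJ_ideal uJ_bar _ _ normalised refl])

text \<open>As in \<open>key_commutator\<close>, let \<open>t = esd u (v a) 0\<close>, now with row \<open>j\<close> of \<open>\<sigma>\<close>, so that \<open>\<xi> = \<sigma> t \<sigma>\<^sup>-\<^sup>1\<close> fixes
  \<open>e (- j)\<close>. The off-diagonal entries of the row lie in \<open>J\<close> and \<open>a\<close> in \<open>I\<^sup>1\<^sup>0\<close>, so \<open>t = t0 n0\<close> with a single short
  transvection \<open>t0\<close> that also fixes \<open>e (- j)\<close>, and with \<open>n0\<close> in \<open>core J\<close>. With a short transvection \<open>x\<close> along \<open>e (- j)\<close>
  the quotient of \<open>\<xi> x \<xi>\<^sup>-\<^sup>1\<close> and \<open>t0 x t0\<^sup>-\<^sup>1\<close> is in \<open>H\<close>; it is a transvection along \<open>e (- j)\<close> with a vector that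
  has all coordinates except \<open>Zero\<close> in \<open>J I\<^sup>1\<^sup>0\<close>. So up to \<open>core J\<close> it is the long transvection of its form,
  and this form is \<open>Q (\<xi> e (- l)) \<circ> b\<close>. Modulo the least level of \<open>J I\<^sup>1\<^sup>0\<close>, only the multiple of \<open>\<sigma> e i\<close> in
  \<open>\<xi> e (- l)\<close> contributes.\<close>

lemma long_column_product:
  assumes ind: "frame i j l" and \<sigma>: "\<sigma> \<in> H" and a'': "a'' \<in> ideal_pow I 10" and b: "b \<in> I"
  shows "long (- j) (act S (Q (\<sigma> *v e i)) (a'' * b)) \<in> H"
proof -
  note n = frameD[OF ind] and J = uJ_ideal[of H] and Jb = uJ_bar[of _ H]
  have \<sigma>U: "\<sigma> \<in> carrier Ug" by (rule H_U[OF normalised \<sigma>])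
  define c where "c = \<sigma> $ j $ j"
  define ci where "ci = \<sigma> $ j $ i"
  define cl where "cl = \<sigma> $ j $ l"
  have ci: "ci \<in> uJ H" and cl: "cl \<in> uJ H" unfolding ci_def cl_def using n by (auto intro!: level_mem(1)[OF \<sigma>])
  have un: "1 - c * bar c \<in> uJ H"
    unfolding c_def by (rule scalar_mod_unit[OF J Jb \<sigma>U upper_scalar_mod[OF \<sigma> n(2)]])
  define u where "u = c *s e i + (- ci) *s e j"
  define v where "v = c *s e l + (- cl) *s e j"
  \<comment> \<open>With this factor the form of column \<open>i\<close> is finally multiplied by \<open>a''\<close>, up to an element of \<open>J I\<^sup>1\<^sup>0\<close>.\<close>
  define a where "a = bar (- (om (- l) * c * a''))"
  have ba: "bar a = - (om (- l) * c * a'')" by (simp add: a_def)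
  have a10: "a \<in> ideal_pow I 10"
    unfolding a_def by (rule pow_bar[OF I_bar], assumption) (intro ideal_neg[OF pow_ideal] ideal_mult_left[OF pow_ideal] a'')
  have ba10: "bar a \<in> ideal_pow I 10" by (rule pow_bar[OF I_bar a10])
  have aI: "a \<in> I" using pow_in_I[of a 9] a10 by (simp del: ideal_pow.simps)
  define U where "U = \<sigma> *v u"
  define V where "V = \<sigma> *v v"
  have Uk: "U $ k = c * \<sigma> $ k $ i - ci * \<sigma> $ k $ j" for k by (simp add: U_def u_def mv_simps mv_col)
  have Vk: "V $ k = c * \<sigma> $ k $ l - cl * \<sigma> $ k $ j" for k by (simp add: V_def v_def mv_simps mv_col)
  have Uj: "U $ j = 0" "V $ j = 0" unfolding Uk Vk by (simp_all add: c_def ci_def cl_def)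
  have Ul: "U $ k \<in> uJ H" if "k \<noteq> Zero" "k \<noteq> i" for k
    unfolding Uk using n that by (intro ideal_diff[OF J] ideal_mult_left[OF J level_mem(1)[OF \<sigma>]] ideal_mult_right[OF J ci])
  have Ui: "U $ i - c * c \<in> uJ H"
  proof -
    have "c * (\<sigma> $ i $ i - c) - ci * \<sigma> $ i $ j \<in> uJ H"
      using n unfolding c_def by (intro ideal_diff[OF J] ideal_mult_left[OF J level_mem(2)[OF \<sigma>]] ideal_mult_right[OF J ci]) auto
    then show ?thesis by (simp add: Uk algebra_simps)
  qed
  have Vl: "V $ l - c * c \<in> uJ H"
  proof -
    have "c * (\<sigma> $ l $ l - c) - cl * \<sigma> $ l $ j \<in> uJ H"
      using n unfolding c_def by (intro ideal_diff[OF J] ideal_mult_left[OF J level_mem(2)[OF \<sigma>]] ideal_mult_right[OF J cl]) auto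
    then show ?thesis by (simp add: Vk algebra_simps)
  qed
  have Vc: "bar (V $ l) * c * c - 1 \<in> uJ H"
  proof -
    have "bar (V $ l - c * c) * (c * c) - (1 + c * bar c) * (1 - c * bar c) \<in> uJ H"
      by (intro ideal_diff[OF J] ideal_mult_right[OF J Jb[OF Vl]] ideal_mult_left[OF J un])
    then show ?thesis by (simp add: bar_simps algebra_simps)
  qed
  define t where "t = esd u (a *s v) 0"
  have av: "a *s v = 0 *s e i + (a * - cl) *s e j + (a * c) *s e l" by (simp add: v_def vec_eq_iff algebra_simps)
  have u3: "u = c *s e i + (- ci) *s e j + 0 *s e l" by (simp add: u_def)
  have t: "normalises H t" unfolding t_def av by (intro normalises_esd_span[OF normalised ind u3] ideal_mult_right[OF I aI] ideal_0[OF I])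
  note tU = normalises_U[OF normalised t]
  have uv0: "B u (e m) = 0 \<and> B v (e m) = 0 \<and> B (e m) u = 0" if "m \<in> {i, j, l}" for m
    using that n by (auto simp: B_e_right u_def v_def)
  have uu: "B u u = 0" "B u v = 0" by (simp_all add: u_def v_def B_simps) (use n in simp_all)
  \<comment> \<open>Expanded in the basis, \<open>t\<close> is a product of four short transvections. The parameter of the first one is not in
    \<open>J I\<^sup>1\<^sup>0\<close>.\<close>
  define x0 where "x0 = - (bar (a * c) * bar \<ell>) * c"
  define t0 where "t0 = short l i x0"
  define \<gamma> where "\<gamma> = bar (a * cl) * bar \<ell>"
  define n0 where "n0 = short l j (bar (a * c) * bar \<ell> * ci) ** (short j i (\<gamma> * c) ** short j j (- (\<gamma> * ci)))"
  have t0: "t0 \<in> EUf" unfolding t0_def using n by (intro short_long_EUf) auto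
  have tt: "t = t0 ** n0"
  proof -
    have "a *s v = (a * c) *s e l + (- (a * cl)) *s e j" by (simp add: v_def vec_eq_iff algebra_simps)
    then have "t = esd u ((a * c) *s e l) 0 ** esd u ((- (a * cl)) *s e j) 0"
      unfolding t_def using uu uv0 n by (subst esd_mult) (simp_all add: B_simps)
    moreover have "esd u ((a * c) *s e l) 0 = t0 ** short l j (bar (a * c) * bar \<ell> * ci)"
    proof -
      have "(- (bar (a * c) * bar \<ell>)) *s u = x0 *s e i + (bar (a * c) * bar \<ell> * ci) *s e j"
        by (simp add: u_def x0_def vec_eq_iff algebra_simps)
      then have "esd u ((a * c) *s e l) 0 = esd (e l) (x0 *s e i + (bar (a * c) * bar \<ell> * ci) *s e j) 0"
        by (rule trans[OF esd_flip arg_cong[where f = "\<lambda>v. esd (e l) v 0"]])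
      then show ?thesis unfolding t0_def short_def using n by (simp add: esd_e_mult B_simps)
    qed
    moreover have "esd u ((- (a * cl)) *s e j) 0 = short j i (\<gamma> * c) ** short j j (- (\<gamma> * ci))"
    proof -
      have "(- (bar (- (a * cl)) * bar \<ell>)) *s u = (\<gamma> * c) *s e i + (- (\<gamma> * ci)) *s e j"
        by (simp add: u_def \<gamma>_def bar_simps vec_eq_iff algebra_simps)
      then have "esd u ((- (a * cl)) *s e j) 0 = esd (e j) ((\<gamma> * c) *s e i + (- (\<gamma> * ci)) *s e j) 0"
        by (rule trans[OF esd_flip arg_cong[where f = "\<lambda>v. esd (e j) v 0"]])
      then show ?thesis unfolding short_def using n by (simp add: esd_e_mult B_simps)
    qed
    ultimately show ?thesis by (simp add: n0_def matrix_mul_assoc)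
  qed
  have n0: "n0 \<in> core (uJ H)"
  proof -
    have "bar (a * c) * bar \<ell> * ci \<in> K (uJ H)"
      using ideal_mult_right[OF K_ideal_H ideal_mult_mem[OF ci ba10], of "bar c * bar \<ell>"] by (simp add: bar_simps ac_simps)
    moreover have \<gamma>: "\<gamma> \<in> K (uJ H)"
      using ideal_mult_right[OF K_ideal_H ideal_mult_mem[OF Jb[OF cl] ba10], of "bar \<ell>"] by (simp add: \<gamma>_def bar_simps ac_simps)
    moreover from \<gamma> have "\<gamma> * c \<in> K (uJ H)" "- (\<gamma> * ci) \<in> K (uJ H)"
      by (auto intro: ideal_neg[OF K_ideal_H] ideal_mult_right[OF K_ideal_H])
    ultimately show ?thesis unfolding n0_def using n
      by (intro core_mul core_short[OF uJ_ideal uJ_bar]) auto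
  qed
  let ?d = "- j" and ?p = "e (- l) :: ('a, 3) vec_th"
  define \<xi> where "\<xi> = \<sigma> ** t ** iv \<sigma>"
  have \<xi>U: "\<xi> \<in> carrier Ug" unfolding \<xi>_def using \<sigma>U tU by (simp add: U_mul)
  have \<xi>: "\<xi> = esd U (a *s V) 0"
    unfolding \<xi>_def t_def U_def V_def esd_conj_iv[OF \<sigma>U] mv_scale ..
  have \<xi>d: "\<xi> *v e ?d = e ?d" unfolding \<xi> using Uj by (simp add: esd_apply B_simps B_e_right)
  define x where "x = short ?d (- l) b"
  have x: "normalises H x" unfolding x_def using b n by (intro normalises_short[OF normalised]) auto
  have xE: "x \<in> EUf" unfolding x_def using n by (intro short_long_EUf) auto
  define Z where "Z = esd (e ?d) (b *s (\<xi> *v ?p)) 0"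
  have Z: "\<xi> ** x ** iv \<xi> = Z" unfolding x_def short_def esd_conj_iv[OF \<xi>U] \<xi>d mv_scale Z_def ..
  define A where "A = t ** x ** iv t"
  have nA: "normalises H A" unfolding A_def by (intro normalises_mul[OF normalised] normalises_iv[OF normalised] t x)
  define A0 where "A0 = t0 ** x ** iv t0"
  have A0: "A0 = esd (e ?d) (b *s (t0 *v ?p)) 0"
  proof -
    have "t0 *v e ?d = e ?d" unfolding t0_def using n by (intro short_fix) auto
    then show ?thesis unfolding A0_def x_def short_def by (simp add: esd_conj_iv[OF EUf_U[OF t0]] mv_scale)
  qed
  have A0U: "A0 \<in> carrier Ug" unfolding A0_def using EUf_U t0 xE by (simp add: U_mul)
  have ZA: "Z ** iv A \<in> H"
  proof -
    define \<theta> where "\<theta> = \<sigma> ** t ** iv \<sigma> ** iv t"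
    have \<theta>: "\<theta> \<in> H" unfolding \<theta>_def by (rule comm_mem[OF normalised \<sigma> t])
    have "\<xi> = \<theta> ** t" unfolding \<theta>_def \<xi>_def using tU by (simp add: matrix_mul_assoc[symmetric] iv_mul)
    then have "Z = \<theta> ** A ** iv \<theta>"
      unfolding Z[symmetric] A_def using H_U[OF normalised \<theta>] tU by (simp add: iv_mul2[OF normalised] matrix_mul_assoc)
    then show ?thesis using comm_mem[OF normalised \<theta> nA] by simp
  qed
  have AA: "A ** iv A0 \<in> H"
    unfolding A_def A0_def tt using core_mem[OF conj_diff_core[OF n0 xE t0]] by simp
  have "(Z ** iv A) ** (A ** iv A0) \<in> H" by (rule H_mul[OF normalised ZA AA])
  also have "(Z ** iv A) ** (A ** iv A0) = Z ** iv A0"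
    using normalises_U[OF normalised nA] by (intro mat_eqI) (simp add: mv_mul)
  finally have ZA0: "Z ** iv A0 \<in> H" .
  \<comment> \<open>The vector \<open>D\<close> of the quotient of \<open>Z\<close> and \<open>A0\<close> is small because \<open>\<xi>\<close> and \<open>t0\<close> agree on \<open>e (- l)\<close> modulo \<open>J I\<^sup>1\<^sup>0\<close>.\<close>
  define r where "r = t0 *v ?p"
  define r' where "r' = \<xi> *v ?p"
  define D where "D = b *s r' - b *s r"
  define \<kappa> where "\<kappa> = om l * bar (U $ l) * a"
  define \<beta> where "\<beta> = bar (om (- l)) * bar a * bar (V $ l)"
  define w where "w = \<kappa> *s V + (- \<beta>) *s U"
  have r'_eq: "r' = ?p + w"
    unfolding r'_def \<xi> esd_apply w_def \<kappa>_def \<beta>_def B_scale_right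
    by (simp add: B_e_right vec_eq_iff bar_simps algebra_simps)
  have "om l * bar \<ell> = bar (om (- l))"
    using om_uminus[of l] by (metis ell_cancel(4) mult.commute)
  then have r_eq: "r = ?p + (- (bar (om (- l)) * bar a * bar c * c)) *s e i"
    unfolding r_def t0_def short_move[OF n(10)] x0_def
    by (simp add: bar_simps) (simp add: ac_simps)
  have \<kappa>: "\<kappa> \<in> K (uJ H)"
    using ideal_mult_left[OF K_ideal_H ideal_mult_mem[OF Jb[OF Ul] a10], of l "om l"] n by (simp add: \<kappa>_def ac_simps)
  have \<beta>10: "\<beta> \<in> ideal_pow I 10"
    unfolding \<beta>_def by (intro ideal_mult_right[OF pow_ideal] ideal_mult_left[OF pow_ideal] ba10)
  have K\<beta>: "y * \<beta> \<in> K (uJ H)" if "y \<in> uJ H" for y using ideal_mult_mem[OF that \<beta>10] .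
  have DK: "D $ k \<in> K (uJ H)" if k: "k \<noteq> Zero" for k
  proof -
    have "w $ k + (if k = i then bar (om (- l)) * bar a * bar c * c else 0) \<in> K (uJ H)"
    proof (cases "k = i")
      case False
      have "\<kappa> * V $ k - U $ k * \<beta> \<in> K (uJ H)"
        by (intro ideal_diff[OF K_ideal_H] ideal_mult_right[OF K_ideal_H \<kappa>] K\<beta> Ul k False)
      then show ?thesis using False by (simp add: w_def ac_simps)
    next
      case True
      have "(bar (V $ l) * c * c - 1) + bar (V $ l) * (U $ i - c * c) + (1 - c * bar c) \<in> uJ H"
        by (intro ideal_add[OF J] ideal_mult_left[OF J Ui] Vc un)
      from ideal_mult_left[OF K_ideal_H ideal_mult_mem[OF this ba10], of "bar (om (- l))"]
      have "\<kappa> * V $ i - bar (om (- l)) * (((bar (V $ l) * c * c - 1) + bar (V $ l) * (U $ i - c * c) + (1 - c * bar c)) * bar a) \<in> K (uJ H)"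
        by (intro ideal_diff[OF K_ideal_H] ideal_mult_right[OF K_ideal_H \<kappa>])
      then show ?thesis using True by (simp add: w_def \<beta>_def algebra_simps)
    qed
    then have "b * (w $ k + (if k = i then bar (om (- l)) * bar a * bar c * c else 0)) \<in> K (uJ H)"
      using ideal_mult_left[OF K_ideal_H] by blast
    then show ?thesis by (cases "k = i") (auto simp: D_def r'_eq r_eq algebra_simps)
  qed
  have rj: "r $ j = 0" "r' $ j = 0" using n Uj by (simp_all add: r_eq r'_eq w_def)
  have rr: "B r r = 0" unfolding r_def U_B[OF EUf_U[OF t0]] using n by simp
  have qr: "q r = 0"
  proof -
    have "r = ?p + (- (bar (om (- l)) * bar a * bar c * c)) *s e i" by (rule r_eq)
    then show ?thesis using n by (simp add: q_add q_scale B_simps Bm_scale_right Bm_e del: mult_minus_left)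
  qed
  define \<eta> where "\<eta> = B (b *s r) (b *s r')"
  have "iv A0 = esd (e ?d) (- (b *s r)) 0"
  proof (rule left_inverse_iv[OF _ A0U, symmetric])
    show "esd (e ?d) (- (b *s r)) 0 ** A0 = mat 1"
      unfolding A0 r_def[symmetric] using n rj rr by (subst esd_e_mult) (simp_all add: B_simps)
  qed
  then have "Z ** iv A0 = esd (e ?d) (b *s r') 0 ** esd (e ?d) (- (b *s r)) 0" by (simp only: Z_def r'_def)
  also have "\<dots> = esd (e ?d) D \<eta>"
    unfolding D_def \<eta>_def using n rj by (subst esd_e_mult) (simp_all add: B_simps)
  finally have "Z ** iv A0 = esd (e ?d) D \<eta>" .
  moreover have "\<exists>n\<in>core (uJ H). esd (e ?d) D \<eta> = long ?d (Qplus \<eta> D) ** n"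
    using n rj by (intro esd_long_core[OF uJ_ideal uJ_bar] DK) (simp_all add: D_def)
  ultimately obtain n' where n': "n' \<in> core (uJ H)" "Z ** iv A0 = long ?d (Qplus \<eta> D) ** n'" by auto
  have "long ?d (Qplus \<eta> D) = (long ?d (Qplus \<eta> D) ** n') ** iv n'"
    using core_U[OF n'(1)] by (simp add: matrix_mul_assoc[symmetric] iv_mul)
  also have "\<dots> \<in> H" using ZA0 n'(2) H_mul[OF normalised _ H_iv[OF normalised core_mem[OF n'(1)]]] by simp
  finally have L1: "long ?d (Qplus \<eta> D) \<in> H" .
  have "cong_mod (K_forms (uJ H)) (Q (b *s r')) (Qplus \<eta> D)"
  proof -
    define g where "g = Bm (b *s r) D"
    have g: "- g \<in> K (uJ H)" unfolding g_def by (intro ideal_neg[OF K_ideal_H] Bm_ideal[OF K_ideal_H] DK)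
    have e: "b *s r' = b *s r + D" by (simp add: D_def)
    have r0: "r $ Zero = 0" using n by (simp add: r_eq)
    have "\<eta> = B (b *s r) D" unfolding \<eta>_def D_def by (simp add: B_simps rr)
    then have "q (b *s r') = q D + \<eta> - (g - bar g * \<ell>)"
      unfolding e q_add g_def[symmetric] using r0 by (simp add: q_scale qr)
    moreover have "(b *s r') $ Zero = D $ Zero" unfolding e using r0 by simp
    ultimately have "heis_diff (Q (b *s r')) (Qplus \<eta> D) = (0, - g - bar (- g) * \<ell>)"
      by (simp add: heis_diff_def Qplus_def bar_simps)
    then show ?thesis unfolding cong_mod_def using is_level_min[OF K_level_H g] by simp
  qed
  from long_cong_H[OF this _ L1] have L2: "long ?d (Q (b *s r')) \<in> H" using n by simp
  have Q\<Delta>: "Q (\<sigma> *v e i) \<in> \<Delta>" "Q (\<sigma> *v e j) \<in> \<Delta>" using n by (auto intro: Q_col_\<Delta>[OF \<sigma>U])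
  \<comment> \<open>Four steps reduce \<open>Q (\<xi> e (- l))\<close>: omit \<open>e (- l)\<close>, omit the multiple of \<open>V\<close>, omit the multiple of \<open>\<sigma> e j\<close> in \<open>U\<close>,
    and replace the remaining factor by \<open>a''\<close>.\<close>
  have c1: "cong_mod (K_forms (uJ H)) (Q r') (Q w)"
  proof -
    define g where "g = Bm ?p w"
    define m where "m = - (bar a * bar (V $ l) * U $ l)"
    have "w $ l = \<kappa> * V $ l - U $ l * \<beta>" by (simp add: w_def)
    then have wl: "w $ l \<in> K (uJ H)"
      using n by (simp only:) (intro ideal_diff[OF K_ideal_H] ideal_mult_right[OF K_ideal_H \<kappa>] K\<beta> Ul; simp)
    have g: "g \<in> K (uJ H)"
      unfolding g_def Bm_def by (rule ideal_sum[OF K_ideal_H]) (use wl in \<open>auto intro: ideal_mult_left[OF K_ideal_H] ideal_0[OF K_ideal_H]\<close>)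
    have m: "m \<in> K (uJ H)"
      unfolding m_def using ideal_mult_right[OF K_ideal_H ideal_mult_mem[OF Ul ba10], of l "bar (V $ l)"] n
      by (intro ideal_neg[OF K_ideal_H]) (simp add: ac_simps)
    have o: "om (- l) * om l = \<ell>" using n(3) by (cases l) (simp_all add: om_def)
    have o': "om (- l) * bar (om (- l)) = 1" using n by (intro om_bar) simp
    have "B ?p w = (om (- l) * om l) * (bar (U $ l) * a * V $ l) - (om (- l) * bar (om (- l))) * (bar a * bar (V $ l) * U $ l)"
      by (simp add: w_def \<kappa>_def \<beta>_def algebra_simps)
    then have "B ?p w = m - bar m * \<ell>" unfolding o o' m_def by (simp add: bar_simps algebra_simps)
    then have "q r' = q w + (m - bar m * \<ell>) - (g - bar g * \<ell>)"
      unfolding r'_eq q_add g_def[symmetric] using n by simp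
    moreover have "r' $ Zero = w $ Zero" using n by (simp add: r'_eq)
    ultimately have "heis_diff (Q r') (Q w) = (0, (m - g) - bar (m - g) * \<ell>)"
      by (simp add: heis_diff_def bar_simps algebra_simps)
    then show ?thesis unfolding cong_mod_def using is_level_min[OF K_level_H ideal_diff[OF K_ideal_H m g]] by simp
  qed
  have 00: "Q u = (0, 0)" "Q v = (0, 0)"
  proof -
    have "q u = 0" "q v = 0" unfolding u_def v_def q_add using n by (simp_all add: q_scale B_simps Bm_scale_right Bm_scale_left Bm_e)
    then show "Q u = (0, 0)" "Q v = (0, 0)" using n by (simp_all add: prod_eq_iff u_def v_def)
  qed
  have "Qplus 0 V \<in> \<Delta>" unfolding V_def by (rule U_Qplus[OF \<sigma>U]) (simp add: Qplus_0 00 hsubmod_0[OF \<Delta>_sub])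
  then have QV: "Q V \<in> \<Delta>" by (simp add: Qplus_0)
  have U0: "U $ Zero \<in> J_of \<Delta>" unfolding U_def by (rule U_JD[OF \<sigma>U]) (use n in \<open>simp add: u_def\<close>)
  have "cong_mod (K_forms (uJ H)) (Q ((- \<beta>) *s U + \<kappa> *s V)) (Q ((- \<beta>) *s U))"
    by (rule Q_perturb[OF K_level_H \<kappa> QV]) (simp only: vec_simps JD_scale[OF U0], simp only: B_scale_left U_def V_def U_B[OF \<sigma>U] uu mult_zero_right)
  then have c2: "cong_mod (K_forms (uJ H)) (Q w) (Q ((- \<beta>) *s U))" by (simp add: w_def add.commute)
  have i0: "(\<sigma> *v e i) $ Zero \<in> J_of \<Delta>" by (rule U_JD[OF \<sigma>U]) (use n in simp)
  have "cong_mod (K_forms (uJ H)) (Q ((- \<beta> * c) *s (\<sigma> *v e i) + (ci * \<beta>) *s (\<sigma> *v e j))) (Q ((- \<beta> * c) *s (\<sigma> *v e i)))"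
    by (rule Q_perturb[OF K_level_H K\<beta>[OF ci] Q\<Delta>(2)]) (simp_all only: vec_simps JD_scale[OF i0] B_scale_left U_B[OF \<sigma>U], use n in simp)
  moreover have "(- \<beta> * c) *s (\<sigma> *v e i) + (ci * \<beta>) *s (\<sigma> *v e j) = (- \<beta>) *s U"
    by (simp add: U_def u_def mv_simps vec_eq_iff algebra_simps)
  ultimately have c3: "cong_mod (K_forms (uJ H)) (Q ((- \<beta>) *s U)) (act S (Q (\<sigma> *v e i)) (- \<beta> * c))" by (simp add: Q_scale)
  have c4: "cong_mod (K_forms (uJ H)) (act S (Q (\<sigma> *v e i)) (- \<beta> * c)) (act S (Q (\<sigma> *v e i)) a'')"
  proof -
    have o': "bar (om (- l)) * om (- l) = 1" using om_bar[of "- l"] n by (simp add: mult.commute)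
    have "- \<beta> * c = (bar (om (- l)) * om (- l)) * (bar (V $ l) * c * c * a'')"
      unfolding \<beta>_def ba by (simp add: ac_simps)
    then have "- \<beta> * c - a'' = (bar (V $ l) * c * c - 1) * a''" unfolding o' by (simp add: algebra_simps)
    then have "- \<beta> * c - a'' \<in> K (uJ H)" using ideal_mult_mem[OF Vc a''] by simp
    from act_cong'[OF K_level_H Q\<Delta>(1) this] show ?thesis .
  qed
  note h = is_level_hsubmod[OF K_level_H]
  have "cong_mod (K_forms (uJ H)) (Q r') (act S (Q (\<sigma> *v e i)) a'')"
    by (rule cong_mod_trans[OF h c1 cong_mod_trans[OF h c2 cong_mod_trans[OF h c3 c4]]])
  from cong_mod_sym[OF h cong_mod_act'[OF h this, of b]]
  have "cong_mod (K_forms (uJ H)) (act S (Q (\<sigma> *v e i)) (a'' * b)) (Q (b *s r'))" by (simp add: act_act Q_scale)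
  then show ?thesis by (rule long_cong_H) (use n L2 in auto)
qed

text \<open>The map \<open>k \<mapsto> \<alpha> \<circ> k\<close> is additive up to \<open>m - bar m \<ell>\<close> with \<open>m = bar k2 k1 q (\<sigma> e i)\<close>, which is in \<open>J I\<^sup>1\<^sup>0\<close>.\<close>

lemma long_column_add:
  assumes y: "Q (\<sigma> *v e i) \<in> \<Delta>" "q (\<sigma> *v e i) \<in> uJ H" and d: "d \<noteq> Zero"
    and k: "k1 \<in> ideal_pow I 10"
    and L: "long d (act S (Q (\<sigma> *v e i)) k1) \<in> H" "long d (act S (Q (\<sigma> *v e i)) k2) \<in> H"
  shows "long d (act S (Q (\<sigma> *v e i)) (k1 + k2)) \<in> H"
proof -
  define x where "x = (\<sigma> *v e i) $ Zero"
  define z where "z = q (\<sigma> *v e i)"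
  have Q: "Q (\<sigma> *v e i) = (x, z)" by (simp add: x_def z_def prod_eq_iff)
  have f: "bar x * \<mu> * x = - z - bar z * \<ell>" using form_neg[of x z] y unfolding Q by (simp add: algebra_simps)
  define m where "m = bar k2 * k1 * z"
  have m: "m \<in> K (uJ H)"
    using ideal_mult_left[OF K_ideal_H ideal_mult_mem[OF y(2) k], of "bar k2"] by (simp add: m_def z_def ac_simps)
  have "bar (x * k1) * \<mu> * (x * k2) = bar k1 * (bar x * \<mu> * x) * k2" by (simp add: bar_simps ac_simps)
  then have "heis_diff (act S (x, z) (k1 + k2)) (act S (x, z) k1 \<otimes>\<^bsub>heis S\<^esub> act S (x, z) k2) = (0, m - bar m * \<ell>)"
    unfolding f by (simp add: heis_diff_def m_def bar_simps algebra_simps)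
  then have "cong_mod (K_forms (uJ H)) (act S (x, z) (k1 + k2)) (act S (x, z) k1 \<otimes>\<^bsub>heis S\<^esub> act S (x, z) k2)"
    unfolding cong_mod_def using is_level_min[OF K_level_H m] by simp
  moreover have "long d (act S (x, z) k1 \<otimes>\<^bsub>heis S\<^esub> act S (x, z) k2) \<in> H"
    using H_mul[OF normalised L(2,1)] unfolding Q long_mult[OF d] .
  ultimately show ?thesis unfolding Q by (rule long_cong_H[OF _ d])
qed

lemma column_form:
  assumes \<sigma>: "\<sigma> \<in> H" and i: "i \<noteq> Zero"
  shows "Q (\<sigma> *v e i) \<in> \<Delta>" "q (\<sigma> *v e i) \<in> uJ H"
  using Q_col_\<Delta>[OF H_U[OF normalised \<sigma>] i] q_ideal[OF uJ_ideal uJ_bar, of H i "\<sigma> *v e i"] level_mem(1)[OF \<sigma> _ i]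
  by (auto simp: mv_col)

lemma long_column_extend:
  assumes \<sigma>: "\<sigma> \<in> H" and i: "i \<noteq> Zero" and d: "d \<noteq> Zero" and n: "10 \<le> n"
    and L: "\<And>a b. a \<in> ideal_pow I n \<Longrightarrow> b \<in> I \<Longrightarrow> long d (act S (Q (\<sigma> *v e i)) (a * b)) \<in> H"
    and k: "k \<in> ideal_pow I (Suc n)"
  shows "long d (act S (Q (\<sigma> *v e i)) k) \<in> H"
proof -
  have "k \<in> ideal_pow I 10 \<and> long d (act S (Q (\<sigma> *v e i)) k) \<in> H"
    using k
  proof (rule pow_induct[where R = "\<lambda>k. k \<in> ideal_pow I 10 \<and> long d (act S (Q (\<sigma> *v e i)) k) \<in> H"])
    show "0 \<in> ideal_pow I 10 \<and> long d (act S (Q (\<sigma> *v e i)) 0) \<in> H"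
      using ideal_0[OF pow_ideal] H_one[OF normalised] by (simp add: act_def del: ideal_pow.simps)
    show "a * b \<in> ideal_pow I 10 \<and> long d (act S (Q (\<sigma> *v e i)) (a * b)) \<in> H" if "a \<in> ideal_pow I n" "b \<in> I" for a b
      using that L pow_mono[OF I n] ideal_mult_right[OF pow_ideal] by blast
    show "x + y \<in> ideal_pow I 10 \<and> long d (act S (Q (\<sigma> *v e i)) (x + y)) \<in> H"
      if "x \<in> ideal_pow I 10 \<and> long d (act S (Q (\<sigma> *v e i)) x) \<in> H" "y \<in> ideal_pow I 10 \<and> long d (act S (Q (\<sigma> *v e i)) y) \<in> H" for x y
      using that long_column_add[OF column_form[OF \<sigma> i] d] ideal_add[OF pow_ideal] by blast
  qed
  then show ?thesis ..
qed

lemma long_column_11: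
  assumes \<sigma>: "\<sigma> \<in> H" and n: "i \<noteq> Zero" "d \<noteq> Zero" "d \<noteq> i" "d \<noteq> - i" and k: "k \<in> ideal_pow I 11"
  shows "long d (act S (Q (\<sigma> *v e i)) k) \<in> H"
proof -
  obtain l where "frame i l (- d)" using third_index[of i "- d"] n by (metis theta_minus_minus theta_minus_Zero(1))
  then have ind: "frame i (- d) l" by (rule frame_perm)
  have "k \<in> ideal_pow I (Suc 10)" using k by simp
  then show ?thesis
    by (rule long_column_extend[OF \<sigma> n(1,2) order_refl, rotated]) (use long_column_product[OF ind \<sigma>] in simp)
qed

end
end

context form_ring3 begin

section \<open>The form parameter of the upper level\<close>

lemma hsubmod_Int: "hsubmod A \<Longrightarrow> hsubmod C \<Longrightarrow> hsubmod (A \<inter> C)"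
  unfolding hsubmod_def Int_iff by simp

text \<open>If \<open>\<tau>\<^sup>-\<^sup>1 w\<close> has the form zero, then \<open>Q\<close> at the image of \<open>w\<close> under \<open>\<tau>\<^sup>-\<^sup>1 \<sigma>\<close> measures how far \<open>\<sigma>\<close> is from the
  scalar \<open>c\<close> on the form of \<open>w\<close>; the argument is that of \<open>level_scalar_conj\<close> read backwards.\<close>

lemma scalar_of_conj_image:
  assumes l: "is_level J \<Omega>" and \<sigma>: "\<sigma> \<in> carrier Ug" and scalar_mod: "scalar_mod J c \<sigma>" and \<tau>: "form_invariant J \<Omega> \<tau>"
    and e: "Q (c *s (iv \<tau> *v w)) = (0, 0)" and w: "w $ Zero \<in> J_of \<Delta>"
    and Q: "Q ((iv \<tau> ** \<sigma>) *v w) \<in> \<Omega>"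
  shows "cong_mod \<Omega> (Q (\<sigma> *v w)) (act S (Q w) c)"
proof -
  note h = is_level_hsubmod[OF l] and \<tau>U = \<tau>[unfolded form_invariant_def, THEN conjunct1]
  have \<tau>iU: "iv \<tau> \<in> carrier Ug" using \<tau>U by simp
  define \<delta> where "\<delta> = \<sigma> *v w - c *s w"
  define \<delta>' where "\<delta>' = iv \<tau> *v \<delta>"
  define a where "a = c *s (iv \<tau> *v w)"
  have \<delta>: "small J \<delta>" unfolding \<delta>_def by (rule scalar_mod_small[OF scalar_mod \<sigma> w])
  have \<delta>': "small J \<delta>'" unfolding \<delta>'_def by (rule small_U[OF \<tau>iU \<delta>])
  have a0: "a $ Zero \<in> J_of \<Delta>" unfolding a_def vec_simps by (intro JD_scale U_JD[OF \<tau>iU w])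
  have w0: "(c *s w) $ Zero \<in> J_of \<Delta>" unfolding vec_simps by (rule JD_scale[OF w])
  have "(iv \<tau> ** \<sigma>) *v w = a + \<delta>'" unfolding a_def \<delta>'_def \<delta>_def by (simp add: mv_simps)
  with Q have "Q (a + \<delta>') \<in> \<Omega>" by simp
  moreover have "heis_diff (Q (a + \<delta>')) (Q a) = Q (a + \<delta>')" unfolding a_def e by (simp add: heis_diff_def prod_eq_iff)
  ultimately have "cong_mod \<Omega> (Qplus 0 (a + \<delta>')) (Qplus 0 a)" unfolding Qplus_0 cong_mod_def by simp
  then have "Qplus (B a \<delta>') \<delta>' \<in> \<Omega>" using cong_mod_small_iff[OF l \<delta>' a0, of 0 0] by simp
  moreover have "cong_mod \<Omega> (Qplus (B a \<delta>') \<delta>) (Qplus (B a \<delta>') \<delta>')"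
  proof -
    have "cong_mod \<Omega> (Q (\<tau> *v \<delta>')) (Q \<delta>')" using \<tau> \<delta>' by (simp add: form_invariant_def)
    then have "cong_mod \<Omega> (Q \<delta>) (Q \<delta>')" using \<tau>U by (simp add: \<delta>'_def)
    then show ?thesis using cong_mod_shift unfolding Qplus_def by (simp add: Q_form_def)
  qed
  ultimately have "Qplus (B a \<delta>') \<delta> \<in> \<Omega>" using cong_mod_mem[OF h] by blast
  moreover have "B a \<delta>' = B (c *s w) \<delta>" unfolding a_def \<delta>'_def B_scale_left U_B[OF \<tau>iU] ..
  ultimately have "cong_mod \<Omega> (Qplus 0 (c *s w + \<delta>)) (Qplus 0 (c *s w))" using cong_mod_small_iff[OF l \<delta> w0, of 0 0] by simp
  then show ?thesis unfolding Qplus_0 by (simp add: \<delta>_def Q_scale)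
qed

end

context lower begin

context
  fixes H assumes normalised: "normalised H"
begin

text \<open>For \<open>d = \<plusminus>i\<close>, conjugate a long transvection at a position \<open>m \<noteq> \<plusminus>i\<close> (\<open>long_conj\<close>). The short
  transvection that arises has its parameter in \<open>J I\<^sup>1\<^sup>0\<close> since \<open>q (\<sigma> e i)\<close> is in \<open>J\<close>.\<close>

lemma long_column_12:
  assumes \<sigma>: "\<sigma> \<in> H" and n: "i \<noteq> Zero" "d \<noteq> Zero" and k: "k \<in> ideal_pow I 12"
  shows "long d (act S (Q (\<sigma> *v e i)) k) \<in> H"
proof (cases "d = i \<or> d = - i")
  case False
  have "k \<in> ideal_pow I 11" using pow_mono[OF I, of 11 12] k by (auto simp del: ideal_pow.simps)
  then show ?thesis using long_column_11[OF normalised \<sigma> n] False by blast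
next
  case True
  have k': "k \<in> ideal_pow I (Suc 11)" using k by simp
  note f = column_form[OF normalised \<sigma> n(1)]
  obtain m where m: "m \<noteq> Zero" "i \<noteq> m" "i \<noteq> - m" "- i \<noteq> m" "m \<noteq> i" "m \<noteq> - i" "- m \<noteq> i"
    by (rule other_index[OF n(1)])
  have md: "d \<noteq> m" "d \<noteq> - m" "m \<noteq> - d" "- m \<noteq> - d" using True m by auto
  show ?thesis
  proof (rule long_column_extend[OF normalised \<sigma> n _ _ k'])
    fix a b assume a: "a \<in> ideal_pow I 11" and b: "b \<in> I"
    define x where "x = (\<sigma> *v e i) $ Zero * a"
    define y where "y = bar a * q (\<sigma> *v e i) * a"
    have xy: "act S (Q (\<sigma> *v e i)) a = (x, y)" by (simp add: act_def x_def y_def)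
    have D: "(x, y) \<in> \<Delta>" unfolding xy[symmetric] by (rule hsubmod_act'[OF \<Delta>_sub f(1)])
    have "a \<in> ideal_pow I 10" using pow_mono[OF I, of 10 11] a by (auto simp del: ideal_pow.simps)
    from ideal_mult_left[OF K_ideal_H[OF normalised] ideal_mult_mem[OF f(2) this], of "bar a"]
    have y: "y \<in> K (uJ H)" by (simp add: y_def ac_simps)
    have y': "bar y * bar b \<in> K (uJ H)"
      by (rule ideal_mult_right[OF K_ideal_H[OF normalised] K_bar[OF uJ_ideal uJ_bar y]])
    define g where "g = short (- m) d (bar (om (- m)) * bar b)"
    have g: "normalises H g" unfolding g_def using n m md b
      by (intro normalises_short[OF normalised] ideal_mult_left[OF I] I_bar) auto
    have L: "long m (x, y) \<in> H" unfolding xy[symmetric] by (rule long_column_11[OF normalised \<sigma> n(1) m(1,5,6) a])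
    have S: "short m d (bar y * bar b) \<in> H"
      using md m n by (intro core_mem[OF normalised] core_short[OF uJ_ideal uJ_bar y']) auto
    have M: "long m (x, y) ** long d (act S (x, y) b) ** short m d (bar y * bar b) \<in> H"
      using normalises_conj[OF normalised g L] unfolding long_conj[OF m(1) n(2) md(1,2) D g_def] bar_bar .
    have "iv (long m (x, y)) ** (long m (x, y) ** long d (act S (x, y) b) ** short m d (bar y * bar b)) ** iv (short m d (bar y * bar b)) \<in> H"
      by (intro H_mul[OF normalised] H_iv[OF normalised] L S M)
    also have "iv (long m (x, y)) ** (long m (x, y) ** long d (act S (x, y) b) ** short m d (bar y * bar b)) ** iv (short m d (bar y * bar b)) = long d (act S (x, y) b)"
      using H_U[OF normalised L] H_U[OF normalised S] by (intro mat_eqI) (simp add: mv_mul)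
    finally show "long d (act S (Q (\<sigma> *v e i)) (a * b)) \<in> H"
      unfolding xy[symmetric] act_act .
  qed simp
qed

text \<open>One set for each position \<open>d\<close>, since \<open>absorbed_forms_conj_column\<close> uses auxiliary indices that depend on \<open>d\<close>.\<close>

definition absorbed_forms :: "3 theta \<Rightarrow> ('a \<times> 'a) set" where
  "absorbed_forms d = \<Delta> \<inter> tilde_forms (uJ H) \<inter> {\<alpha>. \<forall>k\<in>ideal_pow I 12. long d (act S \<alpha> k) \<in> H}"

lemma uJ_pow12_K: "x \<in> uJ H \<Longrightarrow> k \<in> ideal_pow I 12 \<Longrightarrow> x * k \<in> K (uJ H)"
  using pow_mono[OF I, of 10 12] ideal_mult_mem[of x "uJ H" k "ideal_pow I 10"] by (auto simp del: ideal_pow.simps)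

text \<open>Multiplication by \<open>I\<^sup>1\<^sup>2\<close> sends the minimal forms of ideal \<open>J\<close> into those of ideal \<open>J I\<^sup>1\<^sup>0\<close>.\<close>

lemma absorbed_forms_is_level:
  assumes d: "d \<noteq> Zero" shows "is_level (uJ H) (absorbed_forms d)"
proof -
  note J = uJ_ideal[of H]
  have "hsubmod (absorbed_forms d)" unfolding absorbed_forms_def
    by (intro hsubmod_Int \<Delta>_sub tilde_forms_hsubmod[OF J] hsubmod_long[OF H_sub[OF normalised] d])
  moreover have "(0, x - bar x * \<ell>) \<in> absorbed_forms d" if x: "x \<in> uJ H" for x
  proof -
    have "long d (act S (0, x - bar x * \<ell>) k) \<in> H" if k: "k \<in> ideal_pow I 12" for k
    proof -
      define x' where "x' = bar k * x * k"
      have "x' \<in> K (uJ H)" unfolding x'_def by (intro uJ_pow12_K ideal_mult_left[OF J x] k)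
      from core_mem[OF normalised core_long0[OF uJ_ideal uJ_bar this d]]
      show ?thesis by (simp add: x'_def bar_simps algebra_simps)
    qed
    then show ?thesis unfolding absorbed_forms_def using \<Delta>_min by (auto simp: tilde_forms_def ideal_0[OF J])
  qed
  moreover have "(x * a, bar a * y * a) \<in> absorbed_forms d" if xy: "(x, y) \<in> \<Delta>" and a: "a \<in> uJ H" for x y a
  proof -
    have "long d (act S (x, y) (a * k)) \<in> H" if k: "k \<in> ideal_pow I 12" for k
      by (rule core_mem[OF normalised core_long_act[OF uJ_ideal uJ_bar xy uJ_pow12_K[OF a k] d]])
    then have "long d (act S (x * a, bar a * y * a) k) \<in> H" if k: "k \<in> ideal_pow I 12" for k
      using k act_act[of "(x, y)" a k] by (simp add: mult.assoc)
    then show ?thesis unfolding absorbed_forms_def using hsubmod_act[OF \<Delta>_sub xy]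
      by (auto simp: tilde_forms_def mult.assoc[symmetric] intro: ideal_mult_left[OF J a])
  qed
  ultimately show ?thesis
    unfolding is_level_def using J uJ_bar[of _ H] by (auto simp: absorbed_forms_def tilde_forms_def)
qed

lemma absorbed_forms_column:
  assumes \<sigma>: "\<sigma> \<in> H" and n: "i \<noteq> Zero" "d \<noteq> Zero"
  shows "Q (\<sigma> *v e i) \<in> absorbed_forms d"
  unfolding absorbed_forms_def using long_column_12[OF \<sigma> n] column_form(1)[OF normalised \<sigma> n(1)]
    level_form_sub(2)[OF normalised_subset[OF normalised]] level_form_mem(1)[OF \<sigma> n(1)] by blast

end

text \<open>The conjugate of \<open>H\<close> by \<open>\<tau> = long k (y, z)\<close> contains the long transvections of its columns. Conjugating
  back changes them by short transvections at position \<open>(d, k)\<close>, whose parameters are in \<open>J I\<^sup>1\<^sup>0\<close>.\<close>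

lemma absorbed_forms_conj_column:
  assumes normalised: "normalised H" and \<sigma>: "\<sigma> \<in> H" and k: "k \<noteq> Zero" and d: "d \<noteq> Zero" "d \<noteq> k" "d \<noteq> - k"
    and yz: "(y, z) \<in> \<Delta>"
  shows "Q ((iv (long k (y, z)) ** \<sigma> ** long k (y, z)) *v e (- k)) \<in> absorbed_forms H d"
proof -
  define \<tau> where "\<tau> = long k (y, z)"
  have \<tau>: "\<tau> \<in> EUf" unfolding \<tau>_def by (rule short_long_EUf(2)[OF k yz])
  note \<tau>U = EUf_U[OF \<tau>]
  define \<alpha> where "\<alpha> = Q ((iv \<tau> ** \<sigma> ** \<tau>) *v e (- k))"
  have goodc: "normalised (conj_by \<tau> H)" by (rule normalised_conj_by[OF normalised \<tau>])
  have uJc: "uJ (conj_by \<tau> H) = uJ H" by (rule upper_conj_by(1)[OF normalised_subset[OF normalised] \<tau>])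
  have "\<alpha> \<in> absorbed_forms (conj_by \<tau> H) d" unfolding \<alpha>_def using k d by (intro absorbed_forms_column[OF goodc conj_by_mem[OF \<sigma>]]) auto
  then have \<alpha>: "\<alpha> \<in> \<Delta>" "\<alpha> \<in> tilde_forms (uJ H)" "\<And>m. m \<in> ideal_pow I 12 \<Longrightarrow> long d (act S \<alpha> m) \<in> conj_by \<tau> H"
    by (simp_all add: absorbed_forms_def[OF goodc] uJc del: ideal_pow.simps)
  have "long d (act S \<alpha> m) \<in> H" if m: "m \<in> ideal_pow I 12" for m
  proof -
    obtain x' y' where xy: "act S \<alpha> m = (x', y')" by fastforce
    have x': "x' = fst \<alpha> * m" using xy by (simp add: act_def)
    have td: "\<tau> *v e d = e d" unfolding \<tau>_def using d by (intro long_fix) auto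
    have t0: "\<tau> *v e Zero = e Zero - (bar y * bar \<mu>) *s e k"
      unfolding \<tau>_def long_mv using k by (simp add: om_def vector_smult_assoc)
    have "\<tau> ** long d (x', y') ** iv \<tau> = esd (e d) (x' *s e Zero + (- (x' * (bar y * bar \<mu>))) *s e k) y'"
      unfolding long_def esd_conj_short_frame[OF \<tau>U td] fst_conv snd_conv mv_scale t0
      by (rule arg_cong[where f = "\<lambda>v. esd (e d) v y'"]) (simp add: vec_eq_iff algebra_simps)
    also have "\<dots> = long d (x', y') ** short d k (- (x' * (bar y * bar \<mu>)))"
      unfolding long_def short_def using d k by (subst esd_e_mult) (auto simp: B_simps)
    finally have c: "\<tau> ** long d (x', y') ** iv \<tau> = long d (x', y') ** short d k (- (x' * (bar y * bar \<mu>)))" .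
    have 1: "\<tau> ** long d (x', y') ** iv \<tau> \<in> H"
      using conj_byD[OF \<alpha>(3)[OF m] \<tau>U normalised_subset[OF normalised]] unfolding xy .
    have "bar y * \<mu> * fst \<alpha> \<in> uJ H" using \<alpha>(2) JD_I[OF yz] by (cases \<alpha>) (auto simp: tilde_forms_def)
    from ideal_mult_right[OF K_ideal_H[OF normalised] uJ_pow12_K[OF normalised this m], of "bar \<ell>"]
    have "x' * (bar y * bar \<mu>) \<in> K (uJ H)" by (simp add: x' bar_simps ac_simps)
    then have S: "short d k (- (x' * (bar y * bar \<mu>))) \<in> H"
      using d k by (intro core_mem[OF normalised] core_short[OF uJ_ideal uJ_bar] ideal_neg[OF K_ideal_H[OF normalised]]) auto
    have "(\<tau> ** long d (x', y') ** iv \<tau>) ** iv (short d k (- (x' * (bar y * bar \<mu>)))) \<in> H"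
      by (rule H_mul[OF normalised 1 H_iv[OF normalised S]])
    also have "(\<tau> ** long d (x', y') ** iv \<tau>) ** iv (short d k (- (x' * (bar y * bar \<mu>)))) = long d (x', y')"
      unfolding c using H_U[OF normalised S] by (simp add: iv_mul flip: matrix_mul_assoc)
    finally show ?thesis unfolding xy .
  qed
  then show ?thesis unfolding \<tau>_def[symmetric] \<alpha>_def[symmetric] absorbed_forms_def[OF normalised] using \<alpha> by blast
qed

text \<open>For \<open>(y, z)\<close> in \<open>\<Delta>\<close>, the vector \<open>w = \<tau> e (- k)\<close> with \<open>\<tau> = long k (y, z)\<close> has \<open>Q w = (y, z)\<close>. The column \<open>- k\<close> of
  \<open>\<tau>\<^sup>-\<^sup>1 \<sigma> \<tau>\<close> shows that \<open>Q (\<sigma> w)\<close> is \<open>(y, z) \<circ> c\<close> modulo the absorbed forms, and two applications of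
  \<open>Qplus_step\<close> replace \<open>w\<close> by its part in coordinate \<open>Zero\<close>. This is the second kind of generators of \<open>U(H)\<close>.\<close>

lemma absorbed_forms_gens:
  assumes normalised: "normalised H" and d: "d \<noteq> Zero"
  shows "level_form_gens S \<Delta> H \<subseteq> absorbed_forms H d"
proof
  note l = absorbed_forms_is_level[OF normalised d] and h = is_level_hsubmod[OF absorbed_forms_is_level[OF normalised d]]
  fix \<alpha> assume "\<alpha> \<in> level_form_gens S \<Delta> H"
  then show "\<alpha> \<in> absorbed_forms H d"
  proof (cases rule: level_form_cases)
    case (1 \<sigma> i) then show ?thesis using absorbed_forms_column[OF normalised _ _ d] by simp
  next
    case (2 \<sigma> i y z)
    have \<sigma>U: "\<sigma> \<in> carrier Ug" by (rule H_U[OF normalised 2(1)])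
    define c where "c = \<sigma> $ i $ i"
    have scalar_mod: "scalar_mod (uJ H) c \<sigma>" unfolding c_def by (rule upper_scalar_mod[OF 2(1,2)])
    obtain \<kappa> :: 3 where \<kappa>: "d \<noteq> Pos \<kappa>" "d \<noteq> - Pos \<kappa>"
    proof (cases "d = Pos 1 \<or> d = Neg 1")
      case True then show thesis using that[of 2] by auto
    next
      case False then show thesis using that[of 1] by auto
    qed
    define k where "k = (Pos \<kappa> :: 3 theta)"
    have k: "k \<noteq> Zero" "d \<noteq> k" "d \<noteq> - k" "om k = 1" using \<kappa> by (auto simp: k_def om_def)
    define \<tau> where "\<tau> = long k (y, z)"
    have \<tau>: "\<tau> \<in> EUf" unfolding \<tau>_def by (rule short_long_EUf(2)[OF k(1) 2(3)])
    define w where "w = \<tau> *v e (- k)"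
    have w_eq: "w = (y *s e Zero + bar z *s e k) + 1 *s e (- k)"
      unfolding w_def \<tau>_def long_move[OF k(1)] k(4) by simp
    have Qw: "Q w = (y, z)"
    proof -
      have "w $ Zero = y" unfolding w_eq using k by simp
      moreover have "q w = z"
      proof -
        have "bar (w $ p) * w $ (- p) = (if p = k then z else 0)" if "p \<in> Theta_pos" for p
          using that theta_ne_minus[OF k(1)] unfolding w_eq k_def by auto
        then have "q w = (\<Sum>p\<in>Theta_pos. if p = k then z else 0)" unfolding q_sum by (intro sum.cong) auto
        also have "\<dots> = z" by (simp add: k_def)
        finally show ?thesis .
      qed
      ultimately show ?thesis by (simp add: prod_eq_iff)
    qed
    have w0: "w $ Zero \<in> J_of \<Delta>" using JD_I[OF 2(3)] arg_cong[OF Qw, of fst] by simp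
    have "Q ((iv \<tau> ** \<sigma>) *v w) \<in> absorbed_forms H d"
      using absorbed_forms_conj_column[OF normalised 2(1) k(1) d k(2,3) 2(3)] unfolding \<tau>_def[symmetric] w_def by (simp add: mv_mul)
    moreover have "Q (c *s (iv \<tau> *v w)) = (0, 0)"
      unfolding w_def using EUf_U[OF \<tau>] k by (simp add: prod_eq_iff q_scale)
    ultimately have 1: "cong_mod (absorbed_forms H d) (Q (\<sigma> *v w)) (act S (Q w) c)"
      using scalar_of_conj_image[OF l \<sigma>U scalar_mod EUf_form_invariant[OF l \<tau>] _ w0] by blast
    have y0: "(y *s e Zero + bar z *s e k) $ Zero \<in> J_of \<Delta>" "(y *s e Zero) $ Zero \<in> J_of \<Delta>"
      using JD_I[OF 2(3)] k by simp_all
    have k': "- k \<noteq> Zero" using k by simp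
    obtain z1 where z1: "Qplus 0 w = Qplus z1 (y *s e Zero + bar z *s e k)"
      "cong_mod (absorbed_forms H d) (Qplus 0 (\<sigma> *v w)) (Qplus z1 (\<sigma> *v (y *s e Zero + bar z *s e k)))"
      using Qplus_step[OF l \<sigma>U scalar_mod k' y0(1) absorbed_forms_column[OF normalised 2(1) k' d], of 0 1] unfolding w_eq by blast
    obtain z2 where z2: "Qplus z1 (y *s e Zero + bar z *s e k) = Qplus z2 (y *s e Zero)"
      "cong_mod (absorbed_forms H d) (Qplus z1 (\<sigma> *v (y *s e Zero + bar z *s e k))) (Qplus z2 (\<sigma> *v (y *s e Zero)))"
      using Qplus_step[OF l \<sigma>U scalar_mod k(1) y0(2) absorbed_forms_column[OF normalised 2(1) k(1) d], of z1 "bar z"] by blast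
    have "(y, z) = Qplus z2 (y *s e Zero)" using z1(1) z2(1) Qw by (simp add: Qplus_0)
    then have "z2 = z" by (simp add: Qplus_def q_scale)
    with cong_mod_trans[OF h z1(2) z2(2)] have "cong_mod (absorbed_forms H d) (Q (\<sigma> *v w)) (Qplus z (\<sigma> *v (y *s e Zero)))" by (simp add: Qplus_0)
    from cong_mod_trans[OF h cong_mod_sym[OF h this] 1] show ?thesis
      unfolding cong_mod_def Qw c_def 2(4) .
  qed
qed

lemma level_EU_H:
  assumes normalised: "normalised H"
  shows "EU S \<Delta> (ideal_mult (uJ H) (ideal_pow I 12), gen_form (ideal_mult (uJ H) (ideal_pow I 12)) (uS H) (ideal_pow I 12)) \<subseteq> H"
proof -
  let ?K = "ideal_mult (uJ H) (ideal_pow I 12)"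
  let ?\<Omega> = "gen_form ?K (uS H) (ideal_pow I 12)"
  note l = upper_is_level[OF normalised_subset[OF normalised]]
  have K: "?K \<subseteq> K (uJ H)" by (rule ideal_mult_mono, rule pow_mono[OF I]) simp
  have Kb: "bar x \<in> ?K" if "x \<in> ?K" for x
    by (rule ideal_mult_bar[OF uJ_bar pow_bar[OF I_bar] that])
  have t: "act S \<alpha> b \<in> tilde_forms ?K" if "\<alpha> \<in> uS H" "b \<in> ideal_pow I 12" for \<alpha> b
    using that is_level_tilde[OF l] ideal_mult_mem[of _ "uJ H" b "ideal_pow I 12"]
    by (cases \<alpha>) (auto simp: tilde_forms_def mult.assoc[symmetric] simp del: ideal_pow.simps)
  have is_level: "is_level ?K ?\<Omega>" by (rule gen_form_is_level(1)[OF ideal_mult_ideal Kb pow_ideal is_level_sub[OF l] t])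
  have S: "uS H \<subseteq> absorbed_forms H d" if "d \<noteq> Zero" for d
  proof -
    note g = absorbed_forms_is_level[OF normalised that]
    show ?thesis unfolding uS_eq
      by (rule gen_form_least[OF g order_refl]) (use absorbed_forms_gens[OF normalised that] hsubmod_act'[OF is_level_hsubmod[OF g]] in blast)
  qed
  have long: "long d \<alpha> \<in> H" if d: "d \<noteq> Zero" and \<alpha>: "\<alpha> \<in> ?\<Omega>" for d \<alpha>
  proof -
    have "?\<Omega> \<subseteq> {\<alpha>. \<forall>k\<in>ideal_pow I 0. long d (act S \<alpha> k) \<in> H}"
    proof (rule gen_form_subset[OF hsubmod_long[OF H_sub[OF normalised] d]])
      fix x assume "x \<in> ?K"
      then have "(0, x - bar x * \<ell>) \<in> K_forms (uJ H)" using is_level_min[OF K_level_H[OF normalised]] K by blast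
      then have "act S (0, x - bar x * \<ell>) k \<in> K_forms (uJ H)" for k by (rule hsubmod_act'[OF is_level_hsubmod[OF K_level_H[OF normalised]]])
      then show "(0, x - bar x * \<ell>) \<in> {\<alpha>. \<forall>k\<in>ideal_pow I 0. long d (act S \<alpha> k) \<in> H}"
        using core_mem[OF normalised core_long[OF uJ_ideal uJ_bar _ d]] by blast
    next
      fix \<alpha> b assume a: "\<alpha> \<in> \<Delta>" "b \<in> ?K"
      have "long d (act S \<alpha> (b * k)) \<in> H" for k
      proof -
        have bk: "b * k \<in> K (uJ H)" using K a ideal_mult_right[OF K_ideal_H[OF normalised]] by blast
        then show ?thesis using core_mem[OF normalised core_long_act[where x = "fst \<alpha>" and z = "snd \<alpha>", OF uJ_ideal uJ_bar _ bk d]] a by simp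
      qed
      then show "act S \<alpha> b \<in> {\<alpha>. \<forall>k\<in>ideal_pow I 0. long d (act S \<alpha> k) \<in> H}" by (simp add: act_act)
    next
      fix \<alpha> b assume a: "\<alpha> \<in> uS H" "b \<in> ideal_pow I 12"
      have "long d (act S \<alpha> (b * k)) \<in> H" for k
        using S[OF d] a ideal_mult_right[OF pow_ideal a(2)] by (auto simp: absorbed_forms_def[OF normalised] simp del: ideal_pow.simps)
      then show "act S \<alpha> b \<in> {\<alpha>. \<forall>k\<in>ideal_pow I 0. long d (act S \<alpha> k) \<in> H}" by (simp add: act_act)
    qed
    then have "long d (act S \<alpha> 1) \<in> H" using \<alpha> by auto
    then show ?thesis by (simp add: act_def)
  qed
  have "elementary_gens ?K ?\<Omega> \<subseteq> H"
    unfolding elementary_gens_def using long core_mem[OF normalised core_short[OF uJ_ideal uJ_bar]] K by blast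
  then show ?thesis
    unfolding EU_eq[OF is_level_ideal[OF is_level] is_level_hsubmod[OF is_level] is_level_sub[OF is_level]]
    by (rule G.generate_subgroup_incl[OF _ H_sub[OF normalised]])
qed

text \<open>All elementary conjugates of \<open>H\<close> are normalised and have the same upper level, so they contain the
  same elementary group \<open>EU(U(H) * I\<^sup>1\<^sup>2)\<close>.\<close>

lemma level_EU_rel_H:
  assumes normalised: "normalised H"
  shows "EU_rel S \<Delta> (form_ideal_mult S \<Delta> (upper_level S \<Delta> H) (ideal_pow I 12)) \<subseteq> H"
proof -
  have L: "form_ideal_mult S \<Delta> (upper_level S \<Delta> H) (ideal_pow I 12)
    = (ideal_mult (uJ H) (ideal_pow I 12), gen_form (ideal_mult (uJ H) (ideal_pow I 12)) (uS H) (ideal_pow I 12))"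
    by (simp add: form_ideal_mult_def gen_form_def split_beta)
  have "\<tau> ** \<sigma> ** iv \<tau> \<in> H"
    if \<tau>: "\<tau> \<in> EUf" and \<sigma>: "\<sigma> \<in> EU S \<Delta> (form_ideal_mult S \<Delta> (upper_level S \<Delta> H) (ideal_pow I 12))" for \<tau> \<sigma>
  proof (rule conj_byD[OF _ EUf_U[OF \<tau>] normalised_subset[OF normalised]])
    show "\<sigma> \<in> conj_by \<tau> H"
      using level_EU_H[OF normalised_conj_by[OF normalised \<tau>]] \<sigma> unfolding L upper_conj_by[OF normalised_subset[OF normalised] \<tau>] by blast
  qed
  then show ?thesis unfolding EU_rel_def
    by (intro G.generate_subgroup_incl[OF _ H_sub[OF normalised]]) auto
qed

lemma normalisedI:
  assumes H: "subgroup H Ug" and \<Omega>: "hsubmod \<Omega>" "\<Omega> \<subseteq> \<Delta>" "\<And>x. x \<in> I \<Longrightarrow> (0, x - bar x * \<ell>) \<in> \<Omega>"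
    and N: "EU_rel S \<Delta> (I, \<Omega>) \<subseteq> normalizer Ug H"
  shows "normalised H"
  unfolding normalised_def
proof (intro conjI ballI H)
  fix \<tau> g assume \<tau>: "\<tau> \<in> EUf" and g: "g \<in> short_gens"
  note Hc = subgroup.subset[OF H]
  have "g \<in> elementary_gens I \<Omega>"
  proof -
    obtain p r x where g': "g = short p r x" "p \<noteq> Zero" "r \<noteq> Zero" "p \<noteq> - r" "x \<in> I" using g by (auto simp: short_gens_def)
    show ?thesis
    proof (cases "p = r")
      case True
      then have "g = long p (0, bar x - bar (bar x) * \<ell>)" using g' short_diag by simp
      then show ?thesis unfolding elementary_gens_def using \<Omega>(3)[OF I_bar[OF g'(5)]] g'(2) by blast
    next
      case False then show ?thesis unfolding elementary_gens_def using g' by blast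
    qed
  qed
  then have "g \<in> EU S \<Delta> (I, \<Omega>)" unfolding EU_eq[OF I \<Omega>(1,2)] by (rule generate.incl)
  then have "\<tau> \<otimes>\<^bsub>Ug\<^esub> g \<otimes>\<^bsub>Ug\<^esub> iv \<tau> \<in> EU_rel S \<Delta> (I, \<Omega>)"
    unfolding EU_rel_def using \<tau> by (intro generate.incl) blast
  with N have n: "\<tau> ** g ** iv \<tau> \<in> normalizer Ug H" by auto
  define k where "k = \<tau> ** g ** iv \<tau>"
  have k: "k \<in> carrier Ug" "(\<lambda>h. k ** h ** iv k) ` H = H" using n unfolding k_def[symmetric] normalizer_iff[OF Hc] by auto
  show "normalises H (\<tau> ** g ** iv \<tau>)"
    unfolding normalises_def k_def[symmetric]
  proof (intro conjI ballI k)
    fix h assume h: "h \<in> H"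
    show "k ** h ** iv k \<in> H" using k(2) h by blast
    obtain h' where h': "h' \<in> H" "h = k ** h' ** iv k" using h k(2) by blast
    have "iv k ** h ** k = h'" unfolding h'(2) using k(1) by (intro mat_eqI) (simp add: mv_mul)
    with h' show "iv k ** h ** k \<in> H" by simp
  qed
qed

end

theorem theorem42:
  fixes S :: "'a::comm_ring_1 herm"
    and \<Delta> \<Omega> :: "('a \<times> 'a) set"
    and I :: "'a set"
    and H :: "('a, 3) mat_th set"
  assumes "hermitian_form_ring S \<Delta>"
    and "odd_form_ideal S \<Delta> (I, \<Omega>)"
    and "subgroup H (U_grp S \<Delta>)"
    and "EU_rel S \<Delta> (I, \<Omega>) \<subseteq> normalizer (U_grp S \<Delta>) H"
  shows "EU_rel S \<Delta> (form_ideal_mult S \<Delta> (upper_level S \<Delta> H) (ideal_pow I 12)) \<subseteq> H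
    \<and> H \<subseteq> CU_rel S \<Delta> (upper_level S \<Delta> H)"
proof -
  have I: "is_ideal I" "\<And>x. x \<in> I \<Longrightarrow> invol S x \<in> I" and \<Omega>: "heis_submodule S \<Omega>" "Omega_min S \<Delta> I \<subseteq> \<Omega>" "\<Omega> \<subseteq> \<Delta>"
    using assms(2) by (auto simp: odd_form_ideal_def invol_invariant_def Omega_max_def)
  interpret hermitian_form_ring S \<Delta> by (rule assms(1))
  interpret lower S \<Delta> I by unfold_locales (rule I, rule I(2))
  have "(0, x - bar x * \<ell>) \<in> \<Omega>" if x: "x \<in> I" for x
  proof -
    have "(0, 0) \<in> act_gen S \<Delta> I" using hsubmod_0[OF act_gen_hsubmod[OF I(1)]] .
    then have "(0, x - bar x * \<ell>) \<otimes>\<^bsub>heis S\<^esub> (0, 0) \<in> Omega_min S \<Delta> I"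
      unfolding Omega_min_def set_mult_def using x by blast
    then show ?thesis using \<Omega>(2) by auto
  qed
  then have "normalised H" using normalisedI[OF assms(3) _ \<Omega>(3) _ assms(4)] \<Omega>(1) heis_submodule_iff by blast
  from level_EU_rel_H[OF this] H_CU[OF assms(3)] show ?thesis by auto
qed

end
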